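(* Let $\mathcal F$ be a Cauchy flux in $\Omega$, with associated production measure $\sigma$ and bounding measure $\mu$. Then there exists a unique divergence-measure field $F\in\mathcal{DM}^{\mathrm{ext}}(\Omega)$ such that $$-\operatorname{div}F=\sigma$$ and $$\mathcal F_U(S)=(F\cdot\nu)_{\partial U}(S)$$ for any $U\in\mathcal O_\mu$ and any Borel set $S\subset\partial U$, where the measure $(F\cdot\nu)_{\partial U}$ is the normal trace of $F$ on $\partial U$. Conversely, every $F\in\mathcal{DM}^{\mathrm{ext}}(\Omega)$ defines a Cauchy flux, by taking $\mu=|F|$ and $\sigma=-\operatorname{div}F$; here the flux defined by $F$ is $\mathcal F_U(S):=(F\cdot\nu)_{\partial U}(S)$ for Borel $S\subset\partial U$ whenever the normal trace on $\partial U$ is represented by a measure, and $\mathcal F_U(\partial U):=\langle F\cdot\nu,\mathbf 1_\Omega\rangle_{\partial U}$ for every open $U\Subset\Omega$.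
   Context: Let $n\ge2$ and let $\Omega\subset\mathbb R^n$ be open. $A\Subset\Omega$ means that $\overline A$ is compact and $\overline A\subset\Omega$. $\mathcal{DM}^{\mathrm{ext}}(\Omega)$ is the space of finite $\mathbb R^n$-valued Radon measures $F$ on $\Omega$ whose distributional divergence, $\langle\operatorname{div}F,\varphi\rangle=-\int_\Omega\nabla\varphi\cdot \mathrm dF$ for $\varphi\in C_c^\infty(\Omega)$, is a finite signed Radon measure $\operatorname{div}F$ on $\Omega$. Normal trace: for open $U\Subset\Omega$ and $\phi\in C^1_c(\Omega)$, $\langle F\cdot\nu,\phi\rangle_{\partial U}:=-\int_U\nabla\phi\cdot \mathrm dF-\int_U\phi\,\mathrm d(\operatorname{div}F)$. If this distribution is represented by a measure in $\Omega$ (necessarily supported on $\partial U$), that measure is denoted $(F\cdot\nu)_{\partial U}$. For the constant function, $\langle F\cdot\nu,\mathbf 1_\Omega\rangle_{\partial U}=-(\operatorname{div}F)(U)$. For $U$ open and $\varepsilon>0$, $U^\varepsilon=\{x\in U:\operatorname{dist}(x,\partial U)>\varepsilon\}$. For a non-negative finite Radon measure $\mu$ on $\Omega$, $$\mathcal O_\mu=\Big\{U\Subset\Omega\text{ open}:\ \liminf_{\varepsilon\to0}\tfrac1\varepsilon\,\mu(\{x\in U:\operatorname{dist}(x,\partial U)<\varepsilon\})<\infty\Big\}.$$ A Cauchy flux in $\Omega$ is a real-valued mapping $\mathcal F:(S,U)\mapsto\mathcal F_U(S)$ on pairs with $U\Subset\Omega$ open and $S\subset\partial U$ Borel, together with a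 finite signed Radon measure $\sigma$ on $\Omega$ and a non-negative finite Radon measure $\mu$ on $\Omega$, such that the balance law $\mathcal F_U(\partial U)=\sigma(U)$ holds for every open $U\Subset\Omega$, and: (i) (additivity) for any $U\in\mathcal O_\mu$ and disjoint Borel $S,T\subset\partial U$, $\mathcal F_U(S\cup T)=\mathcal F_U(S)+\mathcal F_U(T)$; (ii) (localization) for any $U,V\in\mathcal O_\mu$ and any open $A\subset\Omega$ with $A\cap U=A\cap V$, $\mathcal F_U(A\cap\partial U)=\mathcal F_V(A\cap\partial V)$; (iii) (upper bound) for any $U\in\mathcal O_\mu$, $|\mathcal F_U(S)|\le\mu_U^{n-1}(S)$ for any Borel $S\subset\partial U$ and any measure $\mu^{n-1}_U$ arising as a weak* limit (as measures on $\Omega$) of $\frac1{\varepsilon_k}\mu\llcorner(U\setminus\overline{U^{\varepsilon_k}})$ along some sequence $\varepsilon_k\searrow0$. Only the values $\mathcal F_U(S)$ with $U\in\mathcal O_\mu$ and the values $\mathcal F_U(\partial U)$ enter these conditions; values at other pairs play no role (and may be left unspecified). *)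

theory Defs
  imports "HOL-Analysis.Analysis"
begin

text \<open>
  Every finite Borel measure on an open subset of a Euclidean space is Radon, and so is every
  (automatically finite) countably additive Borel set function with values in the reals or in a
  Euclidean space. Hence finite (signed, vector-valued) Radon measures are represented by finite
  Borel measures and countably additive Borel set functions.
\<close>

definition borel_on :: "'a::topological_space set \<Rightarrow> 'a set set" where
  "borel_on \<Omega> = {A \<in> sets borel. A \<subseteq> \<Omega>}"

definition radon_measure_on :: "'a::topological_space set \<Rightarrow> 'a measure \<Rightarrow> bool" where
  "radon_measure_on \<Omega> \<mu> \<longleftrightarrow>
     space \<mu> = \<Omega> \<and> sets \<mu> = borel_on \<Omega> \<and> finite_measure \<mu>"

text \<open>
  The value 0 off the Borel subsets of \<open>\<Omega>\<close> is a convention which makes equality of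
  set functions coincide with equality of measures.
\<close>

definition vector_measure_on ::
  "'a::topological_space set \<Rightarrow> ('a set \<Rightarrow> 'b::real_normed_vector) \<Rightarrow> bool" where
  "vector_measure_on \<Omega> F \<longleftrightarrow>
     (\<forall>A. A \<notin> borel_on \<Omega> \<longrightarrow> F A = 0) \<and>
     (\<forall>A :: nat \<Rightarrow> 'a set. range A \<subseteq> borel_on \<Omega> \<longrightarrow> disjoint_family A \<longrightarrow>
        (\<lambda>i. F (A i)) sums F (\<Union>i. A i))"

abbreviation signed_measure_on :: "'a::topological_space set \<Rightarrow> ('a set \<Rightarrow> real) \<Rightarrow> bool" where
  "signed_measure_on \<equiv> vector_measure_on"

definition variation ::
  "'a::topological_space set \<Rightarrow> ('a set \<Rightarrow> 'b::real_normed_vector) \<Rightarrow> 'a measure" where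
  "variation \<Omega> F = measure_of \<Omega> (borel_on \<Omega>)
     (\<lambda>A. SUP P \<in> {P. finite P \<and> P \<subseteq> borel_on \<Omega> \<and> partition_on A P}.
            \<Sum>B\<in>P. ennreal (norm (F B)))"

text \<open>
  The positive part of the Jordan decomposition; the negative part of \<open>s\<close> is the
  positive part of \<open>- s\<close>. Note that \<open>ennreal\<close> truncates negative values to 0.
\<close>

definition positive_part :: "'a::topological_space set \<Rightarrow> ('a set \<Rightarrow> real) \<Rightarrow> 'a measure" where
  "positive_part \<Omega> s = measure_of \<Omega> (borel_on \<Omega>)
     (\<lambda>A. SUP B \<in> {B \<in> borel_on \<Omega>. B \<subseteq> A}. ennreal (s B))"

definition signed_integral ::
  "'a::topological_space set \<Rightarrow> ('a set \<Rightarrow> real) \<Rightarrow> 'a set \<Rightarrow> ('a \<Rightarrow> real) \<Rightarrow> real" where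
  "signed_integral \<Omega> s U f =
     (LINT x:U|positive_part \<Omega> s. f x) - (LINT x:U|positive_part \<Omega> (\<lambda>A. - s A). f x)"

text \<open>The integral of \<open>G \<bullet> dF\<close> over \<open>U\<close>, for a vector field \<open>G\<close>.\<close>

definition vector_integral ::
  "'a::euclidean_space set \<Rightarrow> ('a set \<Rightarrow> 'a) \<Rightarrow> 'a set \<Rightarrow> ('a \<Rightarrow> 'a) \<Rightarrow> real" where
  "vector_integral \<Omega> F U G =
     (\<Sum>b\<in>Basis. signed_integral \<Omega> (\<lambda>A. F A \<bullet> b) U (\<lambda>x. G x \<bullet> b))"

primrec Ck :: "nat \<Rightarrow> ('a::euclidean_space \<Rightarrow> real) \<Rightarrow> bool" where
  "Ck 0 f \<longleftrightarrow> continuous_on UNIV f"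
| "Ck (Suc k) f \<longleftrightarrow>
     f differentiable_on UNIV \<and> (\<forall>b\<in>Basis. Ck k (\<lambda>x. frechet_derivative f (at x) b))"

text \<open>Functions with compact support in \<open>\<Omega>\<close> are extended by 0 to the whole space.\<close>

definition test_functions :: "nat \<Rightarrow> 'a::euclidean_space set \<Rightarrow> ('a \<Rightarrow> real) set" where
  "test_functions k \<Omega> =
     {\<phi>. Ck k \<phi> \<and> compact (closure {x. \<phi> x \<noteq> 0}) \<and> closure {x. \<phi> x \<noteq> 0} \<subseteq> \<Omega>}"

definition smooth_test_functions :: "'a::euclidean_space set \<Rightarrow> ('a \<Rightarrow> real) set" where
  "smooth_test_functions \<Omega> = (\<Inter>k. test_functions k \<Omega>)"

definition grad :: "('a::euclidean_space \<Rightarrow> real) \<Rightarrow> 'a \<Rightarrow> 'a" where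
  "grad \<phi> x = (\<Sum>b\<in>Basis. frechet_derivative \<phi> (at x) b *\<^sub>R b)"

definition is_divergence ::
  "'a::euclidean_space set \<Rightarrow> ('a set \<Rightarrow> 'a) \<Rightarrow> ('a set \<Rightarrow> real) \<Rightarrow> bool" where
  "is_divergence \<Omega> F s \<longleftrightarrow> signed_measure_on \<Omega> s \<and>
     (\<forall>\<phi>\<in>smooth_test_functions \<Omega>.
        signed_integral \<Omega> s \<Omega> \<phi> = - vector_integral \<Omega> F \<Omega> (grad \<phi>))"

definition DM_ext :: "'a::euclidean_space set \<Rightarrow> ('a set \<Rightarrow> 'a) set" where
  "DM_ext \<Omega> = {F. vector_measure_on \<Omega> F \<and> (\<exists>s. is_divergence \<Omega> F s)}"

definition divergence :: "'a::euclidean_space set \<Rightarrow> ('a set \<Rightarrow> 'a) \<Rightarrow> 'a set \<Rightarrow> real" where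
  "divergence \<Omega> F = (THE s. is_divergence \<Omega> F s)"

definition open_compactly_inside :: "'a::topological_space set \<Rightarrow> 'a set \<Rightarrow> bool" where
  "open_compactly_inside U \<Omega> \<longleftrightarrow> open U \<and> compact (closure U) \<and> closure U \<subseteq> \<Omega>"

definition normal_trace_distribution ::
  "'a::euclidean_space set \<Rightarrow> ('a set \<Rightarrow> 'a) \<Rightarrow> 'a set \<Rightarrow> ('a \<Rightarrow> real) \<Rightarrow> real" where
  "normal_trace_distribution \<Omega> F U \<phi> =
     - vector_integral \<Omega> F U (grad \<phi>) - signed_integral \<Omega> (divergence \<Omega> F) U \<phi>"

text \<open>
  The distribution is supported on the compact set \<open>frontier U \<subseteq> \<Omega>\<close>, so a
  (a priori only locally finite) signed Radon measure representing it is finite.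
\<close>

definition represents_normal_trace ::
  "'a::euclidean_space set \<Rightarrow> ('a set \<Rightarrow> 'a) \<Rightarrow> 'a set \<Rightarrow> ('a set \<Rightarrow> real) \<Rightarrow> bool" where
  "represents_normal_trace \<Omega> F U \<tau> \<longleftrightarrow> signed_measure_on \<Omega> \<tau> \<and>
     (\<forall>\<phi>\<in>test_functions 1 \<Omega>.
        normal_trace_distribution \<Omega> F U \<phi> = signed_integral \<Omega> \<tau> \<Omega> \<phi>)"

definition has_normal_trace ::
  "'a::euclidean_space set \<Rightarrow> ('a set \<Rightarrow> 'a) \<Rightarrow> 'a set \<Rightarrow> bool" where
  "has_normal_trace \<Omega> F U \<longleftrightarrow> (\<exists>\<tau>. represents_normal_trace \<Omega> F U \<tau>)"

definition normal_trace ::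
  "'a::euclidean_space set \<Rightarrow> ('a set \<Rightarrow> 'a) \<Rightarrow> 'a set \<Rightarrow> 'a set \<Rightarrow> real" where
  "normal_trace \<Omega> F U = (THE \<tau>. represents_normal_trace \<Omega> F U \<tau>)"

text \<open>
  The normal trace paired with the constant function 1, which lies outside the class of compactly
  supported test functions but has vanishing gradient.
\<close>

definition normal_trace_one ::
  "'a::euclidean_space set \<Rightarrow> ('a set \<Rightarrow> 'a) \<Rightarrow> 'a set \<Rightarrow> real" where
  "normal_trace_one \<Omega> F U = - divergence \<Omega> F U"

definition inner_set :: "'a::euclidean_space set \<Rightarrow> real \<Rightarrow> 'a set" where
  "inner_set U \<epsilon> = {x \<in> U. infdist x (frontier U) > \<epsilon>}"

definition O_class :: "'a::euclidean_space set \<Rightarrow> 'a measure \<Rightarrow> 'a set set" where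
  "O_class \<Omega> \<mu> = {U. open_compactly_inside U \<Omega> \<and>
     Liminf (at_right 0) (\<lambda>\<epsilon>. ereal (measure \<mu> {x \<in> U. infdist x (frontier U) < \<epsilon>} / \<epsilon>)) < \<infinity>}"

definition weak_star_limit ::
  "'a::euclidean_space set \<Rightarrow> (nat \<Rightarrow> 'a measure) \<Rightarrow> 'a measure \<Rightarrow> bool" where
  "weak_star_limit \<Omega> M \<nu> \<longleftrightarrow>
     (\<forall>\<phi>\<in>test_functions 0 \<Omega>. (\<lambda>k. integral\<^sup>L (M k) \<phi>) \<longlonglongrightarrow> integral\<^sup>L \<nu> \<phi>)"

definition scaled_layer :: "'a::euclidean_space measure \<Rightarrow> 'a set \<Rightarrow> real \<Rightarrow> 'a measure" where
  "scaled_layer \<mu> U \<epsilon> =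
     density \<mu> (\<lambda>x. ennreal (indicator (U - closure (inner_set U \<epsilon>)) x / \<epsilon>))"

text \<open>
  The layers lie in the compact set \<open>closure U \<subseteq> \<Omega>\<close>; hence testing with continuous
  functions of compact support is equivalent to testing with those vanishing at the boundary, and
  every weak-star limit is a finite measure.
\<close>

definition layer_limit ::
  "'a::euclidean_space set \<Rightarrow> 'a measure \<Rightarrow> 'a set \<Rightarrow> 'a measure \<Rightarrow> bool" where
  "layer_limit \<Omega> \<mu> U \<nu> \<longleftrightarrow> radon_measure_on \<Omega> \<nu> \<and>
     (\<exists>\<epsilon> :: nat \<Rightarrow> real. (\<forall>k. \<epsilon> k > 0) \<and> decseq \<epsilon> \<and> \<epsilon> \<longlonglongrightarrow> 0 \<and>
        weak_star_limit \<Omega> (\<lambda>k. scaled_layer \<mu> U (\<epsilon> k)) \<nu>)"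

text \<open>
  The value of the flux through \<open>S \<subseteq> frontier U\<close> is \<open>\<F> U S\<close>; values at
  other arguments are irrelevant.
\<close>

definition cauchy_flux ::
  "'a::euclidean_space set \<Rightarrow> ('a set \<Rightarrow> 'a set \<Rightarrow> real) \<Rightarrow> ('a set \<Rightarrow> real) \<Rightarrow> 'a measure \<Rightarrow> bool"
where
  "cauchy_flux \<Omega> \<F> \<sigma> \<mu> \<longleftrightarrow>
     signed_measure_on \<Omega> \<sigma> \<and> radon_measure_on \<Omega> \<mu> \<and>
     (\<forall>U. open_compactly_inside U \<Omega> \<longrightarrow> \<F> U (frontier U) = \<sigma> U) \<and>
     (\<forall>U\<in>O_class \<Omega> \<mu>. \<forall>S T. S \<in> sets borel \<longrightarrow> T \<in> sets borel \<longrightarrow>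
        S \<subseteq> frontier U \<longrightarrow> T \<subseteq> frontier U \<longrightarrow> S \<inter> T = {} \<longrightarrow>
        \<F> U (S \<union> T) = \<F> U S + \<F> U T) \<and>
     (\<forall>U\<in>O_class \<Omega> \<mu>. \<forall>V\<in>O_class \<Omega> \<mu>. \<forall>A. open A \<longrightarrow> A \<subseteq> \<Omega> \<longrightarrow> A \<inter> U = A \<inter> V \<longrightarrow>
        \<F> U (A \<inter> frontier U) = \<F> V (A \<inter> frontier V)) \<and>
     (\<forall>U\<in>O_class \<Omega> \<mu>. \<forall>\<nu>. layer_limit \<Omega> \<mu> U \<nu> \<longrightarrow>
        (\<forall>S\<in>sets borel. S \<subseteq> frontier U \<longrightarrow> \<bar>\<F> U S\<bar> \<le> measure \<nu> S))"

text \<open>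
  A field determines a flux only up to irrelevant values, so this is a relation. Both clauses
  apply to \<open>S = frontier U\<close> when the normal trace is a measure; that they are compatible is
  the existence of such an \<open>\<F>\<close>.
\<close>

definition flux_of_field ::
  "'a::euclidean_space set \<Rightarrow> ('a set \<Rightarrow> 'a) \<Rightarrow> ('a set \<Rightarrow> 'a set \<Rightarrow> real) \<Rightarrow> bool" where
  "flux_of_field \<Omega> F \<F> \<longleftrightarrow>
     (\<forall>U. open_compactly_inside U \<Omega> \<longrightarrow>
        \<F> U (frontier U) = normal_trace_one \<Omega> F U \<and>
        (has_normal_trace \<Omega> F U \<longrightarrow>
           (\<forall>S\<in>sets borel. S \<subseteq> frontier U \<longrightarrow> \<F> U S = normal_trace \<Omega> F U S)))"

end

theory Submission
  imports Defs "HOL-Probability.Probability" "HOL-Computational_Algebra.Polynomial"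
begin

text \<open>
  From flux to field. For a Lipschitz function \<open>\<phi>\<close> and \<open>U\<close> in \<open>O_class \<Omega> \<mu>\<close>, a coarea estimate and Fatou's
  lemma show that almost every superlevel set \<open>{x \<in> U. \<phi> x > t}\<close> is again in \<open>O_class \<Omega> \<mu>\<close>, that its edge
  where \<open>{\<phi> = t}\<close> meets the frontier of \<open>U\<close> carries no flux, and that its flux through \<open>{\<phi> = t}\<close>, integrated
  over \<open>t\<close>, is a measure bounded by \<open>\<mu>\<close> times the Lipschitz constant of \<open>\<phi>\<close>. Localization makes these measures
  agree on overlaps, and the balance law on the superlevel sets identifies the total mass over \<open>U\<close> as the
  integral of \<open>\<phi>\<close> against \<open>\<sigma>\<close> over \<open>U\<close> minus that against the flux over the frontier. The coordinate functions give the
  components of \<open>F\<close>. Subtracting from a smooth \<open>\<phi>\<close> its linearization leaves a function with small local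
  Lipschitz constant, so the measure belonging to \<open>\<phi>\<close> is \<open>grad \<phi> \<bullet> dF\<close>. This is the Gauss--Green formula,
  which contains both the divergence and the normal trace of \<open>F\<close>. Since every open set is an increasing
  union of members of \<open>O_class \<Omega> \<mu>\<close>, the coordinate functions also give uniqueness.

  From field to flux. With cutoffs \<open>\<psi>\<^sub>k\<close> that drop from 1 to 0 in thin layers along the frontier of \<open>U\<close>, the
  normal trace is a weak-star limit of the measures \<open>grad \<psi>\<^sub>k \<bullet> dF\<close>; these are bounded by the scaled layers
  of the variation of \<open>F\<close>, because \<open>\<bar>grad \<psi>\<^sub>k\<bar>\<close> is nearly the inverse of the layer's thickness.
\<close>

text \<open>The upper bound on a flux speaks only about weak-star limits of boundary layers, so it
  is empty until such a limit is known to exist. Compactness supplies one for every admissible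
  \<open>U\<close>, and domination by it turns the finitely additive \<open>\<F> U\<close> into a
  measure. For superlevel sets the bound must be localized: on an open \<open>W\<close> a limit
  measure is controlled by the part of the layer inside \<open>W\<close>, while its existence asks
  for bounded mass of the whole layer. Both demands enter one liminf, the second with a small weight
  \<eta> that later tends to 0. The frontier of a superlevel set of \<open>U\<close> consists of the
  slice inside \<open>U\<close>, a piece of \<open>frontier U\<close> that localization transfers to
  \<open>U\<close>, and the edge between them, which neither localization nor balance controls; this
  is why only almost every level is usable. Nor is the dependence on the level measurable by
  hypothesis. On admissible sets the slice flux agrees almost everywhere with an explicit integrable
  function coming from the balance law, and from there measurability spreads to Borel sets, with
  respect to completed Lebesgue measure.\<close>

section \<open>Additivity and linear operations for vector measures\<close>

lemma borel_on_iff: "A \<in> borel_on \<Omega> \<longleftrightarrow> A \<in> sets borel \<and> A \<subseteq> \<Omega>"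
  by (simp add: borel_on_def)

lemma borel_on_eq_sets_restrict_space:
  "\<Omega> \<in> sets borel \<Longrightarrow> borel_on \<Omega> = sets (restrict_space borel \<Omega>)"
  by (auto simp: borel_on_iff sets_restrict_space_iff)

lemma sigma_algebra_borel_on: "\<Omega> \<in> sets borel \<Longrightarrow> sigma_algebra \<Omega> (borel_on \<Omega>)"
  using sets.sigma_algebra_axioms[of "restrict_space borel \<Omega>"]
  by (simp add: borel_on_eq_sets_restrict_space space_restrict_space)

lemma vector_measure_on_outside: "vector_measure_on \<Omega> F \<Longrightarrow> A \<notin> borel_on \<Omega> \<Longrightarrow> F A = 0"
  by (simp add: vector_measure_on_def)

lemma vector_measure_on_sums:
  assumes "vector_measure_on \<Omega> F" "\<And>i. A i \<in> sets borel" "\<And>i. A i \<subseteq> \<Omega>" "disjoint_family A"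
  shows "(\<lambda>i. F (A i)) sums F (\<Union>i. A i)"
proof -
  have "range A \<subseteq> borel_on \<Omega>" using assms by (auto simp: borel_on_iff)
  then show ?thesis using assms by (auto simp: vector_measure_on_def)
qed

text \<open>Countably many copies of the empty set are disjoint, and a constant summable sequence is
  zero.\<close>

lemma vector_measure_on_empty [simp]: assumes "vector_measure_on \<Omega> F" shows "F {} = 0"
proof -
  have "(\<lambda>i::nat. F {}) sums F (\<Union>i::nat. {})"
    by (rule vector_measure_on_sums[OF assms]) (auto simp: disjoint_family_on_def)
  then have "(\<lambda>i::nat. F {}) \<longlonglongrightarrow> 0" by (auto dest: sums_summable summable_LIMSEQ_zero)
  then show ?thesis by (simp add: LIMSEQ_const_iff)
qed

lemma vector_measure_on_Un:
  assumes "vector_measure_on \<Omega> F" "A \<in> sets borel" "B \<in> sets borel" "A \<subseteq> \<Omega>" "B \<subseteq> \<Omega>"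
    "A \<inter> B = {}"
  shows "F (A \<union> B) = F A + F B"
proof -
  have "(\<lambda>i. F (binaryset A B i)) sums F (\<Union>i. binaryset A B i)"
  proof (rule vector_measure_on_sums[OF assms(1)])
    show "disjoint_family (binaryset A B)"
      using assms(6) by (auto simp: disjoint_family_on_def binaryset_def)
  qed (use assms in \<open>auto simp: binaryset_def\<close>)
  then have "(\<lambda>i. F (binaryset A B i)) sums F (A \<union> B)" by (simp add: UN_binaryset_eq)
  moreover have "(\<lambda>i. F (binaryset A B i)) sums (F A + F B)"
    using binaryset_sums[of F A B] assms(1) by simp
  ultimately show ?thesis by (rule sums_unique2)
qed

lemma vector_measure_on_Diff:
  assumes "vector_measure_on \<Omega> F" "A \<in> sets borel" "B \<in> sets borel" "A \<subseteq> \<Omega>" "B \<subseteq> A"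
  shows "F (A - B) = F A - F B"
proof -
  have "F ((A - B) \<union> B) = F (A - B) + F B"
    by (rule vector_measure_on_Un[OF assms(1)]) (use assms in auto)
  moreover have "(A - B) \<union> B = A" using assms by auto
  ultimately show ?thesis by simp
qed

lemma vector_measure_on_Int_Diff:
  assumes "vector_measure_on \<Omega> F" "A \<in> sets borel" "B \<in> sets borel" "A \<subseteq> \<Omega>"
  shows "F A = F (A \<inter> B) + F (A - B)"
proof -
  have "F ((A \<inter> B) \<union> (A - B)) = F (A \<inter> B) + F (A - B)"
    by (rule vector_measure_on_Un[OF assms(1)]) (use assms in auto)
  then show ?thesis by (simp add: Int_Diff_Un)
qed

lemma vector_measure_on_finite_UN:
  assumes "vector_measure_on \<Omega> F" "finite I" "\<And>i. i \<in> I \<Longrightarrow> A i \<in> sets borel"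
    "\<And>i. i \<in> I \<Longrightarrow> A i \<subseteq> \<Omega>" "disjoint_family_on A I"
  shows "F (\<Union>i\<in>I. A i) = (\<Sum>i\<in>I. F (A i))"
  using assms(2-)
proof (induction I rule: finite_induct)
  case empty
  then show ?case using assms(1) by simp
next
  case (insert i I)
  have "F (A i \<union> (\<Union>i\<in>I. A i)) = F (A i) + F (\<Union>i\<in>I. A i)"
    by (rule vector_measure_on_Un[OF assms(1)])
       (use insert in \<open>auto simp: disjoint_family_on_def\<close>)
  moreover have "F (\<Union>i\<in>I. A i) = (\<Sum>i\<in>I. F (A i))"
    by (rule insert.IH) (use insert.prems in \<open>auto simp: disjoint_family_on_def\<close>)
  ultimately show ?case using insert.hyps by simp
qed

lemma vector_measure_on_incseq:
  assumes "vector_measure_on \<Omega> F" "\<And>i. A i \<in> sets borel" "\<And>i. A i \<subseteq> \<Omega>" "incseq A"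
  shows "(\<lambda>i. F (A i)) \<longlonglongrightarrow> F (\<Union>i. A i)"
proof -
  have m: "disjointed A i \<in> sets borel" for i
    using sets.range_disjointed_sets[of A borel] assms(2) by auto
  have sub: "disjointed A i \<subseteq> \<Omega>" for i using disjointed_subset[of A i] assms(3)[of i] by (rule subset_trans)
  have "(\<lambda>i. F (disjointed A i)) sums F (\<Union>i. disjointed A i)"
    by (rule vector_measure_on_sums[OF assms(1) m sub disjoint_family_disjointed])
  then have "(\<lambda>n. \<Sum>i<Suc n. F (disjointed A i)) \<longlonglongrightarrow> F (\<Union>i. A i)"
    unfolding sums_def UN_disjointed_eq by (rule LIMSEQ_Suc)
  moreover have "(\<Sum>i<Suc n. F (disjointed A i)) = F (A n)" for n
  proof -
    have "F (\<Union>i\<in>{..<Suc n}. disjointed A i) = (\<Sum>i\<in>{..<Suc n}. F (disjointed A i))"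
      by (rule vector_measure_on_finite_UN[OF assms(1)])
         (use m sub disjoint_family_disjointed[of A] in \<open>auto simp: disjoint_family_on_def\<close>)
    moreover have "(\<Union>i\<in>{..<Suc n}. disjointed A i) = (\<Union>i\<in>{..<Suc n}. A i)"
      using finite_UN_disjointed_eq[of A "Suc n"] by (simp add: atLeast0LessThan)
    moreover have "(\<Union>i\<in>{..<Suc n}. A i) = A n"
      using incseqD[OF assms(4)] by (fastforce simp: less_Suc_eq_le)
    ultimately show ?thesis by simp
  qed
  ultimately show ?thesis by simp
qed

lemma vector_measure_on_add:
  "vector_measure_on \<Omega> F \<Longrightarrow> vector_measure_on \<Omega> G \<Longrightarrow> vector_measure_on \<Omega> (\<lambda>A. F A + G A)"
  by (auto simp: vector_measure_on_def intro: sums_add)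

lemma vector_measure_on_diff:
  "vector_measure_on \<Omega> F \<Longrightarrow> vector_measure_on \<Omega> G \<Longrightarrow> vector_measure_on \<Omega> (\<lambda>A. F A - G A)"
  by (auto simp: vector_measure_on_def intro: sums_diff)

lemma vector_measure_on_sum:
  "(\<And>i. i \<in> I \<Longrightarrow> vector_measure_on \<Omega> (F i)) \<Longrightarrow> vector_measure_on \<Omega> (\<lambda>A. \<Sum>i\<in>I. F i A)"
  by (auto simp: vector_measure_on_def intro: sums_sum)

lemma vector_measure_on_bounded_linear:
  assumes "bounded_linear h" "vector_measure_on \<Omega> F"
  shows "vector_measure_on \<Omega> (\<lambda>A. h (F A))"
proof -
  interpret bounded_linear h by fact
  show ?thesis using assms(2) unfolding vector_measure_on_def
    by (auto simp: zero intro: sums)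
qed

lemma vector_measure_on_inner:
  fixes F :: "'a::topological_space set \<Rightarrow> 'b::real_inner"
  shows "vector_measure_on \<Omega> F \<Longrightarrow> signed_measure_on \<Omega> (\<lambda>A. F A \<bullet> b)"
  by (rule vector_measure_on_bounded_linear[OF bounded_linear_inner_left])

lemma vector_measure_on_uminus: "vector_measure_on \<Omega> F \<Longrightarrow> vector_measure_on \<Omega> (\<lambda>A. - F A)"
  by (rule vector_measure_on_bounded_linear[OF bounded_linear_minus[OF bounded_linear_ident]])

lemma vector_measure_on_scaleR:
  "vector_measure_on \<Omega> F \<Longrightarrow> vector_measure_on \<Omega> (\<lambda>A. c *\<^sub>R F A)"
  by (rule vector_measure_on_bounded_linear[OF bounded_linear_scaleR_right])

lemma vector_measure_on_scale:
  fixes F :: "'a::topological_space set \<Rightarrow> real"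
  shows "vector_measure_on \<Omega> F \<Longrightarrow> vector_measure_on \<Omega> (\<lambda>A. c * F A)"
  using vector_measure_on_scaleR[of \<Omega> F c] by simp

lemma disjoint_family_Int: "disjoint_family A \<Longrightarrow> disjoint_family (\<lambda>i. B \<inter> A i)"
  unfolding disjoint_family_on_def by blast

text \<open>The case distinction preserves the convention that set functions vanish off the Borel
  subsets: \<open>S \<inter> W\<close> can be Borel although \<open>S\<close> is not.\<close>

lemma vector_measure_on_restrict:
  assumes \<Omega>: "\<Omega> \<in> sets borel" and s: "vector_measure_on \<Omega> s" and W: "W \<in> sets borel"
  shows "vector_measure_on \<Omega> (\<lambda>S. if S \<in> borel_on \<Omega> then s (S \<inter> W) else 0)"
  unfolding vector_measure_on_def
proof (intro conjI allI impI)
  fix A :: "nat \<Rightarrow> 'a set" assume A: "range A \<subseteq> borel_on \<Omega>" "disjoint_family A"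
  have Ai: "A i \<in> borel_on \<Omega>" for i using A(1) by auto
  have "(\<Union>i. A i) \<in> borel_on \<Omega>" using Ai by (auto simp: borel_on_iff)
  moreover have "(\<lambda>i. s (W \<inter> A i)) sums s (\<Union>i. W \<inter> A i)"
    by (rule vector_measure_on_sums[OF s _ _ disjoint_family_Int[OF A(2)]]) (use Ai W in \<open>auto simp: borel_on_iff\<close>)
  ultimately show "(\<lambda>i. if A i \<in> borel_on \<Omega> then s (A i \<inter> W) else 0) sums
      (if (\<Union>i. A i) \<in> borel_on \<Omega> then s ((\<Union>i. A i) \<inter> W) else 0)"
    using Ai by (simp add: Int_commute)
qed simp

section \<open>The Jordan decomposition\<close>

text \<open>The positive part and the variation are both suprema. For a supremum, superadditivity on
  two sets follows by joining competitors and countable subadditivity by cutting one competitor into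
  pieces, so these are the two conditions asked for.\<close>

lemma countably_additive_of_superadditive:
  fixes f :: "'a set \<Rightarrow> ennreal"
  assumes "sigma_algebra \<Omega> M" and "f {} = 0"
    and super: "\<And>A B. A \<in> M \<Longrightarrow> B \<in> M \<Longrightarrow> A \<inter> B = {} \<Longrightarrow> f A + f B \<le> f (A \<union> B)"
    and sub: "\<And>A. range A \<subseteq> M \<Longrightarrow> disjoint_family A \<Longrightarrow> f (\<Union>i::nat. A i) \<le> (\<Sum>i. f (A i))"
  shows "countably_additive M f"
proof (rule countably_additiveI)
  interpret sigma_algebra \<Omega> M by fact
  fix A :: "nat \<Rightarrow> 'a set" assume A: "range A \<subseteq> M" "disjoint_family A" "(\<Union>i. A i) \<in> M"
  have mono: "f B \<le> f C" if "B \<subseteq> C" "B \<in> M" "C \<in> M" for B C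
    \<comment> \<open>Superadditivity contains monotonicity, through
      \<open>C = B \<union> (C - B)\<close>.\<close>
    using super[of B "C - B"] that
    by (metis Diff Diff_disjoint Un_Diff_cancel le_iff_add order_trans sup.absorb2)
  have "(\<Sum>i<n. f (A i)) \<le> f (\<Union>i<n. A i)" for n
  proof (induction n)
    case 0
    then show ?case by (simp add: assms(2))
  next
    case (Suc n)
    have "(\<Sum>i<Suc n. f (A i)) \<le> f (\<Union>i<n. A i) + f (A n)"
      using Suc by (simp add: add_right_mono)
    also have "\<dots> \<le> f ((\<Union>i<n. A i) \<union> A n)"
    proof (rule super)
      have "A i \<inter> A n = {}" if "i < n" for i
        by (rule disjoint_family_onD[OF A(2)]) (use that in auto)
      then show "(\<Union>i<n. A i) \<inter> A n = {}" by blast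
    qed (use A in auto)
    also have "(\<Union>i<n. A i) \<union> A n = (\<Union>i<Suc n. A i)" by (auto simp: less_Suc_eq)
    finally show ?case .
  qed
  also have "f (\<Union>i<n. A i) \<le> f (\<Union>i. A i)" for n
    by (rule mono) (use A in auto)
  finally have "(\<Sum>i. f (A i)) \<le> f (\<Union>i. A i)"
    by (intro suminf_le_const) auto
  with sub[OF A(1,2)] show "(\<Sum>i. f (A i)) = f (\<Union>i. A i)" by (rule antisym[rotated])
qed

text \<open>If \<open>s\<close> were unbounded on the subsets of \<Omega>, one could descend through
  a nested sequence of sets on which it stays unbounded, removing at each stage a piece of measure
  larger than 1 in absolute value. The removed pieces are disjoint, which contradicts
  summability.\<close>

lemma signed_measure_on_bounded:
  assumes "\<Omega> \<in> sets borel" "signed_measure_on \<Omega> s"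
  shows "\<exists>C. \<forall>A. \<bar>s A\<bar> \<le> C"
proof (rule ccontr)
  assume neg: "\<not> ?thesis"
  define unb where "unb A \<longleftrightarrow> A \<in> sets borel \<and> A \<subseteq> \<Omega> \<and> (\<forall>C. \<exists>B\<in>sets borel. B \<subseteq> A \<and> \<bar>s B\<bar> > C)" for A
  have "unb \<Omega>" unfolding unb_def
  proof (intro conjI allI)
    fix C
    obtain A where "\<bar>s A\<bar> > max C 0" using neg by (meson not_le)
    moreover from this have "A \<in> borel_on \<Omega>"
      using vector_measure_on_outside[OF assms(2)] by force
    ultimately show "\<exists>B\<in>sets borel. B \<subseteq> \<Omega> \<and> C < \<bar>s B\<bar>" by (auto simp: borel_on_iff)
  qed (use assms in auto)
  have split: "unb B \<or> unb (A - B)" if "unb A" "B \<in> sets borel" "B \<subseteq> A" for A B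
  proof (rule ccontr)
    assume "\<not> (unb B \<or> unb (A - B))"
    then have "\<not> unb B" "\<not> unb (A - B)" by auto
    moreover have "B \<in> sets borel" "B \<subseteq> \<Omega>" "A - B \<in> sets borel" "A - B \<subseteq> \<Omega>"
      using that by (auto simp: unb_def)
    ultimately have "\<exists>C. \<forall>E\<in>sets borel. E \<subseteq> B \<longrightarrow> \<bar>s E\<bar> \<le> C"
      "\<exists>C. \<forall>E\<in>sets borel. E \<subseteq> A - B \<longrightarrow> \<bar>s E\<bar> \<le> C"
      by (simp_all add: unb_def not_less)
    then obtain C D where C: "\<forall>E\<in>sets borel. E \<subseteq> B \<longrightarrow> \<bar>s E\<bar> \<le> C"
      and D: "\<forall>E\<in>sets borel. E \<subseteq> A - B \<longrightarrow> \<bar>s E\<bar> \<le> D" by auto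
    have "\<exists>E\<in>sets borel. E \<subseteq> A \<and> \<bar>s E\<bar> > C + D" using that(1) by (simp add: unb_def)
    then obtain E where E: "E \<in> sets borel" "E \<subseteq> A" "\<bar>s E\<bar> > C + D" by auto
    have "s E = s (E \<inter> B) + s (E - B)"
      by (rule vector_measure_on_Int_Diff[OF assms(2)]) (use that E in \<open>auto simp: unb_def\<close>)
    moreover have "\<bar>s (E \<inter> B)\<bar> \<le> C" by (rule C[rule_format]) (use that(2) E in auto)
    moreover have "\<bar>s (E - B)\<bar> \<le> D" by (rule D[rule_format]) (use that(2) E in auto)
    ultimately show False using E by linarith
  qed
  \<comment> \<open>When \<open>\<bar>s B\<bar>\<close> exceeds \<open>\<bar>s A\<bar> + 1\<close>,
    both \<open>B\<close> and \<open>A - B\<close> have measure larger than 1 in absolute value. So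
    either may be discarded, and the one on which \<open>s\<close> is unbounded is kept.\<close>
  have step: "\<exists>B. unb B \<and> B \<subseteq> A \<and> \<bar>s (A - B)\<bar> > 1" if A: "unb A" for A
  proof -
    have "\<exists>B\<in>sets borel. B \<subseteq> A \<and> \<bar>s B\<bar> > \<bar>s A\<bar> + 1" using A by (simp add: unb_def)
    then obtain B where B: "B \<in> sets borel" "B \<subseteq> A" "\<bar>s B\<bar> > \<bar>s A\<bar> + 1" by auto
    have AB: "s (A - B) = s A - s B"
      by (rule vector_measure_on_Diff[OF assms(2)]) (use A B in \<open>auto simp: unb_def\<close>)
    show ?thesis
    proof (cases "unb B")
      case True
      then show ?thesis using AB B by (intro exI[of _ B]) auto
    next
      case False
      then have "unb (A - B)" using split[OF A B(1,2)] by auto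
      moreover have "A - (A - B) = B" using B by auto
      ultimately show ?thesis using B by (intro exI[of _ "A - B"]) auto
    qed
  qed
  obtain A where A: "\<And>n::nat. unb (A n)" "\<And>n. A (Suc n) \<subseteq> A n" "\<And>n. \<bar>s (A n - A (Suc n))\<bar> > 1"
  proof -
    have "\<exists>A::nat \<Rightarrow> _. \<forall>n. unb (A n) \<and> A (Suc n) \<subseteq> A n \<and> \<bar>s (A n - A (Suc n))\<bar> > 1"
      by (rule dependent_nat_choice) (use \<open>unb \<Omega>\<close> step in blast)+
    then obtain A where "\<forall>n::nat. unb (A n) \<and> A (Suc n) \<subseteq> A n \<and> \<bar>s (A n - A (Suc n))\<bar> > 1" ..
    then show ?thesis using that[of A] by simp
  qed
  have dec: "decseq A" using A(2) by (rule decseq_SucI)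
  have "(\<lambda>n. s (A n - A (Suc n))) sums s (\<Union>n. A n - A (Suc n))"
  proof (rule vector_measure_on_sums[OF assms(2)])
    show "disjoint_family (\<lambda>n. A n - A (Suc n))"
      unfolding disjoint_family_on_def
    proof (intro ballI impI)
      fix m n :: nat assume "m \<noteq> n"
      then show "(A m - A (Suc m)) \<inter> (A n - A (Suc n)) = {}"
        using dec[THEN decseqD, of "Suc m" n] dec[THEN decseqD, of "Suc n" m]
        by (cases m n rule: linorder_cases) auto
    qed
  qed (use A in \<open>auto simp: unb_def\<close>)
  then have "(\<lambda>n. s (A n - A (Suc n))) \<longlonglongrightarrow> 0" by (auto dest: sums_summable summable_LIMSEQ_zero)
  from tendstoD[OF this, of 1] obtain n where "\<bar>s (A n - A (Suc n))\<bar> < 1"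
    by (auto simp: dist_real_def dest: eventually_happens)
  with A(3)[of n] show False by simp
qed

text \<open>Superadditivity joins competitors in disjoint sets, subadditivity cuts one competitor
  along the \<open>A i\<close>, and the supremum is finite because \<open>s\<close> is
  bounded.\<close>

lemma radon_positive_part:
  assumes \<Omega>: "\<Omega> \<in> sets borel" and s: "signed_measure_on \<Omega> s"
  shows "radon_measure_on \<Omega> (positive_part \<Omega> s)"
    and "A \<in> borel_on \<Omega> \<Longrightarrow>
      emeasure (positive_part \<Omega> s) A = (SUP B \<in> {B \<in> borel_on \<Omega>. B \<subseteq> A}. ennreal (s B))"
proof -
  interpret sigma_algebra \<Omega> "borel_on \<Omega>" by (rule sigma_algebra_borel_on) fact
  define f where "f A = (SUP B \<in> {B \<in> borel_on \<Omega>. B \<subseteq> A}. ennreal (s B))" for A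
  have f_upper: "ennreal (s B) \<le> f A" if "B \<in> borel_on \<Omega>" "B \<subseteq> A" for A B
    unfolding f_def by (rule SUP_upper) (use that in auto)
  have f_empty: "f {} = 0"
  proof -
    have "{B \<in> borel_on \<Omega>. B \<subseteq> {}} = {{}}" by auto
    then show ?thesis using s by (simp add: f_def)
  qed
  have "countably_additive (borel_on \<Omega>) f"
  proof (rule countably_additive_of_superadditive[where \<Omega>=\<Omega>])
    show "f {} = 0" by fact
    fix A B assume AB: "A \<in> borel_on \<Omega>" "B \<in> borel_on \<Omega>" "A \<inter> B = {}"
    \<comment> \<open>Truncation at 0 destroys additivity of \<open>ennreal\<close> on mixed signs.
      A set of negative measure is therefore replaced by the empty set, which has the same truncated
      value.\<close>
    have pos: "\<exists>C'. C' \<in> borel_on \<Omega> \<and> C' \<subseteq> C \<and> s C' \<ge> 0 \<and> ennreal (s C) = ennreal (s C')"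
      if "C \<in> borel_on \<Omega>" for C
    proof (cases "s C \<ge> 0")
      case True
      then show ?thesis using that by blast
    next
      case False
      then show ?thesis using s by (intro exI[of _ "{}"]) (auto simp: ennreal_neg)
    qed
    have *: "ennreal (s C) + ennreal (s D) \<le> f (A \<union> B)"
      if CD: "C \<in> borel_on \<Omega>" "D \<in> borel_on \<Omega>" "C \<subseteq> A" "D \<subseteq> B" for C D
    proof -
      obtain C' D' where C': "C' \<in> borel_on \<Omega>" "C' \<subseteq> C" "s C' \<ge> 0" "ennreal (s C) = ennreal (s C')"
        and D': "D' \<in> borel_on \<Omega>" "D' \<subseteq> D" "s D' \<ge> 0" "ennreal (s D) = ennreal (s D')"
        using pos CD(1,2) by meson
      have "ennreal (s C) + ennreal (s D) = ennreal (s C' + s D')" using C' D' by simp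
      also have "s C' + s D' = s (C' \<union> D')"
      proof (rule vector_measure_on_Un[OF s, symmetric])
        show "C' \<inter> D' = {}" using C'(2) D'(2) CD(3,4) AB(3) by blast
      qed (use C' D' in \<open>auto simp: borel_on_iff\<close>)
      also have "ennreal \<dots> \<le> f (A \<union> B)" by (rule f_upper) (use C' D' CD in auto)
      finally show ?thesis .
    qed
    have "f A + ennreal (s D) \<le> f (A \<union> B)" if "D \<in> borel_on \<Omega>" "D \<subseteq> B" for D
    proof -
      have "f A + ennreal (s D) = (SUP C \<in> {C \<in> borel_on \<Omega>. C \<subseteq> A}. ennreal (s C) + ennreal (s D))"
        unfolding f_def by (rule ennreal_SUP_add_left[symmetric]) (auto simp: AB)
      also have "\<dots> \<le> f (A \<union> B)" by (rule SUP_least) (use * that in auto)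
      finally show ?thesis .
    qed
    then have "(SUP D \<in> {D \<in> borel_on \<Omega>. D \<subseteq> B}. f A + ennreal (s D)) \<le> f (A \<union> B)"
      by (intro SUP_least) auto
    moreover have "f A + f B = (SUP D \<in> {D \<in> borel_on \<Omega>. D \<subseteq> B}. f A + ennreal (s D))"
      unfolding f_def[of B] by (rule ennreal_SUP_add_right) (auto intro: exI[of _ "{}"])
    ultimately show "f A + f B \<le> f (A \<union> B)" by simp
  next
    fix A :: "nat \<Rightarrow> 'a set" assume A: "range A \<subseteq> borel_on \<Omega>" "disjoint_family A"
    have Ai: "A i \<in> sets borel" "A i \<subseteq> \<Omega>" for i
      using A(1)[THEN subsetD, of "A i"] by (auto simp: borel_on_iff)
    show "f (\<Union>i. A i) \<le> (\<Sum>i. f (A i))"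
      unfolding f_def[of "\<Union>i. A i"]
    proof (rule SUP_least)
      fix B assume "B \<in> {B \<in> borel_on \<Omega>. B \<subseteq> (\<Union>i. A i)}"
      then have B: "B \<in> borel_on \<Omega>" "B \<subseteq> (\<Union>i. A i)" by auto
      have "(\<lambda>i. s (B \<inter> A i)) sums s (\<Union>i. B \<inter> A i)"
        by (rule vector_measure_on_sums[OF s])
           (use Ai disjoint_family_Int[OF A(2)] B in \<open>auto simp: borel_on_iff\<close>)
      moreover have "(\<Union>i. B \<inter> A i) = B" using B by auto
      ultimately have "(\<lambda>n. ennreal (\<Sum>i<n. s (B \<inter> A i))) \<longlonglongrightarrow> ennreal (s B)"
        by (intro tendsto_ennrealI) (auto simp: sums_def)
      moreover have "ennreal (\<Sum>i<n. s (B \<inter> A i)) \<le> (\<Sum>i. f (A i))" for n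
      proof -
        \<comment> \<open>Replacing each summand by its positive part first makes
          \<open>ennreal\<close> commute with the sum.\<close>
        have "ennreal (\<Sum>i<n. s (B \<inter> A i)) \<le> ennreal (\<Sum>i<n. max 0 (s (B \<inter> A i)))"
          by (intro ennreal_leI sum_mono) auto
        also have "\<dots> = (\<Sum>i<n. ennreal (s (B \<inter> A i)))"
          by (subst sum_ennreal[symmetric]) simp_all
        also have "\<dots> \<le> (\<Sum>i<n. f (A i))"
          by (intro sum_mono f_upper) (use Ai B in \<open>auto simp: borel_on_iff\<close>)
        also have "\<dots> \<le> (\<Sum>i. f (A i))" by (intro sum_le_suminf) auto
        finally show ?thesis .
      qed
      ultimately show "ennreal (s B) \<le> (\<Sum>i. f (A i))" by (intro LIMSEQ_le_const2) auto
    qed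
  qed (rule sigma_algebra_axioms)
  moreover have "positive (borel_on \<Omega>) f" using f_empty by (simp add: positive_def)
  ultimately have em: "emeasure (positive_part \<Omega> s) A = f A" if "A \<in> borel_on \<Omega>" for A
    unfolding positive_part_def f_def[symmetric]
    by (intro emeasure_measure_of_sigma sigma_algebra_axioms that)
  then show "A \<in> borel_on \<Omega> \<Longrightarrow>
      emeasure (positive_part \<Omega> s) A = (SUP B \<in> {B \<in> borel_on \<Omega>. B \<subseteq> A}. ennreal (s B))"
    by (simp add: f_def)
  obtain C where C: "\<And>A. \<bar>s A\<bar> \<le> C" using signed_measure_on_bounded[OF \<Omega> s] by auto
  have "f \<Omega> \<le> ennreal C" unfolding f_def
    by (rule SUP_least) (metis C abs_le_D1 ennreal_leI)
  moreover have sp: "space (positive_part \<Omega> s) = \<Omega>" "sets (positive_part \<Omega> s) = borel_on \<Omega>"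
    unfolding positive_part_def using space_closed by (auto simp: sigma_sets_eq space_measure_of sets_measure_of)
  ultimately have "finite_measure (positive_part \<Omega> s)"
    using em[OF top] by (intro finite_measureI) (auto simp: top_unique)
  with sp show "radon_measure_on \<Omega> (positive_part \<Omega> s)" by (simp add: radon_measure_on_def)
qed

text \<open>Complementation in \<open>A\<close> exchanges the two suprema:
  \<open>s B = s A + (- s (A - B))\<close>. This yields one inequality between the parts, and the
  same inequality for \<open>- s\<close> is the reverse one.\<close>

lemma Jordan_decomposition:
  assumes \<Omega>: "\<Omega> \<in> sets borel" and s: "signed_measure_on \<Omega> s" and A: "A \<in> borel_on \<Omega>"
  shows "s A = measure (positive_part \<Omega> s) A - measure (positive_part \<Omega> (\<lambda>A. - s A)) A"
proof -
  have bd: "s B \<le> measure (positive_part \<Omega> s) A" if "signed_measure_on \<Omega> s" "B \<in> borel_on \<Omega>" "B \<subseteq> A" for s B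
  proof -
    interpret finite_measure "positive_part \<Omega> s"
      using radon_positive_part(1)[OF \<Omega> that(1)] by (simp add: radon_measure_on_def)
    have "ennreal (s B) \<le> ennreal (measure (positive_part \<Omega> s) A)"
      unfolding emeasure_eq_measure[symmetric] radon_positive_part(2)[OF \<Omega> that(1) A]
      by (rule SUP_upper) (use that in auto)
    then show ?thesis by (simp add: ennreal_le_iff)
  qed
  have le: "measure (positive_part \<Omega> s) A \<le> s A + measure (positive_part \<Omega> (\<lambda>A. - s A)) A"
    if s: "signed_measure_on \<Omega> s" for s
  proof -
    interpret finite_measure "positive_part \<Omega> s"
      using radon_positive_part(1)[OF \<Omega> s] by (simp add: radon_measure_on_def)
    have s': "signed_measure_on \<Omega> (\<lambda>A. - s A)" by (rule vector_measure_on_uminus[OF s])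
    have "emeasure (positive_part \<Omega> s) A \<le> ennreal (s A + measure (positive_part \<Omega> (\<lambda>A. - s A)) A)"
      unfolding radon_positive_part(2)[OF \<Omega> s A]
    proof (intro SUP_least ennreal_leI)
      fix B assume B: "B \<in> {B \<in> borel_on \<Omega>. B \<subseteq> A}"
      have "s (A - B) = s A - s B"
        by (rule vector_measure_on_Diff[OF s]) (use A B in \<open>auto simp: borel_on_iff\<close>)
      moreover have "- s (A - B) \<le> measure (positive_part \<Omega> (\<lambda>A. - s A)) A"
        using bd[OF s', of "A - B"] A B by (auto simp: borel_on_iff)
      ultimately show "s B \<le> s A + measure (positive_part \<Omega> (\<lambda>A. - s A)) A" by linarith
    qed
    moreover have "0 \<le> s A + measure (positive_part \<Omega> (\<lambda>A. - s A)) A"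
      using bd[OF s' A] by simp
    ultimately show ?thesis by (simp add: emeasure_eq_measure)
  qed
  from le[OF s] le[OF vector_measure_on_uminus[OF s]] show ?thesis by simp
qed

section \<open>Integrals against signed and vector measures\<close>

definition bounded_borel :: "('a::topological_space \<Rightarrow> 'b::real_normed_vector) \<Rightarrow> bool" where
  "bounded_borel f \<longleftrightarrow> f \<in> borel_measurable borel \<and> bounded (range f)"

abbreviation sint :: "'a::topological_space set \<Rightarrow> ('a set \<Rightarrow> real) \<Rightarrow> ('a \<Rightarrow> real) \<Rightarrow> real" where
  "sint \<Omega> s f \<equiv> signed_integral \<Omega> s \<Omega> f"

text \<open>The target space is independent of the domain. Integrals over a subset are expressed by
  an indicator factor in \<open>G\<close>.\<close>

definition vint ::
  "'a::topological_space set \<Rightarrow> ('a set \<Rightarrow> 'b::euclidean_space) \<Rightarrow> ('a \<Rightarrow> 'b) \<Rightarrow> real" where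
  "vint \<Omega> F G = (\<Sum>b\<in>Basis. sint \<Omega> (\<lambda>A. F A \<bullet> b) (\<lambda>x. G x \<bullet> b))"

lemma bounded_borelI: "f \<in> borel_measurable borel \<Longrightarrow> (\<And>x. norm (f x) \<le> C) \<Longrightarrow> bounded_borel f"
  by (auto simp: bounded_borel_def bounded_iff)

lemma bounded_borel_measurable: "bounded_borel f \<Longrightarrow> f \<in> borel_measurable borel"
  by (simp add: bounded_borel_def)

lemma bounded_borel_bound:
  assumes "bounded_borel f"
  obtains C where "C \<ge> 0" "\<And>x. norm (f x) \<le> C"
proof -
  obtain C where C: "\<And>x. norm (f x) \<le> C" using assms by (auto simp: bounded_borel_def bounded_iff)
  then have "C \<ge> 0" using norm_ge_zero order_trans by blast
  then show ?thesis using C that by blast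
qed

lemma bounded_borel_const [simp]: "bounded_borel (\<lambda>x. c)"
  by (rule bounded_borelI[where C="norm c"]) auto

lemma bounded_borel_indicator [simp]:
  "A \<in> sets borel \<Longrightarrow> bounded_borel (indicator A :: 'a::topological_space \<Rightarrow> real)"
  by (rule bounded_borelI[where C=1]) (auto simp: indicator_def)

lemma bounded_borel_add:
  fixes f g :: "'a::topological_space \<Rightarrow> 'b::{real_normed_vector, second_countable_topology}"
  assumes "bounded_borel f" "bounded_borel g" shows "bounded_borel (\<lambda>x. f x + g x)"
proof -
  obtain C D where "\<And>x. norm (f x) \<le> C" "\<And>x. norm (g x) \<le> D"
    using assms by (metis bounded_borel_bound)
  then show ?thesis using assms
    by (intro bounded_borelI[where C="C + D"])
       (auto simp: bounded_borel_def intro: order_trans[OF norm_triangle_ineq add_mono])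
qed

lemma bounded_borel_mult:
  fixes f g :: "'a::topological_space \<Rightarrow> real"
  assumes "bounded_borel f" "bounded_borel g" shows "bounded_borel (\<lambda>x. f x * g x)"
proof -
  obtain C D where "C \<ge> 0" "\<And>x. norm (f x) \<le> C" "\<And>x. norm (g x) \<le> D"
    using assms by (metis bounded_borel_bound)
  then show ?thesis using assms
    by (intro bounded_borelI[where C="C * D"])
       (auto simp: bounded_borel_def abs_mult intro: mult_mono)
qed

lemma bounded_borel_scaleR:
  fixes g :: "'a::topological_space \<Rightarrow> 'b::{real_normed_vector, second_countable_topology}"
  assumes "bounded_borel f" "bounded_borel g" shows "bounded_borel (\<lambda>x. f x *\<^sub>R g x)"
proof -
  obtain C D where "C \<ge> 0" "\<And>x. norm (f x) \<le> C" "\<And>x. norm (g x) \<le> D"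
    using assms by (metis bounded_borel_bound)
  then show ?thesis using assms
    by (intro bounded_borelI[where C="C * D"])
       (auto simp: bounded_borel_def intro: mult_mono)
qed

lemma bounded_borel_norm: "bounded_borel f \<Longrightarrow> bounded_borel (\<lambda>x. norm (f x))"
  by (auto simp: bounded_borel_def bounded_iff)

lemma bounded_borel_abs: "bounded_borel (f :: _ \<Rightarrow> real) \<Longrightarrow> bounded_borel (\<lambda>x. \<bar>f x\<bar>)"
  using bounded_borel_norm[of f] by simp

lemma bounded_borel_inner:
  fixes f :: "'a::topological_space \<Rightarrow> 'b::{real_inner, second_countable_topology}"
  assumes "bounded_borel f" shows "bounded_borel (\<lambda>x. f x \<bullet> b)"
proof -
  obtain C where "\<And>x. norm (f x) \<le> C" using assms by (metis bounded_borel_bound)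
  then have "norm (f x \<bullet> b) \<le> C * norm b" for x
    using Cauchy_Schwarz_ineq2[of "f x" b] mult_right_mono[of "norm (f x)" C "norm b"]
    by (simp add: order_trans)
  then show ?thesis using assms by (intro bounded_borelI) (auto simp: bounded_borel_def)
qed

lemma bounded_borel_cmult: "bounded_borel (f :: _ \<Rightarrow> real) \<Longrightarrow> bounded_borel (\<lambda>x. c * f x)"
  by (intro bounded_borel_mult) auto

lemma bounded_borel_uminus: "bounded_borel (f :: _ \<Rightarrow> real) \<Longrightarrow> bounded_borel (\<lambda>x. - f x)"
  using bounded_borel_cmult[of f "-1"] by simp

lemma bounded_borel_diff:
  "bounded_borel (f :: _ \<Rightarrow> real) \<Longrightarrow> bounded_borel g \<Longrightarrow> bounded_borel (\<lambda>x. f x - g x)"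
  using bounded_borel_add[of f "\<lambda>x. - g x"] bounded_borel_uminus by fastforce

lemma bounded_borel_sum:
  fixes f :: "'i \<Rightarrow> 'a::topological_space \<Rightarrow> 'b::{real_normed_vector, second_countable_topology}"
  shows "(\<And>i. i \<in> I \<Longrightarrow> bounded_borel (f i)) \<Longrightarrow> bounded_borel (\<lambda>x. \<Sum>i\<in>I. f i x)"
  by (induction I rule: infinite_finite_induct) (auto intro: bounded_borel_add)

lemmas bounded_borel_intros =
  bounded_borel_const bounded_borel_indicator bounded_borel_add bounded_borel_mult
  bounded_borel_scaleR bounded_borel_norm bounded_borel_abs bounded_borel_inner
  bounded_borel_cmult bounded_borel_uminus bounded_borel_diff bounded_borel_sum

lemma radon_measure_onD:
  assumes "radon_measure_on \<Omega> \<mu>"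
  shows "space \<mu> = \<Omega>" "sets \<mu> = borel_on \<Omega>" "finite_measure \<mu>"
  using assms by (auto simp: radon_measure_on_def)

lemma radon_measurable:
  assumes "radon_measure_on \<Omega> \<mu>" "\<Omega> \<in> sets borel" "f \<in> measurable borel N"
  shows "f \<in> measurable \<mu> N"
proof -
  have "sets \<mu> = sets (restrict_space borel \<Omega>)"
    using assms by (simp add: radon_measure_onD borel_on_eq_sets_restrict_space)
  then show ?thesis using assms(3) measurable_restrict_space1 measurable_cong_sets by blast
qed

lemma radon_integrable:
  fixes f :: "'a::topological_space \<Rightarrow> 'b::{banach, second_countable_topology}"
  assumes "radon_measure_on \<Omega> \<mu>" "\<Omega> \<in> sets borel" "bounded_borel f"
  shows "integrable \<mu> f"
proof -
  interpret finite_measure \<mu> using assms by (simp add: radon_measure_onD)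
  obtain C where "\<And>x. norm (f x) \<le> C" using assms(3) by (metis bounded_borel_bound)
  then show ?thesis using assms by (intro integrable_const_bound[where B=C] radon_measurable[OF assms(1,2)])
      (auto simp: bounded_borel_def)
qed

lemma sint_eq:
  assumes "\<Omega> \<in> sets borel" "signed_measure_on \<Omega> s"
  shows "sint \<Omega> s f =
    integral\<^sup>L (positive_part \<Omega> s) f - integral\<^sup>L (positive_part \<Omega> (\<lambda>A. - s A)) f"
  unfolding signed_integral_def set_lebesgue_integral_def
  using radon_positive_part(1)[OF assms] radon_positive_part(1)[OF assms(1) vector_measure_on_uminus[OF assms(2)]]
  by (intro arg_cong2[where f="(-)"] Bochner_Integration.integral_cong) (auto simp: radon_measure_onD)

lemma signed_integral_eq_sint:
  assumes "\<Omega> \<in> sets borel" "signed_measure_on \<Omega> s"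
  shows "signed_integral \<Omega> s U f = sint \<Omega> s (\<lambda>x. indicator U x * f x)"
  unfolding sint_eq[OF assms] unfolding signed_integral_def set_lebesgue_integral_def by simp

context
  fixes \<Omega> :: "'a::topological_space set" and s :: "'a set \<Rightarrow> real"
  assumes \<Omega>: "\<Omega> \<in> sets borel" and s: "signed_measure_on \<Omega> s"
begin

lemma sint_indicator: "A \<in> sets borel \<Longrightarrow> sint \<Omega> s (indicator A) = s (A \<inter> \<Omega>)"
  using Jordan_decomposition[OF \<Omega> s, of "A \<inter> \<Omega>"] radon_positive_part(1)[OF \<Omega> s]
    radon_positive_part(1)[OF \<Omega> vector_measure_on_uminus[OF s]] \<Omega>
  by (simp add: sint_eq[OF \<Omega> s] radon_measure_onD borel_on_iff)

lemma sint_add: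
  "bounded_borel f \<Longrightarrow> bounded_borel g \<Longrightarrow> sint \<Omega> s (\<lambda>x. f x + g x) = sint \<Omega> s f + sint \<Omega> s g"
  using radon_integrable[OF radon_positive_part(1)[OF \<Omega> s] \<Omega>, of f]
    radon_integrable[OF radon_positive_part(1)[OF \<Omega> s] \<Omega>, of g]
    radon_integrable[OF radon_positive_part(1)[OF \<Omega> vector_measure_on_uminus[OF s]] \<Omega>, of f]
    radon_integrable[OF radon_positive_part(1)[OF \<Omega> vector_measure_on_uminus[OF s]] \<Omega>, of g]
  by (simp add: sint_eq[OF \<Omega> s])

lemma sint_cmult: "sint \<Omega> s (\<lambda>x. c * f x) = c * sint \<Omega> s f"
  by (simp add: sint_eq[OF \<Omega> s] right_diff_distrib)

lemma sint_zero [simp]: "sint \<Omega> s (\<lambda>x. 0) = 0"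
  by (simp add: sint_eq[OF \<Omega> s])

lemma sint_uminus: "sint \<Omega> s (\<lambda>x. - f x) = - sint \<Omega> s f"
  using sint_cmult[of "-1" f] by simp

lemma sint_diff:
  "bounded_borel f \<Longrightarrow> bounded_borel g \<Longrightarrow> sint \<Omega> s (\<lambda>x. f x - g x) = sint \<Omega> s f - sint \<Omega> s g"
  using sint_add[of f "\<lambda>x. - g x"] sint_uminus[of g] bounded_borel_uminus[of g] by simp

lemma sint_sum:
  "finite I \<Longrightarrow> (\<And>i. i \<in> I \<Longrightarrow> bounded_borel (f i)) \<Longrightarrow>
    sint \<Omega> s (\<lambda>x. \<Sum>i\<in>I. f i x) = (\<Sum>i\<in>I. sint \<Omega> s (f i))"
  by (induction I rule: finite_induct) (auto simp: sint_add bounded_borel_sum)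

lemma sint_cong: "(\<And>x. x \<in> \<Omega> \<Longrightarrow> f x = g x) \<Longrightarrow> sint \<Omega> s f = sint \<Omega> s g"
  unfolding sint_eq[OF \<Omega> s]
  using radon_positive_part(1)[OF \<Omega> s] radon_positive_part(1)[OF \<Omega> vector_measure_on_uminus[OF s]]
  by (intro arg_cong2[where f="(-)"] Bochner_Integration.integral_cong) (auto simp: radon_measure_onD)

lemma sint_tendsto:
  assumes "\<And>i. bounded_borel (f i)" "bounded_borel g"
    "\<And>i x. x \<in> \<Omega> \<Longrightarrow> \<bar>f i x\<bar> \<le> C" "\<And>x. x \<in> \<Omega> \<Longrightarrow> (\<lambda>i. f i x) \<longlonglongrightarrow> g x"
  shows "(\<lambda>i. sint \<Omega> s (f i)) \<longlonglongrightarrow> sint \<Omega> s g"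
proof -
  have *: "(\<lambda>i. integral\<^sup>L M (f i)) \<longlonglongrightarrow> integral\<^sup>L M g" if M: "radon_measure_on \<Omega> M" for M
  proof -
    interpret finite_measure M using M by (rule radon_measure_onD)
    show ?thesis
      by (rule integral_dominated_convergence[where w="\<lambda>x. C"])
         (use assms in \<open>auto simp: radon_measure_onD(1)[OF M] intro!: radon_measurable[OF M \<Omega>] bounded_borel_measurable\<close>)
  qed
  show ?thesis unfolding sint_eq[OF \<Omega> s]
    by (intro tendsto_diff * radon_positive_part \<Omega> s vector_measure_on_uminus)
qed

lemma sint_bounded:
  obtains K where "K \<ge> 0"
    "\<And>f C. bounded_borel f \<Longrightarrow> (\<And>x. x \<in> \<Omega> \<Longrightarrow> \<bar>f x\<bar> \<le> C) \<Longrightarrow> \<bar>sint \<Omega> s f\<bar> \<le> K * C"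
proof -
  define K where "K = measure (positive_part \<Omega> s) \<Omega> + measure (positive_part \<Omega> (\<lambda>A. - s A)) \<Omega>"
  have *: "\<bar>integral\<^sup>L M f\<bar> \<le> measure M \<Omega> * C"
    if M: "radon_measure_on \<Omega> M" and f: "bounded_borel f" and C: "\<And>x. x \<in> \<Omega> \<Longrightarrow> \<bar>f x\<bar> \<le> C"
    for M and f :: "'a \<Rightarrow> real" and C
  proof -
    interpret finite_measure M using M by (rule radon_measure_onD)
    have "\<bar>integral\<^sup>L M f\<bar> \<le> integral\<^sup>L M (\<lambda>x. \<bar>f x\<bar>)" by (rule integral_abs_bound)
    also have "\<dots> \<le> integral\<^sup>L M (\<lambda>x. C)"
      using radon_integrable[OF M \<Omega> f] C by (intro integral_mono) (auto simp: radon_measure_onD(1)[OF M])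
    finally show ?thesis by (simp add: radon_measure_onD(1)[OF M])
  qed
  show ?thesis
  proof (rule that[of K])
    fix f :: "'a \<Rightarrow> real" and C assume "bounded_borel f" "\<And>x. x \<in> \<Omega> \<Longrightarrow> \<bar>f x\<bar> \<le> C"
    then have "\<bar>integral\<^sup>L (positive_part \<Omega> s) f\<bar> \<le> measure (positive_part \<Omega> s) \<Omega> * C"
      "\<bar>integral\<^sup>L (positive_part \<Omega> (\<lambda>A. - s A)) f\<bar> \<le> measure (positive_part \<Omega> (\<lambda>A. - s A)) \<Omega> * C"
      by (intro * radon_positive_part \<Omega> s vector_measure_on_uminus; simp)+
    then show "\<bar>sint \<Omega> s f\<bar> \<le> K * C"
      by (simp add: sint_eq[OF \<Omega> s] K_def algebra_simps)
  qed (simp add: K_def)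
qed

end

text \<open>Rounding \<open>f\<close> down to multiples of \<open>e\<close> gives the approximation;
  boundedness leaves finitely many levels.\<close>

lemma bounded_borel_uniform_approx:
  fixes f :: "'a::topological_space \<Rightarrow> real"
  assumes "bounded_borel f" "e > 0"
  obtains I :: "int set" and c A where "finite I" "\<And>j. j \<in> I \<Longrightarrow> A j \<in> sets borel"
    "\<And>x. \<bar>f x - (\<Sum>j\<in>I. c j * indicator (A j) x)\<bar> \<le> e"
proof -
  note [measurable] = bounded_borel_measurable[OF assms(1)]
  obtain C where C: "\<And>x. \<bar>f x\<bar> \<le> C" using assms(1) by (metis bounded_borel_bound real_norm_def)
  define N where "N = \<lceil>C / e\<rceil> + 1"
  define A where "A j = {x. \<lfloor>f x / e\<rfloor> = j}" for j
  show ?thesis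
  proof (rule that[of "{-N..N}" A "\<lambda>j. real_of_int j * e"])
    show "A j \<in> sets borel" for j unfolding A_def by measurable
    fix x
    have "\<bar>f x / e\<bar> \<le> C / e" using C[of x] assms(2) by (simp add: abs_div divide_right_mono)
    then have "f x / e \<le> C / e" "- (f x / e) \<le> C / e" by (fact abs_le_D1, fact abs_le_D2)
    then have "\<lfloor>f x / e\<rfloor> \<in> {-N..N}" unfolding N_def atLeastAtMost_iff by linarith
    then have "(\<Sum>j\<in>{-N..N}. (real_of_int j * e) * indicator (A j) x) = real_of_int \<lfloor>f x / e\<rfloor> * e"
      by (subst sum.remove[of _ "\<lfloor>f x / e\<rfloor>"]) (auto simp: A_def indicator_def intro!: sum.neutral)
    moreover have "\<bar>f x - real_of_int \<lfloor>f x / e\<rfloor> * e\<bar> \<le> e"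
    proof -
      have "f x - real_of_int \<lfloor>f x / e\<rfloor> * e = (f x / e - real_of_int \<lfloor>f x / e\<rfloor>) * e"
        using assms(2) by (simp add: field_simps)
      moreover have "0 \<le> f x / e - real_of_int \<lfloor>f x / e\<rfloor>" "f x / e - real_of_int \<lfloor>f x / e\<rfloor> \<le> 1"
        by linarith+
      ultimately show ?thesis using assms(2) by (simp add: abs_mult mult_left_le_one_le)
    qed
    ultimately show "\<bar>f x - (\<Sum>j\<in>{-N..N}. (real_of_int j * e) * indicator (A j) x)\<bar> \<le> e" by simp
  qed simp
qed

text \<open>A linear functional that is continuous for uniform convergence is determined by its
  values on indicators, since bounded Borel functions are uniform limits of simple ones. Identities
  between integrals against different measures are reduced to this principle.\<close>

lemma sint_unique:
  fixes I :: "('a::topological_space \<Rightarrow> real) \<Rightarrow> real"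
  assumes \<Omega>: "\<Omega> \<in> sets borel" and s: "signed_measure_on \<Omega> s"
    and add: "\<And>f g. bounded_borel f \<Longrightarrow> bounded_borel g \<Longrightarrow> I (\<lambda>x. f x + g x) = I f + I g"
    and scale: "\<And>f c. bounded_borel f \<Longrightarrow> I (\<lambda>x. c * f x) = c * I f"
    and bound: "\<And>f C. bounded_borel f \<Longrightarrow> (\<And>x. \<bar>f x\<bar> \<le> C) \<Longrightarrow> \<bar>I f\<bar> \<le> K * C"
    and ind: "\<And>A. A \<in> sets borel \<Longrightarrow> I (indicator A) = s (A \<inter> \<Omega>)"
    and f: "bounded_borel f"
  shows "I f = sint \<Omega> s f"
proof -
  obtain L where L: "\<And>f C. bounded_borel f \<Longrightarrow> (\<And>x. x \<in> \<Omega> \<Longrightarrow> \<bar>f x\<bar> \<le> C) \<Longrightarrow> \<bar>sint \<Omega> s f\<bar> \<le> L * C"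
    using sint_bounded[OF \<Omega> s] by metis
  have sum: "I (\<lambda>x. \<Sum>i\<in>J. g i x) = (\<Sum>i\<in>J. I (g i))" if "finite J" "\<And>i. i \<in> J \<Longrightarrow> bounded_borel (g i)"
    for J :: "int set" and g
    using that
  proof (induction J rule: finite_induct)
    case empty
    have "I (\<lambda>x. 0 * 0) = 0 * I (\<lambda>x. 0)" by (rule scale) simp
    then show ?case by simp
  qed (auto simp: add bounded_borel_sum)
  have "\<bar>I f - sint \<Omega> s f\<bar> \<le> (K + L) * e" if e: "e > 0" for e
  proof -
    obtain J :: "int set" and c A where J: "finite J" "\<And>j. j \<in> J \<Longrightarrow> A j \<in> sets borel"
      and approx: "\<And>x. \<bar>f x - (\<Sum>j\<in>J. c j * indicator (A j) x)\<bar> \<le> e"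
      by (rule bounded_borel_uniform_approx[OF f e]) (rule that)
    define g where "g = (\<lambda>x. \<Sum>j\<in>J. c j * indicator (A j) x)"
    have g: "bounded_borel g" unfolding g_def using J by (intro bounded_borel_intros)
    have "I g = (\<Sum>j\<in>J. I (\<lambda>x. c j * indicator (A j) x))"
      unfolding g_def by (rule sum) (use J in \<open>auto intro: bounded_borel_intros\<close>)
    also have "\<dots> = (\<Sum>j\<in>J. sint \<Omega> s (\<lambda>x. c j * indicator (A j) x))"
      using J by (intro sum.cong) (auto simp: scale ind sint_cmult[OF \<Omega> s] sint_indicator[OF \<Omega> s])
    also have "\<dots> = sint \<Omega> s g"
      unfolding g_def by (rule sint_sum[OF \<Omega> s, symmetric]) (use J in \<open>auto intro: bounded_borel_intros\<close>)
    finally have "I g = sint \<Omega> s g" .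
    have d: "bounded_borel (\<lambda>x. f x + (-1) * g x)" "bounded_borel (\<lambda>x. (-1) * g x)"
      using f g by (auto intro: bounded_borel_intros)
    have "I (\<lambda>x. f x + (-1) * g x) = I f + (-1) * I g"
      using add[OF f d(2)] scale[OF g, of "-1"] by simp
    moreover have "sint \<Omega> s (\<lambda>x. f x + (-1) * g x) = sint \<Omega> s f + (-1) * sint \<Omega> s g"
      using sint_add[OF \<Omega> s f d(2)] sint_cmult[OF \<Omega> s, of "-1" g] by simp
    moreover have "\<bar>I (\<lambda>x. f x + (-1) * g x)\<bar> \<le> K * e"
      by (rule bound[OF d(1)]) (use approx in \<open>simp add: g_def\<close>)
    moreover have "\<bar>sint \<Omega> s (\<lambda>x. f x + (-1) * g x)\<bar> \<le> L * e"
      by (rule L[OF d(1)]) (use approx in \<open>simp add: g_def\<close>)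
    ultimately show ?thesis using \<open>I g = sint \<Omega> s g\<close> by (simp add: algebra_simps)
  qed
  then have *: "\<bar>I f - sint \<Omega> s f\<bar> \<le> (K + L) * e" if "e > 0" for e using that by blast
  have "((\<lambda>e. (K + L) * e) \<longlongrightarrow> (K + L) * 0) (at_right 0)" by (intro tendsto_intros)
  moreover have "eventually (\<lambda>e. \<bar>I f - sint \<Omega> s f\<bar> \<le> (K + L) * e) (at_right 0)"
    unfolding eventually_at_right_field using * by (intro exI[of _ 1]) auto
  ultimately have "\<bar>I f - sint \<Omega> s f\<bar> \<le> (K + L) * 0"
    by (rule tendsto_lowerbound) simp
  then show ?thesis by simp
qed

text \<open>The integral may be computed from any decomposition into finite measures. This matters
  for weak-star limits of Jordan parts, which need not be the Jordan parts of the limit.\<close>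

lemma sint_measure_diff:
  assumes \<Omega>: "\<Omega> \<in> sets borel" and s: "signed_measure_on \<Omega> s"
    and P: "radon_measure_on \<Omega> P" and N: "radon_measure_on \<Omega> N"
    and eq: "\<And>A. A \<in> borel_on \<Omega> \<Longrightarrow> s A = measure P A - measure N A"
    and f: "bounded_borel f"
  shows "sint \<Omega> s f = integral\<^sup>L P f - integral\<^sup>L N f"
proof -
  interpret P: finite_measure P using P by (rule radon_measure_onD)
  interpret N: finite_measure N using N by (rule radon_measure_onD)
  have b: "\<bar>integral\<^sup>L M f\<bar> \<le> measure M \<Omega> * C"
    if M: "radon_measure_on \<Omega> M" and f: "bounded_borel f" and C: "\<And>x. \<bar>f x\<bar> \<le> C"
    for M and f :: "'a \<Rightarrow> real" and C
  proof -
    interpret finite_measure M using M by (rule radon_measure_onD)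
    have "\<bar>integral\<^sup>L M f\<bar> \<le> integral\<^sup>L M (\<lambda>x. \<bar>f x\<bar>)" by (rule integral_abs_bound)
    also have "\<dots> \<le> integral\<^sup>L M (\<lambda>x. C)"
      using radon_integrable[OF M \<Omega> f] C by (intro integral_mono) auto
    finally show ?thesis by (simp add: radon_measure_onD(1)[OF M])
  qed
  show ?thesis
  proof (rule sint_unique[OF \<Omega> s _ _ _ _ f, symmetric, where K="measure P \<Omega> + measure N \<Omega>"])
    fix f :: "'a \<Rightarrow> real" and C assume "bounded_borel f" "\<And>x. \<bar>f x\<bar> \<le> C"
    then show "\<bar>integral\<^sup>L P f - integral\<^sup>L N f\<bar> \<le> (measure P \<Omega> + measure N \<Omega>) * C"
      using b[OF P, of f C] b[OF N, of f C] by (simp add: algebra_simps)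
  qed (use radon_integrable[OF P \<Omega>, where 'b=real] radon_integrable[OF N \<Omega>, where 'b=real] eq \<Omega> in
        \<open>simp_all add: radon_measure_onD(1)[OF P] radon_measure_onD(1)[OF N] right_diff_distrib borel_on_iff\<close>)
qed

lemma sint_add_measure:
  assumes "\<Omega> \<in> sets borel" "signed_measure_on \<Omega> s" "signed_measure_on \<Omega> t" "bounded_borel f"
  shows "sint \<Omega> (\<lambda>A. s A + t A) f = sint \<Omega> s f + sint \<Omega> t f"
proof -
  obtain K L where KL: "\<And>f C. bounded_borel f \<Longrightarrow> (\<And>x. x \<in> \<Omega> \<Longrightarrow> \<bar>f x\<bar> \<le> C) \<Longrightarrow> \<bar>sint \<Omega> s f\<bar> \<le> K * C"
    "\<And>f C. bounded_borel f \<Longrightarrow> (\<And>x. x \<in> \<Omega> \<Longrightarrow> \<bar>f x\<bar> \<le> C) \<Longrightarrow> \<bar>sint \<Omega> t f\<bar> \<le> L * C"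
    using sint_bounded[OF assms(1,2)] sint_bounded[OF assms(1,3)] by metis
  show ?thesis
  proof (rule sint_unique[OF assms(1) vector_measure_on_add[OF assms(2,3)] _ _ _ _ assms(4), symmetric,
      where K="K + L"])
    fix f :: "'a \<Rightarrow> real" and C assume "bounded_borel f" "\<And>x. \<bar>f x\<bar> \<le> C"
    then show "\<bar>sint \<Omega> s f + sint \<Omega> t f\<bar> \<le> (K + L) * C"
      using KL[of f C] by (simp add: algebra_simps)
  qed (use assms in \<open>auto simp: sint_add sint_cmult sint_indicator algebra_simps\<close>)
qed

lemma sint_scale_measure:
  assumes "\<Omega> \<in> sets borel" "signed_measure_on \<Omega> s" "bounded_borel f"
  shows "sint \<Omega> (\<lambda>A. c * s A) f = c * sint \<Omega> s f"
proof -
  obtain K where K: "\<And>f C. bounded_borel f \<Longrightarrow> (\<And>x. x \<in> \<Omega> \<Longrightarrow> \<bar>f x\<bar> \<le> C) \<Longrightarrow> \<bar>sint \<Omega> s f\<bar> \<le> K * C"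
    using sint_bounded[OF assms(1,2)] by metis
  show ?thesis
  proof (rule sint_unique[OF assms(1) vector_measure_on_scale[OF assms(2)] _ _ _ _ assms(3), symmetric,
      where K="\<bar>c\<bar> * K"])
    fix f :: "'a \<Rightarrow> real" and C assume "bounded_borel f" "\<And>x. \<bar>f x\<bar> \<le> C"
    then show "\<bar>c * sint \<Omega> s f\<bar> \<le> \<bar>c\<bar> * K * C"
      using K[of f C] by (simp add: abs_mult mult.assoc mult_left_mono)
  qed (use assms in \<open>auto simp: sint_add sint_cmult sint_indicator algebra_simps\<close>)
qed

lemma sint_uminus_measure:
  "\<Omega> \<in> sets borel \<Longrightarrow> signed_measure_on \<Omega> s \<Longrightarrow> bounded_borel f \<Longrightarrow>
    sint \<Omega> (\<lambda>A. - s A) f = - sint \<Omega> s f"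
  using sint_scale_measure[of \<Omega> s f "-1"] by simp

lemma sint_diff_measure:
  assumes "\<Omega> \<in> sets borel" "signed_measure_on \<Omega> s" "signed_measure_on \<Omega> t" "bounded_borel f"
  shows "sint \<Omega> (\<lambda>A. s A - t A) f = sint \<Omega> s f - sint \<Omega> t f"
  using sint_add_measure[OF assms(1,2) vector_measure_on_uminus[OF assms(3)] assms(4)]
    sint_uminus_measure[OF assms(1,3,4)] by simp

lemma sint_restrict_measure:
  fixes s :: "'a::topological_space set \<Rightarrow> real"
  assumes \<Omega>: "\<Omega> \<in> sets borel" and s: "signed_measure_on \<Omega> s" and W: "W \<in> sets borel" and f: "bounded_borel f"
  shows "sint \<Omega> (\<lambda>S. if S \<in> borel_on \<Omega> then s (S \<inter> W) else 0) f = sint \<Omega> s (\<lambda>x. indicator W x * f x)"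
proof -
  obtain K where K: "K \<ge> 0"
    "\<And>f C. bounded_borel f \<Longrightarrow> (\<And>x. x \<in> \<Omega> \<Longrightarrow> \<bar>f x\<bar> \<le> C) \<Longrightarrow> \<bar>sint \<Omega> s f\<bar> \<le> K * C"
    using sint_bounded[OF \<Omega> s] by metis
  have b: "bounded_borel (\<lambda>x. indicator W x * f x)" if "bounded_borel f" for f :: "'a \<Rightarrow> real"
    by (intro bounded_borel_mult bounded_borel_indicator W that)
  have "sint \<Omega> s (\<lambda>x. indicator W x * f x) = sint \<Omega> (\<lambda>S. if S \<in> borel_on \<Omega> then s (S \<inter> W) else 0) f"
  proof (rule sint_unique[where K=K and I="\<lambda>f. sint \<Omega> s (\<lambda>x. indicator W x * f x)", OF \<Omega> vector_measure_on_restrict[OF \<Omega> s W] _ _ _ _ f])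
    show "sint \<Omega> s (\<lambda>x. indicator W x * (f x + g x)) = sint \<Omega> s (\<lambda>x. indicator W x * f x) + sint \<Omega> s (\<lambda>x. indicator W x * g x)"
      if "bounded_borel f" "bounded_borel g" for f g
      unfolding distrib_left by (rule sint_add[OF \<Omega> s b[OF that(1)] b[OF that(2)]])
    show "sint \<Omega> s (\<lambda>x. indicator W x * (c * f x)) = c * sint \<Omega> s (\<lambda>x. indicator W x * f x)" for f c
      unfolding mult.left_commute[of _ c] by (rule sint_cmult[OF \<Omega> s])
    show "\<bar>sint \<Omega> s (\<lambda>x. indicator W x * f x)\<bar> \<le> K * C" if "bounded_borel f" "\<And>x. \<bar>f x\<bar> \<le> C" for f C
    proof (rule K(2)[OF b[OF that(1)]])
      fix x show "\<bar>indicator W x * f x\<bar> \<le> C"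
        using that(2)[of x] order_trans[OF abs_ge_zero[of "f x"] that(2)[of x]] by (simp add: indicator_def)
    qed
    show "sint \<Omega> s (\<lambda>x. indicator W x * indicator A x) = (if A \<inter> \<Omega> \<in> borel_on \<Omega> then s (A \<inter> \<Omega> \<inter> W) else 0)"
      if "A \<in> sets borel" for A
    proof -
      have "A \<inter> \<Omega> \<in> borel_on \<Omega>" using that \<Omega> by (auto simp: borel_on_iff)
      moreover have "sint \<Omega> s (indicator (W \<inter> A)) = s (W \<inter> A \<inter> \<Omega>)" by (rule sint_indicator[OF \<Omega> s]) (use that W in simp)
      moreover have "W \<inter> A \<inter> \<Omega> = A \<inter> \<Omega> \<inter> W" by auto
      moreover have "(\<lambda>x. indicator W x * indicator A x) = (indicator (W \<inter> A) :: 'a \<Rightarrow> real)"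
        by (simp add: fun_eq_iff indicator_inter_arith)
      ultimately show ?thesis by simp
    qed
  qed
  then show ?thesis by (rule sym)
qed

lemma sint_null:
  fixes s :: "'a::topological_space set \<Rightarrow> real"
  assumes \<Omega>: "\<Omega> \<in> sets borel" and s: "signed_measure_on \<Omega> s" and A: "A \<in> sets borel"
    and zero: "\<And>S. S \<in> sets borel \<Longrightarrow> S \<subseteq> A \<inter> \<Omega> \<Longrightarrow> s S = 0" and f: "bounded_borel f"
  shows "sint \<Omega> s (\<lambda>x. indicator A x * f x) = 0"
proof -
  have "(\<lambda>S. if S \<in> borel_on \<Omega> then s (S \<inter> A) else 0) = (\<lambda>S. 0 * s S)"
    using A by (auto simp: fun_eq_iff borel_on_iff intro!: zero)
  then show ?thesis
    using sint_restrict_measure[OF \<Omega> s A f] sint_scale_measure[OF \<Omega> s f, of 0] by simp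
qed

section \<open>Domination of vector integrals\<close>

text \<open>Exchanging the sums over the basis and over the values turns the componentwise
  definition into inner products with vectors, to which Cauchy-Schwarz applies without loss.\<close>

lemma simple_function_vint:
  fixes g :: "'a::topological_space \<Rightarrow> 'b::euclidean_space"
  assumes \<Omega>: "\<Omega> \<in> sets borel" and F: "vector_measure_on \<Omega> F" and g: "simple_function borel g"
  shows "vint \<Omega> F g = (\<Sum>y\<in>range g. y \<bullet> F (g -` {y} \<inter> \<Omega>))"
proof -
  have fin: "finite (range g)" and lev: "\<And>y. g -` {y} \<in> sets borel"
    using simple_functionD[OF g] by auto
  have "sint \<Omega> (\<lambda>A. F A \<bullet> b) (\<lambda>x. g x \<bullet> b) = (\<Sum>y\<in>range g. (y \<bullet> b) * (F (g -` {y} \<inter> \<Omega>) \<bullet> b))" for b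
  proof -
    have "g x \<bullet> b = (\<Sum>y\<in>range g. (y \<bullet> b) * indicator (g -` {y}) x)" for x
      using fin by (subst sum.remove[of _ "g x"]) (auto simp: indicator_def intro!: sum.neutral)
    then have "sint \<Omega> (\<lambda>A. F A \<bullet> b) (\<lambda>x. g x \<bullet> b)
        = sint \<Omega> (\<lambda>A. F A \<bullet> b) (\<lambda>x. \<Sum>y\<in>range g. (y \<bullet> b) * indicator (g -` {y}) x)" by simp
    also have "\<dots> = (\<Sum>y\<in>range g. sint \<Omega> (\<lambda>A. F A \<bullet> b) (\<lambda>x. (y \<bullet> b) * indicator (g -` {y}) x))"
      by (rule sint_sum[OF \<Omega> vector_measure_on_inner[OF F] fin]) (intro bounded_borel_intros lev)
    finally show ?thesis
      by (simp add: sint_cmult[OF \<Omega> vector_measure_on_inner[OF F]] sint_indicator[OF \<Omega> vector_measure_on_inner[OF F]] lev)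
  qed
  then have "vint \<Omega> F g = (\<Sum>b\<in>Basis. \<Sum>y\<in>range g. (y \<bullet> b) * (F (g -` {y} \<inter> \<Omega>) \<bullet> b))"
    by (simp add: vint_def)
  also have "\<dots> = (\<Sum>y\<in>range g. \<Sum>b\<in>Basis. (y \<bullet> b) * (F (g -` {y} \<inter> \<Omega>) \<bullet> b))"
    by (rule sum.swap)
  finally show ?thesis by (simp only: euclidean_inner[symmetric])
qed

text \<open>A componentwise estimate would cost a dimensional factor; Cauchy-Schwarz on each level
  set of a simple function does not. With the variation and \<open>c = 1\<close> this keeps the
  upper bound for the flux of a field sharp.\<close>

lemma vint_abs_le:
  fixes G :: "'a::topological_space \<Rightarrow> 'b::euclidean_space"
  assumes \<Omega>: "\<Omega> \<in> sets borel" and F: "vector_measure_on \<Omega> F" and V: "radon_measure_on \<Omega> V"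
    and dom: "\<And>A. A \<in> borel_on \<Omega> \<Longrightarrow> norm (F A) \<le> c * measure V A" and G: "bounded_borel G"
  shows "\<bar>vint \<Omega> F G\<bar> \<le> c * (\<integral>x. norm (G x) \<partial>V)"
proof -
  interpret finite_measure V using V by (rule radon_measure_onD)
  note VD = radon_measure_onD[OF V]
  \<comment> \<open>The factor 2 in the bound on the simple functions serves only as an integrable
    majorant; the limit of the integrals of their norms restores the constant 1.\<close>
  obtain g where g: "\<And>i. simple_function borel (g i)" "\<And>x. (\<lambda>i. g i x) \<longlonglongrightarrow> G x"
    "\<And>i x. norm (g i x) \<le> 2 * norm (G x)"
    using borel_measurable_implies_sequence_metric[OF bounded_borel_measurable[OF G], of 0] by force
  obtain C where C: "\<And>x. norm (G x) \<le> C" using G by (metis bounded_borel_bound)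
  have gC: "norm (g i x) \<le> 2 * C" for i x using g(3)[of i x] C[of x] by linarith
  have gm: "g i \<in> borel_measurable borel" for i by (rule borel_measurable_simple_function[OF g(1)])
  have gb: "bounded_borel (g i)" for i by (rule bounded_borelI[OF gm gC])
  have le: "\<bar>vint \<Omega> F (g i)\<bar> \<le> c * (\<integral>x. norm (g i x) \<partial>V)" for i
  proof -
    have fin: "finite (range (g i))" and lev: "\<And>y. g i -` {y} \<in> sets borel"
      using simple_functionD[OF g(1)[of i]] by auto
    have "norm (g i x) = (\<Sum>y\<in>range (g i). norm y * indicator (g i -` {y}) x)" for x
      using fin by (subst sum.remove[of _ "g i x"]) (auto simp: indicator_def intro!: sum.neutral)
    then have "(\<integral>x. norm (g i x) \<partial>V) = (\<integral>x. (\<Sum>y\<in>range (g i). norm y * indicator (g i -` {y}) x) \<partial>V)"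
      by simp
    also have "\<dots> = (\<Sum>y\<in>range (g i). \<integral>x. norm y * indicator (g i -` {y}) x \<partial>V)"
      by (rule Bochner_Integration.integral_sum)
         (intro radon_integrable[OF V \<Omega>] bounded_borel_intros lev)
    also have "\<dots> = (\<Sum>y\<in>range (g i). norm y * measure V (g i -` {y} \<inter> \<Omega>))"
      by (simp add: VD)
    finally have eq: "(\<integral>x. norm (g i x) \<partial>V) = (\<Sum>y\<in>range (g i). norm y * measure V (g i -` {y} \<inter> \<Omega>))" .
    have "\<bar>vint \<Omega> F (g i)\<bar> \<le> (\<Sum>y\<in>range (g i). \<bar>y \<bullet> F (g i -` {y} \<inter> \<Omega>)\<bar>)"
      unfolding simple_function_vint[OF \<Omega> F g(1)] by (rule sum_abs)
    also have "\<dots> \<le> (\<Sum>y\<in>range (g i). norm y * (c * measure V (g i -` {y} \<inter> \<Omega>)))"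
    proof (rule sum_mono)
      fix y
      have "\<bar>y \<bullet> F (g i -` {y} \<inter> \<Omega>)\<bar> \<le> norm y * norm (F (g i -` {y} \<inter> \<Omega>))"
        by (rule Cauchy_Schwarz_ineq2)
      also have "\<dots> \<le> norm y * (c * measure V (g i -` {y} \<inter> \<Omega>))"
        by (intro mult_left_mono dom) (use lev \<Omega> in \<open>auto simp: borel_on_iff\<close>)
      finally show "\<bar>y \<bullet> F (g i -` {y} \<inter> \<Omega>)\<bar> \<le> norm y * (c * measure V (g i -` {y} \<inter> \<Omega>))" .
    qed
    finally show ?thesis unfolding eq by (simp add: sum_distrib_left mult.left_commute)
  qed
  have "(\<lambda>i. \<integral>x. norm (g i x) \<partial>V) \<longlonglongrightarrow> (\<integral>x. norm (G x) \<partial>V)"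
    by (rule integral_dominated_convergence[where w="\<lambda>x. 2 * C"])
       (use g(2) gC in \<open>auto intro!: radon_measurable[OF V \<Omega>] bounded_borel_measurable bounded_borel_norm gb G tendsto_norm\<close>)
  then have "(\<lambda>i. c * (\<integral>x. norm (g i x) \<partial>V)) \<longlonglongrightarrow> c * (\<integral>x. norm (G x) \<partial>V)"
    by (rule tendsto_mult_left)
  moreover have "(\<lambda>i. vint \<Omega> F (g i)) \<longlonglongrightarrow> vint \<Omega> F G"
    unfolding vint_def
  proof (rule tendsto_sum)
    fix b :: 'b assume b: "b \<in> Basis"
    show "(\<lambda>i. sint \<Omega> (\<lambda>A. F A \<bullet> b) (\<lambda>x. g i x \<bullet> b)) \<longlonglongrightarrow> sint \<Omega> (\<lambda>A. F A \<bullet> b) (\<lambda>x. G x \<bullet> b)"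
    proof (rule sint_tendsto[OF \<Omega> vector_measure_on_inner[OF F], where C="2 * C"])
      show "\<bar>g i x \<bullet> b\<bar> \<le> 2 * C" for i x using gC[of i x] Basis_le_norm[OF b, of "g i x"] by linarith
    qed (auto intro!: bounded_borel_inner gb G tendsto_inner g(2))
  qed
  then have "(\<lambda>i. \<bar>vint \<Omega> F (g i)\<bar>) \<longlonglongrightarrow> \<bar>vint \<Omega> F G\<bar>" by (rule tendsto_rabs)
  ultimately show ?thesis by (intro LIMSEQ_le[OF _ _ exI[of _ 0]]) (use le in auto)
qed

text \<open>The remainder of a disjoint union after finitely many pieces has small
  \<open>V\<close>-measure, so finite additivity and domination together give countable additivity.
  In this way fluxes, densities and glued set functions become measures.\<close>

lemma vector_measure_on_of_dominated:
  fixes F :: "'a::topological_space set \<Rightarrow> 'b::real_normed_vector"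
  assumes \<Omega>: "\<Omega> \<in> sets borel" and V: "radon_measure_on \<Omega> V"
    and out: "\<And>A. A \<notin> borel_on \<Omega> \<Longrightarrow> F A = 0"
    and add: "\<And>A B. A \<in> borel_on \<Omega> \<Longrightarrow> B \<in> borel_on \<Omega> \<Longrightarrow> A \<inter> B = {} \<Longrightarrow> F (A \<union> B) = F A + F B"
    and dom: "\<And>A. A \<in> borel_on \<Omega> \<Longrightarrow> norm (F A) \<le> c * measure V A"
  shows "vector_measure_on \<Omega> F"
  unfolding vector_measure_on_def
proof (intro conjI allI impI)
  interpret sigma_algebra \<Omega> "borel_on \<Omega>" by (rule sigma_algebra_borel_on) fact
  interpret V: finite_measure V using V by (rule radon_measure_onD)
  note VD = radon_measure_onD[OF V]
  fix A :: "nat \<Rightarrow> 'a set" assume A: "range A \<subseteq> borel_on \<Omega>" "disjoint_family A"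
  have Ai: "A i \<in> borel_on \<Omega>" for i using A by auto
  have "F {} = F {} + F {}" using add[of "{}" "{}"] by auto
  then have F0: "F {} = 0" by simp
  have part: "F (\<Union>i<n. A i) = (\<Sum>i<n. F (A i))" for n
  proof (induction n)
    case (Suc n)
    have "A i \<inter> A n = {}" if "i < n" for i
      by (rule disjoint_family_onD[OF A(2)]) (use that in auto)
    then have "F ((\<Union>i<n. A i) \<union> A n) = F (\<Union>i<n. A i) + F (A n)"
      by (intro add) (use Ai in auto)
    moreover have "(\<Union>i<n. A i) \<union> A n = (\<Union>i<Suc n. A i)" by (auto simp: less_Suc_eq)
    ultimately show ?case using Suc by simp
  qed (simp add: F0)
  have U: "(\<Union>i. A i) \<in> borel_on \<Omega>" "(\<Union>i<n. A i) \<in> borel_on \<Omega>" for n using Ai by auto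
  have "norm ((\<Sum>i<n. F (A i)) - F (\<Union>i. A i)) \<le> c * (measure V (\<Union>i. A i) - (\<Sum>i<n. measure V (A i)))" for n
  proof -
    have "F ((\<Union>i<n. A i) \<union> ((\<Union>i. A i) - (\<Union>i<n. A i))) = F (\<Union>i<n. A i) + F ((\<Union>i. A i) - (\<Union>i<n. A i))"
      by (rule add) (use U in auto)
    moreover have "(\<Union>i<n. A i) \<union> ((\<Union>i. A i) - (\<Union>i<n. A i)) = (\<Union>i. A i)" by auto
    ultimately have "(\<Sum>i<n. F (A i)) - F (\<Union>i. A i) = - F ((\<Union>i. A i) - (\<Union>i<n. A i))"
      by (simp add: part)
    then have "norm ((\<Sum>i<n. F (A i)) - F (\<Union>i. A i)) \<le> c * measure V ((\<Union>i. A i) - (\<Union>i<n. A i))"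
      using dom[of "(\<Union>i. A i) - (\<Union>i<n. A i)"] U by auto
    also have "measure V ((\<Union>i. A i) - (\<Union>i<n. A i)) = measure V (\<Union>i. A i) - measure V (\<Union>i<n. A i)"
      by (rule V.finite_measure_Diff) (use U VD in auto)
    also have "measure V (\<Union>i<n. A i) = (\<Sum>i<n. measure V (A i))"
      by (rule V.finite_measure_finite_Union)
         (use Ai VD A(2) in \<open>auto simp: disjoint_family_on_def\<close>)
    finally show ?thesis .
  qed
  note le = this
  have "(\<lambda>i. measure V (A i)) sums measure V (\<Union>i. A i)"
    by (rule V.finite_measure_UNION) (use A VD in auto)
  then have "(\<lambda>n. c * (measure V (\<Union>i. A i) - (\<Sum>i<n. measure V (A i)))) \<longlonglongrightarrow> c * (measure V (\<Union>i. A i) - measure V (\<Union>i. A i))"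
    unfolding sums_def by (intro tendsto_intros)
  then have "(\<lambda>n. c * (measure V (\<Union>i. A i) - (\<Sum>i<n. measure V (A i)))) \<longlonglongrightarrow> 0" by simp
  then have "(\<lambda>n. (\<Sum>i<n. F (A i)) - F (\<Union>i. A i)) \<longlonglongrightarrow> 0"
    by (rule Lim_null_comparison[OF always_eventually[OF allI[OF le]]])
  then show "(\<lambda>i. F (A i)) sums F (\<Union>i. A i)" unfolding sums_def by (rule LIM_zero_cancel)
qed (rule out)

section \<open>Dynkin induction and regularity\<close>

text \<open>Open sets form a generator stable under intersection, so Dynkin's theorem restricts the
  union step to disjoint families, where additivity of a measure is available.\<close>

lemma borel_disjoint_induct [consumes 1, case_names basic compl union]:
  fixes S :: "'a::topological_space set"
  assumes "S \<in> sets borel"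
    and "\<And>S. open S \<Longrightarrow> P S"
    and "\<And>S. S \<in> sets borel \<Longrightarrow> P S \<Longrightarrow> P (- S)"
    and "\<And>A :: nat \<Rightarrow> 'a set. (\<And>i. A i \<in> sets borel) \<Longrightarrow> disjoint_family A \<Longrightarrow> (\<And>i. P (A i)) \<Longrightarrow> P (\<Union>i. A i)"
  shows "P S"
proof -
  have Is: "Int_stable {S::'a set. open S}" by (auto simp: Int_stable_def)
  have borel: "sets borel = sigma_sets UNIV {S::'a set. open S}"
    by (simp add: borel_def)
  show ?thesis
  proof (rule sigma_sets_induct_disjoint[where P=P, OF Is])
    show "S \<in> sigma_sets UNIV {S. open S}" using assms(1) by (simp add: borel)
    show "P A" if "A \<in> {S. open S}" for A using that assms(2) by simp
    show "P {}" by (rule assms(2)) simp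
    show "P (UNIV - A)" if "A \<in> sigma_sets UNIV {S. open S}" "P A" for A
      using assms(3)[of A] that by (simp add: borel Compl_eq_Diff_UNIV)
    show "P (\<Union>i. A i)" if "disjoint_family A" "range A \<subseteq> sigma_sets UNIV {S. open S}" "\<And>i. P (A i)"
      for A :: "nat \<Rightarrow> 'a set"
      by (rule assms(4)) (use that in \<open>auto simp: borel\<close>)
  qed simp
qed

text \<open>The induction runs over \<open>S \<inter> W\<close> instead of \<open>S\<close>, so that
  complements stay inside \<open>W\<close>, where the hypothesis on open sets holds.\<close>

lemma vector_measure_on_eq_zero:
  assumes F: "vector_measure_on \<Omega> F" and W: "open W" "W \<subseteq> \<Omega>"
    and zero: "\<And>A. open A \<Longrightarrow> A \<subseteq> W \<Longrightarrow> F A = 0" and S: "S \<in> sets borel" "S \<subseteq> W"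
  shows "F S = 0"
proof -
  have Wb: "W \<in> sets borel" using W by simp
  have "F (S \<inter> W) = 0" using S(1)
  proof (induction rule: borel_disjoint_induct)
    case (basic S)
    then show ?case using W by (intro zero) auto
  next
    case (compl S)
    have "F (W - S \<inter> W) = F W - F (S \<inter> W)"
      by (rule vector_measure_on_Diff[OF F]) (use W compl Wb in auto)
    moreover have "W - S \<inter> W = - S \<inter> W" by auto
    ultimately show ?case using compl zero[OF W(1)] by simp
  next
    case (union A)
    have "(\<lambda>i. F (W \<inter> A i)) sums F (\<Union>i. W \<inter> A i)"
      by (rule vector_measure_on_sums[OF F _ _ disjoint_family_Int[OF union(2)]])
         (use union(1) W Wb in auto)
    moreover have "(\<Union>i. W \<inter> A i) = (\<Union>i. A i) \<inter> W" by auto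
    moreover have "(\<lambda>i. F (W \<inter> A i)) sums 0" using union(3) by (simp add: Int_commute)
    ultimately show ?case using sums_unique2 by (metis Int_commute)
  qed
  then show ?thesis using S by (simp add: Int_absorb2)
qed

text \<open>The inclusion pushes \<mu> forward to a finite Borel measure on the whole Polish space,
  which is outer regular; intersecting with \<Omega> brings the open set back.\<close>

lemma radon_outer_regular:
  fixes \<mu> :: "'a::polish_space measure"
  assumes \<mu>: "radon_measure_on \<Omega> \<mu>" and \<Omega>: "open \<Omega>" and S: "S \<in> borel_on \<Omega>" and "e > 0"
  obtains W where "open W" "S \<subseteq> W" "W \<subseteq> \<Omega>" "measure \<mu> W < measure \<mu> S + e"
proof -
  have \<Omega>b: "\<Omega> \<in> sets borel" using \<Omega> by simp
  interpret finite_measure \<mu> using \<mu> by (rule radon_measure_onD)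
  note D = radon_measure_onD[OF \<mu>]
  define M where "M = distr \<mu> borel (\<lambda>x. x)"
  have id: "(\<lambda>x. x) \<in> measurable \<mu> borel" by (rule radon_measurable[OF \<mu> \<Omega>b]) simp
  have emM: "emeasure M A = emeasure \<mu> (A \<inter> \<Omega>)" if "A \<in> sets borel" for A
    unfolding M_def using emeasure_distr[OF id that] by (simp add: D)
  have SB: "S \<in> sets borel" "S \<subseteq> \<Omega>" using S by (auto simp: borel_on_iff)
  have "emeasure M S = (INF U \<in> {U. S \<subseteq> U \<and> open U}. emeasure M U)"
    by (rule outer_regular) (use SB emM in \<open>auto simp: M_def\<close>)
  moreover have "emeasure M S < emeasure M S + ennreal e"
    using emM[OF SB(1)] \<open>e > 0\<close> by (simp add: ennreal_less_top less_top)
  ultimately obtain U where U: "S \<subseteq> U" "open U" "emeasure M U < emeasure M S + ennreal e"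
    by (auto simp: INF_less_iff)
  have "ennreal (measure \<mu> (U \<inter> \<Omega>)) < ennreal (measure \<mu> S + e)"
    using U(3) emM[of U] emM[of S] U(2) SB \<open>e > 0\<close> by (simp add: emeasure_eq_measure Int_absorb2)
  then have "measure \<mu> (U \<inter> \<Omega>) < measure \<mu> S + e" by (simp add: ennreal_less_iff)
  then show ?thesis using that[of "U \<inter> \<Omega>"] U \<Omega> SB by auto
qed

text \<open>Outer regularity of both Jordan parts and of \<open>V\<close> yields one open set
  \<open>T\<close> around \<open>S\<close> with little excess mass for all three measures, so the
  bound on \<open>T\<close> descends to \<open>S\<close>.\<close>

lemma signed_measure_dominated_of_open:
  fixes s :: "'a::polish_space set \<Rightarrow> real"
  assumes \<Omega>: "open \<Omega>" and s: "signed_measure_on \<Omega> s" and V: "radon_measure_on \<Omega> V"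
    and W: "open W" "W \<subseteq> \<Omega>" and "c \<ge> 0"
    and le: "\<And>A. open A \<Longrightarrow> A \<subseteq> W \<Longrightarrow> \<bar>s A\<bar> \<le> c * measure V A"
    and S: "S \<in> sets borel" "S \<subseteq> W"
  shows "\<bar>s S\<bar> \<le> c * measure V S"
proof (rule field_le_epsilon)
  fix e :: real assume e: "e > 0"
  have \<Omega>b: "\<Omega> \<in> sets borel" using \<Omega> by simp
  define P N where "P = positive_part \<Omega> s" and "N = positive_part \<Omega> (\<lambda>A. - s A)"
  have P: "radon_measure_on \<Omega> P" and N: "radon_measure_on \<Omega> N"
    unfolding P_def N_def by (intro radon_positive_part \<Omega>b s vector_measure_on_uminus)+
  interpret P: finite_measure P using P by (rule radon_measure_onD)
  interpret N: finite_measure N using N by (rule radon_measure_onD)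
  interpret V: finite_measure V using V by (rule radon_measure_onD)
  have SO: "S \<in> borel_on \<Omega>" using S W by (auto simp: borel_on_iff)
  \<comment> \<open>The excess of \<open>V\<close> costs \<open>c * d'\<close> and the two Jordan
    parts together at most \<open>d'\<close>, since they enter with opposite signs. The denominator
    is positive also for \<open>c = 0\<close>.\<close>
  define d' where "d' = e / (c + 2)"
  have d': "d' > 0" using e \<open>c \<ge> 0\<close> by (simp add: d'_def)
  have "c * d' + d' + d' = (c + 2) * d'" by (simp add: algebra_simps)
  then have d'e: "c * d' + d' + d' = e" using \<open>c \<ge> 0\<close> by (simp add: d'_def)
  obtain A where A: "open A" "S \<subseteq> A" "A \<subseteq> \<Omega>" "measure P A < measure P S + d'"
    by (rule radon_outer_regular[OF P \<Omega> SO d'])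
  obtain B where B: "open B" "S \<subseteq> B" "B \<subseteq> \<Omega>" "measure N B < measure N S + d'"
    by (rule radon_outer_regular[OF N \<Omega> SO d'])
  obtain C where C: "open C" "S \<subseteq> C" "C \<subseteq> \<Omega>" "measure V C < measure V S + d'"
    by (rule radon_outer_regular[OF V \<Omega> SO d'])
  define T where "T = A \<inter> B \<inter> C \<inter> W"
  have T: "open T" "S \<subseteq> T" "T \<subseteq> W" "T \<in> borel_on \<Omega>"
    using A B C W S by (auto simp: T_def borel_on_iff)
  have TS: "T - S \<in> borel_on \<Omega>" using T SO by (auto simp: borel_on_iff)
  have small: "measure M (T - S) \<le> d'" if "radon_measure_on \<Omega> M" "measure M D < measure M S + d'"
     "T \<subseteq> D" "open D" "D \<subseteq> \<Omega>" for M D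
  proof -
    interpret finite_measure M using that by (simp add: radon_measure_onD)
    have "measure M (T - S) = measure M T - measure M S"
      by (rule finite_measure_Diff) (use T SO that in \<open>auto simp: radon_measure_onD(2)\<close>)
    moreover have "measure M T \<le> measure M D"
      by (rule finite_measure_mono) (use that in \<open>auto simp: radon_measure_onD(2) borel_on_iff\<close>)
    ultimately show ?thesis using that by simp
  qed
  have "s T = s S + s (T - S)"
    using vector_measure_on_Un[OF s, of S "T - S"] T(2) SO TS by (auto simp: borel_on_iff Un_absorb1)
  moreover have "s (T - S) = measure P (T - S) - measure N (T - S)"
    unfolding P_def N_def by (rule Jordan_decomposition[OF \<Omega>b s TS])
  moreover have "measure P (T - S) \<le> d'" "measure N (T - S) \<le> d'"
    using small[OF P A(4)] small[OF N B(4)] A B by (auto simp: T_def)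
  moreover have "\<bar>s T\<bar> \<le> c * measure V T" by (rule le[OF T(1,3)])
  moreover have "c * measure V T \<le> c * (measure V S + d')"
  proof (rule mult_left_mono)
    have "measure V T = measure V S + measure V (T - S)"
      using V.finite_measure_Diff[of T S] T SO by (simp add: radon_measure_onD(2)[OF V])
    then show "measure V T \<le> measure V S + d'"
      using small[OF V C(4)] C by (auto simp: T_def)
  qed fact
  moreover have "measure P (T - S) \<ge> 0" "measure N (T - S) \<ge> 0" by simp_all
  ultimately have "\<bar>s S\<bar> \<le> c * (measure V S + d') + d'" by linarith
  also have "\<dots> = c * measure V S + (c * d' + d')" by (simp add: distrib_left)
  finally show "\<bar>s S\<bar> \<le> c * measure V S + e" using d'e d' by linarith
qed

section \<open>The variation of a vector measure\<close>

text \<open>Partitions of disjoint sets unite to a partition of the union, and a partition of a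
  countable union can be cut along its pieces. Finiteness comes from the Jordan parts of the
  components.\<close>

lemma radon_variation:
  fixes F :: "'a::topological_space set \<Rightarrow> 'b::euclidean_space"
  assumes \<Omega>: "\<Omega> \<in> sets borel" and F: "vector_measure_on \<Omega> F"
  shows "radon_measure_on \<Omega> (variation \<Omega> F)"
    and "A \<in> borel_on \<Omega> \<Longrightarrow> norm (F A) \<le> measure (variation \<Omega> F) A"
proof -
  interpret sigma_algebra \<Omega> "borel_on \<Omega>" by (rule sigma_algebra_borel_on) fact
  define parts where "parts A = {P. finite P \<and> P \<subseteq> borel_on \<Omega> \<and> partition_on A P}" for A :: "'a set"
  define f where "f A = (SUP P \<in> parts A. \<Sum>B\<in>P. ennreal (norm (F B)))" for A
  have upper: "(\<Sum>B\<in>P. ennreal (norm (F B))) \<le> f A" if "P \<in> parts A" for A P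
    unfolding f_def by (rule SUP_upper) fact
  have single: "ennreal (norm (F A)) \<le> f A" if "A \<in> borel_on \<Omega>" for A
  proof (cases "A = {}")
    case True
    then show ?thesis using F by simp
  next
    case False
    then have "{A} \<in> parts A" using that by (auto simp: parts_def partition_on_def)
    then show ?thesis using upper[of "{A}" A] by simp
  qed
  have empty_in: "{} \<in> parts {}" by (simp add: parts_def partition_on_def)
  have parts_empty: "parts {} = {{}}"
    by (auto simp: parts_def partition_on_def)
  have f_empty: "f {} = 0" by (simp add: f_def parts_empty)
  have nonempty: "parts A \<noteq> {}" if "A \<in> borel_on \<Omega>" for A
  proof (cases "A = {}")
    case True
    then show ?thesis using empty_in by auto
  next
    case False
    then have "{A} \<in> parts A" using that by (auto simp: parts_def partition_on_def)
    then show ?thesis by auto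
  qed
  have "countably_additive (borel_on \<Omega>) f"
  proof (rule countably_additive_of_superadditive[where \<Omega>=\<Omega>])
    show "f {} = 0" by fact
    fix A B assume AB: "A \<in> borel_on \<Omega>" "B \<in> borel_on \<Omega>" "A \<inter> B = {}"
    have *: "(\<Sum>B\<in>P. ennreal (norm (F B))) + (\<Sum>B\<in>Q. ennreal (norm (F B))) \<le> f (A \<union> B)"
      if P: "P \<in> parts A" and Q: "Q \<in> parts B" for P Q
    proof -
      have "C \<notin> Q" if "C \<in> P" for C
      proof
        assume "C \<in> Q"
        then have "C \<subseteq> A" "C \<subseteq> B" "C \<noteq> {}"
          using P Q \<open>C \<in> P\<close> by (auto simp: parts_def partition_on_def)
        then show False using AB(3) by blast
      qed
      then have "P \<inter> Q = {}" by blast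
      then have "(\<Sum>B\<in>P. ennreal (norm (F B))) + (\<Sum>B\<in>Q. ennreal (norm (F B))) = (\<Sum>B\<in>P \<union> Q. ennreal (norm (F B)))"
        using P Q by (intro sum.union_disjoint[symmetric]) (auto simp: parts_def)
      also have "\<dots> \<le> f (A \<union> B)"
        by (rule upper) (use P Q AB(3) disjoint_union[of P Q] in \<open>auto simp: parts_def partition_on_def\<close>)
      finally show ?thesis .
    qed
    have "f A + (\<Sum>B\<in>Q. ennreal (norm (F B))) \<le> f (A \<union> B)" if "Q \<in> parts B" for Q
      unfolding f_def[of A] ennreal_SUP_add_left[OF nonempty[OF AB(1)], symmetric]
      by (rule SUP_least) (use * that in auto)
    then show "f A + f B \<le> f (A \<union> B)"
      unfolding f_def[of B] ennreal_SUP_add_right[OF nonempty[OF AB(2)]]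
      by (intro SUP_least) auto
  next
    fix A :: "nat \<Rightarrow> 'a set" assume A: "range A \<subseteq> borel_on \<Omega>" "disjoint_family A"
    have Ai: "A i \<in> sets borel" "A i \<subseteq> \<Omega>" for i
      using A(1)[THEN subsetD, of "A i"] by (auto simp: borel_on_iff)
    show "f (\<Union>i. A i) \<le> (\<Sum>i. f (A i))"
      unfolding f_def[of "\<Union>i. A i"]
    proof (rule SUP_least)
      fix P assume P: "P \<in> parts (\<Union>i. A i)"
      then have fin: "finite P" and PO: "\<And>B. B \<in> P \<Longrightarrow> B \<in> borel_on \<Omega>"
        and part: "\<Union>P = (\<Union>i. A i)" "disjoint P" "{} \<notin> P"
        by (auto simp: parts_def partition_on_def)
      have PB: "B \<in> sets borel" "B \<subseteq> \<Omega>" if "B \<in> P" for B using PO[OF that] by (auto simp: borel_on_iff)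
      have le1: "ennreal (norm (F B)) \<le> (\<Sum>i. ennreal (norm (F (B \<inter> A i))))" if B: "B \<in> P" for B
      proof -
        have "(\<lambda>i. F (B \<inter> A i)) sums F (\<Union>i. B \<inter> A i)"
          by (rule vector_measure_on_sums[OF F _ _ disjoint_family_Int[OF A(2)]])
             (use Ai PB[OF B] in auto)
        moreover have "(\<Union>i. B \<inter> A i) = B" using part(1) B by auto
        ultimately have lim: "(\<lambda>n. ennreal (norm (\<Sum>i<n. F (B \<inter> A i)))) \<longlonglongrightarrow> ennreal (norm (F B))"
          by (intro tendsto_ennrealI tendsto_norm) (auto simp: sums_def)
        have "ennreal (norm (\<Sum>i<n. F (B \<inter> A i))) \<le> (\<Sum>i. ennreal (norm (F (B \<inter> A i))))" for n
        proof -
          have "ennreal (norm (\<Sum>i<n. F (B \<inter> A i))) \<le> ennreal (\<Sum>i<n. norm (F (B \<inter> A i)))"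
            by (intro ennreal_leI norm_sum)
          also have "\<dots> = (\<Sum>i<n. ennreal (norm (F (B \<inter> A i))))" by (rule sum_ennreal[symmetric]) simp
          also have "\<dots> \<le> (\<Sum>i. ennreal (norm (F (B \<inter> A i))))" by (rule sum_le_suminf) auto
          finally show ?thesis .
        qed
        then show ?thesis by (intro LIMSEQ_le_const2[OF lim]) auto
      qed
      have le2: "(\<Sum>B\<in>P. ennreal (norm (F (B \<inter> A i)))) \<le> f (A i)" for i
      proof -
        \<comment> \<open>Blocks of a partition are nonempty, so empty intersections are dropped;
          they contribute \<open>F {} = 0\<close>.\<close>
        define Q where "Q = (\<lambda>B. B \<inter> A i) ` {B \<in> P. B \<inter> A i \<noteq> {}}"
        have inj: "inj_on (\<lambda>B. B \<inter> A i) {B \<in> P. B \<inter> A i \<noteq> {}}"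
        proof (rule inj_onI)
          fix B C assume BC: "B \<in> {B \<in> P. B \<inter> A i \<noteq> {}}" "C \<in> {B \<in> P. B \<inter> A i \<noteq> {}}" "B \<inter> A i = C \<inter> A i"
          then have "B \<inter> C \<noteq> {}" by blast
          then show "B = C" using disjointD[OF part(2)] BC by blast
        qed
        have "(\<Sum>B\<in>P. ennreal (norm (F (B \<inter> A i)))) = (\<Sum>B\<in>{B \<in> P. B \<inter> A i \<noteq> {}}. ennreal (norm (F (B \<inter> A i))))"
          by (rule sum.mono_neutral_right) (use fin F in auto)
        also have "\<dots> = (\<Sum>C\<in>Q. ennreal (norm (F C)))"
          unfolding Q_def by (subst sum.reindex[OF inj]) simp
        also have "\<dots> \<le> f (A i)"
        proof (rule upper)
          have "disjoint Q"
          proof (rule disjointI)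
            fix C D assume "C \<in> Q" "D \<in> Q" "C \<noteq> D"
            then obtain C' D' where "C' \<in> P" "D' \<in> P" "C = C' \<inter> A i" "D = D' \<inter> A i" "C' \<noteq> D'"
              by (auto simp: Q_def)
            then show "C \<inter> D = {}" using disjointD[OF part(2), of C' D'] by blast
          qed
          moreover have "\<Union>Q = A i"
          proof -
            have "\<Union>Q = \<Union>P \<inter> A i" by (auto simp: Q_def)
            then show ?thesis using part(1) by auto
          qed
          moreover have "Q \<subseteq> borel_on \<Omega>"
          proof
            fix C assume "C \<in> Q"
            then obtain B where "B \<in> P" "C = B \<inter> A i" by (auto simp: Q_def)
            then show "C \<in> borel_on \<Omega>" using PB[of B] Ai[of i] by (auto simp: borel_on_iff)
          qed
          ultimately show "Q \<in> parts (A i)" using fin by (auto simp: parts_def partition_on_def Q_def)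
        qed
        finally show ?thesis .
      qed
      have "(\<Sum>B\<in>P. ennreal (norm (F B))) \<le> (\<Sum>B\<in>P. \<Sum>i. ennreal (norm (F (B \<inter> A i))))"
        by (rule sum_mono) (rule le1)
      also have "\<dots> = (\<Sum>i. \<Sum>B\<in>P. ennreal (norm (F (B \<inter> A i))))"
        by (rule suminf_sum[symmetric]) simp
      also have "\<dots> \<le> (\<Sum>i. f (A i))" by (intro suminf_le le2) simp_all
      finally show "(\<Sum>B\<in>P. ennreal (norm (F B))) \<le> (\<Sum>i. f (A i))" .
    qed
  qed (rule sigma_algebra_axioms)
  moreover have "positive (borel_on \<Omega>) f" using f_empty by (simp add: positive_def)
  ultimately have em: "emeasure (variation \<Omega> F) A = f A" if "A \<in> borel_on \<Omega>" for A
    unfolding variation_def f_def[symmetric] parts_def[symmetric]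
    by (intro emeasure_measure_of_sigma sigma_algebra_axioms that)
  have sp: "space (variation \<Omega> F) = \<Omega>" "sets (variation \<Omega> F) = borel_on \<Omega>"
    unfolding variation_def using space_closed by (auto simp: sigma_sets_eq space_measure_of sets_measure_of)
  \<comment> \<open>The sum of all Jordan parts of all components is additive over blocks and
    dominates the norm of \<open>F\<close> on each, which bounds every sum in the supremum by
    \<open>v \<Omega>\<close>.\<close>
  define v where "v A = (\<Sum>b\<in>Basis. measure (positive_part \<Omega> (\<lambda>A. F A \<bullet> b)) A
      + measure (positive_part \<Omega> (\<lambda>A. - (F A \<bullet> b))) A)" for A
  have Fv: "norm (F A) \<le> v A" if A: "A \<in> borel_on \<Omega>" for A
  proof -
    have "norm (F A) \<le> (\<Sum>b\<in>Basis. \<bar>F A \<bullet> b\<bar>)" by (rule norm_le_l1)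
    also have "\<dots> \<le> v A" unfolding v_def
    proof (rule sum_mono)
      fix b :: 'b
      show "\<bar>F A \<bullet> b\<bar> \<le> measure (positive_part \<Omega> (\<lambda>A. F A \<bullet> b)) A
          + measure (positive_part \<Omega> (\<lambda>A. - (F A \<bullet> b))) A"
        unfolding Jordan_decomposition[OF \<Omega> vector_measure_on_inner[OF F] A]
        using measure_nonneg[of "positive_part \<Omega> (\<lambda>A. F A \<bullet> b)" A]
          measure_nonneg[of "positive_part \<Omega> (\<lambda>A. - (F A \<bullet> b))" A] by linarith
    qed
    finally show ?thesis .
  qed
  have "f \<Omega> \<le> ennreal (v \<Omega>)"
    unfolding f_def
  proof (rule SUP_least)
    fix P assume "P \<in> parts \<Omega>"
    then have P: "finite P" "P \<subseteq> borel_on \<Omega>" "\<Union>P = \<Omega>" "disjoint P"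
      by (auto simp: parts_def partition_on_def)
    have add: "(\<Sum>B\<in>P. measure M B) = measure M \<Omega>" if M: "radon_measure_on \<Omega> M" for M
    proof -
      interpret finite_measure M using M by (rule radon_measure_onD)
      have "measure M (\<Union>B\<in>P. B) = (\<Sum>B\<in>P. measure M B)"
        by (rule finite_measure_finite_Union)
           (use P radon_measure_onD[OF M] in \<open>auto simp: disjoint_family_on_def disjoint_def\<close>)
      then show ?thesis using P by simp
    qed
    have "(\<Sum>B\<in>P. norm (F B)) \<le> (\<Sum>B\<in>P. v B)" by (rule sum_mono) (use Fv P in auto)
    also have "\<dots> = (\<Sum>b\<in>Basis. \<Sum>B\<in>P. measure (positive_part \<Omega> (\<lambda>A. F A \<bullet> b)) B
      + measure (positive_part \<Omega> (\<lambda>A. - (F A \<bullet> b))) B)"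
      unfolding v_def by (rule sum.swap)
    also have "\<dots> = v \<Omega>" unfolding v_def
      by (intro sum.cong refl) (simp add: sum.distrib add radon_positive_part(1)[OF \<Omega>]
          vector_measure_on_inner[OF F] vector_measure_on_uminus[OF vector_measure_on_inner[OF F]])
    finally show "(\<Sum>B\<in>P. ennreal (norm (F B))) \<le> ennreal (v \<Omega>)"
      by (subst sum_ennreal) (auto intro: ennreal_leI)
  qed
  then have "finite_measure (variation \<Omega> F)"
    using em[OF top] sp by (intro finite_measureI) (auto simp: top_unique)
  then show "radon_measure_on \<Omega> (variation \<Omega> F)" using sp by (simp add: radon_measure_on_def)
  show "norm (F A) \<le> measure (variation \<Omega> F) A" if "A \<in> borel_on \<Omega>"
  proof -
    interpret finite_measure "variation \<Omega> F" by fact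
    have "ennreal (norm (F A)) \<le> ennreal (measure (variation \<Omega> F) A)"
      using single[OF that] em[OF that] by (simp add: emeasure_eq_measure)
    then show ?thesis by (simp add: ennreal_le_iff)
  qed
qed

section \<open>Smooth functions and mollification\<close>

lemma Ck_SucD:
  assumes "Ck (Suc k) f"
  shows "(f has_derivative frechet_derivative f (at x)) (at x)"
    and "b \<in> Basis \<Longrightarrow> Ck k (\<lambda>x. frechet_derivative f (at x) b)"
  using assms by (auto simp: differentiable_on_def frechet_derivative_works)

lemma Ck_SucI:
  assumes "\<And>x. (f has_derivative f' x) (at x)" "\<And>b. b \<in> Basis \<Longrightarrow> Ck k (\<lambda>x. f' x b)"
  shows "Ck (Suc k) f"
proof -
  have "frechet_derivative f (at x) = f' x" for x
    using assms(1) frechet_derivative_at by metis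
  moreover have "f differentiable_on UNIV"
    using assms(1) by (auto simp: differentiable_on_def differentiable_def)
  ultimately show ?thesis using assms(2) by simp
qed

lemma Ck_Suc_imp_Ck: "Ck (Suc k) f \<Longrightarrow> Ck k f"
proof (induction k arbitrary: f)
  case 0
  then show ?case by (auto intro: differentiable_imp_continuous_on)
next
  case (Suc k)
  then show ?case by (metis Ck.simps(2))
qed

lemma Ck_continuous: "Ck k f \<Longrightarrow> continuous_on UNIV f"
  by (induction k) (use Ck_Suc_imp_Ck in auto)

lemma Ck_const: "Ck k (\<lambda>x. c)"
  by (induction k arbitrary: c) (auto intro!: Ck_SucI derivative_eq_intros simp del: Ck.simps(2))

lemma Ck_add: "Ck k f \<Longrightarrow> Ck k g \<Longrightarrow> Ck k (\<lambda>x. f x + g x)"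
proof (induction k arbitrary: f g)
  case 0
  then show ?case by (auto intro: continuous_on_add)
next
  case (Suc k)
  show ?case
    by (rule Ck_SucI[OF has_derivative_add[OF Ck_SucD(1)[OF Suc.prems(1)] Ck_SucD(1)[OF Suc.prems(2)]]])
       (intro Suc.IH Ck_SucD(2) Suc.prems)
qed

lemma Ck_mult: "Ck k f \<Longrightarrow> Ck k g \<Longrightarrow> Ck k (\<lambda>x. f x * g x)"
proof (induction k arbitrary: f g)
  case 0
  then show ?case by (auto intro: continuous_on_mult)
next
  case (Suc k)
  show ?case
    by (rule Ck_SucI[OF has_derivative_mult[OF Ck_SucD(1)[OF Suc.prems(1)] Ck_SucD(1)[OF Suc.prems(2)]]])
       (intro Ck_add Suc.IH Ck_SucD(2) Suc.prems Ck_Suc_imp_Ck)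
qed

lemma Ck_cmult: "Ck k f \<Longrightarrow> Ck k (\<lambda>x. c * f x)"
  by (intro Ck_mult Ck_const)

lemma Ck_diff: "Ck k f \<Longrightarrow> Ck k g \<Longrightarrow> Ck k (\<lambda>x. f x - g x)"
  using Ck_add[of k f "\<lambda>x. (-1) * g x"] Ck_cmult[of k g "-1"] by simp

lemma Ck_inner: "Ck k (\<lambda>x. x \<bullet> c)"
proof (cases k)
  case (Suc j)
  then show ?thesis
    by (auto intro!: Ck_SucI[where f'="\<lambda>x h. h \<bullet> c"] derivative_eq_intros Ck_const simp del: Ck.simps(2))
qed (auto intro: continuous_intros)

lemma Ck_sum: "(\<And>i. i \<in> I \<Longrightarrow> Ck k (f i)) \<Longrightarrow> Ck k (\<lambda>x. \<Sum>i\<in>I. f i x)"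
  by (induction I rule: infinite_finite_induct) (auto intro: Ck_const Ck_add)

text \<open>The whole sequence of derivatives of the outer function is carried along, because the
  chain rule moves \<open>g n\<close> to \<open>g (Suc n)\<close>; the induction on \<open>k\<close>
  therefore quantifies over \<open>n\<close>.\<close>

lemma Ck_comp_real:
  fixes g :: "nat \<Rightarrow> real \<Rightarrow> real"
  assumes g: "\<And>n t. (g n has_real_derivative g (Suc n) t) (at t)" and "Ck k q"
  shows "Ck k (\<lambda>x. g n (q x))"
  using assms(2)
proof (induction k arbitrary: n)
  case 0
  have "continuous_on UNIV (g n)"
    using g by (meson DERIV_isCont continuous_at_imp_continuous_on)
  then show ?case using 0 by (auto intro: continuous_on_compose2)
next
  case (Suc k)
  show ?case
  proof (rule Ck_SucI)
    fix x
    have "((\<lambda>x. g n (q x)) has_derivative (\<lambda>h. g (Suc n) (q x) * frechet_derivative q (at x) h)) (at x)"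
      by (rule has_derivative_compose[OF Ck_SucD(1)[OF Suc.prems]
            g[unfolded has_field_derivative_def]])
    then show "((\<lambda>x. g n (q x)) has_derivative (\<lambda>h. g (Suc n) (q x) * frechet_derivative q (at x) h)) (at x)" .
  next
    fix b :: 'a assume "b \<in> Basis"
    then show "Ck k (\<lambda>x. g (Suc n) (q x) * frechet_derivative q (at x) b)"
      by (intro Ck_mult Suc.IH Ck_SucD(2) Suc.prems Ck_Suc_imp_Ck)
  qed
qed

text \<open>The functions \<open>p(1/t) exp(-1/t)\<close>, continued by 0, form a family closed
  under differentiation, as a single \<open>exp(-1/t)\<close> is not.\<close>

definition exp_poly :: "real poly \<Rightarrow> real \<Rightarrow> real" where
  "exp_poly p t = (if t > 0 then poly p (1 / t) * exp (- (1 / t)) else 0)"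

lemma poly_times_exp_tendsto_0: "((\<lambda>s. poly p s * exp (- s)) \<longlongrightarrow> (0::real)) at_top"
proof -
  have "((\<lambda>s. \<Sum>i\<le>degree p. coeff p i * (s ^ i / exp s)) \<longlongrightarrow> (\<Sum>i\<le>degree p. coeff p i * 0)) at_top"
    by (intro tendsto_intros tendsto_power_div_exp_0)
  then show ?thesis
    by (simp add: poly_altdef sum_divide_distrib exp_minus divide_inverse sum_distrib_right mult.assoc)
qed

text \<open>In the variable \<open>s = 1/t\<close> the derivative is \<open>-s^2 d/ds\<close>, which
  maps \<open>p exp(-s)\<close> to \<open>s^2 (p - p') exp(-s)\<close>. At 0 the difference quotient
  is the member of the family with polynomial \<open>s p\<close>, which decays.\<close>

lemma exp_poly_has_derivative:
  "(exp_poly p has_real_derivative exp_poly ([:0, 0, 1:] * (p - pderiv p)) t) (at t)"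
proof -
  consider "t > 0" | "t < 0" | "t = 0" by linarith
  then show ?thesis
  proof cases
    case 1
    have "((\<lambda>t. poly p (1 / t) * exp (- (1 / t))) has_real_derivative
        exp_poly ([:0, 0, 1:] * (p - pderiv p)) t) (at t)"
      using 1 by (auto intro!: derivative_eq_intros DERIV_chain2[OF poly_DERIV]
          simp: exp_poly_def field_simps power2_eq_square)
    moreover have "\<forall>\<^sub>F s in nhds t. exp_poly p s = poly p (1 / s) * exp (- (1 / s))"
      using eventually_nhds_in_open[of "{0<..}" t] 1 by (auto simp: exp_poly_def elim!: eventually_mono)
    ultimately show ?thesis by (subst DERIV_cong_ev[OF refl _ refl])
  next
    case 2
    have "((\<lambda>t. 0) has_real_derivative exp_poly ([:0, 0, 1:] * (p - pderiv p)) t) (at t)"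
      using 2 by (simp add: exp_poly_def)
    moreover have "\<forall>\<^sub>F s in nhds t. exp_poly p s = 0"
      using eventually_nhds_in_open[of "{..<0}" t] 2 by (auto simp: exp_poly_def elim!: eventually_mono)
    ultimately show ?thesis by (subst DERIV_cong_ev[OF refl _ refl])
  next
    case 3
    have "((\<lambda>s. exp_poly p s / s) \<longlongrightarrow> 0) (at 0)"
    proof (rule filterlim_split_at)
      have "\<forall>\<^sub>F s in at_left 0. exp_poly p s / s = 0"
        by (auto simp: exp_poly_def eventually_at_filter)
      then show "((\<lambda>s. exp_poly p s / s) \<longlongrightarrow> 0) (at_left 0)" by (rule tendsto_eventually)
      have "((\<lambda>s. poly ([:0, 1:] * p) (inverse s) * exp (- inverse s)) \<longlongrightarrow> 0) (at_right (0::real))"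
        by (rule filterlim_compose[OF poly_times_exp_tendsto_0 filterlim_inverse_at_top_right])
      moreover have "\<forall>\<^sub>F s in at_right 0. poly ([:0, 1:] * p) (inverse s) * exp (- inverse s) = exp_poly p s / s"
        by (auto simp: exp_poly_def eventually_at_filter field_simps)
      ultimately show "((\<lambda>s. exp_poly p s / s) \<longlongrightarrow> 0) (at_right 0)"
        by (rule Lim_transform_eventually)
    qed
    then show ?thesis using 3 by (simp add: DERIV_def exp_poly_def)
  qed
qed

lemma Ck_exp_poly: "Ck k q \<Longrightarrow> Ck k (\<lambda>x. exp_poly p (q x))"
  using Ck_comp_real[of "\<lambda>n. exp_poly (((\<lambda>p. [:0, 0, 1:] * (p - pderiv p)) ^^ n) p)" k q 0]
    exp_poly_has_derivative by simp

text \<open>The classical bump \<open>exp(-1/(d^2 - |x|^2))\<close> on the ball of radius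
  \<open>d\<close>. The squared norm is used because it is a polynomial and hence smooth at the
  origin.\<close>

definition bump :: "real \<Rightarrow> 'a::euclidean_space \<Rightarrow> real" where
  "bump d x = exp_poly 1 (d\<^sup>2 - x \<bullet> x)"

lemma Ck_bump: "Ck k (bump d)"
proof -
  have "Ck k (\<lambda>x::'a. \<Sum>b\<in>Basis. (x \<bullet> b) * (x \<bullet> b))"
    by (intro Ck_sum Ck_mult Ck_inner)
  then have "Ck k (\<lambda>x::'a. x \<bullet> x)" by (simp only: euclidean_inner[symmetric])
  then show ?thesis unfolding bump_def by (intro Ck_exp_poly Ck_diff Ck_const)
qed

lemma bump_nonneg: "bump d x \<ge> 0"
  by (simp add: bump_def exp_poly_def)

lemma bump_pos: "norm x < d \<Longrightarrow> bump d x > 0"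
  by (simp add: bump_def exp_poly_def dot_square_norm power_strict_mono)

lemma bump_zero: "norm x \<ge> d \<Longrightarrow> d \<ge> 0 \<Longrightarrow> bump d x = 0"
  by (simp add: bump_def exp_poly_def dot_square_norm power_mono not_less)

text \<open>Convolution over a box, so that differentiation under the integral needs only
  continuity. If the box contains the support of \<open>g\<close>, it is the full
  convolution.\<close>

definition conv :: "'a \<Rightarrow> 'a \<Rightarrow> ('a \<Rightarrow> real) \<Rightarrow> ('a::euclidean_space \<Rightarrow> real) \<Rightarrow> 'a \<Rightarrow> real" where
  "conv a b g f x = integral (cbox a b) (\<lambda>t. g t * f (x - t))"

text \<open>The Leibniz rule puts the derivative on the second factor, so the first one may be
  merely continuous.\<close>

lemma conv_has_derivative:
  fixes f :: "'a::euclidean_space \<Rightarrow> real"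
  assumes g: "continuous_on UNIV g" and f: "Ck (Suc 0) f"
  shows "(conv u v g f has_derivative
    (\<lambda>h. \<Sum>b\<in>Basis. (h \<bullet> b) * conv u v g (\<lambda>x. frechet_derivative f (at x) b) x)) (at x)"
proof -
  define D where "D b y = frechet_derivative f (at y) b" for b y
  have Dc: "continuous_on UNIV (D b)" if "b \<in> Basis" for b
    using f that unfolding D_def by simp
  have fc: "continuous_on UNIV f" by (rule Ck_continuous[OF f])
  \<comment> \<open>The Leibniz rule asks for a jointly continuous family of bounded linear maps. It
    is assembled from partial derivatives, since their continuity is what \<open>Ck\<close>
    provides.\<close>
  define fx where "fx x t = (\<Sum>b\<in>Basis. (g t * D b (x - t)) *\<^sub>R blinfun_inner_left b)" for x t :: 'a
  have fx_apply: "fx x t h = g t * frechet_derivative f (at (x - t)) h" for x t h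
  proof -
    interpret linear "frechet_derivative f (at (x - t))"
      using Ck_SucD(1)[OF f] by (rule has_derivative_linear)
    have "frechet_derivative f (at (x - t)) h = frechet_derivative f (at (x - t)) (\<Sum>b\<in>Basis. (h \<bullet> b) *\<^sub>R b)"
      by (simp add: euclidean_representation)
    also have "\<dots> = (\<Sum>b\<in>Basis. (h \<bullet> b) * D b (x - t))" by (simp add: sum scale D_def)
    finally show ?thesis
      by (simp add: fx_def blinfun.sum_left blinfun.scaleR_left sum_distrib_left mult_ac)
  qed
  have leibniz: "((\<lambda>x. integral (cbox u v) (\<lambda>t. g t * f (x - t))) has_derivative
      blinfun_apply (integral (cbox u v) (fx x))) (at x within UNIV)"
  proof (rule leibniz_rule)
    fix x t :: 'a
    have "((\<lambda>x. f (x - t)) has_derivative (\<lambda>h. frechet_derivative f (at (x - t)) h)) (at x)"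
      by (rule has_derivative_compose[OF _ Ck_SucD(1)[OF f]]) (auto intro!: derivative_eq_intros)
    then have "((\<lambda>x. g t * f (x - t)) has_derivative (\<lambda>h. g t * frechet_derivative f (at (x - t)) h)) (at x)"
      by (rule has_derivative_mult_right)
    moreover have "blinfun_apply (fx x t) = (\<lambda>h. g t * frechet_derivative f (at (x - t)) h)"
      by (rule ext) (rule fx_apply)
    ultimately show "((\<lambda>x. g t * f (x - t)) has_derivative blinfun_apply (fx x t)) (at x within UNIV)"
      by simp
  next
    fix x
    show "(\<lambda>t. g t * f (x - t)) integrable_on cbox u v"
      by (intro integrable_continuous continuous_on_mult continuous_on_subset[OF g]
          continuous_on_compose2[OF fc] continuous_intros) auto
  next
    show "continuous_on (UNIV \<times> cbox u v) (\<lambda>(x, t). fx x t)"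
      unfolding fx_def case_prod_beta
      by (intro continuous_on_sum continuous_on_scaleR continuous_on_mult continuous_on_const
          continuous_on_compose2[OF g] continuous_on_compose2[OF Dc] continuous_intros) auto
  qed auto
  have comp: "blinfun_apply (integral (cbox u v) (fx x)) h =
      (\<Sum>b\<in>Basis. (h \<bullet> b) * conv u v g (D b) x)" for h
  proof -
    have int: "(\<lambda>t. g t * D b (x - t)) integrable_on cbox u v" if "b \<in> Basis" for b
      by (intro integrable_continuous continuous_on_mult continuous_on_subset[OF g]
          continuous_on_compose2[OF Dc[OF that]] continuous_intros) auto
    have "fx x integrable_on cbox u v"
      unfolding fx_def
      by (intro integrable_continuous continuous_on_sum continuous_on_scaleR continuous_on_mult continuous_on_const
          continuous_on_subset[OF g] continuous_on_compose2[OF Dc] continuous_intros) auto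
    then have "blinfun_apply (integral (cbox u v) (fx x)) h = integral (cbox u v) (\<lambda>t. fx x t h)"
      by (rule blinfun_apply_integral)
    also have "\<dots> = integral (cbox u v) (\<lambda>t. \<Sum>b\<in>Basis. (h \<bullet> b) * (g t * D b (x - t)))"
      by (simp add: fx_def blinfun.sum_left blinfun.scaleR_left mult.commute)
    also have "\<dots> = (\<Sum>b\<in>Basis. integral (cbox u v) (\<lambda>t. (h \<bullet> b) * (g t * D b (x - t))))"
      by (rule integral_sum) (auto intro: integrable_on_mult_right int)
    finally show ?thesis by (simp add: conv_def)
  qed
  have "blinfun_apply (integral (cbox u v) (fx x)) = (\<lambda>h. \<Sum>b\<in>Basis. (h \<bullet> b) * conv u v g (D b) x)"
    by (rule ext) (rule comp)
  with leibniz show ?thesis unfolding conv_def[abs_def] D_def by simp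
qed

lemma Ck_conv:
  fixes f :: "'a::euclidean_space \<Rightarrow> real"
  assumes g: "continuous_on UNIV g" and "Ck k f"
  shows "Ck k (conv u v g f)"
  using assms(2)
proof (induction k arbitrary: f)
  case 0
  then have f: "continuous_on UNIV f" by simp
  have "continuous_on UNIV (\<lambda>x. integral (cbox u v) (\<lambda>t. g t * f (x - t)))"
    by (rule integral_continuous_on_param)
       (auto simp: case_prod_beta intro!: continuous_on_mult continuous_on_compose2[OF g] continuous_on_compose2[OF f] continuous_intros)
  then show ?case by (simp add: conv_def[abs_def])
next
  case (Suc k)
  have f1: "Ck (Suc 0) f" using Ck_SucD[OF Suc.prems] Ck_continuous by (intro Ck_SucI) auto
  show ?case
  proof (rule Ck_SucI[OF conv_has_derivative[OF g f1]])
    fix c :: 'a assume c: "c \<in> Basis"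
    have "(\<Sum>b\<in>Basis. (c \<bullet> b) * conv u v g (\<lambda>x. frechet_derivative f (at x) b) x)
       = conv u v g (\<lambda>x. frechet_derivative f (at x) c) x" for x
      using c by (subst sum.remove[of _ c]) (auto simp: inner_Basis split: if_splits intro!: sum.neutral)
    then show "Ck k (\<lambda>x. \<Sum>b\<in>Basis. (c \<bullet> b) * conv u v g (\<lambda>x. frechet_derivative f (at x) b) x)"
      using Suc.IH[OF Ck_SucD(2)[OF Suc.prems c]] by simp
  qed
qed

lemma frechet_derivative_conv:
  fixes f :: "'a::euclidean_space \<Rightarrow> real"
  assumes g: "continuous_on UNIV g" and f: "Ck (Suc 0) f" and c: "c \<in> Basis"
  shows "frechet_derivative (conv u v g f) (at x) c = conv u v g (\<lambda>x. frechet_derivative f (at x) c) x"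
proof -
  have "frechet_derivative (conv u v g f) (at x) c =
      (\<Sum>b\<in>Basis. (c \<bullet> b) * conv u v g (\<lambda>x. frechet_derivative f (at x) b) x)"
    by (rule fun_cong[OF frechet_derivative_at[OF conv_has_derivative[OF g f], symmetric]])
  also have "\<dots> = conv u v g (\<lambda>x. frechet_derivative f (at x) c) x"
    using c by (subst sum.remove[of _ c]) (auto simp: inner_Basis split: if_splits intro!: sum.neutral)
  finally show ?thesis .
qed

text \<open>Along the direction \<open>g = grad f x\<close> the derivative is the squared norm of
  \<open>g\<close>, whereas difference quotients are at most \<open>L * norm g\<close>; dividing by
  \<open>norm g\<close> gives the bound.\<close>

lemma norm_grad_le:
  assumes f: "(f has_derivative f') (at x)" and L: "\<And>y. \<bar>f y - f x\<bar> \<le> L * norm (y - x)"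
  shows "norm (grad f x) \<le> L"
proof -
  interpret f': bounded_linear f' using f by (rule has_derivative_bounded_linear)
  have f'_eq: "frechet_derivative f (at x) = f'" using f frechet_derivative_at by metis
  define g where "g = grad f x"
  have inner: "f' h = g \<bullet> h" for h
  proof -
    have "f' h = f' (\<Sum>b\<in>Basis. (h \<bullet> b) *\<^sub>R b)" by (simp add: euclidean_representation)
    also have "\<dots> = (\<Sum>b\<in>Basis. (h \<bullet> b) * f' b)" by (simp add: f'.sum f'.scaleR)
    also have "\<dots> = g \<bullet> h" unfolding g_def grad_def f'_eq inner_sum_left
      by (intro sum.cong refl) (simp add: inner_commute)
    finally show ?thesis .
  qed
  \<comment> \<open>Nonnegativity of \<open>L\<close> is needed when the gradient vanishes; it
    follows by testing the hypothesis with one basis vector.\<close>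
  obtain b :: 'a where b: "b \<in> Basis" using nonempty_Basis by blast
  have "0 \<le> \<bar>f (x + b) - f x\<bar>" by simp
  also have "\<dots> \<le> L" using L[of "x + b"] b by simp
  finally have L0: "L \<ge> 0" .
  have "((\<lambda>t. f (x + t *\<^sub>R g)) has_derivative (\<lambda>t. f' (t *\<^sub>R g))) (at 0)"
    by (rule has_derivative_compose[of "\<lambda>t. x + t *\<^sub>R g" _ 0 UNIV f f', simplified])
       (auto intro!: derivative_eq_intros f)
  then have "((\<lambda>t. f (x + t *\<^sub>R g)) has_real_derivative f' g) (at 0)"
    unfolding has_field_derivative_def f'.scaleR real_scaleR_def mult.commute[of _ "f' g"] .
  then have "((\<lambda>t. (f (x + t *\<^sub>R g) - f x) / t) \<longlongrightarrow> f' g) (at 0)"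
    by (simp add: DERIV_def)
  moreover have "(f (x + t *\<^sub>R g) - f x) / t \<le> L * norm g" if "t \<noteq> 0" for t
  proof -
    have "\<bar>(f (x + t *\<^sub>R g) - f x) / t\<bar> \<le> L * norm g"
      using L[of "x + t *\<^sub>R g"] that by (simp add: abs_div field_simps)
    then show ?thesis by linarith
  qed
  ultimately have "f' g \<le> L * norm g"
    by (intro tendsto_upperbound[of "\<lambda>t. (f (x + t *\<^sub>R g) - f x) / t" "f' g" "at 0"])
       (auto simp: eventually_at_filter)
  then have "norm g * norm g \<le> L * norm g" by (simp add: inner dot_square_norm power2_eq_square)
  then show ?thesis using L0 unfolding g_def[symmetric] by (cases "norm g = 0") auto
qed

lemma has_derivative_grad:
  assumes "Ck (Suc k) f"
  shows "(f has_derivative (\<lambda>h. grad f x \<bullet> h)) (at x)"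
proof -
  interpret f': bounded_linear "frechet_derivative f (at x)"
    using Ck_SucD(1)[OF assms] by (rule has_derivative_bounded_linear)
  have "frechet_derivative f (at x) h = grad f x \<bullet> h" for h
  proof -
    have "frechet_derivative f (at x) h = frechet_derivative f (at x) (\<Sum>b\<in>Basis. (h \<bullet> b) *\<^sub>R b)"
      by (simp add: euclidean_representation)
    also have "\<dots> = (\<Sum>b\<in>Basis. (h \<bullet> b) * frechet_derivative f (at x) b)"
      by (simp add: f'.sum f'.scaleR)
    also have "\<dots> = grad f x \<bullet> h" unfolding grad_def inner_sum_left
      by (intro sum.cong refl) (simp add: inner_commute)
    finally show ?thesis .
  qed
  then have "frechet_derivative f (at x) = (\<lambda>h. grad f x \<bullet> h)" by (rule ext)
  then show ?thesis using Ck_SucD(1)[OF assms, of x] by simp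
qed

lemma grad_inner_Basis: "b \<in> Basis \<Longrightarrow> grad f x \<bullet> b = frechet_derivative f (at x) b"
  by (simp add: grad_def inner_sum_left inner_Basis if_distrib cong: if_cong)

lemma grad_eqI: "(f has_derivative (\<lambda>h. g \<bullet> h)) (at x) \<Longrightarrow> grad f x = g"
  using frechet_derivative_at[of f "\<lambda>h. g \<bullet> h" x]
  by (auto simp: grad_def euclidean_representation dest: sym)

lemma continuous_on_grad:
  assumes "Ck (Suc k) f"
  shows "continuous_on UNIV (grad f)"
  unfolding grad_def[abs_def]
  by (intro continuous_on_sum continuous_on_scaleR continuous_on_const Ck_continuous[OF Ck_SucD(2)[OF assms]])

text \<open>Averaging with a probability kernel supported in the ball of radius \<open>d\<close>
  preserves every one-sided bound valid on that ball. Read with the kernel as second factor the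
  convolution is smooth; read with \<open>f\<close> as second factor its derivatives are averages of
  those of \<open>f\<close>.\<close>

lemma mollification:
  fixes f :: "'a::euclidean_space \<Rightarrow> real"
  assumes f: "continuous_on UNIV f" and supp: "compact (closure {x. f x \<noteq> 0})" and d: "d > 0"
  obtains g where "\<forall>k. Ck k g"
    "\<forall>x c. (\<forall>y. dist x y \<le> d \<longrightarrow> f y \<le> c) \<longrightarrow> g x \<le> c"
    "\<forall>x c. (\<forall>y. dist x y \<le> d \<longrightarrow> c \<le> f y) \<longrightarrow> c \<le> g x"
    "\<forall>L x. (\<forall>x y. \<bar>f x - f y\<bar> \<le> L * dist x y) \<longrightarrow> norm (grad g x) \<le> L"
    "\<forall>x c. \<forall>b\<in>Basis. Ck (Suc 0) f \<and> (\<forall>y. dist x y \<le> d \<longrightarrow> frechet_derivative f (at y) b \<le> c) \<longrightarrow>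
       frechet_derivative g (at x) b \<le> c"
    "\<forall>x c. \<forall>b\<in>Basis. Ck (Suc 0) f \<and> (\<forall>y. dist x y \<le> d \<longrightarrow> c \<le> frechet_derivative f (at y) b) \<longrightarrow>
       c \<le> frechet_derivative g (at x) b"
proof -
  obtain u v :: 'a where uv: "cball 0 d \<subseteq> cbox u v"
    using bounded_subset_cbox_symmetric[OF bounded_cball] by metis
  obtain u' v' :: 'a where uv': "closure {x. f x \<noteq> 0} \<subseteq> cbox u' v'"
    using bounded_subset_cbox_symmetric[OF compact_imp_bounded[OF supp]] by metis
  define Z where "Z = integral (cbox u v) (bump d)"
  define \<kappa> where "\<kappa> x = bump d x / Z" for x :: 'a
  have bc: "continuous_on A (bump d)" for A :: "'a set"
    using Ck_continuous[OF Ck_bump] continuous_on_subset by blast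
  have Z: "Z > 0"
  proof -
    have "0 \<in> cbox u v" "0 \<in> interior (cball (0::'a) d)" using uv d by auto
    then have ne: "interior (cbox u v) \<noteq> {}" using interior_mono[OF uv] by auto
    have "Z \<noteq> 0"
    proof
      assume "Z = 0"
      moreover have "(bump d has_integral Z) (cbox u v)"
        unfolding Z_def by (intro integrable_integral integrable_continuous bc)
      ultimately have "bump d (0::'a) = 0"
        using has_integral_0_cbox_imp_0[OF bc, where x=0 and a=u and b=v] ne bump_nonneg \<open>0 \<in> cbox u v\<close>
        by (auto simp: interior_cbox)
      then show False using bump_pos[of "0::'a" d] d by simp
    qed
    moreover have "Z \<ge> 0" unfolding Z_def
      by (rule integral_nonneg) (auto intro: integrable_continuous bc bump_nonneg)
    ultimately show ?thesis by simp
  qed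
  have \<kappa>c: "continuous_on A \<kappa>" for A unfolding \<kappa>_def[abs_def] by (intro continuous_intros bc) (use Z in auto)
  have \<kappa>0: "\<kappa> x \<ge> 0" for x using Z by (simp add: \<kappa>_def bump_nonneg)
  have \<kappa>out: "\<kappa> x = 0" if "norm x \<ge> d" for x using that d by (simp add: \<kappa>_def bump_zero)
  have \<kappa>int: "integral (cbox u v) \<kappa> = 1"
    using Z by (simp add: \<kappa>_def[abs_def] Z_def)
  define g where "g = conv u v \<kappa> f"
  have mono: "conv u v \<kappa> p x \<le> c" if p: "continuous_on UNIV p" and c: "\<And>y. dist x y \<le> d \<Longrightarrow> p y \<le> c" for p x c
  proof -
    have "conv u v \<kappa> p x \<le> integral (cbox u v) (\<lambda>t. \<kappa> t * c)"
      unfolding conv_def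
    proof (rule integral_le)
      show "(\<lambda>t. \<kappa> t * p (x - t)) integrable_on cbox u v"
        by (intro integrable_continuous continuous_on_mult \<kappa>c continuous_on_compose2[OF p] continuous_intros) auto
      show "(\<lambda>t. \<kappa> t * c) integrable_on cbox u v"
        by (intro integrable_continuous continuous_on_mult \<kappa>c continuous_intros)
      fix t
      show "\<kappa> t * p (x - t) \<le> \<kappa> t * c"
        using \<kappa>out[of t] \<kappa>0[of t] c[of "x - t"] by (cases "norm t \<ge> d") (auto simp: dist_norm intro: mult_left_mono)
    qed
    then show ?thesis using \<kappa>int by simp
  qed
  have uminus: "conv u v \<kappa> (\<lambda>x. - p x) x = - conv u v \<kappa> p x" for p x
    by (simp add: conv_def)
  have mono': "c \<le> conv u v \<kappa> p x" if p: "continuous_on UNIV p" and c: "\<And>y. dist x y \<le> d \<Longrightarrow> c \<le> p y" for p x c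
    using mono[of "\<lambda>x. - p x" x "- c"] p c uminus by (auto intro: continuous_on_minus)
  \<comment> \<open>Commutativity of the convolution. Compact support of \<open>f\<close> lets both
    readings be taken over boxes.\<close>
  have eq: "g = conv u' v' f \<kappa>"
  proof
    fix x
    have i1: "integrable lborel (\<lambda>t. indicator (cbox u v) t *\<^sub>R (\<kappa> t * f (x - t)))"
      by (intro borel_integrable_compact compact_cbox continuous_on_mult \<kappa>c continuous_on_compose2[OF f] continuous_intros) auto
    have i2: "integrable lborel (\<lambda>t. indicator (cbox u' v') t *\<^sub>R (f t * \<kappa> (x - t)))"
      by (intro borel_integrable_compact compact_cbox continuous_on_mult continuous_on_subset[OF f] continuous_on_compose2[OF \<kappa>c[of UNIV]] continuous_intros) auto
    have e1: "indicator (cbox u v) t *\<^sub>R (\<kappa> t * f (x - t)) = \<kappa> t * f (x - t)" for t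
    proof (cases "t \<in> cbox u v")
      case False
      then have "norm t \<ge> d" using subsetD[OF uv, of t] by (cases "norm t < d") auto
      then show ?thesis by (simp add: \<kappa>out)
    qed simp
    have e2: "indicator (cbox u' v') t *\<^sub>R (f t * \<kappa> (x - t)) = f t * \<kappa> (x - t)" for t
      using uv' closure_subset[of "{x. f x \<noteq> 0}"] by (cases "t \<in> cbox u' v'") (auto simp: subset_iff)
    have "g x = (\<integral>t. indicator (cbox u v) t *\<^sub>R (\<kappa> t * f (x - t)) \<partial>lborel)"
      unfolding g_def conv_def
      using set_borel_integral_eq_integral(2)[of "cbox u v" "\<lambda>t. \<kappa> t * f (x - t)"] i1
      by (simp add: set_integrable_def set_lebesgue_integral_def)
    also have "\<dots> = (\<integral>t. \<kappa> t * f (x - t) \<partial>lborel)" unfolding e1 ..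
    \<comment> \<open>Lebesgue measure is invariant under the reflection
      \<open>t \<mapsto> x - t\<close>.\<close>
    also have "\<dots> = (\<integral>t. \<kappa> t * f (x - t) \<partial>(distr lborel borel (\<lambda>t. x + (-1) *\<^sub>R t)))"
      using lborel_affine[of "-1" x] by (simp add: density_1)
    also have "\<dots> = (\<integral>t. \<kappa> (x - t) * f t \<partial>lborel)"
      by (subst integral_distr) (auto intro!: borel_measurable_continuous_onI continuous_on_mult \<kappa>c continuous_on_compose2[OF f] continuous_intros)
    also have "\<dots> = (\<integral>t. indicator (cbox u' v') t *\<^sub>R (f t * \<kappa> (x - t)) \<partial>lborel)"
      unfolding e2 by (simp add: mult.commute)
    also have "\<dots> = conv u' v' f \<kappa> x"
      unfolding conv_def
      using set_borel_integral_eq_integral(2)[of "cbox u' v'" "\<lambda>t. f t * \<kappa> (x - t)"] i2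
      by (simp add: set_integrable_def set_lebesgue_integral_def)
    finally show "g x = conv u' v' f \<kappa> x" .
  qed
  have "Ck k \<kappa>" for k unfolding \<kappa>_def[abs_def] divide_inverse by (intro Ck_mult Ck_bump Ck_const)
  then have gk: "Ck k g" for k unfolding eq by (rule Ck_conv[OF f])
  show ?thesis
  proof (rule that[of g])
    show "\<forall>k. Ck k g" using gk by simp
    show "\<forall>x c. (\<forall>y. dist x y \<le> d \<longrightarrow> f y \<le> c) \<longrightarrow> g x \<le> c"
      unfolding g_def by (simp add: mono[OF f])
    show "\<forall>x c. (\<forall>y. dist x y \<le> d \<longrightarrow> c \<le> f y) \<longrightarrow> c \<le> g x"
      unfolding g_def by (simp add: mono'[OF f])
    have "norm (grad g x) \<le> L" if L: "\<And>x y. \<bar>f x - f y\<bar> \<le> L * dist x y" for L x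
    proof (rule norm_grad_le[OF Ck_SucD(1)[OF gk]])
      fix y
      \<comment> \<open>The increment of \<open>g\<close> from \<open>x\<close> to \<open>y\<close>
        is the average of the increment of \<open>f\<close> under the same translation, hence
        inherits the Lipschitz constant.\<close>
      define p where "p = (\<lambda>z. f (z + (y - x)) - f z)"
      have p: "continuous_on UNIV p" unfolding p_def by (intro continuous_intros continuous_on_compose2[OF f]) (auto intro: f)
      have pL: "\<bar>p z\<bar> \<le> L * norm (y - x)" for z using L[of "z + (y - x)" z] by (simp add: p_def dist_norm)
      have "conv u v \<kappa> p x = integral (cbox u v) (\<lambda>t. \<kappa> t * f (y - t) - \<kappa> t * f (x - t))"
        unfolding conv_def p_def by (simp add: algebra_simps)
      also have "\<dots> = g y - g x" unfolding g_def conv_def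
        by (rule integral_diff; intro integrable_continuous continuous_on_mult \<kappa>c continuous_on_compose2[OF f] continuous_intros) auto
      finally have "conv u v \<kappa> p x = g y - g x" .
      moreover have "conv u v \<kappa> p x \<le> L * norm (y - x)" "- (L * norm (y - x)) \<le> conv u v \<kappa> p x"
        using pL by (auto intro!: mono mono' p simp: abs_le_iff) (metis abs_le_D2 minus_le_iff pL)
      ultimately show "\<bar>g y - g x\<bar> \<le> L * norm (y - x)" by linarith
    qed
    then show "\<forall>L x. (\<forall>x y. \<bar>f x - f y\<bar> \<le> L * dist x y) \<longrightarrow> norm (grad g x) \<le> L" by blast
    show "\<forall>x c. \<forall>b\<in>Basis. Ck (Suc 0) f \<and> (\<forall>y. dist x y \<le> d \<longrightarrow> frechet_derivative f (at y) b \<le> c) \<longrightarrow>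
       frechet_derivative g (at x) b \<le> c"
    proof (intro allI ballI impI)
      fix x c b assume *: "b \<in> Basis" "Ck (Suc 0) f \<and> (\<forall>y. dist x y \<le> d \<longrightarrow> frechet_derivative f (at y) b \<le> c)"
      then have f1: "Ck (Suc 0) f" by blast
      show "frechet_derivative g (at x) b \<le> c"
        unfolding g_def frechet_derivative_conv[OF \<kappa>c f1 *(1)] by (rule mono) (use * in auto)
    qed
    show "\<forall>x c. \<forall>b\<in>Basis. Ck (Suc 0) f \<and> (\<forall>y. dist x y \<le> d \<longrightarrow> c \<le> frechet_derivative f (at y) b) \<longrightarrow>
       c \<le> frechet_derivative g (at x) b"
    proof (intro allI ballI impI)
      fix x c b assume *: "b \<in> Basis" "Ck (Suc 0) f \<and> (\<forall>y. dist x y \<le> d \<longrightarrow> c \<le> frechet_derivative f (at y) b)"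
      then have f1: "Ck (Suc 0) f" by blast
      show "c \<le> frechet_derivative g (at x) b"
        unfolding g_def frechet_derivative_conv[OF \<kappa>c f1 *(1)] by (rule mono') (use * in auto)
    qed
  qed
qed

lemma uniformly_continuous_compact_support:
  fixes f :: "'a::heine_borel \<Rightarrow> 'b::real_normed_vector"
  assumes f: "continuous_on UNIV f" and K: "compact K" and out: "\<And>x. x \<notin> K \<Longrightarrow> f x = 0" and "e > 0"
  obtains d where "d > 0" "\<forall>x y. dist x y < d \<longrightarrow> dist (f x) (f y) < e"
proof (cases "K = {}")
  case True
  then show ?thesis using that[of 1] out \<open>e > 0\<close> by simp
next
  case False
  \<comment> \<open>The compact set is enlarged by distance 1, so that two points less than 1 apart,
    one of them in \<open>K\<close>, both lie in it.\<close>
  define K' where "K' = {x. infdist x K \<le> 1}"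
  have "compact K'" unfolding K'_def by (rule compact_infdist_le) (use False K in auto)
  then have "uniformly_continuous_on K' f"
    using f by (intro compact_uniformly_continuous) (auto intro: continuous_on_subset)
  then obtain d where d: "d > 0" "\<And>x y. x \<in> K' \<Longrightarrow> y \<in> K' \<Longrightarrow> dist y x < d \<Longrightarrow> dist (f y) (f x) < e"
    using \<open>e > 0\<close> unfolding uniformly_continuous_on_def by metis
  have near: "y \<in> K'" if "x \<in> K" "dist x y < 1" for x y
    using infdist_le[OF that(1), of y] that(2) by (simp add: K'_def dist_commute)
  show ?thesis
  proof (rule that[of "min d 1"])
    have "dist (f x) (f y) < e" if xy: "dist x y < min d 1" for x y
    proof (cases "x \<in> K \<or> y \<in> K")
      case True
      then have "x \<in> K'" "y \<in> K'" using near[of x x] near[of x y] near[of y x] near[of y y] xy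
        by (auto simp: dist_commute)
      then show ?thesis using d(2)[of y x] xy by simp
    next
      case False
      then show ?thesis using out \<open>e > 0\<close> by simp
    qed
    then show "\<forall>x y. dist x y < min d 1 \<longrightarrow> dist (f x) (f y) < e" by blast
  qed (use d in simp)
qed

section \<open>Test functions, smooth approximation and cutoffs\<close>

lemma test_functionsD:
  assumes "\<phi> \<in> test_functions k \<Omega>"
  shows "Ck k \<phi>" "compact (closure {x. \<phi> x \<noteq> 0})" "closure {x. \<phi> x \<noteq> 0} \<subseteq> \<Omega>"
    "continuous_on UNIV \<phi>" "x \<notin> closure {x. \<phi> x \<noteq> 0} \<Longrightarrow> \<phi> x = 0" "x \<notin> \<Omega> \<Longrightarrow> \<phi> x = 0"
  using assms closure_subset[of "{x. \<phi> x \<noteq> 0}"] Ck_continuous by (auto simp: test_functions_def)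

lemma test_functions_mono: "\<phi> \<in> test_functions k A \<Longrightarrow> A \<subseteq> \<Omega> \<Longrightarrow> \<phi> \<in> test_functions k \<Omega>"
  by (auto simp: test_functions_def)

lemma smooth_test_functions_mono:
  "\<phi> \<in> smooth_test_functions A \<Longrightarrow> A \<subseteq> \<Omega> \<Longrightarrow> \<phi> \<in> smooth_test_functions \<Omega>"
  by (auto simp: smooth_test_functions_def intro: test_functions_mono)

lemma smooth_test_functions_subset: "\<phi> \<in> smooth_test_functions \<Omega> \<Longrightarrow> \<phi> \<in> test_functions k \<Omega>"
  by (auto simp: smooth_test_functions_def)

lemma test_functions_Suc: "\<phi> \<in> test_functions (Suc k) \<Omega> \<Longrightarrow> \<phi> \<in> test_functions k \<Omega>"
  using Ck_Suc_imp_Ck by (auto simp: test_functions_def simp del: Ck.simps)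

lemma bounded_borel_compact_support:
  fixes f :: "'a::euclidean_space \<Rightarrow> 'b::euclidean_space"
  assumes f: "continuous_on UNIV f" and K: "compact K" and out: "\<And>x. x \<notin> K \<Longrightarrow> f x = 0"
  shows "bounded_borel f"
proof -
  have "bounded (f ` K)"
    by (intro compact_imp_bounded compact_continuous_image continuous_on_subset[OF f] K) auto
  moreover have "range f \<subseteq> insert 0 (f ` K)" using out by auto
  ultimately have "bounded (range f)" using bounded_insert bounded_subset by metis
  then show ?thesis using f by (simp add: bounded_borel_def borel_measurable_continuous_onI)
qed

lemma test_function_bounded_borel: "\<phi> \<in> test_functions k \<Omega> \<Longrightarrow> bounded_borel \<phi>"
  by (rule bounded_borel_compact_support[of _ "closure {x. \<phi> x \<noteq> 0}"]) (auto dest: test_functionsD)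

lemma grad_zero:
  assumes "open S" "x \<in> S" "\<And>y. y \<in> S \<Longrightarrow> \<phi> y = c"
  shows "grad \<phi> x = 0"
proof (rule grad_eqI)
  have "((\<lambda>y. c) has_derivative (\<lambda>h. 0 \<bullet> h)) (at x)" by simp
  then show "(\<phi> has_derivative (\<lambda>h. 0 \<bullet> h)) (at x)"
    by (rule has_derivative_transform_within_open[OF _ assms(1,2)]) (simp add: assms(3))
qed

lemma grad_zero_outside_support: "x \<notin> closure {x. \<phi> x \<noteq> 0} \<Longrightarrow> grad \<phi> x = 0"
  by (rule grad_zero[of "- closure {x. \<phi> x \<noteq> 0}" _ _ 0])
     (use closure_subset[of "{x. \<phi> x \<noteq> 0}"] in auto)

lemma grad_bounded_borel: "\<phi> \<in> test_functions (Suc k) \<Omega> \<Longrightarrow> bounded_borel (grad \<phi>)"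
  by (rule bounded_borel_compact_support[of _ "closure {x. \<phi> x \<noteq> 0}"])
     (auto intro: grad_zero_outside_support continuous_on_grad simp: test_functions_def simp del: Ck.simps)

lemma mollified_test_function:
  assumes K: "compact K" "{x. infdist x K \<le> d} \<subseteq> A" "K \<noteq> {}"
    and g: "\<And>k. Ck k g" and zero: "\<And>x. (\<And>y. dist x y \<le> d \<Longrightarrow> y \<notin> K) \<Longrightarrow> g x = 0" and "d > 0"
  shows "g \<in> smooth_test_functions A"
proof -
  have "compact {x. infdist x K \<le> d}" by (rule compact_infdist_le) (use K \<open>d > 0\<close> in auto)
  moreover have "{x. g x \<noteq> 0} \<subseteq> {x. infdist x K \<le> d}"
  proof
    fix x assume "x \<in> {x. g x \<noteq> 0}"
    then obtain y where y: "dist x y \<le> d" "y \<in> K" using zero by auto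
    then show "x \<in> {x. infdist x K \<le> d}" using infdist_le[of y K x] by simp
  qed
  ultimately have sub: "closure {x. g x \<noteq> 0} \<subseteq> {x. infdist x K \<le> d}"
    and "compact (closure {x. g x \<noteq> 0})"
    by (auto intro: closure_minimal compact_imp_closed bounded_subset compact_imp_bounded simp: compact_closure)
       (meson closure_minimal compact_imp_closed subsetD mem_Collect_eq)
  then show ?thesis using g K(2) by (auto simp: smooth_test_functions_def test_functions_def)
qed

lemma smooth_approx:
  assumes A: "open A" and f: "f \<in> test_functions 0 A" and e: "e > 0"
  obtains g where "g \<in> smooth_test_functions A" "\<And>x. \<bar>g x - f x\<bar> \<le> e"
    "f \<in> test_functions 1 A \<Longrightarrow> (\<And>x. norm (grad g x - grad f x) \<le> e)"
proof (cases "closure {x. f x \<noteq> 0} = {}")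
  case True
  then have "{x. f x \<noteq> 0} = {}" by (simp only: closure_eq_empty)
  then have "f = (\<lambda>x. 0)" by auto
  then show ?thesis using e f that[of "\<lambda>x. 0"]
    by (auto simp: smooth_test_functions_def test_functions_def intro: Ck_const)
next
  case False
  define K where "K = closure {x. f x \<noteq> 0}"
  note fD = test_functionsD[OF f]
  have K: "compact K" "K \<subseteq> A" "K \<noteq> {}" using fD(2,3) False by (simp_all add: K_def)
  obtain r where r: "r > 0" "{x. infdist x K \<le> r} \<subseteq> A"
    using compact_in_open_separated[OF K(3,1) A K(2)] by auto
  have fout: "f x = 0" "grad f x = 0" if "x \<notin> K" for x
    using that fD(5)[of x] grad_zero_outside_support[of x f] by (simp_all add: K_def)
  obtain d1 where d1: "d1 > 0" "\<forall>x y. dist x y < d1 \<longrightarrow> dist (f x) (f y) < e"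
    by (rule uniformly_continuous_compact_support[OF fD(4) K(1) fout(1) e])
  \<comment> \<open>Gradients are compared component by component and the \<open>DIM('a)\<close>
    errors add up to \<open>e\<close>.\<close>
  define e' where "e' = e / DIM('a)"
  have e': "e' > 0" using e by (simp add: e'_def)
  \<comment> \<open>A radius is provided also when \<open>f\<close> is not continuously
    differentiable, so that a single mollification serves both the uniform and the gradient
    estimate.\<close>
  have "\<exists>d2>0. f \<in> test_functions 1 A \<longrightarrow> (\<forall>x y. dist x y < d2 \<longrightarrow> dist (grad f x) (grad f y) < e')"
  proof (cases "f \<in> test_functions 1 A")
    case True
    then have gc: "continuous_on UNIV (grad f)"
      by (intro continuous_on_grad[of 0]) (auto simp: test_functions_def)
    obtain d2 where "d2 > 0" "\<forall>x y. dist x y < d2 \<longrightarrow> dist (grad f x) (grad f y) < e'"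
      by (rule uniformly_continuous_compact_support[OF gc K(1) fout(2) e'])
    then show ?thesis by blast
  qed (auto intro: exI[of _ 1])
  then obtain d2 where d2: "d2 > 0"
    "f \<in> test_functions 1 A \<Longrightarrow> \<forall>x y. dist x y < d2 \<longrightarrow> dist (grad f x) (grad f y) < e'" by blast
  define d where "d = min r (min (d1/2) (d2/2))"
  have d: "d > 0" "d \<le> r" "d < d1" "d < d2" using r d1 d2 by (auto simp: d_def)
  obtain g where g: "\<forall>k. Ck k g"
    "\<forall>x c. (\<forall>y. dist x y \<le> d \<longrightarrow> f y \<le> c) \<longrightarrow> g x \<le> c"
    "\<forall>x c. (\<forall>y. dist x y \<le> d \<longrightarrow> c \<le> f y) \<longrightarrow> c \<le> g x"
    "\<forall>x c. \<forall>b\<in>Basis. Ck (Suc 0) f \<and> (\<forall>y. dist x y \<le> d \<longrightarrow> frechet_derivative f (at y) b \<le> c) \<longrightarrow>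
       frechet_derivative g (at x) b \<le> c"
    "\<forall>x c. \<forall>b\<in>Basis. Ck (Suc 0) f \<and> (\<forall>y. dist x y \<le> d \<longrightarrow> c \<le> frechet_derivative f (at y) b) \<longrightarrow>
       c \<le> frechet_derivative g (at x) b"
    by (rule mollification[OF fD(4,2) d(1)]) (rule that)
  show ?thesis
  proof (rule that[of g])
    show "g \<in> smooth_test_functions A"
    proof (rule mollified_test_function[OF K(1) _ K(3) g(1)[rule_format] _ d(1)])
      show "{x. infdist x K \<le> d} \<subseteq> A" using r d by auto
      fix x assume *: "\<And>y. dist x y \<le> d \<Longrightarrow> y \<notin> K"
      have "f y = 0" if "dist x y \<le> d" for y by (rule fout(1)[OF *[OF that]])
      then show "g x = 0" using g(2)[rule_format, of x 0] g(3)[rule_format, of x 0] by (intro antisym) auto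
    qed
    fix x
    have *: "\<bar>f y - f x\<bar> \<le> e" if "dist x y \<le> d" for y
      using d1(2)[rule_format, of y x] that d by (simp add: dist_real_def dist_commute)
    have "f y \<le> f x + e" "f x - e \<le> f y" if "dist x y \<le> d" for y
      using *[OF that] by linarith+
    then have "g x \<le> f x + e" "f x - e \<le> g x" using g(2,3) by blast+
    then show "\<bar>g x - f x\<bar> \<le> e" by linarith
    assume f1: "f \<in> test_functions 1 A"
    then have f1': "Ck (Suc 0) f" by (simp add: test_functions_def)
    have comp: "\<bar>(grad g x - grad f x) \<bullet> b\<bar> \<le> e'" if b: "b \<in> Basis" for b
    proof -
      have *: "\<bar>grad f y \<bullet> b - grad f x \<bullet> b\<bar> \<le> e'" if "dist x y \<le> d" for y
      proof -
        have "\<bar>(grad f y - grad f x) \<bullet> b\<bar> \<le> norm (grad f y - grad f x)" by (rule Basis_le_norm[OF b])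
        also have "\<dots> \<le> e'" using d2(2)[OF f1, rule_format, of y x] that d by (simp add: dist_norm norm_minus_commute)
        finally show ?thesis by (simp add: inner_diff_left)
      qed
      have "frechet_derivative f (at y) b \<le> grad f x \<bullet> b + e'" "grad f x \<bullet> b - e' \<le> frechet_derivative f (at y) b"
        if "dist x y \<le> d" for y
        using *[OF that] grad_inner_Basis[OF b, of f y] by linarith+
      then have "frechet_derivative g (at x) b \<le> grad f x \<bullet> b + e'"
        "grad f x \<bullet> b - e' \<le> frechet_derivative g (at x) b"
        using g(4,5) f1' b by blast+
      then show ?thesis using grad_inner_Basis[OF b, of g x] by (simp add: inner_diff_left)
    qed
    have "norm (grad g x - grad f x) \<le> (\<Sum>b\<in>Basis. \<bar>(grad g x - grad f x) \<bullet> b\<bar>)" by (rule norm_le_l1)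
    also have "\<dots> \<le> (\<Sum>b\<in>(Basis::'a set). e')" by (rule sum_mono) (rule comp)
    also have "\<dots> = e" by (simp add: e'_def)
    finally show "norm (grad g x - grad f x) \<le> e" .
  qed
qed

lemma smooth_cutoff:
  fixes K :: "'a::euclidean_space set"
  assumes K: "compact K" "K \<subseteq> A" and A: "open A"
  obtains g V where "g \<in> smooth_test_functions A" "open V" "K \<subseteq> V" "\<And>x. x \<in> V \<Longrightarrow> g x = 1"
proof (cases "K = {}")
  case True
  then show ?thesis using that[of "\<lambda>x. 0" "{}"]
    by (auto simp: smooth_test_functions_def test_functions_def intro: Ck_const)
next
  case False
  obtain r where r: "r > 0" "{x. infdist x K \<le> r} \<subseteq> A"
    using compact_in_open_separated[OF False K(1) A K(2)] by auto
  \<comment> \<open>The profile is 1 up to distance \<open>r/3\<close> and 0 from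
    \<open>2r/3\<close> on. Mollified at radius \<open>r/6\<close> it stays 1 up to distance
    \<open>r/6\<close>, with support within distance \<open>5r/6\<close> of
    \<open>K\<close>.\<close>
  define f where "f x = max 0 (min 1 (2 - 3 / r * infdist x K))" for x
  define K' where "K' = {x. infdist x K \<le> 2 * r / 3}"
  have K': "compact K'" unfolding K'_def by (rule compact_infdist_le) (use False K r in auto)
  have "K \<subseteq> K'" using r by (auto simp: K'_def)
  then have K'ne: "K' \<noteq> {}" using False by auto
  have supp: "closure {x. f x \<noteq> 0} \<subseteq> K'"
    using r by (intro closure_minimal compact_imp_closed[OF K']) (auto simp: f_def K'_def field_simps max_def)
  have f: "continuous_on UNIV f" unfolding f_def by (intro continuous_intros)
  have comp: "compact (closure {x. f x \<noteq> 0})"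
    using supp K' by (metis closed_closure compact_Int_closed inf.absorb_iff2)
  define d where "d = r / 6"
  have d: "d > 0" using r by (simp add: d_def)
  obtain g where g: "\<forall>k. Ck k g"
    "\<forall>x c. (\<forall>y. dist x y \<le> d \<longrightarrow> f y \<le> c) \<longrightarrow> g x \<le> c"
    "\<forall>x c. (\<forall>y. dist x y \<le> d \<longrightarrow> c \<le> f y) \<longrightarrow> c \<le> g x"
    by (rule mollification[OF f comp d]) (rule that)
  have tri: "\<bar>infdist x K - infdist y K\<bar> \<le> dist x y" for x y by (rule infdist_triangle_abs)
  show ?thesis
  proof (rule that[of g "{x. infdist x K < r / 6}"])
    show "g \<in> smooth_test_functions A"
    proof (rule mollified_test_function[OF K' _ _ g(1)[rule_format] _ d])
      show "{x. infdist x K' \<le> d} \<subseteq> A"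
      proof
        fix x assume x: "x \<in> {x. infdist x K' \<le> d}"
        obtain y where y: "y \<in> K'" "infdist x K' = dist x y"
          using infdist_attains_inf[OF compact_imp_closed[OF K'] K'ne, of x] by metis
        then have "infdist x K \<le> r" using x tri[of x y] r by (auto simp: K'_def d_def)
        then show "x \<in> A" using r by auto
      qed
      show "K' \<noteq> {}" by (rule K'ne)
      fix x assume *: "\<And>y. dist x y \<le> d \<Longrightarrow> y \<notin> K'"
      have "f y = 0" if "dist x y \<le> d" for y
        using *[OF that] supp closure_subset[of "{x. f x \<noteq> 0}"] by auto
      then show "g x = 0" using g(2)[rule_format, of x 0] g(3)[rule_format, of x 0] by (intro antisym) auto
    qed
    have "{x. infdist x K < r / 6} = (\<lambda>x. infdist x K) -` {..<r/6}" by auto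
    then show "open {x. infdist x K < r / 6}"
      by (simp add: open_vimage continuous_on_infdist)
    show "K \<subseteq> {x. infdist x K < r / 6}" using r by auto
    fix x assume x: "x \<in> {x. infdist x K < r / 6}"
    have "f y = 1" if "dist x y \<le> d" for y
    proof -
      have "infdist y K \<le> r / 3" using tri[of x y] that x unfolding d_def by simp
      then show ?thesis using r by (simp add: f_def field_simps min_def)
    qed
    then show "g x = 1" using g(2)[rule_format, of x 1] g(3)[rule_format, of x 1] by (intro antisym) auto
  qed
qed

text \<open>The segment from \<open>x\<close> to a nearest point of the complement has to cross the
  frontier. Distances to the complement are more convenient, since they vanish off
  \<open>U\<close>.\<close>

lemma infdist_frontier:
  fixes U :: "'a::euclidean_space set"
  assumes U: "open U" "x \<in> U" "U \<noteq> UNIV"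
  shows "infdist x (frontier U) = infdist x (- U)"
proof -
  have ne: "- U \<noteq> {}" "closed (- U)" using U by (auto simp: closed_Compl)
  obtain y where y: "y \<in> - U" "infdist x (- U) = dist x y"
    using infdist_attains_inf[OF ne(2,1)] by metis
  have "closed_segment x y \<inter> frontier U \<noteq> {}"
    by (rule connected_Int_frontier) (use U y in auto)
  then obtain z where z: "z \<in> closed_segment x y" "z \<in> frontier U" by auto
  have "infdist x (frontier U) \<le> dist x z" by (rule infdist_le[OF z(2)])
  also have "\<dots> \<le> dist x y" using z(1) dist_in_closed_segment dist_commute by metis
  finally have "infdist x (frontier U) \<le> infdist x (- U)" using y by simp
  moreover have "infdist x (- U) \<le> infdist x (frontier U)"
    by (rule infdist_mono) (use z U in \<open>auto simp: frontier_def interior_open\<close>)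
  ultimately show ?thesis by simp
qed

text \<open>A ramp in the distance to the complement rises from 0 at level \<open>a\<close> to 1 at
  level \<open>e - a\<close>, and mollifying at radius \<open>a/2\<close> keeps its gradient inside
  the layer. Slope exactly \<open>1/e\<close> would leave no room for this, whence the surplus
  factor \<open>\<theta> > 1\<close>.\<close>

lemma layer_cutoff:
  fixes U :: "'a::euclidean_space set"
  assumes U: "open U" "bounded U" and e: "e > 0" and \<theta>: "\<theta> > 1"
  shows "\<exists>\<psi>\<in>smooth_test_functions U. \<forall>x. 0 \<le> \<psi> x \<and> \<psi> x \<le> 1 \<and> norm (grad \<psi> x) \<le> \<theta> / e \<and>
    (grad \<psi> x \<noteq> 0 \<longrightarrow> x \<in> U \<and> infdist x (frontier U) < e) \<and>
    (x \<in> U \<and> e \<le> infdist x (frontier U) \<longrightarrow> \<psi> x = 1)"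
proof -
  define D where "D x = infdist x (- U)" for x
  have "U \<noteq> UNIV" using U not_bounded_UNIV by auto
  then have Df: "infdist x (frontier U) = D x" if "x \<in> U" for x
    using infdist_frontier[OF U(1) that] by (simp add: D_def)
  have Dc: "continuous_on S D" for S unfolding D_def by (intro continuous_intros)
  have D0: "D x = 0" if "x \<notin> U" for x using that by (simp add: D_def)
  have tri: "\<bar>D x - D y\<bar> \<le> dist x y" for x y unfolding D_def by (rule infdist_triangle_abs)
  \<comment> \<open>Chosen so that the ramp has length \<open>e - 2 * a = e / \<theta>\<close>, that
    is, slope \<open>\<theta> / e\<close>.\<close>
  define \<kappa> where "\<kappa> = (1 - 1 / \<theta>) / 2"
  have \<kappa>: "\<kappa> > 0" "\<kappa> < 1/2" using \<theta> by (auto simp: \<kappa>_def field_simps)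
  define a where "a = \<kappa> * e"
  have a: "a > 0" "a < e / 2" using \<kappa> e by (auto simp: a_def)
  have ba: "e - 2 * a = e / \<theta>" using \<theta> by (simp add: a_def \<kappa>_def field_simps)
  define f where "f x = max 0 (min 1 ((D x - a) / (e - 2 * a)))" for x
  have pos: "e - 2 * a > 0" using a by simp
  have f: "continuous_on UNIV f" unfolding f_def using pos by (intro continuous_intros Dc) auto
  define K where "K = {x. D x \<ge> a}"
  have clos: "closed {x. D x \<ge> c}" for c
    by (rule closed_Collect_le[OF continuous_on_const Dc])
  have comp: "compact {x. D x \<ge> c}" if "c > 0" for c
    unfolding compact_eq_bounded_closed using clos U(2) D0 that
    by (auto intro!: bounded_subset[OF U(2)]) (metis not_less)
  have supp: "closure {x. f x \<noteq> 0} \<subseteq> K" unfolding K_def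
    by (intro closure_minimal clos) (use pos in \<open>auto simp: f_def max_def field_simps\<close>)
  have fcomp: "compact (closure {x. f x \<noteq> 0})"
    using supp comp[OF a(1)] unfolding K_def by (metis closed_closure compact_Int_closed inf.absorb_iff2)
  have d: "a / 2 > 0" using a by simp
  obtain g where g: "\<forall>k. Ck k g"
    "\<forall>x c. (\<forall>y. dist x y \<le> a/2 \<longrightarrow> f y \<le> c) \<longrightarrow> g x \<le> c"
    "\<forall>x c. (\<forall>y. dist x y \<le> a/2 \<longrightarrow> c \<le> f y) \<longrightarrow> c \<le> g x"
    "\<forall>L x. (\<forall>x y. \<bar>f x - f y\<bar> \<le> L * dist x y) \<longrightarrow> norm (grad g x) \<le> L"
    by (rule mollification[OF f fcomp d]) (rule that)
  have g0: "g x = 0" if "D x < a / 2" for x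
  proof -
    have "f y = 0" if y: "dist x y \<le> a/2" for y
    proof -
      have "D y < a" using tri[of x y] y \<open>D x < a / 2\<close> by linarith
      then show ?thesis using pos by (simp add: f_def divide_nonpos_pos)
    qed
    then show "g x = 0" using g(2)[rule_format, of x 0] g(3)[rule_format, of x 0] by (intro antisym) auto
  qed
  have g1: "g x = 1" if "D x > e - a / 2" for x
  proof -
    have "f y = 1" if y: "dist x y \<le> a/2" for y
    proof -
      have "D y \<ge> e - a" using tri[of x y] y \<open>D x > e - a / 2\<close> by linarith
      then show ?thesis using pos by (simp add: f_def field_simps min_def)
    qed
    then show "g x = 1" using g(2)[rule_format, of x 1] g(3)[rule_format, of x 1] by (intro antisym) auto
  qed
  show ?thesis
  proof (rule bexI[of _ g])
    have "closure {x. g x \<noteq> 0} \<subseteq> {x. D x \<ge> a / 2}"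
      by (intro closure_minimal clos) (use g0 in force)
    moreover have "compact (closure {x. g x \<noteq> 0})"
      using calculation comp[OF d] by (metis closed_closure compact_Int_closed inf.absorb_iff2)
    moreover have "{x. D x \<ge> a / 2} \<subseteq> U" using D0 d by force
    ultimately show "g \<in> smooth_test_functions U"
      using g(1) by (auto simp: smooth_test_functions_def test_functions_def)
    have "0 \<le> g x" "g x \<le> 1" for x using g(3)[rule_format, of x 0] g(2)[rule_format, of x 1] by (auto simp: f_def)
    moreover have "norm (grad g x) \<le> \<theta> / e" for x
    proof (rule g(4)[rule_format])
      fix x y :: 'a
      have "\<bar>f x - f y\<bar> \<le> \<bar>(D x - a) / (e - 2 * a) - (D y - a) / (e - 2 * a)\<bar>"
        unfolding f_def by (auto simp: max_def min_def)
      also have "\<dots> = \<bar>D x - D y\<bar> * (\<theta> / e)"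
      proof -
        have "(D x - a) / (e - 2 * a) - (D y - a) / (e - 2 * a) = (D x - D y) * (\<theta> / e)"
          unfolding ba by (simp add: diff_divide_distrib[symmetric] algebra_simps)
        then show ?thesis using e \<theta> by (simp add: abs_mult)
      qed
      also have "\<dots> \<le> dist x y * (\<theta> / e)"
        by (rule mult_right_mono[OF tri]) (use e \<theta> in simp)
      finally show "\<bar>f x - f y\<bar> \<le> \<theta> / e * dist x y" by (simp add: mult.commute)
    qed
    moreover have "x \<in> U \<and> infdist x (frontier U) < e" if "grad g x \<noteq> 0" for x
    proof -
      have o: "open {x. D x < a / 2}" "open {x. D x > e - a / 2}"
        by (intro open_Collect_less continuous_on_const Dc)+
      have "\<not> D x < a / 2" "\<not> D x > e - a / 2"
        using grad_zero[OF o(1), of x g 0] grad_zero[OF o(2), of x g 1] g0 g1 that by auto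
      moreover from this have "x \<in> U" using D0[of x] a by force
      ultimately show ?thesis using Df[of x] a by simp
    qed
    moreover have "g x = 1" if "x \<in> U" "infdist x (frontier U) \<ge> e" for x
      using g1[of x] that Df[of x] a by simp
    ultimately show "\<forall>x. 0 \<le> g x \<and> g x \<le> 1 \<and> norm (grad g x) \<le> \<theta> / e \<and>
      (grad g x \<noteq> 0 \<longrightarrow> x \<in> U \<and> infdist x (frontier U) < e) \<and>
      (x \<in> U \<and> e \<le> infdist x (frontier U) \<longrightarrow> g x = 1)" by simp
  qed
qed

section \<open>Rules for vector integrals\<close>

lemma vector_integral_eq_vint:
  assumes "\<Omega> \<in> sets borel" "vector_measure_on \<Omega> F"
  shows "vector_integral \<Omega> F U G = vint \<Omega> F (\<lambda>x. indicator U x *\<^sub>R G x)"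
  unfolding vector_integral_def vint_def
  by (intro sum.cong refl)
     (simp add: signed_integral_eq_sint[OF assms(1) vector_measure_on_inner[OF assms(2)], where U=U])

lemma vector_integral_space:
  "vector_integral \<Omega> F \<Omega> G = vint \<Omega> F G"
  by (simp add: vector_integral_def vint_def)

lemma vint_add:
  fixes G H :: "'a::topological_space \<Rightarrow> 'b::euclidean_space"
  assumes "\<Omega> \<in> sets borel" "vector_measure_on \<Omega> F" "bounded_borel G" "bounded_borel H"
  shows "vint \<Omega> F (\<lambda>x. G x + H x) = vint \<Omega> F G + vint \<Omega> F H"
  unfolding vint_def using assms
  by (simp add: inner_add_left sint_add vector_measure_on_inner bounded_borel_inner sum.distrib)

lemma vint_scaleR:
  assumes "\<Omega> \<in> sets borel" "vector_measure_on \<Omega> F"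
  shows "vint \<Omega> F (\<lambda>x. c *\<^sub>R G x) = c * vint \<Omega> F G"
  unfolding vint_def using assms
  by (simp add: sint_cmult vector_measure_on_inner sum_distrib_left)

lemma vint_diff:
  fixes G H :: "'a::topological_space \<Rightarrow> 'b::euclidean_space"
  assumes "\<Omega> \<in> sets borel" "vector_measure_on \<Omega> F" "bounded_borel G" "bounded_borel H"
  shows "vint \<Omega> F (\<lambda>x. G x - H x) = vint \<Omega> F G - vint \<Omega> F H"
  unfolding vint_def using assms
  by (simp add: inner_diff_left sint_diff vector_measure_on_inner bounded_borel_inner sum_subtractf)

lemma vint_cong:
  assumes "\<Omega> \<in> sets borel" "vector_measure_on \<Omega> F" "\<And>x. x \<in> \<Omega> \<Longrightarrow> G x = H x"
  shows "vint \<Omega> F G = vint \<Omega> F H"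
  unfolding vint_def using assms
  by (intro sum.cong refl sint_cong) (auto intro: vector_measure_on_inner)

lemma vint_tendsto:
  fixes G :: "'a::topological_space \<Rightarrow> 'b::euclidean_space"
  assumes \<Omega>: "\<Omega> \<in> sets borel" and F: "vector_measure_on \<Omega> F"
    and "\<And>i. bounded_borel (g i)" "bounded_borel G"
    "\<And>i x. x \<in> \<Omega> \<Longrightarrow> norm (g i x) \<le> C" "\<And>x. x \<in> \<Omega> \<Longrightarrow> (\<lambda>i. g i x) \<longlonglongrightarrow> G x"
  shows "(\<lambda>i. vint \<Omega> F (g i)) \<longlonglongrightarrow> vint \<Omega> F G"
  unfolding vint_def
proof (rule tendsto_sum)
  fix b :: 'b assume b: "b \<in> Basis"
  show "(\<lambda>i. sint \<Omega> (\<lambda>A. F A \<bullet> b) (\<lambda>x. g i x \<bullet> b)) \<longlonglongrightarrow> sint \<Omega> (\<lambda>A. F A \<bullet> b) (\<lambda>x. G x \<bullet> b)"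
  proof (rule sint_tendsto[OF \<Omega> vector_measure_on_inner[OF F], where C=C])
    show "\<bar>g i x \<bullet> b\<bar> \<le> C" if "x \<in> \<Omega>" for i x
      using assms(5)[OF that, of i] Basis_le_norm[OF b, of "g i x"] by linarith
  qed (use assms in \<open>auto intro!: bounded_borel_inner tendsto_inner\<close>)
qed

lemma open_indicator_approx:
  fixes W :: "'a::euclidean_space set"
  assumes W: "open W"
  obtains f :: "nat \<Rightarrow> 'a \<Rightarrow> real" where "\<And>j. f j \<in> test_functions 0 W"
    "\<And>j x. 0 \<le> f j x" "\<And>j x. f j x \<le> 1" "\<And>x. (\<lambda>j. f j x) \<longlonglongrightarrow> indicator W x"
proof -
  define A where "A j = W \<inter> ball 0 (real j)" for j :: nat
  define D where "D j x = infdist x (- A j)" for j and x :: 'a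
  \<comment> \<open>Subtracting 1 before clamping confines the support to points at distance at
    least \<open>1/j\<close> from the complement of the bounded set \<open>A j\<close>, so it is
    compact inside \<open>W\<close>.\<close>
  define f where "f j x = min 1 (max 0 (real j * D j x - 1))" for j x
  have A: "open (A j)" "bounded (A j)" "- A j \<noteq> {}" "closed (- A j)" for j
  proof -
    show o: "open (A j)" using W by (auto simp: A_def)
    show b: "bounded (A j)" by (auto simp: A_def intro: bounded_Int)
    have "A j \<noteq> UNIV" using b not_bounded_UNIV by auto
    then show "- A j \<noteq> {}" by auto
    show "closed (- A j)" using o by (simp add: closed_Compl)
  qed
  have D0: "D j x = 0" if "x \<notin> A j" for j x using that by (simp add: D_def)
  have Dc: "continuous_on S (D j)" for S j unfolding D_def by (intro continuous_intros)
  show ?thesis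
  proof (rule that[of f])
    fix j
    have cl: "closure {x. f j x \<noteq> 0} \<subseteq> {x. real j * D j x \<ge> 1}"
      by (rule closure_minimal) (auto simp: f_def intro!: closed_Collect_le continuous_intros Dc)
    have sub: "{x. real j * D j x \<ge> 1} \<subseteq> A j"
    proof
      fix x assume "x \<in> {x. real j * D j x \<ge> 1}"
      then have "D j x \<noteq> 0" by auto
      then show "x \<in> A j" using D0 by blast
    qed
    have "compact (closure {x. f j x \<noteq> 0})"
      unfolding compact_closure using A(2)[of j] cl sub closure_subset
      by (meson bounded_subset subset_trans)
    then show "f j \<in> test_functions 0 W"
      using cl sub by (auto simp: test_functions_def f_def[abs_def] A_def intro!: continuous_intros Dc)
    show "0 \<le> f j x" "f j x \<le> 1" for x by (auto simp: f_def)
  next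
    fix x
    show "(\<lambda>j. f j x) \<longlonglongrightarrow> indicator W x"
    proof (cases "x \<in> W")
      case False
      then have "f j x = 0" for j using D0[of x j] by (simp add: f_def A_def)
      then show ?thesis using False by simp
    next
      case True
      obtain N :: nat where N: "norm x < real N" using reals_Archimedean2 by blast
      have "x \<in> A N" using True N by (simp add: A_def)
      then have c: "D N x > 0"
        using in_closed_iff_infdist_zero[OF A(4,3), of x N] infdist_nonneg[of x "- A N"]
        by (auto simp: D_def less_le)
      obtain M :: nat where M: "2 / D N x < real M" using reals_Archimedean2 by blast
      have "f j x = 1" if j: "j \<ge> max N M" for j
      proof -
        have "A N \<subseteq> A j" using j by (auto simp: A_def)
        then have "D N x \<le> D j x" unfolding D_def by (intro infdist_mono) (use A(3) in auto)
        moreover have "2 \<le> real M * D N x" using M c by (simp add: field_simps)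
        moreover have "real M * D N x \<le> real j * D j x"
          by (rule mult_mono) (use j c calculation in auto)
        ultimately show ?thesis by (simp add: f_def)
      qed
      then have "\<forall>\<^sub>F j in sequentially. f j x = 1" by (auto simp: eventually_sequentially intro!: exI[of _ "max N M"])
      then show ?thesis using True by (simp add: tendsto_eventually)
    qed
  qed
qed

section \<open>Measures determined by smooth test functions; uniqueness of divergence and
  trace\<close>

text \<open>Indicators of open sets are bounded pointwise limits of continuous test functions, and
  those are uniform limits of smooth ones. Both limits pass through the integral, and open sets
  determine the measure.\<close>

lemma signed_measure_zero_of_smooth:
  fixes s :: "'a::euclidean_space set \<Rightarrow> real"
  assumes \<Omega>: "open \<Omega>" and s: "signed_measure_on \<Omega> s" and A: "open A" "A \<subseteq> \<Omega>"
    and zero: "\<And>\<phi>. \<phi> \<in> smooth_test_functions A \<Longrightarrow> sint \<Omega> s \<phi> = 0"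
    and S: "S \<in> sets borel" "S \<subseteq> A"
  shows "s S = 0"
proof (rule vector_measure_on_eq_zero[OF s A _ S])
  have \<Omega>b: "\<Omega> \<in> sets borel" using \<Omega> by simp
  fix W assume W: "open W" "W \<subseteq> A"
  obtain K where K: "K \<ge> 0"
    "\<And>f C. bounded_borel f \<Longrightarrow> (\<And>x. x \<in> \<Omega> \<Longrightarrow> \<bar>f x\<bar> \<le> C) \<Longrightarrow> \<bar>sint \<Omega> s f\<bar> \<le> K * C"
    using sint_bounded[OF \<Omega>b s] by metis
  obtain f :: "nat \<Rightarrow> 'a \<Rightarrow> real" where f: "\<And>j. f j \<in> test_functions 0 W"
    "\<And>j x. 0 \<le> f j x" "\<And>j x. f j x \<le> 1" "\<And>x. (\<lambda>j. f j x) \<longlonglongrightarrow> indicator W x"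
    using open_indicator_approx[OF W(1)] by metis
  have "sint \<Omega> s (f j) = 0" for j
  proof (rule ccontr)
    assume ne: "sint \<Omega> s (f j) \<noteq> 0"
    \<comment> \<open>With this choice the nonzero integral equals \<open>(K + 1) * (2 * e)\<close>
      in absolute value, which exceeds the approximation error \<open>K * e\<close>.\<close>
    define e where "e = \<bar>sint \<Omega> s (f j)\<bar> / (K + 1) / 2"
    have e: "e > 0" using ne K(1) by (simp add: e_def)
    have fj: "f j \<in> test_functions 0 A" using f(1) W(2) test_functions_mono by blast
    obtain g where g: "g \<in> smooth_test_functions A" "\<And>x. \<bar>g x - f j x\<bar> \<le> e"
      using smooth_approx[OF A(1) fj e] by metis
    have gb: "bounded_borel g" "bounded_borel (f j)"
      using test_function_bounded_borel[OF smooth_test_functions_subset[OF g(1), of 0]]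
        test_function_bounded_borel[OF fj] by auto
    have "\<bar>sint \<Omega> s (\<lambda>x. g x - f j x)\<bar> \<le> K * e"
      by (rule K(2)) (use gb g in \<open>auto intro: bounded_borel_diff\<close>)
    then have "\<bar>sint \<Omega> s (f j)\<bar> \<le> K * e"
      using sint_diff[OF \<Omega>b s gb] zero[OF g(1)] by simp
    also have "\<dots> < (K + 1) * (2 * e)" using e K(1) by (intro mult_strict_mono) auto
    also have "\<dots> = \<bar>sint \<Omega> s (f j)\<bar>" using K(1) by (simp add: e_def field_simps)
    finally show False by simp
  qed
  moreover have "(\<lambda>j. sint \<Omega> s (f j)) \<longlonglongrightarrow> sint \<Omega> s (indicator W)"
    by (rule sint_tendsto[OF \<Omega>b s, where C=1])
       (use f W in \<open>auto intro: test_function_bounded_borel\<close>)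
  ultimately have "sint \<Omega> s (indicator W) = 0" by (simp add: LIMSEQ_const_iff)
  moreover have "W \<inter> \<Omega> = W" using W A by auto
  ultimately show "s W = 0" using sint_indicator[OF \<Omega>b s, of W] W by simp
qed

lemma signed_measure_eq_of_smooth:
  fixes s t :: "'a::euclidean_space set \<Rightarrow> real"
  assumes \<Omega>: "open \<Omega>" and s: "signed_measure_on \<Omega> s" and t: "signed_measure_on \<Omega> t"
    and A: "open A" "A \<subseteq> \<Omega>"
    and eq: "\<And>\<phi>. \<phi> \<in> smooth_test_functions A \<Longrightarrow> sint \<Omega> s \<phi> = sint \<Omega> t \<phi>"
    and S: "S \<in> sets borel" "S \<subseteq> A"
  shows "s S = t S"
proof -
  have "s S - t S = 0"
  proof (rule signed_measure_zero_of_smooth[OF \<Omega> vector_measure_on_diff[OF s t] A _ S])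
    fix \<phi> assume \<phi>: "\<phi> \<in> smooth_test_functions A"
    have "bounded_borel \<phi>"
      by (rule test_function_bounded_borel[OF smooth_test_functions_subset[OF \<phi>, of 0]])
    then show "sint \<Omega> (\<lambda>A. s A - t A) \<phi> = 0"
      using sint_diff_measure[OF _ s t, of \<phi>] \<Omega> eq[OF \<phi>] by simp
  qed
  then show ?thesis by simp
qed

text \<open>Makes the definite description in \<open>divergence\<close> meaningful. Equality of set
  functions uses the convention that they vanish off the Borel sets.\<close>

lemma is_divergence_unique:
  fixes F :: "'a::euclidean_space set \<Rightarrow> 'a"
  assumes \<Omega>: "open \<Omega>" and s: "is_divergence \<Omega> F s" and t: "is_divergence \<Omega> F t"
  shows "s = t"
proof
  fix S
  have st: "signed_measure_on \<Omega> s" "signed_measure_on \<Omega> t" using s t by (auto simp: is_divergence_def)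
  show "s S = t S"
  proof (cases "S \<in> borel_on \<Omega>")
    case True
    show ?thesis
      by (rule signed_measure_eq_of_smooth[OF \<Omega> st \<Omega>])
         (use True s t in \<open>auto simp: borel_on_iff is_divergence_def\<close>)
  next
    case False
    then show ?thesis using st by (simp add: vector_measure_on_outside)
  qed
qed

lemma divergence_eq:
  fixes F :: "'a::euclidean_space set \<Rightarrow> 'a"
  assumes "open \<Omega>" "is_divergence \<Omega> F s"
  shows "divergence \<Omega> F = s"
  unfolding divergence_def using assms is_divergence_unique by (intro the_equality) auto

lemma DM_extD:
  fixes F :: "'a::euclidean_space set \<Rightarrow> 'a"
  assumes "open \<Omega>" "F \<in> DM_ext \<Omega>"
  shows "vector_measure_on \<Omega> F" "is_divergence \<Omega> F (divergence \<Omega> F)"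
    "signed_measure_on \<Omega> (divergence \<Omega> F)"
  using assms divergence_eq[OF assms(1)] by (auto simp: DM_ext_def is_divergence_def)

text \<open>A once differentiable test function times a smooth cutoff is only once differentiable,
  so the defining identity is extended from smooth functions by approximation together with the
  gradient.\<close>

lemma divergence_C1:
  fixes F :: "'a::euclidean_space set \<Rightarrow> 'a"
  assumes \<Omega>: "open \<Omega>" and F: "vector_measure_on \<Omega> F" and s: "is_divergence \<Omega> F s"
    and \<phi>: "\<phi> \<in> test_functions 1 \<Omega>"
  shows "sint \<Omega> s \<phi> = - vint \<Omega> F (grad \<phi>)"
proof -
  have \<Omega>b: "\<Omega> \<in> sets borel" using \<Omega> by simp
  have s': "signed_measure_on \<Omega> s" using s by (simp add: is_divergence_def)
  have \<phi>0: "\<phi> \<in> test_functions 0 \<Omega>" using test_functions_Suc[of \<phi> 0] \<phi> by simp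
  have "\<exists>g \<in> smooth_test_functions \<Omega>. \<forall>x. \<bar>g x - \<phi> x\<bar> \<le> inverse (Suc n)
      \<and> norm (grad g x - grad \<phi> x) \<le> inverse (Suc n)" for n
    using smooth_approx[OF \<Omega> \<phi>0, of "inverse (Suc n)"] \<phi>
    by (metis inverse_positive_iff_positive of_nat_0_less_iff zero_less_Suc)
  then obtain g where g: "\<And>n. g n \<in> smooth_test_functions \<Omega>"
    "\<And>n x. \<bar>g n x - \<phi> x\<bar> \<le> inverse (Suc n)" "\<And>n x. norm (grad (g n) x - grad \<phi> x) \<le> inverse (Suc n)"
    by metis
  have b: "bounded_borel \<phi>" "bounded_borel (grad \<phi>)" "bounded_borel (g n)" "bounded_borel (grad (g n))" for n
    using test_function_bounded_borel[OF \<phi>] grad_bounded_borel[of \<phi> 0] \<phi>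
      test_function_bounded_borel[OF smooth_test_functions_subset[OF g(1)[of n], of 0]]
      grad_bounded_borel[OF smooth_test_functions_subset[OF g(1)[of n], of "Suc 0"]] by auto
  obtain C D where C: "\<And>x. norm (\<phi> x) \<le> C" and D: "\<And>x. norm (grad \<phi> x) \<le> D"
    using b(1,2) by (metis bounded_borel_bound)
  have inv1: "inverse (real (Suc n)) \<le> 1" for n by (simp add: inverse_le_1_iff)
  have "(\<lambda>n. sint \<Omega> s (g n)) \<longlonglongrightarrow> sint \<Omega> s \<phi>"
  proof (rule sint_tendsto[OF \<Omega>b s', where C="C + 1"])
    fix x
    show "\<bar>g n x\<bar> \<le> C + 1" for n using g(2)[of n x] C[of x] inv1[of n] by simp
    show "(\<lambda>n. g n x) \<longlonglongrightarrow> \<phi> x"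
      by (rule LIM_zero_cancel, rule Lim_null_comparison[OF always_eventually LIMSEQ_inverse_real_of_nat])
         (use g(2) in simp)
  qed (use b in auto)
  moreover have "(\<lambda>n. - vint \<Omega> F (grad (g n))) \<longlonglongrightarrow> - vint \<Omega> F (grad \<phi>)"
  proof (rule tendsto_minus, rule vint_tendsto[OF \<Omega>b F, where C="D + 1"])
    fix x
    show "norm (grad (g n) x) \<le> D + 1" for n
      using norm_triangle_sub[of "grad (g n) x" "grad \<phi> x"] g(3)[of n x] D[of x] inv1[of n] by linarith
    show "(\<lambda>n. grad (g n) x) \<longlonglongrightarrow> grad \<phi> x"
      by (rule LIM_zero_cancel, rule Lim_null_comparison[OF always_eventually LIMSEQ_inverse_real_of_nat])
         (use g(3) in simp)
  qed (use b in auto)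
  moreover have "sint \<Omega> s (g n) = - vint \<Omega> F (grad (g n))" for n
    using s g(1) by (simp add: is_divergence_def vector_integral_space)
  ultimately show ?thesis by (simp add: LIMSEQ_unique)
qed

lemma represents_normal_trace_unique:
  fixes F :: "'a::euclidean_space set \<Rightarrow> 'a"
  assumes \<Omega>: "open \<Omega>" and s: "represents_normal_trace \<Omega> F U s" and t: "represents_normal_trace \<Omega> F U t"
  shows "s = t"
proof
  fix S
  have st: "signed_measure_on \<Omega> s" "signed_measure_on \<Omega> t"
    using s t by (auto simp: represents_normal_trace_def)
  show "s S = t S"
  proof (cases "S \<in> borel_on \<Omega>")
    case True
    have eq: "sint \<Omega> s \<phi> = sint \<Omega> t \<phi>" if "\<phi> \<in> smooth_test_functions \<Omega>" for \<phi>
      using s t smooth_test_functions_subset[OF that, of 1] by (simp add: represents_normal_trace_def)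
    show ?thesis
      by (rule signed_measure_eq_of_smooth[OF \<Omega> st \<Omega> _ eq]) (use True in \<open>auto simp: borel_on_iff\<close>)
  next
    case False
    then show ?thesis using st by (simp add: vector_measure_on_outside)
  qed
qed

lemma normal_trace_eq:
  fixes F :: "'a::euclidean_space set \<Rightarrow> 'a"
  assumes "open \<Omega>" "represents_normal_trace \<Omega> F U \<tau>"
  shows "normal_trace \<Omega> F U = \<tau>"
  unfolding normal_trace_def using assms represents_normal_trace_unique by (intro the_equality) auto

section \<open>Weak-star compactness\<close>

text \<open>
  A compact set is coded into the real line by recording membership in a countable basis of open
  sets as ternary digits. The code is merely Borel, but its inverse is uniformly continuous.
\<close>

lemma uniformly_continuous_decoding:
  fixes K :: "'a::euclidean_space set"
  assumes K: "compact K"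
  obtains h :: "'a \<Rightarrow> real" where "h \<in> borel_measurable borel" "\<And>x. 0 \<le> h x" "\<And>x. h x \<le> 1"
    "\<And>e. e > 0 \<Longrightarrow> \<exists>d>0. \<forall>x\<in>K. \<forall>y\<in>K. \<bar>h x - h y\<bar> < d \<longrightarrow> dist x y < e"
proof -
  obtain B :: "'a set set" where B: "countable B" "topological_basis B"
    using ex_countable_basis by metis
  have "B \<noteq> {}" using B(2) by (auto simp: topological_basis_def)
  define O' where "O' = from_nat_into B"
  have O'B: "range O' = B" unfolding O'_def by (rule range_from_nat_into[OF \<open>B \<noteq> {}\<close> B(1)])
  have O'open: "open (O' j)" for j using O'B B(2) topological_basis_open by blast
  \<comment> \<open>Ternary digits 0 and 2: one digit weighs twice the sum of all later ones, so the
    first differing digit decides the distance of two codes.\<close>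
  define p :: "nat \<Rightarrow> real" where "p j = 2 * (1/3) ^ Suc j" for j
  have p_sums: "(\<lambda>i. p (i + j)) sums ((1/3) ^ j)" for j
  proof -
    have "(\<lambda>i. (1/3) ^ i * (2 * (1/3) ^ Suc j)) sums (1 / (1 - 1/3) * (2 * (1/3::real) ^ Suc j))"
      by (intro sums_mult2 geometric_sums) simp
    then show ?thesis by (simp add: p_def power_add mult_ac)
  qed
  have p_pos: "p j > 0" for j by (simp add: p_def)
  have p_summable: "summable p" using p_sums[of 0] by (simp add: sums_iff)
  define h where "h x = (\<Sum>j. indicator (O' j) x * p j)" for x
  have summ: "summable (\<lambda>j. indicator (O' j) x * p j)" for x
    by (rule summable_comparison_test'[OF p_summable, of 0]) (use p_pos in \<open>auto simp: indicator_def less_imp_le\<close>)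
  have h0: "0 \<le> h x" for x
    unfolding h_def by (rule suminf_nonneg[OF summ]) (use p_pos in \<open>auto simp: indicator_def less_imp_le\<close>)
  have h1: "h x \<le> 1" for x
  proof -
    have "h x \<le> (\<Sum>j. p j)"
      unfolding h_def by (rule suminf_le[OF _ summ p_summable]) (use p_pos in \<open>auto simp: indicator_def less_imp_le\<close>)
    then show ?thesis using p_sums[of 0] by (simp add: sums_iff)
  qed
  have hm: "h \<in> borel_measurable borel"
    unfolding h_def using O'open by (intro borel_measurable_suminf borel_measurable_times borel_measurable_indicator) auto
  have sep: "\<bar>h x - h y\<bar> \<ge> (1/3) ^ Suc N"
    if ne: "\<exists>j\<le>N. (x \<in> O' j) \<noteq> (y \<in> O' j)" for x y N
  proof -
    define P where "P j \<longleftrightarrow> (x \<in> O' j) \<noteq> (y \<in> O' j)" for j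
    define j where "j = (LEAST j. P j)"
    obtain i where i: "i \<le> N" "P i" using ne unfolding P_def by blast
    have Pj: "P j" unfolding j_def by (rule LeastI[of P, OF i(2)])
    have less: "\<not> P i" if "i < j" for i using that unfolding j_def by (rule not_less_Least)
    have jN: "j \<le> N" using Least_le[of P, OF i(2)] i(1) by (simp add: j_def)
    define d where "d i = indicator (O' i) x * p i - indicator (O' i) y * p i" for i
    have d_sums: "summable d" unfolding d_def by (intro summable_diff summ)
    have "h x - h y = (\<Sum>i. d i)" unfolding h_def d_def by (rule suminf_diff[OF summ summ])
    also have "\<dots> = (\<Sum>i. d (i + Suc j)) + (\<Sum>i<Suc j. d i)"
      by (rule suminf_split_initial_segment[OF d_sums])
    also have "(\<Sum>i<Suc j. d i) = d j"
    proof -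
      have "d i = 0" if "i < j" for i using less[OF that] by (auto simp: P_def d_def indicator_def)
      then show ?thesis by simp
    qed
    finally have eq: "h x - h y = (\<Sum>i. d (i + Suc j)) + d j" .
    have dp: "\<bar>d i\<bar> \<le> p i" for i using p_pos[of i] by (auto simp: d_def indicator_def)
    have ps: "summable (\<lambda>i. p (i + Suc j))" "(\<Sum>i. p (i + Suc j)) = (1/3) ^ Suc j"
      using p_sums[of "Suc j"] by (simp_all add: sums_iff)
    have "summable (\<lambda>i. \<bar>d (i + Suc j)\<bar>)"
      by (rule summable_comparison_test'[OF ps(1), of 0]) (use dp in auto)
    then have "\<bar>\<Sum>i. d (i + Suc j)\<bar> \<le> (\<Sum>i. \<bar>d (i + Suc j)\<bar>)" by (rule summable_rabs)
    also have "\<dots> \<le> (\<Sum>i. p (i + Suc j))"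
      by (rule suminf_le) (use dp ps \<open>summable (\<lambda>i. \<bar>d (i + Suc j)\<bar>)\<close> in auto)
    finally have tail: "\<bar>\<Sum>i. d (i + Suc j)\<bar> \<le> (1/3) ^ Suc j" using ps by simp
    have "\<bar>d j\<bar> = 2 * (1/3) ^ Suc j" using Pj by (auto simp: P_def d_def indicator_def p_def)
    then have "\<bar>h x - h y\<bar> \<ge> (1/3) ^ Suc j" using tail eq by linarith
    moreover have "(1/3::real) ^ Suc N \<le> (1/3) ^ Suc j" using jN by (intro power_decreasing) auto
    ultimately show ?thesis by linarith
  qed
  show ?thesis
  proof (rule that[of h])
    fix e :: real assume e: "e > 0"
    \<comment> \<open>Finitely many basic sets of radius \<open>e/2\<close> cover \<open>K\<close>,
      with indices at most \<open>N\<close>. Codes closer than \<open>(1/3) ^ Suc N\<close> agree in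
      all digits up to \<open>N\<close>, so the two points share a covering set.\<close>
    have "\<exists>j. x \<in> O' j \<and> O' j \<subseteq> ball x (e/2)" for x
    proof -
      obtain U where "U \<in> B" "x \<in> U" "U \<subseteq> ball x (e/2)"
        using topological_basisE[OF B(2), of "ball x (e/2)" x] e by auto
      then show ?thesis using O'B by blast
    qed
    then obtain J where J: "\<And>x. x \<in> O' (J x)" "\<And>x. O' (J x) \<subseteq> ball x (e/2)" by metis
    obtain X where X: "X \<subseteq> K" "finite X" "K \<subseteq> (\<Union>x\<in>X. O' (J x))"
    proof -
      have cover: "K \<subseteq> (\<Union>x\<in>K. O' (J x))" using J(1) by blast
      show ?thesis using compactE_image[OF K O'open cover] that by metis
    qed
    define N where "N = Max (insert 0 (J ` X))"
    have JN: "J x \<le> N" if "x \<in> X" for x unfolding N_def using X that by (intro Max_ge) auto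
    show "\<exists>d>0. \<forall>x\<in>K. \<forall>y\<in>K. \<bar>h x - h y\<bar> < d \<longrightarrow> dist x y < e"
    proof (intro exI[of _ "(1/3) ^ Suc N"] conjI ballI impI)
      fix x y assume xy: "x \<in> K" "y \<in> K" "\<bar>h x - h y\<bar> < (1/3) ^ Suc N"
      obtain z where z: "z \<in> X" "x \<in> O' (J z)" using X xy by auto
      have "y \<in> O' (J z)" using sep[of N x y] xy(3) JN[OF z(1)] z(2) by (meson not_le)
      then have "x \<in> ball z (e/2)" "y \<in> ball z (e/2)" using z J(2) by blast+
      then show "dist x y < e" using dist_triangle_half_r[of z x e y] by simp
    qed simp
  qed (use hm h0 h1 in auto)
qed

text \<open>After normalization the code \<open>h\<close> transports the measures to a bounded
  interval, where they are tight and a weakly convergent subsequence exists. The decoding extends to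
  a continuous function on the line, so continuous functions of the original variable become
  continuous functions of the code, and the limit is transported back.\<close>

lemma weak_star_compact_borel:
  fixes M :: "nat \<Rightarrow> 'a::euclidean_space measure"
  assumes fin: "\<And>k. finite_measure (M k)" and setsM: "\<And>k. sets (M k) = sets borel"
    and K: "compact K" and AEK: "\<And>k. AE x in M k. x \<in> K" and C: "\<And>k. measure (M k) UNIV \<le> C"
  obtains r \<nu> where "strict_mono (r :: nat \<Rightarrow> nat)" "finite_measure \<nu>" "sets \<nu> = sets borel"
    "\<forall>f :: 'a \<Rightarrow> real. continuous_on UNIV f \<and> bounded (range f) \<longrightarrow>
       (\<lambda>k. integral\<^sup>L (M (r k)) f) \<longlonglongrightarrow> integral\<^sup>L \<nu> f"
proof -
  define c where "c k = measure (M k) UNIV" for k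
  have meas: "f \<in> borel_measurable (M k)" if "f \<in> borel_measurable borel" for f :: "'a \<Rightarrow> real" and k
    using that measurable_cong_sets[OF setsM refl] by blast
  have spaceM: "space (M k) = UNIV" for k using sets_eq_imp_space_eq[OF setsM] by simp
  have "seq_compact {0..C}" by (intro compact_imp_seq_compact) simp
  moreover have "\<forall>k. c k \<in> {0..C}" using C by (simp add: c_def)
  ultimately obtain c0 r1 where c0: "c0 \<in> {0..C}" and r1: "strict_mono (r1 :: nat \<Rightarrow> nat)"
    and lim: "(c \<circ> r1) \<longlonglongrightarrow> c0" by (rule seq_compactE)
  show ?thesis
  \<comment> \<open>If the masses tend to 0, the limit is the null measure. Otherwise they are
    eventually positive and can be normalized.\<close>
  proof (cases "c0 = 0")
    case True
    show ?thesis
    proof (rule that[of r1 "null_measure borel"])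
      show "finite_measure (null_measure borel :: 'a measure)" by (intro finite_measureI) simp
      have "(\<lambda>k. integral\<^sup>L (M (r1 k)) f) \<longlonglongrightarrow> integral\<^sup>L (null_measure borel) f"
        if f: "continuous_on UNIV f" "bounded (range f)" for f :: "'a \<Rightarrow> real"
      proof -
      obtain D where D: "\<And>x. \<bar>f x\<bar> \<le> D" using f(2) by (auto simp: bounded_iff)
      have "0 \<le> D" using order_trans[OF abs_ge_zero D] by simp
      have "\<bar>integral\<^sup>L (M (r1 k)) f\<bar> \<le> D * (c \<circ> r1) k" for k
      proof -
        interpret finite_measure "M (r1 k)" by (rule fin)
        have "\<bar>integral\<^sup>L (M (r1 k)) f\<bar> \<le> integral\<^sup>L (M (r1 k)) (\<lambda>x. \<bar>f x\<bar>)" by (rule integral_abs_bound)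
        also have "\<dots> \<le> integral\<^sup>L (M (r1 k)) (\<lambda>x. D)"
          using D f \<open>0 \<le> D\<close> by (intro integral_mono integrable_const_bound[where B=D] meas borel_measurable_abs borel_measurable_continuous_onI) auto
        finally show ?thesis by (simp add: c_def spaceM mult.commute)
      qed
      moreover have "(\<lambda>k. D * (c \<circ> r1) k) \<longlonglongrightarrow> 0" using tendsto_mult_left[OF lim, of D] True by simp
      ultimately have "(\<lambda>k. integral\<^sup>L (M (r1 k)) f) \<longlonglongrightarrow> 0"
        by (intro Lim_null_comparison[OF always_eventually[OF allI], where f="\<lambda>k. integral\<^sup>L (M (r1 k)) f"])
          (simp_all only: real_norm_def)
        then show ?thesis by (simp only: integral_null_measure)
      qed
      then show "\<forall>f :: 'a \<Rightarrow> real. continuous_on UNIV f \<and> bounded (range f) \<longrightarrow>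
        (\<lambda>k. integral\<^sup>L (M (r1 k)) f) \<longlonglongrightarrow> integral\<^sup>L (null_measure borel) f" by blast
    qed (use r1 in auto)
  next
    case False
    then have "c0 > 0" using c0 by simp
    then have "\<forall>\<^sub>F k in sequentially. (c \<circ> r1) k > 0" using order_tendstoD(1)[OF lim] by blast
    then obtain k0 where k0: "\<And>k. k \<ge> k0 \<Longrightarrow> c (r1 k) > 0" by (auto simp: eventually_sequentially)
    define r2 where "r2 k = r1 (k + k0)" for k
    have r2: "strict_mono r2" using r1 by (auto simp: r2_def strict_mono_def)
    have c2: "c (r2 k) > 0" for k using k0 by (simp add: r2_def)
    have lim2: "(\<lambda>k. c (r2 k)) \<longlonglongrightarrow> c0" using LIMSEQ_ignore_initial_segment[OF lim, of k0] by (simp add: r2_def)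
    obtain h :: "'a \<Rightarrow> real" where h: "h \<in> borel_measurable borel" "\<And>x. 0 \<le> h x" "\<And>x. h x \<le> 1"
      and dec: "\<And>e. e > 0 \<Longrightarrow> \<exists>d>0. \<forall>x\<in>K. \<forall>y\<in>K. \<bar>h x - h y\<bar> < d \<longrightarrow> dist x y < e"
      using uniformly_continuous_decoding[OF K] by blast
    have inj: "inj_on h K"
    proof (rule inj_onI, rule ccontr)
      fix x y assume xy: "x \<in> K" "y \<in> K" "h x = h y" "x \<noteq> y"
      then show False using dec[of "dist x y"] by force
    qed
    define p where "p = inv_into K h"
    have ph: "p (h x) = x" if "x \<in> K" for x unfolding p_def by (rule inv_into_f_f[OF inj that])
    \<comment> \<open>As \<open>h\<close> is not continuous, its image of \<open>K\<close> need not
      be closed. Uniform continuity extends the decoding to the closure, and Tietze's theorem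
      extends it from there to the line.\<close>
    have "uniformly_continuous_on (h ` K) p"
      unfolding uniformly_continuous_on_def using dec ph by (fastforce simp: dist_real_def)
    then obtain q where q: "uniformly_continuous_on (closure (h ` K)) q" "\<And>x. x \<in> h ` K \<Longrightarrow> p x = q x"
      by (rule uniformly_continuous_on_extension_on_closure) blast
    have qc: "continuous_on (closure (h ` K)) q" by (rule uniformly_continuous_imp_continuous[OF q(1)])
    have "bounded (h ` K)" using h by (auto simp: bounded_iff intro!: exI[of _ 1])
    then have "bounded (q ` closure (h ` K))"
      by (intro compact_imp_bounded compact_continuous_image qc) (simp add: compact_closure)
    then obtain Q where Q: "Q > 0" "\<And>t. t \<in> closure (h ` K) \<Longrightarrow> norm (q t) \<le> Q"
      by (auto simp: bounded_pos)
    have clin: "closedin (top_of_set UNIV) (closure (h ` K))" by simp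
    obtain g where gc: "continuous_on UNIV g" and gq: "\<And>t. t \<in> closure (h ` K) \<Longrightarrow> g t = q t"
      by (rule Tietze[OF qc clin less_imp_le[OF Q(1)] Q(2)]) auto
    have gh: "g (h x) = x" if "x \<in> K" for x
      using gq[of "h x"] q(2)[of "h x"] ph[OF that] that closure_subset[of "h ` K"] by auto
    have gm: "g \<in> borel_measurable borel" by (rule borel_measurable_continuous_onI[OF gc])
    define N where "N k = distr (density (M (r2 k)) (\<lambda>x. ennreal (1 / c (r2 k)))) borel h" for k
    have hM: "h \<in> borel_measurable (density (M k) v)" for k v
      using h(1) by (simp add: measurable_def setsM spaceM)
    have rdN: "real_distribution (N k)" for k
    proof -
      interpret finite_measure "M (r2 k)" by (rule fin)
      have "emeasure (density (M (r2 k)) (\<lambda>x. ennreal (1 / c (r2 k)))) UNIV = ennreal (1 / c (r2 k)) * emeasure (M (r2 k)) UNIV"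
        by (subst emeasure_density_const) (auto simp: setsM)
      also have "\<dots> = 1"
        using c2[of k] by (simp add: emeasure_eq_measure c_def ennreal_mult[symmetric])
      finally have "prob_space (density (M (r2 k)) (\<lambda>x. ennreal (1 / c (r2 k))))"
        by (intro prob_spaceI) (simp add: spaceM)
      then have "prob_space (N k)" unfolding N_def by (rule prob_space.prob_space_distr[OF _ hM])
      then show ?thesis by (simp add: real_distribution_def real_distribution_axioms_def N_def)
    qed
    have intN: "integral\<^sup>L (M (r2 k)) f = c (r2 k) * integral\<^sup>L (N k) (\<lambda>t. f (g t))"
      if f: "continuous_on UNIV f" for f :: "'a \<Rightarrow> real" and k
    proof -
      have fm: "f \<in> borel_measurable borel" by (rule borel_measurable_continuous_onI[OF f])
      have fgm: "(\<lambda>t. f (g t)) \<in> borel_measurable borel" using fm gm by simp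
      have fghm: "(\<lambda>x. f (g (h x))) \<in> borel_measurable borel" using fm gm h(1) by simp
      have "integral\<^sup>L (N k) (\<lambda>t. f (g t)) = integral\<^sup>L (density (M (r2 k)) (\<lambda>x. ennreal (1 / c (r2 k)))) (\<lambda>x. f (g (h x)))"
        unfolding N_def by (rule integral_distr[OF hM fgm])
      also have "\<dots> = integral\<^sup>L (M (r2 k)) (\<lambda>x. (1 / c (r2 k)) *\<^sub>R f (g (h x)))"
        by (rule integral_density) (use c2[of k] meas[OF fghm] in auto)
      also have "\<dots> = (1 / c (r2 k)) * integral\<^sup>L (M (r2 k)) (\<lambda>x. f (g (h x)))" by simp
      also have "integral\<^sup>L (M (r2 k)) (\<lambda>x. f (g (h x))) = integral\<^sup>L (M (r2 k)) f"
        by (rule integral_cong_AE[OF meas[OF fghm] meas[OF fm]]) (use AEK[of "r2 k"] gh in auto)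
      finally show ?thesis using c2[of k] by simp
    qed
    have "tight N"
      unfolding tight_def
    proof (intro conjI allI impI rdN)
      fix e :: real assume "e > 0"
      have "measure (N k) {-1<..1} = 1" for k
      proof -
        interpret real_distribution "N k" by (rule rdN)
        have "h -` {-1<..1} = UNIV" using h(2,3) by (force intro: less_le_trans[of "-1" 0])
        then have "measure (N k) {-1<..1} = measure (N k) UNIV"
          unfolding N_def using hM[of "r2 k"] by (simp add: measure_distr spaceM)
        then show ?thesis using prob_space by (simp add: N_def)
      qed
      then show "\<exists>a b. a < b \<and> (\<forall>n. 1 - e < measure (N n) {a<..b})"
        using \<open>e > 0\<close> by (intro exI[of _ "-1"] exI[of _ 1]) auto
    qed
    then obtain r3 P where r3: "strict_mono (r3 :: nat \<Rightarrow> nat)" and P: "real_distribution P"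
      and wc: "weak_conv_m (N \<circ> id \<circ> r3) P"
      using tight_imp_convergent_subsubsequence[of N id] by (auto simp: strict_mono_def)
    interpret P: real_distribution P by (rule P)
    define \<nu> where "\<nu> = density (distr P borel g) (\<lambda>x. ennreal c0)"
    have gP: "g \<in> borel_measurable P" using gm by (simp add: measurable_def P.events_eq_borel P.space_eq_univ)
    show ?thesis
    proof (rule that[of "r2 \<circ> r3" \<nu>])
      show "strict_mono (r2 \<circ> r3)" using r2 r3 by (simp add: strict_mono_o)
      show "sets \<nu> = sets borel" by (simp add: \<nu>_def)
      interpret D: prob_space "distr P borel g" by (rule P.prob_space_distr[OF gP])
      show "finite_measure \<nu>"
        by (intro finite_measureI) (simp add: \<nu>_def emeasure_density_const D.emeasure_eq_measure ennreal_mult_eq_top_iff)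
      have "(\<lambda>k. integral\<^sup>L (M ((r2 \<circ> r3) k)) f) \<longlonglongrightarrow> integral\<^sup>L \<nu> f"
        if f: "continuous_on UNIV f" "bounded (range f)" for f :: "'a \<Rightarrow> real"
      proof -
      have fm: "f \<in> borel_measurable borel" by (rule borel_measurable_continuous_onI[OF f(1)])
      obtain D where D: "\<And>x. \<bar>f x\<bar> \<le> D" using f(2) by (auto simp: bounded_iff)
      have rdN': "real_distribution ((N \<circ> id \<circ> r3) k)" for k using rdN by simp
      have "(\<lambda>k. integral\<^sup>L ((N \<circ> id \<circ> r3) k) (\<lambda>t. f (g t))) \<longlonglongrightarrow> integral\<^sup>L P (\<lambda>t. f (g t))"
      proof (rule weak_conv_imp_integral_bdd_continuous_conv[OF rdN' P wc, where B=D])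
        have "continuous_on UNIV (\<lambda>t. f (g t))" by (rule continuous_on_compose2[OF f(1) gc]) simp
        then show "isCont (\<lambda>t. f (g t)) t" for t by (simp add: continuous_on_eq_continuous_at)
      qed (use D in auto)
      then have "(\<lambda>k. c (r2 (r3 k)) * integral\<^sup>L (N (r3 k)) (\<lambda>t. f (g t))) \<longlonglongrightarrow> c0 * integral\<^sup>L P (\<lambda>t. f (g t))"
        using LIMSEQ_subseq_LIMSEQ[OF lim2 r3] by (intro tendsto_mult) (auto simp: o_def)
      moreover have "integral\<^sup>L \<nu> f = c0 * integral\<^sup>L P (\<lambda>t. f (g t))"
        unfolding \<nu>_def using \<open>c0 > 0\<close> fm by (simp add: integral_density integral_distr[OF gP])
      ultimately show ?thesis by (simp add: intN[OF f(1)])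
      qed
      then show "\<forall>f :: 'a \<Rightarrow> real. continuous_on UNIV f \<and> bounded (range f) \<longrightarrow>
        (\<lambda>k. integral\<^sup>L (M ((r2 \<circ> r3) k)) f) \<longlonglongrightarrow> integral\<^sup>L \<nu> f" by blast
    qed
  qed
qed

text \<open>The measures are pushed forward to the whole space and the limit is restricted to
  \<Omega>. A test function vanishes off \<Omega>, so neither operation affects its
  integrals.\<close>

lemma weak_star_compact:
  fixes M :: "nat \<Rightarrow> 'a::euclidean_space measure"
  assumes \<Omega>: "\<Omega> \<in> sets borel" and M: "\<And>k. radon_measure_on \<Omega> (M k)"
    and K: "compact K" and AEK: "\<And>k. AE x in M k. x \<in> K" and C: "\<And>k. measure (M k) \<Omega> \<le> C"
  obtains r \<nu> where "strict_mono (r :: nat \<Rightarrow> nat)" "radon_measure_on \<Omega> \<nu>"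
    "\<forall>\<phi>\<in>test_functions 0 \<Omega>. (\<lambda>k. integral\<^sup>L (M (r k)) \<phi>) \<longlonglongrightarrow> integral\<^sup>L \<nu> \<phi>"
proof -
  define M' where "M' k = distr (M k) borel (\<lambda>x. x)" for k
  note D = radon_measure_onD[OF M]
  have id: "(\<lambda>x. x) \<in> measurable (M k) borel" for k by (rule radon_measurable[OF M \<Omega>]) simp
  have fin: "finite_measure (M' k)" for k unfolding M'_def by (rule finite_measure.finite_measure_distr[OF D(3) id])
  have "AE x in M' k. x \<in> K" for k
    unfolding M'_def using AEK K by (subst AE_distr_iff[OF id]) (auto intro: borel_compact)
  note AE' = this
  have C': "measure (M' k) UNIV \<le> C" for k
    using C[of k] unfolding M'_def by (subst measure_distr[OF id]) (auto simp: D)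
  have sets': "sets (M' k) = sets borel" for k by (simp add: M'_def)
  obtain r \<nu> where r: "strict_mono (r :: nat \<Rightarrow> nat)" and \<nu>: "finite_measure \<nu>" "sets \<nu> = sets borel"
    and conv: "\<forall>f :: 'a \<Rightarrow> real. continuous_on UNIV f \<and> bounded (range f) \<longrightarrow>
       (\<lambda>k. integral\<^sup>L (M' (r k)) f) \<longlonglongrightarrow> integral\<^sup>L \<nu> f"
    by (rule weak_star_compact_borel[OF fin sets' K AE' C'])
  interpret \<nu>: finite_measure \<nu> by (rule \<nu>)
  have sp\<nu>: "space \<nu> = UNIV" using sets_eq_imp_space_eq[OF \<nu>(2)] by simp
  show ?thesis
  proof (rule that[of r "restrict_space \<nu> \<Omega>"])
    have "finite_measure (restrict_space \<nu> \<Omega>)"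
      by (rule finite_measure_restrict_space[OF \<nu>(1)]) (simp add: sp\<nu> \<nu> \<Omega>)
    moreover have "sets (restrict_space \<nu> \<Omega>) = borel_on \<Omega>"
      using \<Omega> \<nu>(2) by (auto simp: sets_restrict_space borel_on_def)
    ultimately show "radon_measure_on \<Omega> (restrict_space \<nu> \<Omega>)"
      by (simp add: radon_measure_on_def space_restrict_space sp\<nu>)
    have "(\<lambda>k. integral\<^sup>L (M (r k)) \<phi>) \<longlonglongrightarrow> integral\<^sup>L (restrict_space \<nu> \<Omega>) \<phi>"
      if \<phi>: "\<phi> \<in> test_functions 0 \<Omega>" for \<phi> :: "'a \<Rightarrow> real"
    proof -
    have b: "bounded_borel \<phi>" by (rule test_function_bounded_borel[OF \<phi>])
    have "integral\<^sup>L (M' k) \<phi> = integral\<^sup>L (M k) \<phi>" for k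
      unfolding M'_def by (rule integral_distr[OF id]) (use b in \<open>simp add: bounded_borel_def\<close>)
    moreover have "integral\<^sup>L (restrict_space \<nu> \<Omega>) \<phi> = integral\<^sup>L \<nu> \<phi>"
    proof -
      have "integral\<^sup>L (restrict_space \<nu> \<Omega>) \<phi> = (\<integral>x. indicator \<Omega> x *\<^sub>R \<phi> x \<partial>\<nu>)"
        by (rule integral_restrict_space) (simp add: sp\<nu> \<nu> \<Omega>)
      also have "\<dots> = integral\<^sup>L \<nu> \<phi>"
        using test_functionsD(6)[OF \<phi>] by (intro Bochner_Integration.integral_cong) (auto simp: indicator_def)
      finally show ?thesis .
    qed
    ultimately show ?thesis
      using conv[rule_format, of \<phi>] test_functionsD(4)[OF \<phi>] b by (simp add: bounded_borel_def)
    qed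
    then show "\<forall>\<phi>\<in>test_functions 0 \<Omega>.
      (\<lambda>k. integral\<^sup>L (M (r k)) \<phi>) \<longlonglongrightarrow> integral\<^sup>L (restrict_space \<nu> \<Omega>) \<phi>" by blast
  qed (rule r)
qed

section \<open>Boundary layers\<close>

text \<open>The closure makes this set awkward; it is handled by enclosing it between the layers
  with strict and with non-strict distance inequality.\<close>

definition layer :: "'a::euclidean_space set \<Rightarrow> real \<Rightarrow> 'a set" where
  "layer U e = U - closure (inner_set U e)"

lemma layer_subset: "layer U e \<subseteq> {x \<in> U. infdist x (frontier U) \<le> e}"
  using closure_subset[of "inner_set U e"] by (force simp: layer_def inner_set_def)

lemma subset_layer: "{x \<in> U. infdist x (frontier U) < e} \<subseteq> layer U e"
proof
  fix x assume x: "x \<in> {x \<in> U. infdist x (frontier U) < e}"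
  have "open {y. infdist y (frontier U) < e}"
    by (intro open_Collect_less continuous_intros)
  moreover have "{y. infdist y (frontier U) < e} \<inter> inner_set U e = {}" by (auto simp: inner_set_def)
  ultimately have "{y. infdist y (frontier U) < e} \<inter> closure (inner_set U e) = {}"
    by (simp add: open_Int_closure_eq_empty)
  then show "x \<in> layer U e" using x by (auto simp: layer_def)
qed

lemma layer_borel: "open U \<Longrightarrow> layer U e \<in> sets borel"
  by (simp add: layer_def)

lemma open_layer: "open U \<Longrightarrow> open {x \<in> U. infdist x (frontier U) < e}"
  by (intro open_Collect_conj open_Collect_less continuous_intros) simp

lemma closed_layer_borel: "open U \<Longrightarrow> {x \<in> U. infdist x (frontier U) \<le> e} \<in> sets borel"
proof -
  assume "open U"
  moreover have "{x \<in> U. infdist x (frontier U) \<le> e} = U \<inter> {x. infdist x (frontier U) \<le> e}" by auto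
  moreover have "closed {x. infdist x (frontier U) \<le> e}"
    by (intro closed_Collect_le continuous_intros)
  ultimately show ?thesis by simp
qed

lemma scaled_layer_eq: "scaled_layer \<mu> U e = density \<mu> (\<lambda>x. ennreal (indicator (layer U e) x / e))"
  by (simp add: scaled_layer_def layer_def)

lemma integral_scaled_layer:
  fixes f :: "'a::euclidean_space \<Rightarrow> real"
  assumes \<mu>: "radon_measure_on \<Omega> \<mu>" and \<Omega>: "\<Omega> \<in> sets borel" and U: "open U" and e: "e > 0"
    and f: "bounded_borel f"
  shows "integral\<^sup>L (scaled_layer \<mu> U e) f = (\<integral>x. indicator (layer U e) x * f x \<partial>\<mu>) / e"
proof -
  have "integral\<^sup>L (scaled_layer \<mu> U e) f = (\<integral>x. (indicator (layer U e) x / e) *\<^sub>R f x \<partial>\<mu>)"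
    unfolding scaled_layer_eq
    by (rule integral_density; (intro radon_measurable[OF \<mu> \<Omega>])?)
       (use e f layer_borel[OF U, of e] in \<open>auto simp: bounded_borel_def\<close>)
  also have "\<dots> = (\<integral>x. (indicator (layer U e) x * f x) / e \<partial>\<mu>)" by simp
  finally show ?thesis by simp
qed

lemma radon_scaled_layer:
  assumes \<mu>: "radon_measure_on \<Omega> \<mu>" and \<Omega>: "\<Omega> \<in> sets borel" and U: "open U" "U \<subseteq> \<Omega>" and e: "e > 0"
  shows "radon_measure_on \<Omega> (scaled_layer \<mu> U e)"
    and "A \<in> sets borel \<Longrightarrow> A \<subseteq> \<Omega> \<Longrightarrow> measure (scaled_layer \<mu> U e) A = measure \<mu> (A \<inter> layer U e) / e"
proof -
  interpret finite_measure \<mu> using \<mu> by (rule radon_measure_onD)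
  note D = radon_measure_onD[OF \<mu>]
  have em: "emeasure (scaled_layer \<mu> U e) A = ennreal (measure \<mu> (A \<inter> layer U e) / e)"
    if A: "A \<in> sets borel" "A \<subseteq> \<Omega>" for A
  proof -
    have LO: "layer U e \<inter> A \<in> sets \<mu>" using A layer_borel[OF U(1), of e] by (auto simp: D borel_on_iff)
    have "emeasure (scaled_layer \<mu> U e) A = (\<integral>\<^sup>+x. ennreal (indicator (layer U e) x / e) * indicator A x \<partial>\<mu>)"
      unfolding scaled_layer_eq
      by (rule emeasure_density; (intro radon_measurable[OF \<mu> \<Omega>])?)
         (use A layer_borel[OF U(1), of e] in \<open>auto simp: D borel_on_iff\<close>)
    also have "\<dots> = (\<integral>\<^sup>+x. ennreal (1 / e) * indicator (layer U e \<inter> A) x \<partial>\<mu>)"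
      by (intro nn_integral_cong) (auto simp: indicator_def)
    also have "\<dots> = ennreal (1 / e) * emeasure \<mu> (layer U e \<inter> A)"
      by (rule nn_integral_cmult_indicator[OF LO])
    also have "\<dots> = ennreal (measure \<mu> (A \<inter> layer U e) / e)"
      using e by (simp add: emeasure_eq_measure ennreal_mult[symmetric] Int_commute)
    finally show ?thesis .
  qed
  have sp: "space (scaled_layer \<mu> U e) = \<Omega>" "sets (scaled_layer \<mu> U e) = borel_on \<Omega>"
    by (simp_all add: scaled_layer_def D)
  have "finite_measure (scaled_layer \<mu> U e)"
    by (rule finite_measureI) (simp add: sp em \<Omega>)
  then show "radon_measure_on \<Omega> (scaled_layer \<mu> U e)" using sp by (simp add: radon_measure_on_def)
  show "measure (scaled_layer \<mu> U e) A = measure \<mu> (A \<inter> layer U e) / e" if "A \<in> sets borel" "A \<subseteq> \<Omega>"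
    using em[OF that] e by (simp add: measure_def)
qed

lemma infdist_frontier_pos:
  fixes U :: "'a::euclidean_space set"
  assumes "open U" "bounded U" "x \<in> U"
  shows "infdist x (frontier U) > 0"
proof -
  have "U \<noteq> UNIV" using assms not_bounded_UNIV by auto
  then have "frontier U \<noteq> {}" using frontier_eq_empty[of U] assms by auto
  moreover have "x \<notin> frontier U" using assms by (simp add: frontier_def interior_open)
  ultimately show ?thesis
    using in_closed_iff_infdist_zero[OF frontier_closed, of U x] infdist_nonneg[of x "frontier U"] by auto
qed

lemma open_compactly_insideD:
  fixes U :: "'a::euclidean_space set"
  assumes "open_compactly_inside U \<Omega>"
  shows "open U" "compact (closure U)" "closure U \<subseteq> \<Omega>" "U \<subseteq> \<Omega>" "bounded U" "frontier U \<subseteq> \<Omega>"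
    "compact (frontier U)"
proof -
  show 1: "open U" "compact (closure U)" "closure U \<subseteq> \<Omega>" using assms by (auto simp: open_compactly_inside_def)
  show "U \<subseteq> \<Omega>" using 1(3) closure_subset by blast
  show 2: "bounded U" using 1(2) compact_closure by blast
  show "frontier U \<subseteq> \<Omega>" using 1(3) by (auto simp: frontier_def)
  show "compact (frontier U)" using 2 by (rule compact_frontier_bounded)
qed

text \<open>A finite liminf means that layers of mass at most \<open>C * \<epsilon>\<close> occur at
  arbitrarily small thickness; dependent choice arranges them in a decreasing sequence.\<close>

lemma O_class_sequence:
  assumes U: "U \<in> O_class \<Omega> \<mu>" and \<mu>: "radon_measure_on \<Omega> \<mu>"
  obtains e :: "nat \<Rightarrow> real" and C where "\<forall>k. e k > 0" "decseq e" "e \<longlonglongrightarrow> 0" "C \<ge> 0"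
    "\<forall>k. measure \<mu> {x \<in> U. infdist x (frontier U) \<le> e k} \<le> C * e k"
proof -
  define g where "g \<epsilon> = measure \<mu> {x \<in> U. infdist x (frontier U) < \<epsilon>}" for \<epsilon>
  interpret finite_measure \<mu> using \<mu> by (rule radon_measure_onD)
  have Ui: "open_compactly_inside U \<Omega>" and lim: "Liminf (at_right 0) (\<lambda>\<epsilon>. ereal (g \<epsilon> / \<epsilon>)) < \<infinity>"
    using U by (auto simp: O_class_def g_def)
  note UD = open_compactly_insideD[OF Ui]
  obtain C where C: "\<not> (\<forall>\<^sub>F \<epsilon> in at_right 0. C \<le> g \<epsilon> / \<epsilon>)"
  proof (rule ccontr)
    assume "\<not> thesis"
    then have "\<forall>\<^sub>F \<epsilon> in at_right 0. ereal C \<le> ereal (g \<epsilon> / \<epsilon>)" for C using that by auto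
    then have "ereal C \<le> Liminf (at_right 0) (\<lambda>\<epsilon>. ereal (g \<epsilon> / \<epsilon>))" for C by (rule Liminf_bounded)
    then show False using lim by (metis ereal_top less_irrefl)
  qed
  have freq: "\<exists>\<epsilon>>0. \<epsilon> < b \<and> g \<epsilon> < C * \<epsilon>" if "b > 0" for b
  proof (rule ccontr)
    assume neg: "\<not> ?thesis"
    have "C \<le> g \<epsilon> / \<epsilon>" if "\<epsilon> > 0" "\<epsilon> < b" for \<epsilon>
    proof -
      have "\<not> g \<epsilon> < C * \<epsilon>" using neg that by blast
      then show ?thesis using that by (simp add: pos_le_divide_eq)
    qed
    then show False using C \<open>b > 0\<close> by (auto simp: eventually_at_right_field)
  qed
  have "\<exists>e::nat \<Rightarrow> real. \<forall>k. (e k > 0 \<and> g (e k) < C * e k \<and> e k < 1 / Suc k) \<and> e (Suc k) \<le> e k"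
  proof (rule dependent_nat_choice)
    show "\<exists>e. e > 0 \<and> g e < C * e \<and> e < 1 / Suc 0" using freq[of 1] by auto
    fix x :: real and n :: nat assume x: "x > 0 \<and> g x < C * x \<and> x < 1 / Suc n"
    then show "\<exists>y. (y > 0 \<and> g y < C * y \<and> y < 1 / Suc (Suc n)) \<and> y \<le> x"
      using freq[of "min x (1 / Suc (Suc n))"] by (auto simp: less_imp_le)
  qed
  then obtain e :: "nat \<Rightarrow> real" where e: "\<And>k. e k > 0" "\<And>k. g (e k) < C * e k" "\<And>k. e k < 1 / Suc k"
    "\<And>k. e (Suc k) \<le> e k" by blast
  have C0: "C \<ge> 0"
  proof -
    have "0 \<le> g (e 0)" by (simp add: g_def)
    then have "0 < C * e 0" using e(2)[of 0] by linarith
    then show ?thesis using e(1)[of 0] by (simp add: zero_less_mult_iff)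
  qed
  show ?thesis
  \<comment> \<open>Halving the thickness passes from the strict to the non-strict layer, at the
    price of doubling the constant.\<close>
  proof (rule that[of "\<lambda>k. e k / 2" "2 * C"])
    show "decseq (\<lambda>k. e k / 2)" using e(4) by (intro decseq_SucI) simp
    have "e \<longlonglongrightarrow> 0"
      by (rule tendsto_sandwich[OF always_eventually always_eventually tendsto_const LIMSEQ_inverse_real_of_nat])
         (use e(1,3) in \<open>auto simp: less_imp_le inverse_eq_divide\<close>)
    then have "(\<lambda>k. e k / 2) \<longlonglongrightarrow> 0 / 2" by (intro tendsto_intros) auto
    then show "(\<lambda>k. e k / 2) \<longlonglongrightarrow> 0" by simp
    show "\<forall>k. measure \<mu> {x \<in> U. infdist x (frontier U) \<le> e k / 2} \<le> 2 * C * (e k / 2)"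
    proof
    fix k
    have sets: "{x \<in> U. infdist x (frontier U) < e k} \<in> sets \<mu>"
      using open_layer[OF UD(1)] UD(4) by (auto simp: radon_measure_onD(2)[OF \<mu>] borel_on_iff)
    have "measure \<mu> {x \<in> U. infdist x (frontier U) \<le> e k / 2} \<le> g (e k)"
      unfolding g_def by (rule finite_measure_mono[OF _ sets]) (use e(1)[of k] in auto)
    then show "measure \<mu> {x \<in> U. infdist x (frontier U) \<le> e k / 2} \<le> 2 * C * (e k / 2)"
      using e(2)[of k] by simp
    qed
  qed (use e C0 in auto)
qed

section \<open>The flux of a divergence-measure field\<close>

text \<open>Membership in a frontier is tested by arbitrarily small balls, which can be taken inside
  \<open>A\<close>, where \<open>U\<close> and \<open>V\<close> coincide.\<close>

lemma frontier_local:
  fixes A :: "'a::metric_space set"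
  assumes "open A" "A \<inter> U = A \<inter> V"
  shows "A \<inter> frontier U = A \<inter> frontier V"
proof -
  have *: "A \<inter> frontier U \<subseteq> frontier V" if "A \<inter> U = A \<inter> V" for U V
  proof
    fix x assume x: "x \<in> A \<inter> frontier U"
    show "x \<in> frontier V"
      unfolding frontier_straddle
    proof (intro allI impI)
      fix e :: real assume "e > 0"
      obtain r where r: "r > 0" "ball x r \<subseteq> A" using assms(1) x by (auto simp: open_contains_ball)
      have "(\<exists>y\<in>U. dist x y < min e r) \<and> (\<exists>y. y \<notin> U \<and> dist x y < min e r)"
        using x frontier_straddle[of x U] \<open>e > 0\<close> r(1) by (metis IntD2 min_less_iff_conj)
      then obtain y z where "y \<in> U" "dist x y < min e r" "z \<notin> U" "dist x z < min e r" by blast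
      moreover from this have "y \<in> A" "z \<in> A" using r by (auto simp: subset_iff)
      ultimately have "y \<in> V" "z \<notin> V" "dist x y < e" "dist x z < e" using that by auto
      then show "(\<exists>y\<in>V. dist x y < e) \<and> (\<exists>y. y \<notin> V \<and> dist x y < e)" by blast
    qed
  qed
  show ?thesis using *[OF assms(2)] *[OF assms(2)[symmetric]] by blast
qed

lemma grad_mult:
  assumes "Ck (Suc k) \<phi>" "Ck (Suc k) \<psi>"
  shows "grad (\<lambda>x. \<phi> x * \<psi> x) x = \<phi> x *\<^sub>R grad \<psi> x + \<psi> x *\<^sub>R grad \<phi> x"
proof (rule grad_eqI)
  have "((\<lambda>x. \<phi> x * \<psi> x) has_derivative (\<lambda>h. \<phi> x * (grad \<psi> x \<bullet> h) + (grad \<phi> x \<bullet> h) * \<psi> x)) (at x)"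
    by (rule has_derivative_mult[OF has_derivative_grad[OF assms(1)] has_derivative_grad[OF assms(2)]])
  then show "((\<lambda>x. \<phi> x * \<psi> x) has_derivative (\<lambda>h. (\<phi> x *\<^sub>R grad \<psi> x + \<psi> x *\<^sub>R grad \<phi> x) \<bullet> h)) (at x)"
    by (simp add: inner_add_left mult.commute)
qed

lemma test_functions_mult:
  assumes "\<phi> \<in> test_functions k \<Omega>" "Ck k \<psi>"
  shows "(\<lambda>x. \<phi> x * \<psi> x) \<in> test_functions k \<Omega>"
proof -
  have sub: "closure {x. \<phi> x * \<psi> x \<noteq> 0} \<subseteq> closure {x. \<phi> x \<noteq> 0}" by (rule closure_mono) auto
  have "compact (closure {x. \<phi> x \<noteq> 0} \<inter> closure {x. \<phi> x * \<psi> x \<noteq> 0})"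
    by (rule compact_Int_closed[OF test_functionsD(2)[OF assms(1)] closed_closure])
  then have "compact (closure {x. \<phi> x * \<psi> x \<noteq> 0})" unfolding inf.absorb2[OF sub] .
  moreover have "closure {x. \<phi> x * \<psi> x \<noteq> 0} \<subseteq> \<Omega>"
    by (rule subset_trans[OF sub test_functionsD(3)[OF assms(1)]])
  moreover have "Ck k (\<lambda>x. \<phi> x * \<psi> x)"
    by (rule Ck_mult[OF test_functionsD(1)[OF assms(1)] assms(2)])
  ultimately show ?thesis unfolding test_functions_def by blast
qed

lemma cutoff_tendsto:
  fixes U :: "'a::euclidean_space set"
  assumes U: "open U" "bounded U" and e: "e \<longlonglongrightarrow> 0"
    and 1: "\<And>k x. x \<in> U \<Longrightarrow> infdist x (frontier U) \<ge> e k \<Longrightarrow> \<psi> k x = 1"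
    and 0: "\<And>k x. x \<notin> U \<Longrightarrow> \<psi> k x = (0::real)"
  shows "(\<lambda>k. \<psi> k x) \<longlonglongrightarrow> indicator U x"
proof (cases "x \<in> U")
  case True
  then have "\<forall>\<^sub>F k in sequentially. e k < infdist x (frontier U)"
    using order_tendstoD(2)[OF e infdist_frontier_pos[OF U True]] by blast
  then have "\<forall>\<^sub>F k in sequentially. \<psi> k x = 1" by eventually_elim (use 1 True in auto)
  then show ?thesis using True by (simp add: tendsto_eventually)
next
  case False
  then show ?thesis using 0 by simp
qed

definition layer_cutoffs ::
  "'a::euclidean_space set \<Rightarrow> (nat \<Rightarrow> real) \<Rightarrow> real \<Rightarrow> (nat \<Rightarrow> 'a \<Rightarrow> real) \<Rightarrow> bool" where
  "layer_cutoffs U e \<theta> \<psi> \<longleftrightarrow> (\<forall>k. \<psi> k \<in> smooth_test_functions U \<and>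
    (\<forall>x. 0 \<le> \<psi> k x \<and> \<psi> k x \<le> 1 \<and> norm (grad (\<psi> k) x) \<le> \<theta> / e k \<and>
      (grad (\<psi> k) x \<noteq> 0 \<longrightarrow> x \<in> U \<and> infdist x (frontier U) < e k) \<and>
      (x \<in> U \<and> e k \<le> infdist x (frontier U) \<longrightarrow> \<psi> k x = 1)))"

lemma layer_cutoffs_exist:
  fixes U :: "'a::euclidean_space set"
  assumes "open U" "bounded U" and e: "\<And>k::nat. e k > 0" and "\<theta> > 1"
  obtains \<psi> where "layer_cutoffs U e \<theta> \<psi>"
proof -
  define P where "P k \<psi> \<longleftrightarrow> \<psi> \<in> smooth_test_functions U \<and> (\<forall>x. 0 \<le> \<psi> x \<and> \<psi> x \<le> 1 \<and>
      norm (grad \<psi> x) \<le> \<theta> / e k \<and>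
      (grad \<psi> x \<noteq> 0 \<longrightarrow> x \<in> U \<and> infdist x (frontier U) < e k) \<and>
      (x \<in> U \<and> e k \<le> infdist x (frontier U) \<longrightarrow> \<psi> x = 1))" for k \<psi>
  have "\<exists>\<psi>. P k \<psi>" for k
    unfolding P_def Bex_def[symmetric] by (rule layer_cutoff[OF assms(1,2) e assms(4)])
  then obtain \<psi> where "\<And>k. P k (\<psi> k)" by metis
  then have "layer_cutoffs U e \<theta> \<psi>" unfolding layer_cutoffs_def P_def by blast
  then show ?thesis by (rule that)
qed

lemma layer_cutoffsD:
  assumes "layer_cutoffs U e \<theta> \<psi>"
  shows "\<psi> k \<in> smooth_test_functions U" "0 \<le> \<psi> k x" "\<psi> k x \<le> 1"
    "norm (grad (\<psi> k) x) \<le> \<theta> / e k"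
    "grad (\<psi> k) x \<noteq> 0 \<Longrightarrow> x \<in> U \<and> infdist x (frontier U) < e k"
    "x \<in> U \<Longrightarrow> infdist x (frontier U) \<ge> e k \<Longrightarrow> \<psi> k x = 1"
proof -
  have 1: "\<psi> k \<in> smooth_test_functions U \<and>
    (\<forall>x. 0 \<le> \<psi> k x \<and> \<psi> k x \<le> 1 \<and> norm (grad (\<psi> k) x) \<le> \<theta> / e k \<and>
      (grad (\<psi> k) x \<noteq> 0 \<longrightarrow> x \<in> U \<and> infdist x (frontier U) < e k) \<and>
      (x \<in> U \<and> e k \<le> infdist x (frontier U) \<longrightarrow> \<psi> k x = 1))"
    using assms unfolding layer_cutoffs_def by (rule spec)
  then show "\<psi> k \<in> smooth_test_functions U" by (rule conjunct1)
  note 2 = spec[OF conjunct2[OF 1], of x]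
  note 3 = conjunct2[OF 2]
  note 4 = conjunct2[OF 3]
  note 5 = conjunct2[OF 4]
  show "0 \<le> \<psi> k x" by (rule conjunct1[OF 2])
  show "\<psi> k x \<le> 1" by (rule conjunct1[OF 3])
  show "norm (grad (\<psi> k) x) \<le> \<theta> / e k" by (rule conjunct1[OF 4])
  show "x \<in> U \<and> infdist x (frontier U) < e k" if "grad (\<psi> k) x \<noteq> 0"
    by (rule mp[OF conjunct1[OF 5] that])
  show "\<psi> k x = 1" if "x \<in> U" "infdist x (frontier U) \<ge> e k"
    by (rule mp[OF conjunct2[OF 5] conjI[OF that]])
qed

text \<open>Dominated convergence carries the bound from smooth functions to indicators of open
  sets, and outer regularity carries it to Borel sets.\<close>

lemma signed_measure_dominated_of_smooth:
  fixes s :: "'a::euclidean_space set \<Rightarrow> real"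
  assumes \<Omega>: "open \<Omega>" and s: "signed_measure_on \<Omega> s" and V: "radon_measure_on \<Omega> V"
    and le: "\<And>\<phi>. \<phi> \<in> smooth_test_functions \<Omega> \<Longrightarrow> \<bar>sint \<Omega> s \<phi>\<bar> \<le> (\<integral>x. \<bar>\<phi> x\<bar> \<partial>V)"
    and S: "S \<in> borel_on \<Omega>"
  shows "\<bar>s S\<bar> \<le> measure V S"
proof -
  have \<Omega>b: "\<Omega> \<in> sets borel" using \<Omega> by simp
  interpret V: finite_measure V using V by (rule radon_measure_onD)
  have W_le: "\<bar>s W\<bar> \<le> 1 * measure V W" if W: "open W" "W \<subseteq> \<Omega>" for W
  proof -
    obtain f :: "nat \<Rightarrow> 'a \<Rightarrow> real" where f: "\<And>j. f j \<in> test_functions 0 W"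
      "\<And>j x. 0 \<le> f j x" "\<And>j x. f j x \<le> 1" "\<And>x. (\<lambda>j. f j x) \<longlonglongrightarrow> indicator W x"
      using open_indicator_approx[OF W(1)] by metis
    have "\<exists>g. g \<in> smooth_test_functions W \<and> (\<forall>x. \<bar>g x - f n x\<bar> \<le> inverse (Suc n))" for n
      using smooth_approx[OF W(1) f(1)[of n], of "inverse (Suc n)"]
      by (metis inverse_positive_iff_positive of_nat_0_less_iff zero_less_Suc)
    then obtain g where g: "\<And>n. g n \<in> smooth_test_functions W" "\<And>n x. \<bar>g n x - f n x\<bar> \<le> inverse (Suc n)"
      by metis
    have gb: "bounded_borel (g n)" for n
      by (rule test_function_bounded_borel[OF smooth_test_functions_subset[OF g(1), of _ 0]])
    have inv1: "inverse (real (Suc n)) \<le> 1" for n by (simp add: inverse_le_1_iff)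
    have bd: "\<bar>g n x\<bar> \<le> 2" for n x using g(2)[of n x] f(2,3)[of n x] inv1[of n] by linarith
    have lim: "(\<lambda>n. g n x) \<longlonglongrightarrow> indicator W x" for x
    proof -
      have "(\<lambda>n. g n x - f n x) \<longlonglongrightarrow> 0"
        by (rule Lim_null_comparison[OF always_eventually LIMSEQ_inverse_real_of_nat]) (use g(2) in simp)
      from tendsto_add[OF this f(4)[of x]] show ?thesis by simp
    qed
    have "(\<lambda>n. sint \<Omega> s (g n)) \<longlonglongrightarrow> sint \<Omega> s (indicator W)"
      by (rule sint_tendsto[OF \<Omega>b s, where C=2]) (use gb bd lim W in auto)
    then have A1: "(\<lambda>n. \<bar>sint \<Omega> s (g n)\<bar>) \<longlonglongrightarrow> \<bar>sint \<Omega> s (indicator W)\<bar>" by (rule tendsto_rabs)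
    have A2: "sint \<Omega> s (indicator W) = s W"
      using sint_indicator[OF \<Omega>b s, of W] W by (simp add: Int_absorb2)
    have A3: "(\<lambda>n. \<integral>x. \<bar>g n x\<bar> \<partial>V) \<longlonglongrightarrow> (\<integral>x. \<bar>indicator W x\<bar> \<partial>V)"
    proof (rule integral_dominated_convergence[where w="\<lambda>x. 2"])
      show "(\<lambda>x. \<bar>indicator W x :: real\<bar>) \<in> borel_measurable V"
        by (rule radon_measurable[OF V \<Omega>b]) (use W in simp)
      show "(\<lambda>x. \<bar>g n x\<bar>) \<in> borel_measurable V" for n
        by (intro radon_measurable[OF V \<Omega>b] bounded_borel_measurable bounded_borel_abs gb)
      show "AE x in V. (\<lambda>n. \<bar>g n x\<bar>) \<longlonglongrightarrow> \<bar>indicator W x\<bar>"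
        by (intro AE_I2 tendsto_rabs lim)
    qed (use bd in auto)
    have A4: "(\<integral>x. \<bar>indicator W x\<bar> \<partial>V) = measure V W"
      using W by (simp add: radon_measure_onD(1)[OF V] Int_absorb2)
    have le': "\<bar>sint \<Omega> s (g n)\<bar> \<le> (\<integral>x. \<bar>g n x\<bar> \<partial>V)" for n
      by (rule le) (rule smooth_test_functions_mono[OF g(1) W(2)])
    have "\<bar>s W\<bar> \<le> measure V W"
    proof (rule LIMSEQ_le)
      show "(\<lambda>n. \<bar>sint \<Omega> s (g n)\<bar>) \<longlonglongrightarrow> \<bar>s W\<bar>" using A1 A2 by simp
      show "(\<lambda>n. \<integral>x. \<bar>g n x\<bar> \<partial>V) \<longlonglongrightarrow> measure V W" using A3 A4 by simp
      show "\<exists>N. \<forall>n\<ge>N. \<bar>sint \<Omega> s (g n)\<bar> \<le> (\<integral>x. \<bar>g n x\<bar> \<partial>V)" by (intro exI[of _ 0] allI impI le')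
    qed
    then show ?thesis by simp
  qed
  have "\<bar>s S\<bar> \<le> 1 * measure V S"
    by (rule signed_measure_dominated_of_open[OF \<Omega> s V \<Omega> _ _ W_le]) (use S in \<open>auto simp: borel_on_iff\<close>)
  then show ?thesis by simp
qed

section \<open>Normal traces as limits of cutoff gradients\<close>

context
  fixes \<Omega> :: "'a::euclidean_space set" and F :: "'a set \<Rightarrow> 'a"
  assumes \<Omega>: "open \<Omega>" and F: "F \<in> DM_ext \<Omega>"
begin

private lemma \<Omega>b: "\<Omega> \<in> sets borel"
  using \<Omega> by simp

private lemmas D = DM_extD[OF \<Omega> F]

lemma normal_trace_distribution_eq:
  "normal_trace_distribution \<Omega> F U \<phi> =
    - vint \<Omega> F (\<lambda>x. indicator U x *\<^sub>R grad \<phi> x) - sint \<Omega> (divergence \<Omega> F) (\<lambda>x. indicator U x * \<phi> x)"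
proof -
  show ?thesis
    unfolding normal_trace_distribution_def vector_integral_eq_vint[OF \<Omega>b D(1)]
    by (subst signed_integral_eq_sint[OF \<Omega>b D(3), where U=U]) (rule refl)
qed

text \<open>Testing the divergence with \<open>\<phi> * \<psi> k\<close> and using the product rule
  moves the gradient from the cutoff to \<phi>. The resulting integrals converge, as the cutoffs
  tend to the indicator of \<open>U\<close>, to the two terms that define the trace.\<close>

lemma normal_trace_distribution_tendsto:
  assumes U: "open_compactly_inside U \<Omega>" and e: "e \<longlonglongrightarrow> 0"
    and \<psi>: "\<And>k. \<psi> k \<in> smooth_test_functions U" "\<And>k x. 0 \<le> \<psi> k x" "\<And>k x. \<psi> k x \<le> 1"
      "\<And>k x. x \<in> U \<Longrightarrow> infdist x (frontier U) \<ge> e k \<Longrightarrow> \<psi> k x = 1"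
    and \<phi>: "\<phi> \<in> test_functions 1 \<Omega>"
  shows "(\<lambda>k. vint \<Omega> F (\<lambda>x. \<phi> x *\<^sub>R grad (\<psi> k) x)) \<longlonglongrightarrow> normal_trace_distribution \<Omega> F U \<phi>"
proof -
  define s where "s = divergence \<Omega> F"
  note D = DM_extD[OF \<Omega> F, folded s_def]
  note UD = open_compactly_insideD[OF U]
  have \<psi>1: "\<psi> k \<in> test_functions 1 U" for k by (rule smooth_test_functions_subset[OF \<psi>(1)])
  have \<phi>1: "\<phi> \<in> test_functions (Suc 0) \<Omega>" using \<phi> by simp
  have b: "bounded_borel \<phi>" "bounded_borel (grad \<phi>)" "bounded_borel (\<psi> k)" "bounded_borel (grad (\<psi> k))" for k
    using test_function_bounded_borel[OF \<phi>] grad_bounded_borel[OF \<phi>1]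
      test_function_bounded_borel[OF \<psi>1[of k]] grad_bounded_borel[of "\<psi> k" 0] \<psi>1[of k] by auto
  have U01: "bounded_borel (indicator U :: 'a \<Rightarrow> real)" using UD(1) by simp
  have eq: "vint \<Omega> F (\<lambda>x. \<phi> x *\<^sub>R grad (\<psi> k) x)
      = - vint \<Omega> F (\<lambda>x. \<psi> k x *\<^sub>R grad \<phi> x) - sint \<Omega> s (\<lambda>x. \<psi> k x * \<phi> x)" for k
  proof -
    have C1: "Ck (Suc 0) \<phi>" "Ck (Suc 0) (\<psi> k)" using \<phi> \<psi>1[of k] by (auto simp: test_functions_def)
    have "sint \<Omega> s (\<lambda>x. \<phi> x * \<psi> k x) = - vint \<Omega> F (grad (\<lambda>x. \<phi> x * \<psi> k x))"
      by (rule divergence_C1[OF \<Omega> D(1,2) test_functions_mult[OF \<phi> test_functionsD(1)[OF \<psi>1]]])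
    also have "grad (\<lambda>x. \<phi> x * \<psi> k x) = (\<lambda>x. \<phi> x *\<^sub>R grad (\<psi> k) x + \<psi> k x *\<^sub>R grad \<phi> x)"
      by (rule ext) (rule grad_mult[OF C1])
    also have "vint \<Omega> F \<dots> = vint \<Omega> F (\<lambda>x. \<phi> x *\<^sub>R grad (\<psi> k) x) + vint \<Omega> F (\<lambda>x. \<psi> k x *\<^sub>R grad \<phi> x)"
      by (intro vint_add[OF \<Omega>b D(1)] bounded_borel_scaleR b)
    finally show ?thesis by (simp add: mult.commute)
  qed
  obtain C D' where C: "\<And>x. norm (\<phi> x) \<le> C" and D': "\<And>x. norm (grad \<phi> x) \<le> D'"
    using b(1,2) by (metis bounded_borel_bound)
  have lim: "(\<lambda>k. \<psi> k x) \<longlonglongrightarrow> indicator U x" for x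
    by (rule cutoff_tendsto[OF UD(1,5) e \<psi>(4)]) (use test_functionsD(6)[OF \<psi>1] in auto)
  have "(\<lambda>k. vint \<Omega> F (\<lambda>x. \<psi> k x *\<^sub>R grad \<phi> x)) \<longlonglongrightarrow> vint \<Omega> F (\<lambda>x. indicator U x *\<^sub>R grad \<phi> x)"
  proof (rule vint_tendsto[OF \<Omega>b D(1), where C=D'])
    show "norm (\<psi> k x *\<^sub>R grad \<phi> x) \<le> D'" for k x
      using mult_left_le_one_le[of "norm (grad \<phi> x)" "\<psi> k x"] \<psi>(2,3)[where x=x and k=k] D'[of x] by simp
  qed (auto intro!: bounded_borel_scaleR b U01 tendsto_scaleR lim)
  moreover have "(\<lambda>k. sint \<Omega> s (\<lambda>x. \<psi> k x * \<phi> x)) \<longlonglongrightarrow> sint \<Omega> s (\<lambda>x. indicator U x * \<phi> x)"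
  proof (rule sint_tendsto[OF \<Omega>b D(3), where C=C])
    show "\<bar>\<psi> k x * \<phi> x\<bar> \<le> C" for k x
      using mult_left_le_one_le[of "\<bar>\<phi> x\<bar>" "\<psi> k x"] \<psi>(2,3)[where x=x and k=k] C[of x] by (simp add: abs_mult)
  qed (auto intro!: bounded_borel_mult b U01 tendsto_mult lim)
  ultimately show ?thesis
    unfolding eq normal_trace_distribution_eq s_def[symmetric] by (intro tendsto_diff tendsto_minus)
qed

lemma vint_cutoff_le:
  assumes \<phi>: "bounded_borel \<phi>" and \<psi>: "bounded_borel (grad \<psi>)" "\<And>x. norm (grad \<psi> x) \<le> \<theta> / e"
      "\<And>x. grad \<psi> x \<noteq> 0 \<Longrightarrow> x \<in> U \<and> infdist x (frontier U) < e" and U: "open U" and e: "e > 0" "\<theta> \<ge> 0"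
  shows "\<bar>vint \<Omega> F (\<lambda>x. \<phi> x *\<^sub>R grad \<psi> x)\<bar> \<le> \<theta> * ((\<integral>x. indicator (layer U e) x * \<bar>\<phi> x\<bar> \<partial>variation \<Omega> F) / e)"
proof -
  note V = radon_variation[OF \<Omega>b D(1)]
  have "\<bar>vint \<Omega> F (\<lambda>x. \<phi> x *\<^sub>R grad \<psi> x)\<bar> \<le> 1 * (\<integral>x. norm (\<phi> x *\<^sub>R grad \<psi> x) \<partial>variation \<Omega> F)"
    by (rule vint_abs_le[OF \<Omega>b D(1) V(1)]) (use V(2) in \<open>auto intro!: bounded_borel_scaleR \<phi> \<psi>(1)\<close>)
  also have "\<dots> \<le> 1 * (\<integral>x. (\<theta> / e) * (indicator (layer U e) x * \<bar>\<phi> x\<bar>) \<partial>variation \<Omega> F)"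
  proof (intro mult_left_mono integral_mono)
    show "integrable (variation \<Omega> F) (\<lambda>x. norm (\<phi> x *\<^sub>R grad \<psi> x))"
      by (intro radon_integrable[OF V(1) \<Omega>b] bounded_borel_norm bounded_borel_scaleR \<phi> \<psi>(1))
    show "integrable (variation \<Omega> F) (\<lambda>x. (\<theta> / e) * (indicator (layer U e) x * \<bar>\<phi> x\<bar>))"
      by (intro radon_integrable[OF V(1) \<Omega>b] bounded_borel_intros \<phi> layer_borel[OF U])
    fix x
    show "norm (\<phi> x *\<^sub>R grad \<psi> x) \<le> (\<theta> / e) * (indicator (layer U e) x * \<bar>\<phi> x\<bar>)"
    proof (cases "grad \<psi> x = 0")
      case False
      then have "x \<in> layer U e" using \<psi>(3) subset_layer by blast
      then show ?thesis using mult_right_mono[OF \<psi>(2)[of x], of "\<bar>\<phi> x\<bar>"] by (simp add: mult.commute)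
    qed (use e in simp)
  qed simp
  finally show ?thesis by simp
qed

text \<open>The cutoffs are built on the very thicknesses along which the layers converge to \<nu>,
  and the surplus \<theta> in their slope is removed by letting it decrease to 1. The layers are
  tested against \<open>\<bar>\<phi>\<bar>\<close>, which is merely continuous.\<close>

lemma normal_trace_layer_limit_bound:
  assumes U: "open_compactly_inside U \<Omega>" and \<nu>: "layer_limit \<Omega> (variation \<Omega> F) U \<nu>"
    and \<phi>: "\<phi> \<in> test_functions 1 \<Omega>"
  shows "\<bar>normal_trace_distribution \<Omega> F U \<phi>\<bar> \<le> (\<integral>x. \<bar>\<phi> x\<bar> \<partial>\<nu>)"
proof -
  note UD = open_compactly_insideD[OF U]
  note V = radon_variation[OF \<Omega>b D(1)]
  obtain e :: "nat \<Rightarrow> real" where e: "\<And>k. e k > 0" "e \<longlonglongrightarrow> 0"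
    and lim: "\<And>\<phi>. \<phi> \<in> test_functions 0 \<Omega> \<Longrightarrow>
      (\<lambda>k. integral\<^sup>L (scaled_layer (variation \<Omega> F) U (e k)) \<phi>) \<longlonglongrightarrow> integral\<^sup>L \<nu> \<phi>"
    using \<nu> unfolding layer_limit_def weak_star_limit_def by blast
  have \<phi>b: "bounded_borel \<phi>" by (rule test_function_bounded_borel[OF \<phi>])
  have abs\<phi>: "(\<lambda>x. \<bar>\<phi> x\<bar>) \<in> test_functions 0 \<Omega>"
  proof -
    have "{x. \<bar>\<phi> x\<bar> \<noteq> 0} = {x. \<phi> x \<noteq> 0}" by auto
    then show ?thesis using test_functionsD(2,3)[OF \<phi>] continuous_on_rabs[OF test_functionsD(4)[OF \<phi>]]
      by (simp add: test_functions_def)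
  qed
  have "\<bar>normal_trace_distribution \<Omega> F U \<phi>\<bar> \<le> \<theta> * (\<integral>x. \<bar>\<phi> x\<bar> \<partial>\<nu>)" if \<theta>: "\<theta> > 1" for \<theta>
  proof -
    obtain \<psi> where \<psi>': "layer_cutoffs U e \<theta> \<psi>"
      by (rule layer_cutoffs_exist[OF UD(1) UD(5) e(1) \<theta>])
    note \<psi> = layer_cutoffsD[OF \<psi>']
    have gb: "bounded_borel (grad (\<psi> k))" for k
      by (rule grad_bounded_borel[OF smooth_test_functions_subset[OF \<psi>(1)]])
    have le: "\<bar>vint \<Omega> F (\<lambda>x. \<phi> x *\<^sub>R grad (\<psi> k) x)\<bar> \<le>
        \<theta> * integral\<^sup>L (scaled_layer (variation \<Omega> F) U (e k)) (\<lambda>x. \<bar>\<phi> x\<bar>)" for k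
    proof -
      have eq: "integral\<^sup>L (scaled_layer (variation \<Omega> F) U (e k)) (\<lambda>x. \<bar>\<phi> x\<bar>)
          = (\<integral>x. indicator (layer U (e k)) x * \<bar>\<phi> x\<bar> \<partial>variation \<Omega> F) / e k"
        by (rule integral_scaled_layer[OF V(1) \<Omega>b UD(1) e(1) bounded_borel_abs[OF \<phi>b]])
      show ?thesis unfolding eq
        by (rule vint_cutoff_le[OF \<phi>b gb \<psi>(4) _ UD(1) e(1)]) (use \<theta> \<psi>(5) in auto)
    qed
    have "(\<lambda>k. \<bar>vint \<Omega> F (\<lambda>x. \<phi> x *\<^sub>R grad (\<psi> k) x)\<bar>) \<longlonglongrightarrow> \<bar>normal_trace_distribution \<Omega> F U \<phi>\<bar>"
      by (intro tendsto_rabs normal_trace_distribution_tendsto[OF U e(2) \<psi>(1,2,3,6) \<phi>])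
    moreover have "(\<lambda>k. \<theta> * integral\<^sup>L (scaled_layer (variation \<Omega> F) U (e k)) (\<lambda>x. \<bar>\<phi> x\<bar>)) \<longlonglongrightarrow> \<theta> * (\<integral>x. \<bar>\<phi> x\<bar> \<partial>\<nu>)"
      by (intro tendsto_mult_left lim abs\<phi>)
    ultimately show ?thesis by (rule LIMSEQ_le) (use le in auto)
  qed
  moreover have "((\<lambda>\<theta>. \<theta> * (\<integral>x. \<bar>\<phi> x\<bar> \<partial>\<nu>)) \<longlongrightarrow> 1 * (\<integral>x. \<bar>\<phi> x\<bar> \<partial>\<nu>)) (at_right 1)"
    by (intro tendsto_intros)
  ultimately show ?thesis
    by (intro tendsto_lowerbound[of "\<lambda>\<theta>. \<theta> * (\<integral>x. \<bar>\<phi> x\<bar> \<partial>\<nu>)" _ "at_right 1"])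
       (auto simp: eventually_at_filter)
qed

text \<open>\<open>T\<close> is the scalar measure \<open>G \<bullet> dF\<close>; the bound of
  \<open>G\<close> times the variation of \<open>F\<close> dominates it, which gives countable
  additivity.\<close>

lemma vint_density_signed_measure:
  assumes G: "bounded_borel G"
  defines "T \<equiv> \<lambda>S. if S \<in> borel_on \<Omega> then vint \<Omega> F (\<lambda>x. indicator S x *\<^sub>R G x) else 0"
  shows "signed_measure_on \<Omega> T" "bounded_borel f \<Longrightarrow> sint \<Omega> T f = vint \<Omega> F (\<lambda>x. f x *\<^sub>R G x)"
proof -
  note V = radon_variation[OF \<Omega>b D(1)]
  interpret V: finite_measure "variation \<Omega> F" by (rule radon_measure_onD(3)[OF V(1)])
  obtain C where C: "C \<ge> 0" "\<And>x. norm (G x) \<le> C" using bounded_borel_bound[OF G] by blast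
  have bound: "\<bar>vint \<Omega> F (\<lambda>x. f x *\<^sub>R G x)\<bar> \<le> C * (\<integral>x. \<bar>f x\<bar> \<partial>variation \<Omega> F)" if f: "bounded_borel f" for f
  proof -
    have "\<bar>vint \<Omega> F (\<lambda>x. f x *\<^sub>R G x)\<bar> \<le> 1 * (\<integral>x. norm (f x *\<^sub>R G x) \<partial>variation \<Omega> F)"
      by (rule vint_abs_le[OF \<Omega>b D(1) V(1)]) (use V(2) in \<open>auto intro: bounded_borel_scaleR f G\<close>)
    also have "\<dots> \<le> 1 * (\<integral>x. C * \<bar>f x\<bar> \<partial>variation \<Omega> F)"
    proof (intro mult_left_mono integral_mono)
      show "integrable (variation \<Omega> F) (\<lambda>x. norm (f x *\<^sub>R G x))"
        by (intro radon_integrable[OF V(1) \<Omega>b] bounded_borel_norm bounded_borel_scaleR f G)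
      show "integrable (variation \<Omega> F) (\<lambda>x. C * \<bar>f x\<bar>)"
        by (intro radon_integrable[OF V(1) \<Omega>b] bounded_borel_cmult bounded_borel_abs f)
      show "norm (f x *\<^sub>R G x) \<le> C * \<bar>f x\<bar>" for x
        using mult_left_mono[OF C(2)[of x], of "\<bar>f x\<bar>"] by (simp add: mult.commute)
    qed simp
    finally show ?thesis by simp
  qed
  show T: "signed_measure_on \<Omega> T"
  proof (rule vector_measure_on_of_dominated[OF \<Omega>b V(1), where c=C])
    fix A B assume AB: "A \<in> borel_on \<Omega>" "B \<in> borel_on \<Omega>" "A \<inter> B = {}"
    then have b: "bounded_borel (\<lambda>x. indicator A x *\<^sub>R G x)" "bounded_borel (\<lambda>x. indicator B x *\<^sub>R G x)"
      by (auto simp: borel_on_iff intro!: bounded_borel_scaleR G)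
    have "(\<lambda>x. indicator (A \<union> B) x *\<^sub>R G x) = (\<lambda>x. indicator A x *\<^sub>R G x + indicator B x *\<^sub>R G x)"
      using AB(3) by (auto simp: fun_eq_iff indicator_def)
    moreover have "A \<union> B \<in> borel_on \<Omega>" using AB by (auto simp: borel_on_iff)
    ultimately show "T (A \<union> B) = T A + T B"
      using AB vint_add[OF \<Omega>b D(1) b] by (simp add: T_def)
  next
    fix A assume A: "A \<in> borel_on \<Omega>"
    have "\<bar>vint \<Omega> F (\<lambda>x. indicator A x *\<^sub>R G x)\<bar> \<le> C * (\<integral>x. \<bar>indicator A x :: real\<bar> \<partial>variation \<Omega> F)"
      by (rule bound) (use A in \<open>simp add: borel_on_iff\<close>)
    also have "(\<integral>x. \<bar>indicator A x :: real\<bar> \<partial>variation \<Omega> F) = (\<integral>x. indicator A x \<partial>variation \<Omega> F)" by simp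
    also have "\<dots> = measure (variation \<Omega> F) A"
      using A by (simp add: radon_measure_onD(1)[OF V(1)] borel_on_iff Int_absorb2)
    finally show "norm (T A) \<le> C * measure (variation \<Omega> F) A" using A by (simp add: T_def)
  qed (simp add: T_def)
  assume f: "bounded_borel f"
  show "sint \<Omega> T f = vint \<Omega> F (\<lambda>x. f x *\<^sub>R G x)"
  proof (rule sint_unique[OF \<Omega>b T _ _ _ _ f, symmetric, where K="C * measure (variation \<Omega> F) \<Omega>"])
    fix f g :: "'a \<Rightarrow> real" assume fg: "bounded_borel f" "bounded_borel g"
    show "vint \<Omega> F (\<lambda>x. (f x + g x) *\<^sub>R G x) = vint \<Omega> F (\<lambda>x. f x *\<^sub>R G x) + vint \<Omega> F (\<lambda>x. g x *\<^sub>R G x)"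
      unfolding scaleR_add_left by (intro vint_add[OF \<Omega>b D(1)] bounded_borel_scaleR fg G)
  next
    fix f :: "'a \<Rightarrow> real" and c
    show "vint \<Omega> F (\<lambda>x. (c * f x) *\<^sub>R G x) = c * vint \<Omega> F (\<lambda>x. f x *\<^sub>R G x)"
      using vint_scaleR[OF \<Omega>b D(1), of c "\<lambda>x. f x *\<^sub>R G x"] by simp
  next
    fix f :: "'a \<Rightarrow> real" and c assume f: "bounded_borel f" "\<And>x. \<bar>f x\<bar> \<le> c"
    have "(\<integral>x. \<bar>f x\<bar> \<partial>variation \<Omega> F) \<le> (\<integral>x. c \<partial>variation \<Omega> F)"
      by (intro integral_mono radon_integrable[OF V(1) \<Omega>b] bounded_borel_abs f bounded_borel_const)
    then have "(\<integral>x. \<bar>f x\<bar> \<partial>variation \<Omega> F) \<le> measure (variation \<Omega> F) \<Omega> * c"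
      by (simp add: radon_measure_onD(1)[OF V(1)])
    then show "\<bar>vint \<Omega> F (\<lambda>x. f x *\<^sub>R G x)\<bar> \<le> C * measure (variation \<Omega> F) \<Omega> * c"
      using bound[OF f(1)] mult_left_mono[OF _ C(1)] by (fastforce simp: mult.assoc intro: order_trans)
  next
    fix A :: "'a set" assume A: "A \<in> sets borel"
    then have "A \<inter> \<Omega> \<in> borel_on \<Omega>" using \<Omega>b by (simp add: borel_on_iff)
    then show "vint \<Omega> F (\<lambda>x. indicator A x *\<^sub>R G x) = T (A \<inter> \<Omega>)"
      unfolding T_def by (simp, intro vint_cong[OF \<Omega>b D(1)]) (auto simp: indicator_def)
  qed
qed

text \<open>Along thicknesses with controlled layer mass, the measures
  \<open>grad (\<psi> k) \<bullet> dF\<close> have bounded total variation. Their Jordan parts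
  converge weak-star along a subsequence, and the difference of the limits represents the
  trace.\<close>

lemma has_normal_trace_O_class:
  assumes U: "U \<in> O_class \<Omega> (variation \<Omega> F)"
  shows "has_normal_trace \<Omega> F U"
proof -
  note V = radon_variation[OF \<Omega>b D(1)]
  interpret V: finite_measure "variation \<Omega> F" by (rule radon_measure_onD(3)[OF V(1)])
  note VD = radon_measure_onD[OF V(1)]
  have Ui: "open_compactly_inside U \<Omega>" using U by (simp add: O_class_def)
  note UD = open_compactly_insideD[OF Ui]
  obtain e :: "nat \<Rightarrow> real" and C where e0: "\<forall>k. e k > 0" "decseq e" and e2: "e \<longlonglongrightarrow> 0" and C: "C \<ge> 0"
    "\<forall>k. measure (variation \<Omega> F) {x \<in> U. infdist x (frontier U) \<le> e k} \<le> C * e k"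
    by (rule O_class_sequence[OF U V(1)])
  have e1: "e k > 0" for k using e0 by simp
  note e = e1 e2
  \<comment> \<open>Only boundedness of the masses is at stake here, so any slope factor above 1
    will do.\<close>
  have "(2::real) > 1" by simp
  then obtain \<psi> where \<psi>': "layer_cutoffs U e 2 \<psi>"
    by (rule layer_cutoffs_exist[OF UD(1) UD(5) e(1)])
  note \<psi> = layer_cutoffsD[OF \<psi>']
  have gb: "bounded_borel (grad (\<psi> k))" for k
    by (rule grad_bounded_borel[OF smooth_test_functions_subset[OF \<psi>(1)]])
  define T where "T k S = (if S \<in> borel_on \<Omega> then vint \<Omega> F (\<lambda>x. indicator S x *\<^sub>R grad (\<psi> k) x) else 0)" for k S
  have T: "signed_measure_on \<Omega> (T k)" "\<And>f. bounded_borel f \<Longrightarrow> sint \<Omega> (T k) f = vint \<Omega> F (\<lambda>x. f x *\<^sub>R grad (\<psi> k) x)" for k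
    using vint_density_signed_measure[OF gb[of k]] unfolding T_def[abs_def] by auto
  have T_le: "\<bar>T k S\<bar> \<le> 2 * C" and T_0: "S \<inter> U = {} \<Longrightarrow> T k S = 0" if S: "S \<in> borel_on \<Omega>" for k S
  proof -
    have Sb: "bounded_borel (indicator S :: 'a \<Rightarrow> real)" using S by (simp add: borel_on_iff)
    have "\<bar>T k S\<bar> \<le> 2 * ((\<integral>x. indicator (layer U (e k)) x * \<bar>indicator S x\<bar> \<partial>variation \<Omega> F) / e k)"
    proof -
      have "\<bar>vint \<Omega> F (\<lambda>x. indicator S x *\<^sub>R grad (\<psi> k) x)\<bar>
          \<le> 2 * ((\<integral>x. indicator (layer U (e k)) x * \<bar>indicator S x\<bar> \<partial>variation \<Omega> F) / e k)"
      proof (rule vint_cutoff_le[OF Sb gb \<psi>(4) _ UD(1) e(1)])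
        show "x \<in> U \<and> infdist x (frontier U) < e k" if "grad (\<psi> k) x \<noteq> 0" for x by (rule \<psi>(5)[OF that])
      qed simp
      then show ?thesis using S by (simp add: T_def)
    qed
    also have "\<dots> = 2 * (measure (variation \<Omega> F) (layer U (e k) \<inter> S) / e k)"
    proof -
      have "(\<lambda>x. indicator (layer U (e k)) x * \<bar>indicator S x\<bar>) = (indicator (layer U (e k) \<inter> S) :: 'a \<Rightarrow> real)"
        by (auto simp: fun_eq_iff indicator_def)
      then show ?thesis using S by (simp add: VD(1) borel_on_iff Int_absorb2 Int_absorb1 le_infI2)
    qed
    finally have le: "\<bar>T k S\<bar> \<le> 2 * (measure (variation \<Omega> F) (layer U (e k) \<inter> S) / e k)" .
    have "measure (variation \<Omega> F) (layer U (e k) \<inter> S) \<le> measure (variation \<Omega> F) {x \<in> U. infdist x (frontier U) \<le> e k}"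
      by (rule V.finite_measure_mono) (use layer_subset[of U "e k"] closed_layer_borel[OF UD(1)] UD(4) in \<open>auto simp: VD(2) borel_on_iff\<close>)
    also have "\<dots> \<le> C * e k" using C(2) by (rule spec)
    finally have "measure (variation \<Omega> F) (layer U (e k) \<inter> S) / e k \<le> C" using e(1)[of k] by (simp add: pos_divide_le_eq)
    then show "\<bar>T k S\<bar> \<le> 2 * C" using le by linarith
    assume "S \<inter> U = {}"
    then have "layer U (e k) \<inter> S = {}" by (auto simp: layer_def)
    then show "T k S = 0" using le by simp
  qed
  \<comment> \<open>A positive part inherits the upper bound of the set function and gives no mass
    to sets disjoint from \<open>U\<close>, hence is carried by the compact set
    \<open>closure U\<close>.\<close>
  have pp: "measure (positive_part \<Omega> s) \<Omega> \<le> 2 * C \<and> (AE x in positive_part \<Omega> s. x \<in> closure U)"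
    if s: "signed_measure_on \<Omega> s" "\<And>S. S \<in> borel_on \<Omega> \<Longrightarrow> s S \<le> 2 * C"
      "\<And>S. S \<in> borel_on \<Omega> \<Longrightarrow> S \<inter> U = {} \<Longrightarrow> s S = 0" for s
  proof
    note R = radon_positive_part[OF \<Omega>b s(1)]
    have "emeasure (positive_part \<Omega> s) \<Omega> \<le> ennreal (2 * C)"
      using R(2)[of \<Omega>] \<Omega>b s(2) by (auto simp: borel_on_iff intro!: SUP_least ennreal_leI)
    then show "measure (positive_part \<Omega> s) \<Omega> \<le> 2 * C"
      using C(1) by (simp add: measure_def enn2real_leI)
    have out: "\<Omega> - closure U \<in> borel_on \<Omega>" using \<Omega>b by (simp add: borel_on_iff)
    have "s B = 0" if "B \<in> borel_on \<Omega>" "B \<subseteq> \<Omega> - closure U" for B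
      by (rule s(3)[OF that(1)]) (use that closure_subset[of U] in blast)
    then have "emeasure (positive_part \<Omega> s) (\<Omega> - closure U) \<le> 0"
      unfolding R(2)[OF out] by (intro SUP_least) simp
    then show "AE x in positive_part \<Omega> s. x \<in> closure U"
      using out by (intro AE_I[of _ _ "\<Omega> - closure U"]) (auto simp: radon_measure_onD[OF R(1)])
  qed
  define P N where "P k = positive_part \<Omega> (T k)" and "N k = positive_part \<Omega> (\<lambda>A. - T k A)" for k
  have P: "radon_measure_on \<Omega> (P k)" and N: "radon_measure_on \<Omega> (N k)" for k
    unfolding P_def N_def by (intro radon_positive_part \<Omega>b T vector_measure_on_uminus)+
  have P2: "AE x in P k. x \<in> closure U" "measure (P k) \<Omega> \<le> 2 * C" for k
    using pp[OF T(1)] T_le T_0 unfolding P_def by (force simp: abs_le_iff)+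
  have N2: "AE x in N k. x \<in> closure U" "measure (N k) \<Omega> \<le> 2 * C" for k
    using pp[OF vector_measure_on_uminus[OF T(1)]] T_le T_0 unfolding N_def by (force simp: abs_le_iff)+
  obtain r1 P' where r1: "strict_mono (r1 :: nat \<Rightarrow> nat)" and P': "radon_measure_on \<Omega> P'"
    and limP: "\<forall>\<phi>\<in>test_functions 0 \<Omega>. (\<lambda>k. integral\<^sup>L (P (r1 k)) \<phi>) \<longlonglongrightarrow> integral\<^sup>L P' \<phi>"
    by (rule weak_star_compact[OF \<Omega>b P UD(2) P2])
  \<comment> \<open>The second subsequence is taken inside the first, so that both Jordan parts
    converge along the composition.\<close>
  obtain r2 N' where r2: "strict_mono (r2 :: nat \<Rightarrow> nat)" and N': "radon_measure_on \<Omega> N'"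
    and limN: "\<forall>\<phi>\<in>test_functions 0 \<Omega>. (\<lambda>k. integral\<^sup>L (N (r1 (r2 k))) \<phi>) \<longlonglongrightarrow> integral\<^sup>L N' \<phi>"
    by (rule weak_star_compact[where M="\<lambda>k. N (r1 k)", OF \<Omega>b N UD(2) N2])
  define \<tau> where "\<tau> S = (if S \<in> borel_on \<Omega> then measure P' S - measure N' S else 0)" for S
  have \<tau>: "signed_measure_on \<Omega> \<tau>"
  proof -
    have m: "signed_measure_on \<Omega> (\<lambda>S. if S \<in> borel_on \<Omega> then measure M S else 0)" if M: "radon_measure_on \<Omega> M" for M
    proof (rule vector_measure_on_of_dominated[OF \<Omega>b M, where c=1])
      interpret finite_measure M using M by (rule radon_measure_onD)
      fix A B assume AB: "A \<in> borel_on \<Omega>" "B \<in> borel_on \<Omega>" "A \<inter> B = {}"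
      moreover from this have "A \<union> B \<in> borel_on \<Omega>" by (auto simp: borel_on_iff)
      ultimately show "(if A \<union> B \<in> borel_on \<Omega> then measure M (A \<union> B) else 0) =
        (if A \<in> borel_on \<Omega> then measure M A else 0) + (if B \<in> borel_on \<Omega> then measure M B else 0)"
        using finite_measure_Union[of A B] by (simp add: radon_measure_onD(2)[OF M])
    qed auto
    have "\<tau> = (\<lambda>S. (if S \<in> borel_on \<Omega> then measure P' S else 0) - (if S \<in> borel_on \<Omega> then measure N' S else 0))"
      by (auto simp: \<tau>_def fun_eq_iff)
    then show ?thesis using vector_measure_on_diff[OF m[OF P'] m[OF N']] by simp
  qed
  have "represents_normal_trace \<Omega> F U \<tau>"
    unfolding represents_normal_trace_def
  proof (intro conjI ballI \<tau>)
    fix \<phi> :: "'a \<Rightarrow> real" assume \<phi>: "\<phi> \<in> test_functions 1 \<Omega>"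
    then have \<phi>0: "\<phi> \<in> test_functions 0 \<Omega>" using test_functions_Suc[of \<phi> 0] by simp
    have \<phi>b: "bounded_borel \<phi>" by (rule test_function_bounded_borel[OF \<phi>])
    have "(\<lambda>k. integral\<^sup>L (P (r1 (r2 k))) \<phi> - integral\<^sup>L (N (r1 (r2 k))) \<phi>) \<longlonglongrightarrow> integral\<^sup>L P' \<phi> - integral\<^sup>L N' \<phi>"
      using LIMSEQ_subseq_LIMSEQ[OF limP[rule_format, OF \<phi>0] r2] limN \<phi>0 by (intro tendsto_diff) (auto simp: o_def)
    moreover have "integral\<^sup>L (P k) \<phi> - integral\<^sup>L (N k) \<phi> = vint \<Omega> F (\<lambda>x. \<phi> x *\<^sub>R grad (\<psi> k) x)" for k
      using sint_eq[OF \<Omega>b T(1), of k \<phi>] T(2)[OF \<phi>b] by (simp add: P_def N_def)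
    moreover have "(\<lambda>k. vint \<Omega> F (\<lambda>x. \<phi> x *\<^sub>R grad (\<psi> (r1 (r2 k))) x)) \<longlonglongrightarrow> normal_trace_distribution \<Omega> F U \<phi>"
      using LIMSEQ_subseq_LIMSEQ[OF normal_trace_distribution_tendsto[OF Ui e(2) \<psi>(1,2,3,6) \<phi>] strict_mono_o[OF r1 r2]]
      by (simp add: o_def)
    ultimately have "normal_trace_distribution \<Omega> F U \<phi> = integral\<^sup>L P' \<phi> - integral\<^sup>L N' \<phi>"
      by (simp add: LIMSEQ_unique)
    also have "\<dots> = sint \<Omega> \<tau> \<phi>"
      by (rule sint_measure_diff[OF \<Omega>b \<tau> P' N' _ \<phi>b, symmetric]) (simp add: \<tau>_def)
    finally show "normal_trace_distribution \<Omega> F U \<phi> = sint \<Omega> \<tau> \<phi>" .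
  qed
  then show ?thesis by (auto simp: has_normal_trace_def)
qed

text \<open>For test functions supported in \<open>U\<close> the trace is the divergence identity
  itself, hence 0; for those supported off \<open>closure U\<close> both integrals over
  \<open>U\<close> vanish.\<close>

lemma normal_trace_supported:
  assumes U: "open_compactly_inside U \<Omega>" and \<tau>: "represents_normal_trace \<Omega> F U \<tau>"
    and S: "S \<in> sets borel" "S \<subseteq> \<Omega>" "S \<inter> frontier U = {}"
  shows "\<tau> S = 0"
proof -
  note UD = open_compactly_insideD[OF U]
  have \<tau>s: "signed_measure_on \<Omega> \<tau>"
    and \<tau>t: "\<And>\<phi>. \<phi> \<in> test_functions 1 \<Omega> \<Longrightarrow> normal_trace_distribution \<Omega> F U \<phi> = sint \<Omega> \<tau> \<phi>"
    using \<tau> by (auto simp: represents_normal_trace_def)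
  have 1: "\<tau> (S \<inter> U) = 0"
  proof (rule signed_measure_zero_of_smooth[OF \<Omega> \<tau>s UD(1,4)])
    fix \<phi> assume \<phi>: "\<phi> \<in> smooth_test_functions U"
    have \<phi>1: "\<phi> \<in> test_functions 1 U" by (rule smooth_test_functions_subset[OF \<phi>])
    have \<phi>\<Omega>: "\<phi> \<in> test_functions 1 \<Omega>" by (rule test_functions_mono[OF \<phi>1 UD(4)])
    have "grad \<phi> x = 0" if "x \<notin> U" for x
      by (rule grad_zero_outside_support) (use test_functionsD(3)[OF \<phi>1] that in blast)
    then have "(\<lambda>x. indicator U x *\<^sub>R grad \<phi> x) = grad \<phi>"
      by (auto simp: fun_eq_iff indicator_def)
    moreover have "(\<lambda>x. indicator U x * \<phi> x) = \<phi>"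
      using test_functionsD(6)[OF \<phi>1] by (auto simp: fun_eq_iff indicator_def)
    ultimately show "sint \<Omega> \<tau> \<phi> = 0"
      using \<tau>t[OF \<phi>\<Omega>] divergence_C1[OF \<Omega> D(1,2) \<phi>\<Omega>] normal_trace_distribution_eq[of U \<phi>] by simp
  qed (use S UD(1) in auto)
  define E where "E = \<Omega> - closure U"
  have E: "open E" "E \<subseteq> \<Omega>" using \<Omega> by (auto simp: E_def)
  have 2: "\<tau> (S \<inter> E) = 0"
  proof (rule signed_measure_zero_of_smooth[OF \<Omega> \<tau>s E])
    fix \<phi> assume \<phi>: "\<phi> \<in> smooth_test_functions E"
    have \<phi>1: "\<phi> \<in> test_functions 1 E" by (rule smooth_test_functions_subset[OF \<phi>])
    have \<phi>\<Omega>: "\<phi> \<in> test_functions 1 \<Omega>" by (rule test_functions_mono[OF \<phi>1 E(2)])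
    have UE: "x \<notin> E" if "x \<in> U" for x using that closure_subset[of U] by (auto simp: E_def)
    have "grad \<phi> x = 0" if "x \<in> U" for x
      by (rule grad_zero_outside_support) (use test_functionsD(3)[OF \<phi>1] UE[OF that] in blast)
    then have "(\<lambda>x. indicator U x *\<^sub>R grad \<phi> x) = (\<lambda>x. 0 *\<^sub>R grad \<phi> x)"
      by (auto simp: fun_eq_iff indicator_def)
    moreover have "(\<lambda>x. indicator U x * \<phi> x) = (\<lambda>x. 0)"
      using test_functionsD(6)[OF \<phi>1] UE by (auto simp: fun_eq_iff indicator_def)
    ultimately have "normal_trace_distribution \<Omega> F U \<phi> = 0"
      using normal_trace_distribution_eq[of U \<phi>] vint_scaleR[OF \<Omega>b D(1), of 0 "grad \<phi>"]
        sint_zero[OF \<Omega>b D(3)] by simp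
    then show "sint \<Omega> \<tau> \<phi> = 0" using \<tau>t[OF \<phi>\<Omega>] by simp
  qed (use S E in auto)
  have "S - U = S \<inter> E" using S UD(1) closure_subset[of U] by (auto simp: E_def frontier_def interior_open)
  then show ?thesis
    using vector_measure_on_Int_Diff[OF \<tau>s S(1), of U] S UD(1) 1 2 by simp
qed

text \<open>A test function equal to 1 near \<open>closure U\<close> plays the part of the constant
  1, because the trace does not charge the complement of the frontier and the gradient vanishes on
  \<open>U\<close>.\<close>

lemma normal_trace_frontier:
  assumes U: "open_compactly_inside U \<Omega>" and \<tau>: "represents_normal_trace \<Omega> F U \<tau>"
  shows "\<tau> (frontier U) = - divergence \<Omega> F U"
proof -
  note UD = open_compactly_insideD[OF U]
  have \<tau>s: "signed_measure_on \<Omega> \<tau>"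
    and \<tau>t: "\<And>\<phi>. \<phi> \<in> test_functions 1 \<Omega> \<Longrightarrow> normal_trace_distribution \<Omega> F U \<phi> = sint \<Omega> \<tau> \<phi>"
    using \<tau> by (auto simp: represents_normal_trace_def)
  obtain \<phi> V where \<phi>: "\<phi> \<in> smooth_test_functions \<Omega>" and V: "open V" "closure U \<subseteq> V" and one: "\<And>x. x \<in> V \<Longrightarrow> \<phi> x = 1"
    by (rule smooth_cutoff[OF UD(2,3) \<Omega>]) blast
  have \<phi>1: "\<phi> \<in> test_functions 1 \<Omega>" by (rule smooth_test_functions_subset[OF \<phi>])
  have \<phi>b: "bounded_borel \<phi>" by (rule test_function_bounded_borel[OF \<phi>1])
  have frb: "frontier U \<in> sets borel" by simp
  have UV: "x \<in> V" if "x \<in> U \<or> x \<in> frontier U" for x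
    using that V(2) closure_subset[of U] by (auto simp: frontier_def)
  have "\<phi> = (\<lambda>x. indicator (frontier U) x + indicator (- frontier U) x * \<phi> x)"
    using one UV by (auto simp: fun_eq_iff indicator_def)
  then have "sint \<Omega> \<tau> \<phi> = sint \<Omega> \<tau> (\<lambda>x. indicator (frontier U) x + indicator (- frontier U) x * \<phi> x)"
    by simp
  also have "\<dots> = sint \<Omega> \<tau> (indicator (frontier U)) + sint \<Omega> \<tau> (\<lambda>x. indicator (- frontier U) x * \<phi> x)"
    by (intro sint_add[OF \<Omega>b \<tau>s] bounded_borel_mult \<phi>b bounded_borel_indicator) auto
  also have "sint \<Omega> \<tau> (\<lambda>x. indicator (- frontier U) x * \<phi> x) = 0"
    by (rule sint_null[OF \<Omega>b \<tau>s _ _ \<phi>b]) (auto intro!: normal_trace_supported[OF U \<tau>])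
  also have "sint \<Omega> \<tau> (indicator (frontier U)) = \<tau> (frontier U)"
    using sint_indicator[OF \<Omega>b \<tau>s frb] UD(6) by (simp add: Int_absorb2)
  finally have "sint \<Omega> \<tau> \<phi> = \<tau> (frontier U)" by simp
  moreover have "normal_trace_distribution \<Omega> F U \<phi> = - divergence \<Omega> F U"
  proof -
    have "grad \<phi> x = 0" if "x \<in> U" for x
      by (rule grad_zero[OF V(1) _ one]) (use UV that in auto)
    then have "(\<lambda>x. indicator U x *\<^sub>R grad \<phi> x) = (\<lambda>x. 0 *\<^sub>R grad \<phi> x)"
      by (auto simp: fun_eq_iff indicator_def)
    moreover have "(\<lambda>x. indicator U x * \<phi> x) = indicator U"
      using one UV by (auto simp: fun_eq_iff indicator_def)
    ultimately show ?thesis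
      using normal_trace_distribution_eq[of U \<phi>] vint_scaleR[OF \<Omega>b D(1), of 0 "grad \<phi>"]
        sint_indicator[OF \<Omega>b D(3), of U] UD(1,4) by (simp add: Int_absorb2)
  qed
  ultimately show ?thesis using \<tau>t[OF \<phi>1] by simp
qed

text \<open>A test function supported in \<open>A\<close> sees \<open>U\<close> and
  \<open>U'\<close> only through their common part in \<open>A\<close>.\<close>

lemma normal_trace_local:
  assumes U: "open_compactly_inside U \<Omega>" and \<tau>: "represents_normal_trace \<Omega> F U \<tau>"
    and U': "open_compactly_inside U' \<Omega>" and \<tau>': "represents_normal_trace \<Omega> F U' \<tau>'"
    and A: "open A" "A \<subseteq> \<Omega>" "A \<inter> U = A \<inter> U'"
    and S: "S \<in> sets borel" "S \<subseteq> A"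
  shows "\<tau> S = \<tau>' S"
proof (rule signed_measure_eq_of_smooth[OF \<Omega> _ _ A(1,2) _ S])
  show "signed_measure_on \<Omega> \<tau>" "signed_measure_on \<Omega> \<tau>'"
    using \<tau> \<tau>' by (auto simp: represents_normal_trace_def)
  fix \<phi> assume \<phi>: "\<phi> \<in> smooth_test_functions A"
  have \<phi>1: "\<phi> \<in> test_functions 1 A" by (rule smooth_test_functions_subset[OF \<phi>])
  have \<phi>\<Omega>: "\<phi> \<in> test_functions 1 \<Omega>" by (rule test_functions_mono[OF \<phi>1 A(2)])
  have g: "grad \<phi> x = 0" if "x \<notin> A" for x
    by (rule grad_zero_outside_support) (use test_functionsD(3)[OF \<phi>1] that in blast)
  have iff: "x \<in> U \<longleftrightarrow> x \<in> U'" if "x \<in> A" for x using A(3) that by blast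
  have "(\<lambda>x. indicator U x *\<^sub>R grad \<phi> x) = (\<lambda>x. indicator U' x *\<^sub>R grad \<phi> x)"
  proof
    show "indicator U x *\<^sub>R grad \<phi> x = indicator U' x *\<^sub>R grad \<phi> x" for x
      using g[of x] iff[of x] by (cases "x \<in> A") (simp_all add: indicator_def)
  qed
  moreover have "(\<lambda>x. indicator U x * \<phi> x) = (\<lambda>x. indicator U' x * \<phi> x)"
  proof
    show "indicator U x * \<phi> x = indicator U' x * \<phi> x" for x
      using test_functionsD(6)[OF \<phi>1, of x] iff[of x] by (cases "x \<in> A") (simp_all add: indicator_def)
  qed
  ultimately have "normal_trace_distribution \<Omega> F U \<phi> = normal_trace_distribution \<Omega> F U' \<phi>"
    by (simp add: normal_trace_distribution_eq)
  then show "sint \<Omega> \<tau> \<phi> = sint \<Omega> \<tau>' \<phi>"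
    using \<tau> \<tau>' \<phi>\<Omega> by (simp add: represents_normal_trace_def)
qed

text \<open>The two prescriptions overlap only at \<open>S = frontier U\<close> when the trace is a
  measure, and there \<open>normal_trace_frontier\<close> makes them agree.\<close>

theorem flux_of_field_exists: "\<exists>\<F>. flux_of_field \<Omega> F \<F>"
proof -
  define \<F> where "\<F> U S = (if has_normal_trace \<Omega> F U then normal_trace \<Omega> F U S else normal_trace_one \<Omega> F U)" for U S
  have "flux_of_field \<Omega> F \<F>"
    unfolding flux_of_field_def
  proof (intro allI impI conjI)
    fix U assume U: "open_compactly_inside U \<Omega>"
    show "\<F> U (frontier U) = normal_trace_one \<Omega> F U"
    proof (cases "has_normal_trace \<Omega> F U")
      case True
      then obtain \<tau> where \<tau>: "represents_normal_trace \<Omega> F U \<tau>" by (auto simp: has_normal_trace_def)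
      then show ?thesis
        using True normal_trace_frontier[OF U \<tau>] normal_trace_eq[OF \<Omega> \<tau>] by (simp add: \<F>_def normal_trace_one_def)
    qed (simp add: \<F>_def)
  qed (simp add: \<F>_def)
  then show ?thesis by blast
qed

theorem cauchy_flux_of_field:
  assumes \<F>: "flux_of_field \<Omega> F \<F>"
  shows "cauchy_flux \<Omega> \<F> (\<lambda>A. - divergence \<Omega> F A) (variation \<Omega> F)"
proof -
  note V = radon_variation[OF \<Omega>b D(1)]
  have tr: "open_compactly_inside U \<Omega>" "represents_normal_trace \<Omega> F U (normal_trace \<Omega> F U)"
      "\<And>S. S \<in> sets borel \<Longrightarrow> S \<subseteq> frontier U \<Longrightarrow> \<F> U S = normal_trace \<Omega> F U S"
    if U: "U \<in> O_class \<Omega> (variation \<Omega> F)" for U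
  proof -
    show Ui: "open_compactly_inside U \<Omega>" using U by (simp add: O_class_def)
    have h: "has_normal_trace \<Omega> F U" by (rule has_normal_trace_O_class[OF U])
    then obtain \<tau> where \<tau>: "represents_normal_trace \<Omega> F U \<tau>" by (auto simp: has_normal_trace_def)
    then show "represents_normal_trace \<Omega> F U (normal_trace \<Omega> F U)" by (simp add: normal_trace_eq[OF \<Omega> \<tau>])
    show "\<F> U S = normal_trace \<Omega> F U S" if "S \<in> sets borel" "S \<subseteq> frontier U" for S
      using h Ui \<F> that by (simp add: flux_of_field_def)
  qed
  show ?thesis
    unfolding cauchy_flux_def
  proof (intro conjI allI impI ballI)
    show "signed_measure_on \<Omega> (\<lambda>A. - divergence \<Omega> F A)" by (rule vector_measure_on_uminus[OF D(3)])
    show "radon_measure_on \<Omega> (variation \<Omega> F)" by (rule V(1))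
    show "\<F> U (frontier U) = - divergence \<Omega> F U" if "open_compactly_inside U \<Omega>" for U
      using \<F> that by (simp add: flux_of_field_def normal_trace_one_def)
  next
    fix U S T assume *: "U \<in> O_class \<Omega> (variation \<Omega> F)" "S \<in> sets borel" "T \<in> sets borel"
      "S \<subseteq> frontier U" "T \<subseteq> frontier U" "S \<inter> T = {}"
    have fr: "frontier U \<subseteq> \<Omega>" by (rule open_compactly_insideD(6)[OF tr(1)[OF *(1)]])
    have r: "signed_measure_on \<Omega> (normal_trace \<Omega> F U)"
      using tr(2)[OF *(1)] by (simp add: represents_normal_trace_def)
    have "normal_trace \<Omega> F U (S \<union> T) = normal_trace \<Omega> F U S + normal_trace \<Omega> F U T"
      by (rule vector_measure_on_Un[OF r]) (use * fr in auto)
    moreover have "S \<union> T \<in> sets borel" "S \<union> T \<subseteq> frontier U" using * by auto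
    ultimately show "\<F> U (S \<union> T) = \<F> U S + \<F> U T"
      using tr(3)[OF *(1)] * by simp
  next
    fix U U' A assume *: "U \<in> O_class \<Omega> (variation \<Omega> F)" "U' \<in> O_class \<Omega> (variation \<Omega> F)"
      "open A" "A \<subseteq> \<Omega>" "A \<inter> U = A \<inter> U'"
    have fr: "A \<inter> frontier U = A \<inter> frontier U'" by (rule frontier_local[OF *(3,5)])
    have sets: "A \<inter> frontier U \<in> sets borel" "A \<inter> frontier U' \<in> sets borel"
      by (intro sets.Int borel_open[OF *(3)] borel_closed frontier_closed)+
    note t1 = tr(1,2)[OF *(1)] tr(3)[OF *(1) sets(1) Int_lower2]
      and t2 = tr(1,2)[OF *(2)] tr(3)[OF *(2) sets(2) Int_lower2]
    have "normal_trace \<Omega> F U (A \<inter> frontier U) = normal_trace \<Omega> F U' (A \<inter> frontier U)"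
      by (rule normal_trace_local[OF t1(1,2) t2(1,2) *(3,4,5) sets(1)]) simp
    then show "\<F> U (A \<inter> frontier U) = \<F> U' (A \<inter> frontier U')"
      unfolding t1(3) t2(3) by (simp only: fr)
  next
    fix U \<nu> S assume *: "U \<in> O_class \<Omega> (variation \<Omega> F)" "layer_limit \<Omega> (variation \<Omega> F) U \<nu>"
      "S \<in> sets borel" "S \<subseteq> frontier U"
    have \<nu>: "radon_measure_on \<Omega> \<nu>" using *(2) by (simp add: layer_limit_def)
    note t1 = tr(1,2)[OF *(1)] tr(3)[OF *(1,3,4)]
    have fr: "frontier U \<subseteq> \<Omega>" by (rule open_compactly_insideD(6)[OF t1(1)])
    have r: "signed_measure_on \<Omega> (normal_trace \<Omega> F U)"
      "\<And>\<phi>. \<phi> \<in> test_functions 1 \<Omega> \<Longrightarrow> normal_trace_distribution \<Omega> F U \<phi> = sint \<Omega> (normal_trace \<Omega> F U) \<phi>"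
      using t1(2) unfolding represents_normal_trace_def by blast+
    have "\<bar>normal_trace \<Omega> F U S\<bar> \<le> measure \<nu> S"
    proof (rule signed_measure_dominated_of_smooth[OF \<Omega> r(1) \<nu>])
      fix \<phi> assume "\<phi> \<in> smooth_test_functions \<Omega>"
      then have \<phi>: "\<phi> \<in> test_functions 1 \<Omega>" by (rule smooth_test_functions_subset)
      show "\<bar>sint \<Omega> (normal_trace \<Omega> F U) \<phi>\<bar> \<le> (\<integral>x. \<bar>\<phi> x\<bar> \<partial>\<nu>)"
        using normal_trace_layer_limit_bound[OF t1(1) *(2) \<phi>] unfolding r(2)[OF \<phi>] .
    qed (use *(3,4) fr in \<open>simp add: borel_on_iff\<close>)
    then show "\<bar>\<F> U S\<bar> \<le> measure \<nu> S" unfolding t1(3) .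
  qed
qed

end

section \<open>Open sets with thin boundary layers\<close>

definition closed_layer :: "'a::euclidean_space set \<Rightarrow> real \<Rightarrow> 'a set" where
  "closed_layer U e = {x \<in> U. infdist x (frontier U) \<le> e}"

lemma layer_subset_closed_layer: "layer U e \<subseteq> closed_layer U e"
  using layer_subset by (simp add: closed_layer_def)

lemma closed_layer_subset: "closed_layer U e \<subseteq> U"
  by (auto simp: closed_layer_def)

lemma borel_closed_layer: "open U \<Longrightarrow> closed_layer U e \<in> sets borel"
  unfolding closed_layer_def by (rule closed_layer_borel)

text \<open>A nearest frontier point \<open>y\<close> of the superlevel set lies either on
  \<open>frontier U\<close>, and \<open>x\<close> is in the layer of \<open>U\<close>, or inside
  \<open>U\<close>, where \<open>\<phi> y = t\<close> and the Lipschitz bound places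
  \<open>\<phi> x\<close> in a slab just above \<open>t\<close>. The geometry of a superlevel set
  thus enters only through slabs of \<phi>, which Fubini can integrate over
  \<open>t\<close>.\<close>

lemma superlevel_layer:
  fixes \<phi> :: "'a::euclidean_space \<Rightarrow> real"
  assumes U: "open U" "bounded U" and L: "L-lipschitz_on UNIV \<phi>"
    and x: "x \<in> closed_layer (U \<inter> {x. \<phi> x > t}) e"
  shows "x \<in> closed_layer U e \<or> 0 < \<phi> x - t \<and> \<phi> x - t \<le> L * e"
proof -
  define V where "V = U \<inter> {x. \<phi> x > t}"
  have \<phi>c: "continuous_on UNIV \<phi>" using L by (rule lipschitz_on_continuous_on)
  have "open {x. \<phi> x > t}" by (intro open_Collect_less continuous_on_const \<phi>c)
  then have V: "open V" "bounded V" using U by (auto simp: V_def intro: bounded_Int)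
  have xV: "x \<in> V" "infdist x (frontier V) \<le> e" using x by (auto simp: closed_layer_def V_def)
  have "V \<noteq> UNIV" using V not_bounded_UNIV by auto
  then have "frontier V \<noteq> {}" using frontier_eq_empty[of V] xV by auto
  then obtain y where y: "y \<in> frontier V" "infdist x (frontier V) = dist x y"
    using infdist_attains_inf[OF frontier_closed] by metis
  have "y \<in> closure V" "y \<notin> V" using y(1) V by (auto simp: frontier_def interior_open)
  moreover have "closure V \<subseteq> closure U \<inter> {x. \<phi> x \<ge> t}"
    using closed_Collect_le[OF continuous_on_const \<phi>c, of t] closure_subset[of U]
    by (intro closure_minimal closed_Int) (auto simp: V_def)
  ultimately have y2: "y \<in> closure U" "\<phi> y \<ge> t" "y \<in> U \<longrightarrow> \<phi> y \<le> t" by (auto simp: V_def)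
  show ?thesis
  proof (cases "y \<in> U")
    case False
    then have "y \<in> frontier U" using y2 U by (simp add: frontier_def interior_open)
    then have "infdist x (frontier U) \<le> e" using infdist_le[of y "frontier U" x] y(2) xV by simp
    then show ?thesis using xV by (simp add: V_def closed_layer_def)
  next
    case True
    then have "\<phi> y = t" using y2 by simp
    moreover have "dist (\<phi> x) (\<phi> y) \<le> L * dist x y" by (rule lipschitz_onD[OF L]) auto
    moreover have "L * dist x y \<le> L * e"
      using y xV lipschitz_on_nonneg[OF L] by (intro mult_left_mono) auto
    moreover have "\<phi> x > t" using xV by (simp add: V_def)
    ultimately show ?thesis by (simp add: dist_real_def)
  qed
qed

lemma liminf_subsequence:
  fixes q :: "nat \<Rightarrow> ennreal"
  assumes "liminf q < c"
  obtains r where "strict_mono (r :: nat \<Rightarrow> nat)" "\<forall>k. q (r k) < c"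
proof -
  have "\<not> (\<forall>\<^sub>F k in sequentially. c \<le> q k)"
    using Liminf_bounded[of c q sequentially] assms by (auto simp: not_le[symmetric])
  then have "infinite {k. q k < c}"
    by (auto simp: eventually_sequentially infinite_nat_iff_unbounded_le not_le)
  then show ?thesis
    using that[of "enumerate {k. q k < c}"] strict_mono_enumerate enumerate_in_set by blast
qed

lemma infdist_lipschitz: "1-lipschitz_on UNIV (\<lambda>x::'a::metric_space. infdist x A)"
  by (rule lipschitz_onI) (simp_all add: infdist_triangle_abs dist_real_def)

lemma bounded_Compl_nonempty: "bounded U \<Longrightarrow> - U \<noteq> {}" for U :: "'a::euclidean_space set"
  using not_bounded_UNIV[where 'a='a] by (cases "U = UNIV") auto

lemma AE_lborel_interval:
  assumes "AE t in lborel. P t" "a < (b::real)"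
  obtains t where "a < t" "t < b" "P t"
proof -
  have "\<not> (\<forall>t\<in>{a<..<b}. \<not> P t)"
  proof
    assume h: "\<forall>t\<in>{a<..<b}. \<not> P t"
    have "AE t in lborel. t \<notin> {a<..<b}" using assms(1) by eventually_elim (use h in blast)
    then have "emeasure lborel {a<..<b} = 0"
      using AE_iff_measurable[of "{a<..<b}" lborel "\<lambda>t. t \<notin> {a<..<b}"] by (simp add: greaterThanLessThan_def greaterThan_def lessThan_def Int_def)
    then show False using assms(2) by simp
  qed
  then show ?thesis using that by auto
qed

lemma open_compactly_inside_subset:
  "open_compactly_inside U \<Omega> \<Longrightarrow> V \<subseteq> U \<Longrightarrow> open V \<Longrightarrow> open_compactly_inside V \<Omega>"
  using closure_mono[of V U] compact_closure bounded_subset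
  unfolding open_compactly_inside_def by (metis compact_Int_closed closed_closure inf.absorb2 order_trans)

lemma empty_O_class: "{} \<in> O_class \<Omega> \<mu>"
  by (simp add: O_class_def open_compactly_inside_def Liminf_const)

lemma O_classD: "U \<in> O_class \<Omega> \<mu> \<Longrightarrow> open_compactly_inside U \<Omega>"
  by (simp add: O_class_def)

lemma open_superlevel:
  fixes \<phi> :: "'a::metric_space \<Rightarrow> real"
  assumes "open U" "L-lipschitz_on UNIV \<phi>"
  shows "open (U \<inter> {x. \<phi> x > t})"
  by (intro open_Int assms(1) open_Collect_less continuous_on_const lipschitz_on_continuous_on[OF assms(2)])

lemma frontier_superlevel_subset:
  fixes \<phi> :: "'a::metric_space \<Rightarrow> real"
  assumes "L-lipschitz_on UNIV \<phi>"
  shows "frontier (U \<inter> {x. \<phi> x > t}) \<subseteq> closure U \<inter> {x. \<phi> x \<ge> t}"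
proof -
  have "closure (U \<inter> {x. \<phi> x > t}) \<subseteq> closure U \<inter> {x. \<phi> x \<ge> t}"
    by (intro closure_minimal closed_Int closed_closure closed_Collect_le continuous_on_const
        lipschitz_on_continuous_on[OF assms]) (use closure_subset[of U] in auto)
  then show ?thesis by (auto simp: frontier_def)
qed

lemma slice_support:
  fixes \<phi> :: "'a::euclidean_space \<Rightarrow> real"
  assumes "open U" "L-lipschitz_on UNIV \<phi>"
  shows "U \<inter> frontier (U \<inter> {x. \<phi> x > t}) \<subseteq> {x. \<phi> x = t}"
proof
  fix x assume x: "x \<in> U \<inter> frontier (U \<inter> {x. \<phi> x > t})"
  have "x \<notin> U \<inter> {x. \<phi> x > t}"
    using x interior_open[OF open_superlevel[OF assms, of t]] unfolding frontier_def by blast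
  moreover have "\<phi> x \<ge> t" using x frontier_superlevel_subset[OF assms(2), of U t] by blast
  ultimately show "x \<in> {x. \<phi> x = t}" using x by auto
qed

lemma lipschitz_bounded_on:
  fixes \<phi> :: "'a::euclidean_space \<Rightarrow> real"
  assumes "compact K" "L-lipschitz_on UNIV \<phi>"
  obtains R where "R \<ge> 0" "\<forall>x\<in>K. \<bar>\<phi> x\<bar> < R"
proof -
  have "compact (\<phi> ` K)"
    by (rule compact_continuous_image[OF continuous_on_subset[OF lipschitz_on_continuous_on[OF assms(2)]] assms(1)]) simp
  then obtain b where "b > 0" "\<forall>y\<in>\<phi> ` K. norm y \<le> b" using compact_imp_bounded bounded_pos by metis
  then show ?thesis by (intro that[of "b + 1"]) force+
qed

section \<open>Layer-cake formulas and gluing of measures\<close>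

text \<open>Cavalieri's principle for a function of either sign: the levels from \<open>-R\<close>
  up to \<open>f x\<close> have length \<open>f x + R\<close>, which accounts for the added
  constant.\<close>

lemma layer_cake_radon:
  fixes f :: "'a::topological_space \<Rightarrow> real"
  assumes \<Omega>: "\<Omega> \<in> sets borel" and P: "radon_measure_on \<Omega> P" and f: "f \<in> borel_measurable borel"
    and R: "\<And>x. \<bar>f x\<bar> \<le> R"
  shows "integrable lborel (\<lambda>t. indicator {-R..R} t * measure P {x \<in> \<Omega>. f x > t})"
    and "(\<integral>t. indicator {-R..R} t * measure P {x \<in> \<Omega>. f x > t} \<partial>lborel) = (\<integral>x. f x + R \<partial>P)"
proof -
  interpret P: finite_measure P using P by (rule radon_measure_onD)
  interpret pair: pair_sigma_finite lborel P ..
  note D = radon_measure_onD[OF P]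
  have [measurable]: "f \<in> borel_measurable P" by (rule radon_measurable[OF P \<Omega> f])
  have fb: "bounded_borel f" by (rule bounded_borelI[OF f, where C=R]) (simp add: R)
  have Ri: "integrable P (\<lambda>x. f x + R)"
    by (intro Bochner_Integration.integrable_add radon_integrable[OF P \<Omega> fb] P.integrable_const)
  have R0: "0 \<le> f x + R" for x using R[of x] by simp
  define k where "k t x = (indicator {-R..R} t * indicator {t<..} (f x) :: ennreal)" for t x
  have km: "(\<lambda>(t, x). k t x) \<in> borel_measurable (lborel \<Otimes>\<^sub>M P)"
  proof -
    have "(\<lambda>(t, x). k t x) = (\<lambda>p. indicator {-R..R} (fst p) * (if fst p < f (snd p) then 1 else 0))"
      by (auto simp: k_def indicator_def fun_eq_iff)
    then show ?thesis by simp
  qed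
  define m where "m t = indicator {-R..R} t * measure P {x \<in> \<Omega>. f x > t}" for t
  have in1: "(\<integral>\<^sup>+x. k t x \<partial>P) = ennreal (m t)" for t
  proof -
    have "{x \<in> \<Omega>. f x > t} = f -` {t<..} \<inter> space P" by (auto simp: D)
    then have m1: "{x \<in> \<Omega>. f x > t} \<in> sets P" using measurable_sets[OF \<open>f \<in> borel_measurable P\<close>, of "{t<..}"] by simp
    have "(\<integral>\<^sup>+x. k t x \<partial>P) = indicator {-R..R} t * (\<integral>\<^sup>+x. indicator {t<..} (f x) \<partial>P)"
      unfolding k_def by (rule nn_integral_cmult) simp
    also have "(\<integral>\<^sup>+x. indicator {t<..} (f x) \<partial>P) = (\<integral>\<^sup>+x. indicator {x \<in> \<Omega>. f x > t} x \<partial>P)"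
      by (rule nn_integral_cong) (auto simp: D indicator_def)
    also have "\<dots> = emeasure P {x \<in> \<Omega>. f x > t}" by (rule nn_integral_indicator[OF m1])
    finally show ?thesis by (simp add: m_def P.emeasure_eq_measure indicator_def)
  qed
  have mm: "m \<in> borel_measurable lborel"
  proof -
    have "(\<lambda>t. \<integral>\<^sup>+x. k t x \<partial>P) \<in> borel_measurable lborel" using P.borel_measurable_nn_integral[OF km] by simp
    then have "(\<lambda>t. enn2real (ennreal (m t))) \<in> borel_measurable lborel"
      unfolding in1 by (rule borel_measurable_enn2real)
    moreover have "m t \<ge> 0" for t by (simp add: m_def)
    ultimately show ?thesis by simp
  qed
  have "(\<integral>\<^sup>+t. ennreal (m t) \<partial>lborel) = (\<integral>\<^sup>+x. \<integral>\<^sup>+t. k t x \<partial>lborel \<partial>P)"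
    unfolding in1[symmetric] by (rule pair.Fubini'[OF km, symmetric])
  also have "\<dots> = (\<integral>\<^sup>+x. ennreal (f x + R) \<partial>P)"
  proof (rule nn_integral_cong)
    fix x
    have "k t x = indicator {-R..<f x} t" for t using R[of x] by (auto simp: k_def indicator_def)
    then show "(\<integral>\<^sup>+t. k t x \<partial>lborel) = ennreal (f x + R)" using R0[of x] by simp
  qed
  also have "\<dots> = ennreal (\<integral>x. f x + R \<partial>P)"
    by (rule nn_integral_eq_integral[OF Ri]) (simp add: R0)
  finally have eq: "(\<integral>\<^sup>+t. ennreal (m t) \<partial>lborel) = ennreal (\<integral>x. f x + R \<partial>P)" .
  have "integrable lborel m \<and> integral\<^sup>L lborel m = (\<integral>x. f x + R \<partial>P)"
    using nn_integral_eq_integrable[OF mm, of "\<integral>x. f x + R \<partial>P"] eq R0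
    by (simp add: m_def)
  then show "integrable lborel (\<lambda>t. indicator {-R..R} t * measure P {x \<in> \<Omega>. f x > t})"
    and "(\<integral>t. indicator {-R..R} t * measure P {x \<in> \<Omega>. f x > t} \<partial>lborel) = (\<integral>x. f x + R \<partial>P)"
    by (simp_all add: m_def[abs_def])
qed

text \<open>Total mass 0 kills the constant \<open>R\<close> of the unsigned formula. It also makes
  levels below \<open>-R\<close> contribute nothing, so the integral can run over the whole line.
  Cutting \<phi> off outside the carrier \<open>K\<close> makes it bounded.\<close>

lemma layer_cake_signed:
  fixes \<phi> :: "'a::topological_space \<Rightarrow> real"
  assumes \<Omega>: "\<Omega> \<in> sets borel" and s: "signed_measure_on \<Omega> s" and s0: "s \<Omega> = 0"
    and K: "K \<in> sets borel" "\<And>S. S \<in> borel_on \<Omega> \<Longrightarrow> s S = s (S \<inter> K)"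
    and \<phi>: "\<phi> \<in> borel_measurable borel" and R: "R \<ge> 0" "\<And>x. x \<in> K \<Longrightarrow> \<bar>\<phi> x\<bar> \<le> R"
  shows "integrable lborel (\<lambda>t. s {x \<in> \<Omega>. \<phi> x > t})"
    and "(\<integral>t. s {x \<in> \<Omega>. \<phi> x > t} \<partial>lborel) = sint \<Omega> s (\<lambda>x. indicator K x * \<phi> x)"
proof -
  define P N where "P = positive_part \<Omega> s" and "N = positive_part \<Omega> (\<lambda>A. - s A)"
  have P: "radon_measure_on \<Omega> P" unfolding P_def by (rule radon_positive_part(1)[OF \<Omega> s])
  have N: "radon_measure_on \<Omega> N" unfolding N_def by (rule radon_positive_part(1)[OF \<Omega> vector_measure_on_uminus[OF s]])
  define f where "f x = indicator K x * \<phi> x" for x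
  have fm: "f \<in> borel_measurable borel" unfolding f_def[abs_def] using K(1) \<phi> by simp
  have fR: "\<bar>f x\<bar> \<le> R" for x using R by (auto simp: f_def indicator_def)
  have B: "{x \<in> \<Omega>. h x > t} \<in> borel_on \<Omega>" if "h \<in> borel_measurable borel" for h and t :: real
  proof -
    have "{x \<in> \<Omega>. h x > t} = \<Omega> \<inter> h -` {t<..}" by auto
    then show ?thesis using \<Omega> measurable_sets[OF that, of "{t<..}"] by (auto simp: borel_on_iff)
  qed
  have eq: "s {x \<in> \<Omega>. \<phi> x > t} = indicator {-R..R} t * measure P {x \<in> \<Omega>. f x > t} - indicator {-R..R} t * measure N {x \<in> \<Omega>. f x > t}" for t
  proof (cases "t \<in> {-R..R}")
    case True
    have "s {x \<in> \<Omega>. \<phi> x > t} = s ({x \<in> \<Omega>. \<phi> x > t} \<inter> K)" by (rule K(2)[OF B[OF \<phi>]])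
    also have "{x \<in> \<Omega>. \<phi> x > t} \<inter> K = {x \<in> \<Omega>. f x > t} \<inter> K" by (auto simp: f_def)
    also have "s \<dots> = s {x \<in> \<Omega>. f x > t}" by (rule K(2)[OF B[OF fm], symmetric])
    also have "\<dots> = measure P {x \<in> \<Omega>. f x > t} - measure N {x \<in> \<Omega>. f x > t}"
      unfolding P_def N_def by (rule Jordan_decomposition[OF \<Omega> s B[OF fm]])
    finally show ?thesis using True by simp
  next
    case False
    have \<Omega>B: "\<Omega> \<in> borel_on \<Omega>" using \<Omega> by (simp add: borel_on_iff)
    have "s {x \<in> \<Omega>. \<phi> x > t} = s ({x \<in> \<Omega>. \<phi> x > t} \<inter> K)" by (rule K(2)[OF B[OF \<phi>]])
    also have "\<dots> = 0"
    proof (cases "t > R")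
      case True
      then have "{x \<in> \<Omega>. \<phi> x > t} \<inter> K = {}" using R(2) by force
      then show ?thesis by (simp add: vector_measure_on_empty[OF s])
    next
      case tR: False
      then have "t < -R" using False by auto
      then have "{x \<in> \<Omega>. \<phi> x > t} \<inter> K = \<Omega> \<inter> K" using R(2) by force
      then show ?thesis using K(2)[OF \<Omega>B] s0 by simp
    qed
    finally show ?thesis using False by simp
  qed
  have fb: "bounded_borel f" by (rule bounded_borelI[OF fm, where C=R]) (simp add: fR)
  have cb: "bounded_borel (\<lambda>x. R)" by (simp add: bounded_borel_const)
  have "sint \<Omega> s (\<lambda>x. R) = R * sint \<Omega> s (\<lambda>x. 1)" using sint_cmult[OF \<Omega> s, of R "\<lambda>x. 1"] by simp
  also have "sint \<Omega> s (\<lambda>x. 1) = sint \<Omega> s (indicator UNIV)" by (rule sint_cong[OF \<Omega> s]) simp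
  also have "\<dots> = 0" using sint_indicator[OF \<Omega> s, of UNIV] s0 by simp
  finally have sR: "sint \<Omega> s (\<lambda>x. R) = 0" by simp
  show "integrable lborel (\<lambda>t. s {x \<in> \<Omega>. \<phi> x > t})"
    unfolding eq by (intro Bochner_Integration.integrable_diff layer_cake_radon(1)[OF \<Omega> P fm fR] layer_cake_radon(1)[OF \<Omega> N fm fR])
  have "(\<integral>t. s {x \<in> \<Omega>. \<phi> x > t} \<partial>lborel) = (\<integral>x. f x + R \<partial>P) - (\<integral>x. f x + R \<partial>N)"
    unfolding eq by (simp add: Bochner_Integration.integral_diff[OF layer_cake_radon(1)[OF \<Omega> P fm fR] layer_cake_radon(1)[OF \<Omega> N fm fR]]
      layer_cake_radon(2)[OF \<Omega> P fm fR] layer_cake_radon(2)[OF \<Omega> N fm fR])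
  also have "\<dots> = sint \<Omega> s (\<lambda>x. f x + R)" by (simp add: sint_eq[OF \<Omega> s] P_def N_def)
  also have "\<dots> = sint \<Omega> s f" unfolding sint_add[OF \<Omega> s fb cb] sR by simp
  finally show "(\<integral>t. s {x \<in> \<Omega>. \<phi> x > t} \<partial>lborel) = sint \<Omega> s (\<lambda>x. indicator K x * \<phi> x)" by (simp add: f_def[abs_def])
qed

text \<open>Domination by one finite measure makes \<open>\<Phi> n (S \<inter> B n)\<close> a Cauchy
  sequence, since what is missing lies in \<open>\<Omega> - B n\<close>, and also makes the limit
  countably additive.\<close>

lemma signed_measure_glue:
  fixes \<Phi> :: "nat \<Rightarrow> 'a::topological_space set \<Rightarrow> real"
  assumes \<Omega>: "\<Omega> \<in> sets borel" and V: "radon_measure_on \<Omega> V" and \<Phi>: "\<And>n. signed_measure_on \<Omega> (\<Phi> n)"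
    and B: "incseq B" "\<And>n. B n \<in> borel_on \<Omega>" "(\<Union>n. B n) = \<Omega>"
    and agree: "\<And>m n S. m \<le> n \<Longrightarrow> S \<in> sets borel \<Longrightarrow> S \<subseteq> B m \<Longrightarrow> \<Phi> m S = \<Phi> n S"
    and dom: "\<And>n S. S \<in> borel_on \<Omega> \<Longrightarrow> \<bar>\<Phi> n S\<bar> \<le> c * measure V S"
  obtains \<Psi> where "signed_measure_on \<Omega> \<Psi>" "\<forall>S\<in>borel_on \<Omega>. \<bar>\<Psi> S\<bar> \<le> c * measure V S"
    "\<forall>n S. S \<in> sets borel \<longrightarrow> S \<subseteq> B n \<longrightarrow> \<Psi> S = \<Phi> n S"
proof -
  interpret finite_measure V using V by (rule radon_measure_onD)
  note VS = radon_measure_onD(2)[OF V]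
  define \<Psi> where "\<Psi> S = (if S \<in> borel_on \<Omega> then lim (\<lambda>n. \<Phi> n (S \<inter> B n)) else 0)" for S
  have SB: "S \<inter> B n \<in> borel_on \<Omega>" "S - B n \<in> borel_on \<Omega>" if "S \<in> borel_on \<Omega>" for S n
    using that B(2)[of n] by (auto simp: borel_on_iff)
  have tail: "(\<lambda>n. measure V (\<Omega> - B n)) \<longlonglongrightarrow> 0"
  proof -
    have "\<Omega> - B n \<in> sets V" for n using \<Omega> B(2)[of n] by (auto simp: VS borel_on_iff)
    moreover have "decseq (\<lambda>n. \<Omega> - B n)" using B(1) by (auto simp: decseq_def incseq_def)
    ultimately have "(\<lambda>n. measure V (\<Omega> - B n)) \<longlonglongrightarrow> measure V (\<Inter>n. \<Omega> - B n)"
      by (intro finite_Lim_measure_decseq) auto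
    moreover have "(\<Inter>n. \<Omega> - B n) = {}" using B(3) by auto
    ultimately show ?thesis by (simp only: measure_empty)
  qed
  have lim: "(\<lambda>n. \<Phi> n (S \<inter> B n)) \<longlonglongrightarrow> \<Psi> S" if S: "S \<in> borel_on \<Omega>" for S
  proof -
    have est: "\<bar>\<Phi> n (S \<inter> B n) - \<Phi> m (S \<inter> B m)\<bar> \<le> \<bar>c\<bar> * measure V (\<Omega> - B m)" if "m \<le> n" for m n
    proof -
      have "\<Phi> m (S \<inter> B m) = \<Phi> n (S \<inter> B m)" by (rule agree[OF that]) (use SB(1)[OF S] in \<open>auto simp: borel_on_iff\<close>)
      moreover have "\<Phi> n (S \<inter> B n - S \<inter> B m) = \<Phi> n (S \<inter> B n) - \<Phi> n (S \<inter> B m)"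
        by (rule vector_measure_on_Diff[OF \<Phi>]) (use SB(1)[OF S] incseqD[OF B(1) that] in \<open>auto simp: borel_on_iff\<close>)
      moreover have "\<bar>\<Phi> n (S \<inter> B n - S \<inter> B m)\<bar> \<le> c * measure V (S \<inter> B n - S \<inter> B m)"
        by (rule dom) (use SB(1)[OF S] in \<open>auto simp: borel_on_iff\<close>)
      moreover have "c * measure V (S \<inter> B n - S \<inter> B m) \<le> \<bar>c\<bar> * measure V (S \<inter> B n - S \<inter> B m)"
        by (intro mult_right_mono) auto
      moreover have "\<bar>c\<bar> * measure V (S \<inter> B n - S \<inter> B m) \<le> \<bar>c\<bar> * measure V (\<Omega> - B m)"
        by (intro mult_left_mono finite_measure_mono) (use S \<Omega> B(2)[of m] in \<open>auto simp: VS borel_on_iff\<close>)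
      ultimately show ?thesis by linarith
    qed
    have "Cauchy (\<lambda>n. \<Phi> n (S \<inter> B n))"
    proof (rule CauchyI')
      fix e :: real assume "e > 0"
      have "(\<lambda>n. \<bar>c\<bar> * measure V (\<Omega> - B n)) \<longlonglongrightarrow> \<bar>c\<bar> * 0" by (intro tendsto_mult tendsto_const tail)
      then have "\<forall>\<^sub>F n in sequentially. \<bar>c\<bar> * measure V (\<Omega> - B n) < e" using \<open>e > 0\<close> by (intro order_tendstoD(2)) auto
      then obtain M where "\<bar>c\<bar> * measure V (\<Omega> - B n) < e" if "n \<ge> M" for n by (auto simp: eventually_sequentially)
      then have "\<bar>\<Phi> m (S \<inter> B m) - \<Phi> n (S \<inter> B n)\<bar> < e" if "m \<ge> M" "n > m" for m n
        using est[OF less_imp_le[OF that(2)]] that(1)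
        by (subst abs_minus_commute) (rule le_less_trans)
      then show "\<exists>M. \<forall>m\<ge>M. \<forall>n>m. dist (\<Phi> m (S \<inter> B m)) (\<Phi> n (S \<inter> B n)) < e"
        by (intro exI[of _ M]) (simp add: dist_real_def)
    qed
    then have "convergent (\<lambda>n. \<Phi> n (S \<inter> B n))" by (rule Cauchy_convergent)
    then show ?thesis using S by (simp add: \<Psi>_def convergent_LIMSEQ_iff)
  qed
  have bound: "\<bar>\<Psi> S\<bar> \<le> c * measure V S" if S: "S \<in> borel_on \<Omega>" for S
  proof -
    have "(\<lambda>n. measure V (S \<inter> B n)) \<longlonglongrightarrow> measure V (\<Union>n. S \<inter> B n)"
      by (rule finite_Lim_measure_incseq) (use SB(1)[OF S] B(1) in \<open>auto simp: VS incseq_def\<close>)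
    moreover have "(\<Union>n. S \<inter> B n) = S" using S B(3) by (auto simp: borel_on_iff)
    ultimately have "(\<lambda>n. c * measure V (S \<inter> B n)) \<longlonglongrightarrow> c * measure V S" by (intro tendsto_mult tendsto_const) simp
    with tendsto_rabs[OF lim[OF S]] show ?thesis
      by (rule LIMSEQ_le) (use dom[OF SB(1)[OF S]] in blast)
  qed
  have "signed_measure_on \<Omega> \<Psi>"
  proof (rule vector_measure_on_of_dominated[OF \<Omega> V, where c=c])
    fix A C assume A: "A \<in> borel_on \<Omega>" "C \<in> borel_on \<Omega>" "A \<inter> C = {}"
    have AC: "A \<union> C \<in> borel_on \<Omega>" using A by (auto simp: borel_on_iff)
    have "\<Phi> n ((A \<union> C) \<inter> B n) = \<Phi> n (A \<inter> B n) + \<Phi> n (C \<inter> B n)" for n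
      unfolding Int_Un_distrib2
      by (rule vector_measure_on_Un[OF \<Phi>]) (use SB(1)[OF A(1), of n] SB(1)[OF A(2), of n] A(3) in \<open>auto simp: borel_on_iff\<close>)
    then have "(\<lambda>n. \<Phi> n (A \<inter> B n) + \<Phi> n (C \<inter> B n)) \<longlonglongrightarrow> \<Psi> (A \<union> C)" using lim[OF AC] by simp
    moreover have "(\<lambda>n. \<Phi> n (A \<inter> B n) + \<Phi> n (C \<inter> B n)) \<longlonglongrightarrow> \<Psi> A + \<Psi> C" by (intro tendsto_add lim A)
    ultimately show "\<Psi> (A \<union> C) = \<Psi> A + \<Psi> C" by (rule LIMSEQ_unique)
  next
    show "norm (\<Psi> A) \<le> c * measure V A" if "A \<in> borel_on \<Omega>" for A using bound[OF that] by simp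
  qed (simp add: \<Psi>_def)
  moreover have "\<forall>n S. S \<in> sets borel \<longrightarrow> S \<subseteq> B n \<longrightarrow> \<Psi> S = \<Phi> n S"
  proof (intro allI impI)
    fix n S assume S: "S \<in> sets borel" "S \<subseteq> B n"
    then have "S \<in> borel_on \<Omega>" using B(2)[of n] by (auto simp: borel_on_iff)
    from lim[OF this] have "(\<lambda>k. \<Phi> k (S \<inter> B k)) \<longlonglongrightarrow> \<Psi> S" .
    moreover have "\<forall>\<^sub>F k in sequentially. \<Phi> k (S \<inter> B k) = \<Phi> n S"
      using eventually_ge_at_top[of n]
    proof eventually_elim
      case (elim k)
      have "S \<inter> B k = S" using S(2) incseqD[OF B(1) elim] by auto
      then show ?case using agree[OF elim S] by simp
    qed
    ultimately have "(\<lambda>k. \<Phi> n S) \<longlonglongrightarrow> \<Psi> S" by (simp add: tendsto_cong)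
    then show "\<Psi> S = \<Phi> n S" by (simp add: LIMSEQ_const_iff)
  qed
  ultimately show ?thesis using bound by (intro that) auto
qed

lemma bounded_borel_indicator_compact:
  fixes f :: "'a::t2_space \<Rightarrow> real"
  assumes "compact K" "continuous_on UNIV f"
  shows "bounded_borel (\<lambda>x. indicator K x * f x)"
proof -
  have "compact (f ` K)" by (rule compact_continuous_image[OF continuous_on_subset[OF assms(2)] assms(1)]) simp
  then obtain c where c: "c > 0" "\<forall>y\<in>f ` K. norm y \<le> c" using compact_imp_bounded bounded_pos by metis
  show ?thesis
  proof (rule bounded_borelI[where C=c])
    show "(\<lambda>x. indicator K x * f x) \<in> borel_measurable borel"
      by (intro borel_measurable_times borel_measurable_indicator borel_measurable_continuous_onI assms(2)
          borel_closed compact_imp_closed assms(1))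
    show "norm (indicator K x * f x) \<le> c" for x using c by (auto simp: indicator_def)
  qed
qed

lemma inner_lipschitz: "norm a \<le> L \<Longrightarrow> L-lipschitz_on S (\<lambda>x. a \<bullet> x)"
  by (rule lipschitz_onI)
     (auto simp: dist_norm inner_diff_right[symmetric] intro: order_trans[OF Cauchy_Schwarz_ineq2 mult_right_mono] order_trans[OF norm_ge_zero])

lemma lipschitz_of_gradient_bound:
  fixes f :: "'a::euclidean_space \<Rightarrow> real"
  assumes S: "convex S" and f: "\<And>x. x \<in> S \<Longrightarrow> (f has_derivative (\<lambda>h. g x \<bullet> h)) (at x)"
    and B: "\<And>x. x \<in> S \<Longrightarrow> norm (g x) \<le> B" "B \<ge> 0"
  shows "B-lipschitz_on S f"
proof (rule lipschitz_onI[OF _ B(2)])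
  fix x y assume xy: "x \<in> S" "y \<in> S"
  have "norm (f x - f y) \<le> B * norm (x - y)"
  proof (rule differentiable_bound[OF S])
    show "(f has_derivative (\<lambda>h. g x \<bullet> h)) (at x within S)" if "x \<in> S" for x
      using f[OF that] by (rule has_derivative_at_withinI)
    show "onorm (\<lambda>h. g x \<bullet> h) \<le> B" if "x \<in> S" for x
    proof (rule onorm_le)
      fix h show "norm (g x \<bullet> h) \<le> B * norm h"
        using Cauchy_Schwarz_ineq2[of "g x" h] mult_right_mono[OF B(1)[OF that] norm_ge_zero[of h]] by simp
    qed
  qed (use xy in auto)
  then show "dist (f x) (f y) \<le> B * dist x y" by (simp add: dist_norm)
qed

lemma vint_indicator_const:
  fixes F :: "'a::topological_space set \<Rightarrow> 'b::euclidean_space"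
  assumes \<Omega>b: "\<Omega> \<in> sets borel" and F: "vector_measure_on \<Omega> F" and S: "S \<in> borel_on \<Omega>"
  shows "vint \<Omega> F (\<lambda>x. indicator S x *\<^sub>R a) = a \<bullet> F S"
proof -
  have Sb: "S \<in> sets borel" "S \<inter> \<Omega> = S" using S by (auto simp: borel_on_iff)
  have "sint \<Omega> (\<lambda>A. F A \<bullet> b) (\<lambda>x. (indicator S x *\<^sub>R a) \<bullet> b) = (a \<bullet> b) * (F S \<bullet> b)" for b
  proof -
    note m = vector_measure_on_inner[OF F, of b]
    have "sint \<Omega> (\<lambda>A. F A \<bullet> b) (\<lambda>x. (a \<bullet> b) * indicator S x) = (a \<bullet> b) * sint \<Omega> (\<lambda>A. F A \<bullet> b) (indicator S)"
      by (rule sint_cmult[OF \<Omega>b m])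
    also have "sint \<Omega> (\<lambda>A. F A \<bullet> b) (indicator S) = F S \<bullet> b" using sint_indicator[OF \<Omega>b m Sb(1)] Sb(2) by simp
    finally show ?thesis by (simp add: mult.commute)
  qed
  then show ?thesis unfolding vint_def euclidean_inner[of a "F S"] by (intro sum.cong) auto
qed

section \<open>Coarea estimates and abundance of admissible sets\<close>

locale radon_on_open =
  fixes \<Omega> :: "'a::euclidean_space set" and \<mu> :: "'a measure"
  assumes \<Omega>: "open \<Omega>" and \<mu>: "radon_measure_on \<Omega> \<mu>"
begin

abbreviation \<O> :: "'a set set" where "\<O> \<equiv> O_class \<Omega> \<mu>"

sublocale finite_measure \<mu>
  using \<mu> by (rule radon_measure_onD)

lemma \<Omega>b: "\<Omega> \<in> sets borel"
  using \<Omega> by simp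

lemmas space_\<mu> = radon_measure_onD(1)[OF \<mu>] and sets_\<mu> = radon_measure_onD(2)[OF \<mu>]

text \<open>For fixed \<open>x\<close> the admissible levels form a reflected translate of
  \<open>I\<close>, so Fubini yields the product. This replaces the coarea formula and involves no
  gradient.\<close>

lemma nn_integral_slices:
  fixes \<phi> :: "'a::euclidean_space \<Rightarrow> real"
  assumes \<phi>: "\<phi> \<in> borel_measurable borel"
    and E: "E \<in> borel_on \<Omega>" and I: "I \<in> sets borel"
  shows "(\<lambda>t. emeasure \<mu> {x \<in> E. \<phi> x - t \<in> I}) \<in> borel_measurable lborel"
    and "(\<integral>\<^sup>+t. emeasure \<mu> {x \<in> E. \<phi> x - t \<in> I} \<partial>lborel) = emeasure lborel I * emeasure \<mu> E"
proof -
  interpret P: pair_sigma_finite lborel \<mu> ..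
  note D = radon_measure_onD[OF \<mu>]
  have Eb: "E \<in> sets borel" "E \<subseteq> \<Omega>" using E by (auto simp: borel_on_iff)
  define f where "f t x = (indicator E x * indicator I (\<phi> x - t) :: ennreal)" for t :: real and x
  have [measurable]: "\<phi> \<in> borel_measurable \<mu>" by (rule radon_measurable[OF \<mu> \<Omega>b \<phi>])
  have [measurable]: "E \<in> sets \<mu>" using E by (simp add: D)
  have [measurable]: "I \<in> sets borel" by fact
  have fm: "(\<lambda>(t, x). f t x) \<in> borel_measurable (lborel \<Otimes>\<^sub>M \<mu>)"
    unfolding f_def by measurable
  have eq: "emeasure \<mu> {x \<in> E. \<phi> x - t \<in> I} = (\<integral>\<^sup>+x. f t x \<partial>\<mu>)" for t
  proof -
    have "{x \<in> E. \<phi> x - t \<in> I} = E \<inter> ((\<lambda>x. \<phi> x - t) -` I \<inter> space \<mu>)" using Eb by (auto simp: D)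
    moreover have "(\<lambda>x. \<phi> x - t) -` I \<inter> space \<mu> \<in> sets \<mu>" by (rule measurable_sets) measurable
    ultimately have m: "{x \<in> E. \<phi> x - t \<in> I} \<in> sets \<mu>" by simp
    have "f t x = indicator {x \<in> E. \<phi> x - t \<in> I} x" for x by (auto simp: f_def indicator_def)
    then show ?thesis using nn_integral_indicator[OF m] by simp
  qed
  show "(\<lambda>t. emeasure \<mu> {x \<in> E. \<phi> x - t \<in> I}) \<in> borel_measurable lborel"
    unfolding eq using borel_measurable_nn_integral[OF fm] by simp
  have "(\<integral>\<^sup>+t. emeasure \<mu> {x \<in> E. \<phi> x - t \<in> I} \<partial>lborel) = (\<integral>\<^sup>+x. \<integral>\<^sup>+t. f t x \<partial>lborel \<partial>\<mu>)"
    unfolding eq by (rule P.Fubini'[OF fm, symmetric])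
  also have "\<dots> = (\<integral>\<^sup>+x. emeasure lborel I * indicator E x \<partial>\<mu>)"
  proof (rule nn_integral_cong)
    fix x
    have "(\<integral>\<^sup>+t. indicator I t \<partial>lborel) = ennreal \<bar>-1\<bar> * (\<integral>\<^sup>+t. indicator I (\<phi> x + (-1) * t) \<partial>lborel)"
      by (rule nn_integral_real_affine) auto
    then have "(\<integral>\<^sup>+t. indicator I (\<phi> x - t) \<partial>lborel) = emeasure lborel I" by simp
    moreover have "(\<integral>\<^sup>+t. f t x \<partial>lborel) = indicator E x * (\<integral>\<^sup>+t. indicator I (\<phi> x - t) \<partial>lborel)"
      unfolding f_def by (rule nn_integral_cmult) simp
    ultimately show "(\<integral>\<^sup>+t. f t x \<partial>lborel) = emeasure lborel I * indicator E x" by (simp add: mult.commute)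
  qed
  also have "\<dots> = emeasure lborel I * emeasure \<mu> E" by (rule nn_integral_cmult_indicator) simp
  finally show "(\<integral>\<^sup>+t. emeasure \<mu> {x \<in> E. \<phi> x - t \<in> I} \<partial>lborel) = emeasure lborel I * emeasure \<mu> E" .
qed

text \<open>The value is the same for every thickness \<open>e\<close>, as an application of Fatou's
  lemma for \<open>e\<close> tending to 0 requires.\<close>

lemma nn_integral_slices_scaled:
  fixes \<phi> :: "'a::euclidean_space \<Rightarrow> real"
  assumes \<phi>: "\<phi> \<in> borel_measurable borel"
    and E: "E \<in> borel_on \<Omega>" and L: "L > 0" and e: "e > 0"
  shows "(\<integral>\<^sup>+t. ennreal (1 / e) * emeasure \<mu> {x \<in> E. \<phi> x - t \<in> {0<..L * e}} \<partial>lborel) = ennreal L * emeasure \<mu> E"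
proof -
  have "(\<integral>\<^sup>+t. ennreal (1 / e) * emeasure \<mu> {x \<in> E. \<phi> x - t \<in> {0<..L * e}} \<partial>lborel)
      = ennreal (1 / e) * (ennreal (L * e) * emeasure \<mu> E)"
    using nn_integral_slices[OF \<phi> E, of "{0<..L * e}"] L e
    by (simp add: nn_integral_cmult)
  also have "ennreal (1 / e) * (ennreal (L * e) * emeasure \<mu> E) = ennreal (1 / e * (L * e)) * emeasure \<mu> E"
    unfolding mult.assoc[symmetric] using L e by (subst ennreal_mult[symmetric]) (simp_all add: mult.assoc)
  finally show ?thesis using e by simp
qed

text \<open>Converse of \<open>O_class_sequence\<close>: a liminf is bounded by what happens along a
  single sequence of thicknesses.\<close>

lemma O_class_of_sequence:
  assumes V: "open_compactly_inside V \<Omega>"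
    and e: "\<And>k. e k > 0" "e \<longlonglongrightarrow> 0" and C: "\<And>k. measure \<mu> (closed_layer V (e k)) \<le> C * e k"
  shows "V \<in> \<O>"
proof -
  define g where "g \<epsilon> = ereal (measure \<mu> {x \<in> V. infdist x (frontier V) < \<epsilon>} / \<epsilon>)" for \<epsilon>
  note VD = open_compactly_insideD[OF V]
  have "\<forall>k. e k \<in> {0<..} \<and> e k \<noteq> 0" using e(1) by (simp add: less_imp_neq[symmetric])
  then have "filterlim e (at_right 0) sequentially"
    unfolding filterlim_at using e(2) by (intro conjI always_eventually)
  note lim = this
  have gC: "g (e k) \<le> ereal C" for k
  proof -
    have "closed_layer V (e k) \<in> sets \<mu>"
      using borel_closed_layer[OF VD(1)] closed_layer_subset[of V "e k"] VD(4)
      by (simp add: sets_\<mu> borel_on_iff)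
    then have "measure \<mu> {x \<in> V. infdist x (frontier V) < e k} \<le> measure \<mu> (closed_layer V (e k))"
      by (intro finite_measure_mono) (auto simp: closed_layer_def)
    then have "measure \<mu> {x \<in> V. infdist x (frontier V) < e k} \<le> C * e k" using C[of k] by linarith
    then show "g (e k) \<le> ereal C" using e(1)[of k] by (simp add: g_def pos_divide_le_eq)
  qed
  have "Liminf (at_right 0) g \<le> ereal C"
  proof (rule ccontr)
    assume "\<not> ?thesis"
    then have "\<forall>\<^sub>F \<epsilon> in at_right 0. ereal C < g \<epsilon>" by (intro less_LiminfD) simp
    from eventually_compose_filterlim[OF this lim] obtain k where "ereal C < g (e k)"
      by (auto dest: eventually_happens)
    then show False using gC[of k] by simp
  qed
  also have "\<dots> < \<infinity>" by simp
  finally show ?thesis using V by (simp add: O_class_def g_def[abs_def])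
qed

text \<open>Existence of the limit measures that the upper bound of a flux refers to. The scaled
  layers have bounded mass and are carried by the compact set \<open>closure V\<close>.\<close>

lemma layer_limit_subsequence:
  assumes V: "open_compactly_inside V \<Omega>"
    and e: "\<And>k. e k > 0" "decseq e" "e \<longlonglongrightarrow> 0" and C: "\<And>k. measure \<mu> (closed_layer V (e k)) \<le> C * e k"
  obtains r \<nu> where "strict_mono (r :: nat \<Rightarrow> nat)" "layer_limit \<Omega> \<mu> V \<nu>"
    "\<forall>\<phi>\<in>test_functions 0 \<Omega>. (\<lambda>k. integral\<^sup>L (scaled_layer \<mu> V (e (r k))) \<phi>) \<longlonglongrightarrow> integral\<^sup>L \<nu> \<phi>"
proof -
  note VD = open_compactly_insideD[OF V]
  define M where "M k = scaled_layer \<mu> V (e k)" for k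
  have M: "radon_measure_on \<Omega> (M k)" for k
    unfolding M_def by (rule radon_scaled_layer(1)[OF \<mu> \<Omega>b VD(1,4) e(1)])
  have meas: "measure (M k) A = measure \<mu> (A \<inter> layer V (e k)) / e k" if "A \<in> sets borel" "A \<subseteq> \<Omega>" for A k
    unfolding M_def by (rule radon_scaled_layer(2)[OF \<mu> \<Omega>b VD(1,4) e(1) that])
  have "measure (M k) \<Omega> \<le> C" for k
  proof -
    have "closed_layer V (e k) \<in> sets \<mu>"
      using borel_closed_layer[OF VD(1)] closed_layer_subset[of V "e k"] VD(4)
      by (simp add: sets_\<mu> borel_on_iff)
    then have "measure \<mu> (\<Omega> \<inter> layer V (e k)) \<le> measure \<mu> (closed_layer V (e k))"
      by (intro finite_measure_mono) (use layer_subset_closed_layer in blast)+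
    also have "\<dots> \<le> C * e k" by (rule C)
    finally show ?thesis using meas[OF \<Omega>b, of k] e(1)[of k] by (simp add: pos_divide_le_eq)
  qed
  note MC = this
  have AE: "AE x in M k. x \<in> closure V" for k
  proof (rule AE_I)
    show out: "\<Omega> - closure V \<in> sets (M k)"
      using \<Omega>b by (simp add: radon_measure_onD(2)[OF M] borel_on_iff)
    show "{x \<in> space (M k). x \<notin> closure V} \<subseteq> \<Omega> - closure V"
      by (auto simp: radon_measure_onD(1)[OF M])
    have "(\<Omega> - closure V) \<inter> layer V (e k) = {}" using closure_subset[of V] by (auto simp: layer_def)
    then have "measure (M k) (\<Omega> - closure V) = 0" using meas[of "\<Omega> - closure V" k] \<Omega>b by simp
    then show "emeasure (M k) (\<Omega> - closure V) = 0"
      using finite_measure.emeasure_eq_measure[OF radon_measure_onD(3)[OF M]] by simp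
  qed
  obtain r \<nu> where r: "strict_mono (r :: nat \<Rightarrow> nat)" and \<nu>: "radon_measure_on \<Omega> \<nu>"
    and lim: "\<forall>\<phi>\<in>test_functions 0 \<Omega>. (\<lambda>k. integral\<^sup>L (M (r k)) \<phi>) \<longlonglongrightarrow> integral\<^sup>L \<nu> \<phi>"
    by (rule weak_star_compact[OF \<Omega>b M VD(2) AE MC])
  have "decseq (\<lambda>k. e (r k))"
    unfolding decseq_def using decseqD[OF e(2)] strict_mono_less_eq[OF r] by simp
  moreover have "(\<lambda>k. e (r k)) \<longlonglongrightarrow> 0" using LIMSEQ_subseq_LIMSEQ[OF e(3) r] by (simp add: o_def)
  ultimately have "layer_limit \<Omega> \<mu> V \<nu>"
    unfolding layer_limit_def weak_star_limit_def using \<nu> e(1) lim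
    by (intro conjI exI[of _ "\<lambda>k. e (r k)"]) (auto simp: M_def)
  then show ?thesis using that[OF r] lim by (simp add: M_def)
qed

lemma measure_closed_layer_tendsto_0:
  assumes U: "open_compactly_inside U \<Omega>"
  shows "(\<lambda>j. measure \<mu> (closed_layer U (1 / real (Suc j)))) \<longlonglongrightarrow> 0"
proof -
  note UD = open_compactly_insideD[OF U]
  define A where "A j = closed_layer U (1 / real (Suc j))" for j
  have AS: "A j \<in> sets \<mu>" for j
    using borel_closed_layer[OF UD(1)] closed_layer_subset[of U "1 / real (Suc j)"] UD(4)
    by (auto simp: sets_\<mu> borel_on_iff A_def)
  have "decseq A"
  proof (rule decseq_SucI)
    fix j
    have "1 / real (Suc (Suc j)) \<le> 1 / real (Suc j)" by (simp add: divide_simps)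
    then show "A (Suc j) \<subseteq> A j" unfolding A_def closed_layer_def by (auto intro: order_trans)
  qed
  have "(\<Inter>j. A j) = {}"
  proof -
    have "\<exists>j. x \<notin> A j" if x: "x \<in> U" for x
    proof -
      have "infdist x (frontier U) > 0" by (rule infdist_frontier_pos[OF UD(1,5) x])
      then obtain n where "1 / real (Suc n) < infdist x (frontier U)" using nat_approx_posE by metis
      then show ?thesis by (intro exI[of _ n]) (simp add: A_def closed_layer_def)
    qed
    then show ?thesis using closed_layer_subset[of U] by (fastforce simp: A_def)
  qed
  moreover have "(\<lambda>j. measure \<mu> (A j)) \<longlonglongrightarrow> measure \<mu> (\<Inter>j. A j)"
    by (rule finite_Lim_measure_decseq) (use AS \<open>decseq A\<close> in auto)
  ultimately show ?thesis by (simp add: A_def)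
qed

text \<open>Here \<open>U\<close> is an arbitrary bounded open set with no control of its layers.
  Taking the distance to its complement as level function helps, because the layer of
  \<open>U\<close> is then itself described by levels. The scaled slab masses have level integrals
  \<open>\<mu> U\<close>, so by Fatou their liminf is finite for almost every level.\<close>

lemma AE_superlevel_O_class:
  fixes U :: "'a::euclidean_space set"
  assumes U: "open U" "bounded U" "U \<subseteq> \<Omega>"
  shows "AE t in lborel. t > 0 \<longrightarrow> open_compactly_inside {x \<in> U. infdist x (- U) > t} U \<and>
    {x \<in> U. infdist x (- U) > t} \<in> \<O>"
proof -
  define h where "h x = infdist x (- U)" for x
  have hL: "1-lipschitz_on UNIV h" unfolding h_def by (rule infdist_lipschitz)
  have hc: "continuous_on UNIV h" using hL by (rule lipschitz_on_continuous_on)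
  have hb: "h \<in> borel_measurable borel" using hc by (rule borel_measurable_continuous_onI)
  have Uc: "- U \<noteq> {}" using U(2) by (rule bounded_Compl_nonempty)
  have UB: "U \<in> borel_on \<Omega>" using U by (simp add: borel_on_iff)
  define e where "e k = 1 / real (Suc k)" for k
  have e: "e k > 0" "e \<longlonglongrightarrow> 0" for k
    unfolding e_def by (simp, rule LIMSEQ_Suc[OF lim_1_over_n])
  define m where "m k t = ennreal (1 / e k) * emeasure \<mu> {x \<in> U. h x - t \<in> {0<..1 * e k}}" for k t
  have mm: "m k \<in> borel_measurable lborel" for k
    unfolding m_def by (intro borel_measurable_times_ennreal nn_integral_slices(1)[OF hb UB]) simp_all
  have "(\<integral>\<^sup>+t. liminf (\<lambda>k. m k t) \<partial>lborel) \<le> liminf (\<lambda>k. \<integral>\<^sup>+t. m k t \<partial>lborel)"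
    by (rule nn_integral_liminf[OF mm])
  also have "\<dots> = emeasure \<mu> U"
    unfolding m_def nn_integral_slices_scaled[OF hb UB zero_less_one e(1)] by (simp add: Liminf_const)
  also have "\<dots> < \<infinity>" by (simp add: emeasure_eq_measure)
  finally have "(\<integral>\<^sup>+t. liminf (\<lambda>k. m k t) \<partial>lborel) \<noteq> \<infinity>" by simp
  from nn_integral_PInf_AE[OF borel_measurable_liminf[OF mm] this]
  have "AE t in lborel. liminf (\<lambda>k. m k t) \<noteq> \<infinity>" .
  then show ?thesis
  proof (eventually_elim, intro impI)
    fix t :: real assume fin: "liminf (\<lambda>k. m k t) \<noteq> \<infinity>" and t: "t > 0"
    define V where "V = {x \<in> U. infdist x (- U) > t}"
    have V: "V = U \<inter> {x. h x > t}" by (auto simp: V_def h_def)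
    have oV: "open V" unfolding V by (intro open_Int U open_Collect_less continuous_on_const hc)
    have cV: "closure V \<subseteq> {x. t \<le> h x}"
      by (rule closure_minimal) (auto simp: V intro!: closed_Collect_le continuous_on_const hc)
    have "x \<in> U" if "t \<le> h x" for x
      using that t infdist_zero[of x "- U"] by (cases "x \<in> U") (auto simp: h_def)
    then have cVU: "closure V \<subseteq> U" using cV by blast
    have VU: "open_compactly_inside V U"
      unfolding open_compactly_inside_def
      using oV cVU U(2) by (auto simp: compact_eq_bounded_closed intro: bounded_subset)
    then have V\<Omega>: "open_compactly_inside V \<Omega>" using U(3) by (auto simp: open_compactly_inside_def)
    obtain c where c: "c > 0" "liminf (\<lambda>k. m k t) < ennreal c"
    proof -
      obtain c0 where "c0 \<ge> 0" "liminf (\<lambda>k. m k t) = ennreal c0" using fin by (cases "liminf (\<lambda>k. m k t)") auto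
      then have "liminf (\<lambda>k. m k t) < ennreal (c0 + 1)" "c0 + 1 > 0" by (auto intro: ennreal_lessI)
      then show ?thesis using that by blast
    qed
    obtain r where r: "strict_mono (r :: nat \<Rightarrow> nat)" "\<forall>k. m (r k) t < ennreal c"
      by (rule liminf_subsequence[OF c(2)])
    have "V \<in> \<O>"
    proof (rule O_class_of_sequence[OF V\<Omega>, where e="\<lambda>k. e (r k)" and C=c])
      show "e (r k) > 0" for k by (rule e)
      show "(\<lambda>k. e (r k)) \<longlonglongrightarrow> 0" using LIMSEQ_subseq_LIMSEQ[OF e(2) r(1)] by (simp add: o_def)
      fix k
      define X where "X = {x \<in> U. h x - t \<in> {0<..1 * e (r k)}}"
      have "X = U \<inter> (\<lambda>x. h x - t) -` {0<..1 * e (r k)}" by (auto simp: X_def)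
      moreover have "(\<lambda>x. h x - t) -` {0<..1 * e (r k)} \<in> sets borel"
        using measurable_sets[OF borel_measurable_diff[OF hb borel_measurable_const[of t]], of "{0<..1 * e (r k)}"] by simp
      ultimately have Xs: "X \<in> sets \<mu>" using UB by (auto simp: sets_\<mu> borel_on_iff)
      have sub: "closed_layer V (e (r k)) \<subseteq> X"
      proof
        fix x assume x: "x \<in> closed_layer V (e (r k))"
        then have xV: "x \<in> U" "t < h x" using closed_layer_subset[of V "e (r k)"] by (auto simp: V)
        \<comment> \<open>If \<open>x\<close> lies in the layer of \<open>U\<close>, its distance to
          the complement is at most the thickness, and subtracting the positive level
          \<open>t\<close> keeps it in the slab.\<close>
        from superlevel_layer[OF U(1,2) hL x[unfolded V]] have "h x - t \<le> e (r k)"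
        proof
          assume xl: "x \<in> closed_layer U (e (r k))"
          have "U \<noteq> {}" "U \<noteq> UNIV" using xV Uc by auto
          then have "frontier U \<noteq> {}" using frontier_eq_empty by blast
          moreover have "frontier U \<subseteq> - U" using U(1) by (auto simp: frontier_def interior_open)
          ultimately have "infdist x (- U) \<le> infdist x (frontier U)" by (intro infdist_mono)
          then show ?thesis using xl t by (simp add: closed_layer_def h_def)
        qed simp
        then show "x \<in> X" using xV by (simp add: X_def)
      qed
      have "ennreal (1 / e (r k)) * emeasure \<mu> X < ennreal c" using r(2) by (simp add: m_def X_def)
      then have "ennreal (measure \<mu> X / e (r k)) < ennreal c"
        using e(1)[of "r k"] by (simp add: emeasure_eq_measure ennreal_mult[symmetric])
      then have "measure \<mu> X / e (r k) < c" using e(1)[of "r k"] by (simp add: ennreal_less_iff)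
      then have "measure \<mu> X \<le> c * e (r k)" using e(1)[of "r k"] by (simp add: pos_divide_less_eq)
      moreover have "measure \<mu> (closed_layer V (e (r k))) \<le> measure \<mu> X" by (rule finite_measure_mono[OF sub Xs])
      ultimately show "measure \<mu> (closed_layer V (e (r k))) \<le> c * e (r k)" by linarith
    qed
    then show "open_compactly_inside {x \<in> U. infdist x (- U) > t} U \<and> {x \<in> U. infdist x (- U) > t} \<in> \<O>"
      using VU by (simp add: V_def)
  qed
qed

text \<open>Intersecting with growing balls makes the sets bounded, and in each of them almost every
  distance level is admissible.\<close>

lemma O_class_exhaustion:
  fixes A :: "'a::euclidean_space set"
  assumes A: "open A" "A \<subseteq> \<Omega>"
  obtains B :: "nat \<Rightarrow> 'a set" where "incseq B" "(\<Union>j. B j) = A"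
    "\<forall>j. B j \<in> \<O> \<and> open_compactly_inside (B j) A"
proof -
  define U where "U j = A \<inter> ball 0 (real (Suc j))" for j
  have U: "open (U j)" "bounded (U j)" "U j \<subseteq> \<Omega>" for j
    using A by (auto simp: U_def intro: bounded_subset[OF bounded_ball])
  \<comment> \<open>Consecutive intervals share only an endpoint, so the chosen levels decrease to 0
    and the sets increase to \<open>A\<close>.\<close>
  have "\<exists>t. 1 / real (Suc (Suc j)) < t \<and> t < 1 / real (Suc j) \<and>
      open_compactly_inside {x \<in> U j. infdist x (- U j) > t} (U j) \<and> {x \<in> U j. infdist x (- U j) > t} \<in> \<O>" for j
  proof -
    have "1 / real (Suc (Suc j)) < 1 / real (Suc j)" by (simp add: divide_simps)
    from AE_lborel_interval[OF AE_superlevel_O_class[OF U] this]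
    obtain t where t: "1 / real (Suc (Suc j)) < t" "t < 1 / real (Suc j)" "t > 0 \<longrightarrow> open_compactly_inside {x \<in> U j. infdist x (- U j) > t} (U j) \<and> {x \<in> U j. infdist x (- U j) > t} \<in> \<O>" .
    moreover have "t > 0" using t(1) by (rule less_trans[rotated]) simp
    ultimately show ?thesis by blast
  qed
  then obtain s where s: "\<forall>j. 1 / real (Suc (Suc j)) < s j \<and> s j < 1 / real (Suc j) \<and>
      open_compactly_inside {x \<in> U j. infdist x (- U j) > s j} (U j) \<and> {x \<in> U j. infdist x (- U j) > s j} \<in> \<O>"
    using that choice[where Q="\<lambda>j t. 1 / real (Suc (Suc j)) < t \<and> t < 1 / real (Suc j) \<and>
      open_compactly_inside {x \<in> U j. infdist x (- U j) > t} (U j) \<and> {x \<in> U j. infdist x (- U j) > t} \<in> \<O>"]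
    by blast
  define B where "B j = {x \<in> U j. infdist x (- U j) > s j}" for j
  have mono: "infdist x (- U j) \<le> infdist x (- U (Suc j))" for x j
  proof (rule infdist_mono)
    show "- U (Suc j) \<noteq> {}" by (rule bounded_Compl_nonempty[OF U(2)])
  qed (auto simp: U_def)
  show ?thesis
  proof
    show "incseq B"
    proof (rule incseq_SucI, rule subsetI)
      fix j x assume x: "x \<in> B j"
      have "s (Suc j) < 1 / real (Suc (Suc j))" "1 / real (Suc (Suc j)) < s j" using s by blast+
      moreover have "U j \<subseteq> U (Suc j)" by (auto simp: U_def)
      ultimately show "x \<in> B (Suc j)" using x mono[of x j] by (auto simp: B_def)
    qed
    show "\<forall>j. B j \<in> \<O> \<and> open_compactly_inside (B j) A"
    proof (intro allI conjI)
      fix j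
      show "B j \<in> \<O>" using s by (simp add: B_def)
      have "open_compactly_inside (B j) (U j)" using s by (simp add: B_def)
      then show "open_compactly_inside (B j) A" by (auto simp: open_compactly_inside_def U_def)
    qed
    show "(\<Union>j. B j) = A"
    proof
      show "(\<Union>j. B j) \<subseteq> A" by (auto simp: B_def U_def)
      show "A \<subseteq> (\<Union>j. B j)"
      proof
        fix x assume x: "x \<in> A"
        obtain i where i: "norm x < real i" using reals_Archimedean2 by blast
        have xU: "x \<in> U j" if "j \<ge> i" for j using x i that by (simp add: U_def)
        have "- U i \<noteq> {}" by (rule bounded_Compl_nonempty[OF U(2)])
        then have "infdist x (- U i) > 0"
          using xU[of i] U(1)[of i] infdist_pos_not_in_closed[of "- U i" x] by (auto simp: closed_def)
        then obtain n where n: "1 / real (Suc n) < infdist x (- U i)"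
          using nat_approx_posE by metis
        define j where "j = max i n"
        have "incseq (\<lambda>j. infdist x (- U j))" by (rule incseq_SucI) (rule mono)
        then have "infdist x (- U i) \<le> infdist x (- U j)" by (rule incseqD) (simp add: j_def)
        moreover have "s j < 1 / real (Suc j)" using s by blast
        moreover have "1 / real (Suc j) \<le> 1 / real (Suc n)" by (simp add: j_def divide_simps)
        ultimately have "x \<in> B j" using n xU[of j] by (simp add: B_def j_def)
        then show "x \<in> (\<Union>j. B j)" by blast
      qed
    qed
  qed
qed

lemma O_class_superset:
  fixes K :: "'a::euclidean_space set"
  assumes K: "compact K" "K \<subseteq> \<Omega>"
  obtains U where "U \<in> \<O>" "K \<subseteq> U"
proof -
  obtain B :: "nat \<Rightarrow> 'a set" where B: "incseq B" "(\<Union>j. B j) = \<Omega>"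
    "\<forall>j. B j \<in> \<O> \<and> open_compactly_inside (B j) \<Omega>"
    by (rule O_class_exhaustion[OF \<Omega> order_refl])
  have "open (B n)" for n using B(3) by (simp add: open_compactly_inside_def)
  moreover have "K \<subseteq> (\<Union>n\<in>UNIV. B n)" using K(2) B(2) by simp
  ultimately obtain N where N: "finite N" "K \<subseteq> (\<Union>n\<in>N. B n)"
    using compactE_image[OF K(1), of UNIV B] by (metis subset_UNIV)
  have "B n \<subseteq> B (Max (insert 0 N))" if "n \<in> N" for n
    by (rule incseqD[OF B(1)]) (use that N(1) in simp)
  then have "K \<subseteq> B (Max (insert 0 N))" using N(2) by blast
  then show ?thesis using that B(3) by blast
qed

text \<open>Equality is passed to open sets by exhaustion before the Dynkin argument, which avoids
  asking whether the class is stable under intersection.\<close>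

lemma vector_measure_eq_of_O_class:
  fixes s :: "'a::euclidean_space set \<Rightarrow> 'b::real_normed_vector"
  assumes s: "vector_measure_on \<Omega> s" "vector_measure_on \<Omega> t"
    and W: "open W" "W \<subseteq> \<Omega>"
    and eq: "\<And>V. V \<in> \<O> \<Longrightarrow> open_compactly_inside V W \<Longrightarrow> s V = t V"
    and S: "S \<in> sets borel" "S \<subseteq> W"
  shows "s S = t S"
proof -
  have "s S - t S = 0"
  proof (rule vector_measure_on_eq_zero[OF vector_measure_on_diff[OF s] W _ S])
    fix A assume A: "open A" "A \<subseteq> W"
    then have A\<Omega>: "A \<subseteq> \<Omega>" using W(2) by simp
    obtain B :: "nat \<Rightarrow> 'a set" where B: "incseq B" "(\<Union>j. B j) = A"
      "\<forall>j. B j \<in> \<O> \<and> open_compactly_inside (B j) A"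
      by (rule O_class_exhaustion[OF A(1) A\<Omega>])
    have BA: "open_compactly_inside (B j) A" and BO: "B j \<in> \<O>" for j using B(3) by blast+
    have "open_compactly_inside (B j) W" for j using BA[of j] A(2) by (auto simp: open_compactly_inside_def)
    then have st: "s (B j) = t (B j)" for j by (intro eq BO)
    have "(\<lambda>j. u (B j)) \<longlonglongrightarrow> u A" if "vector_measure_on \<Omega> u" for u :: "'a set \<Rightarrow> 'b"
    proof -
      have "(\<lambda>j. u (B j)) \<longlonglongrightarrow> u (\<Union>j. B j)"
        by (rule vector_measure_on_incseq[OF that])
           (use open_compactly_insideD(1,4)[OF BA] A\<Omega> B(1) in \<open>auto simp: borel_on_iff\<close>)
      then show ?thesis by (simp only: B(2))
    qed
    from this[OF s(1)] this[OF s(2)] have "s A = t A" unfolding st by (rule LIMSEQ_unique)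
    then show "s A - t A = 0" by simp
  qed
  then show ?thesis by simp
qed

text \<open>For a function that equals the coordinate \<open>x \<bullet> b\<close> near
  \<open>closure U\<close>, the Gauss-Green formula expresses the component
  \<open>F U \<bullet> b\<close> through the trace and the divergence alone. Traces are carried by
  the frontier, so agreement there suffices, and the admissible sets determine the measure.\<close>

lemma DM_ext_eqI:
  fixes F G :: "'a::euclidean_space set \<Rightarrow> 'a"
  assumes F: "F \<in> DM_ext \<Omega>" and G: "G \<in> DM_ext \<Omega>"
    and div: "divergence \<Omega> F = divergence \<Omega> G"
    and tr: "\<And>U. U \<in> \<O> \<Longrightarrow> has_normal_trace \<Omega> F U \<and> has_normal_trace \<Omega> G U \<and>
      (\<forall>S\<in>sets borel. S \<subseteq> frontier U \<longrightarrow> normal_trace \<Omega> F U S = normal_trace \<Omega> G U S)"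
  shows "F = G"
proof
  fix S
  note Fm = DM_extD(1)[OF \<Omega> F] and Gm = DM_extD(1)[OF \<Omega> G]
  show "F S = G S"
  proof (cases "S \<in> borel_on \<Omega>")
    case True
    show ?thesis
    proof (rule vector_measure_eq_of_O_class[OF Fm Gm \<Omega> order_refl])
      fix U assume U: "U \<in> \<O>"
      note Ui = O_classD[OF U]
      note UD = open_compactly_insideD[OF Ui]
      have UB: "U \<in> borel_on \<Omega>" using UD by (simp add: borel_on_iff)
      obtain s t where s: "represents_normal_trace \<Omega> F U s" and t: "represents_normal_trace \<Omega> G U t"
        using tr[OF U] unfolding has_normal_trace_def by blast
      have sm: "signed_measure_on \<Omega> s" "signed_measure_on \<Omega> t"
        using s t by (simp_all add: represents_normal_trace_def)
      have st_frontier: "s S = t S" if "S \<in> sets borel" "S \<subseteq> frontier U" for S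
        using tr[OF U] that normal_trace_eq[OF \<Omega> s] normal_trace_eq[OF \<Omega> t] by auto
      have "s = t"
      proof
        fix S
        show "s S = t S"
        proof (cases "S \<in> borel_on \<Omega>")
          case S: True
          then have Sb: "S \<in> sets borel" "S \<subseteq> \<Omega>" by (simp_all add: borel_on_iff)
          have fr: "frontier U \<in> sets borel" by simp
          have "s (S - frontier U) = 0"
            by (rule normal_trace_supported[OF \<Omega> F Ui s]) (use Sb fr in auto)
          moreover have "t (S - frontier U) = 0"
            by (rule normal_trace_supported[OF \<Omega> G Ui t]) (use Sb fr in auto)
          moreover have "s (S \<inter> frontier U) = t (S \<inter> frontier U)" by (rule st_frontier) (use Sb fr in auto)
          ultimately show ?thesis
            using vector_measure_on_Int_Diff[OF sm(1) Sb(1) fr Sb(2)] vector_measure_on_Int_Diff[OF sm(2) Sb(1) fr Sb(2)] by simp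
        qed (simp add: vector_measure_on_outside[OF sm(1)] vector_measure_on_outside[OF sm(2)])
      qed
      obtain g V where g: "g \<in> smooth_test_functions \<Omega>" and V: "open V" "closure U \<subseteq> V" and one: "\<And>x. x \<in> V \<Longrightarrow> g x = 1"
        by (rule smooth_cutoff[OF UD(2,3) \<Omega>]) blast
      show "F U = G U"
      proof (rule euclidean_eqI)
        fix b :: 'a assume "b \<in> Basis"
        \<comment> \<open>The cutoff makes the coordinate function a test function without altering
          it near \<open>closure U\<close>.\<close>
        define \<phi> where "\<phi> x = g x * (x \<bullet> b)" for x
        have \<phi>: "\<phi> \<in> test_functions 1 \<Omega>"
          unfolding \<phi>_def[abs_def] by (rule test_functions_mult[OF smooth_test_functions_subset[OF g] Ck_inner])
        have gr: "grad \<phi> x = b" if "x \<in> U" for x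
        proof (rule grad_eqI)
          have "x \<in> V" using that V(2) closure_subset[of U] by auto
          have "((\<lambda>x. x \<bullet> b) has_derivative (\<lambda>h. b \<bullet> h)) (at x)"
            by (rule has_derivative_eq_rhs[OF has_derivative_inner_left[OF has_derivative_ident]]) (simp add: inner_commute)
          then show "(\<phi> has_derivative (\<lambda>h. b \<bullet> h)) (at x)"
            by (rule has_derivative_transform_within_open[OF _ V(1) \<open>x \<in> V\<close>]) (simp add: \<phi>_def one)
        qed
        have ind: "(\<lambda>x. indicator U x *\<^sub>R grad \<phi> x) = (\<lambda>x. indicator U x *\<^sub>R b)"
          using gr by (auto simp: fun_eq_iff indicator_def)
        have *: "H U \<bullet> b = - sint \<Omega> u \<phi> - sint \<Omega> (divergence \<Omega> H) (\<lambda>x. indicator U x * \<phi> x)"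
          if H: "H \<in> DM_ext \<Omega>" "represents_normal_trace \<Omega> H U u" for H u
        proof -
          have "normal_trace_distribution \<Omega> H U \<phi> = sint \<Omega> u \<phi>"
            using H(2) \<phi> unfolding represents_normal_trace_def by blast
          then have "- (b \<bullet> H U) - sint \<Omega> (divergence \<Omega> H) (\<lambda>x. indicator U x * \<phi> x) = sint \<Omega> u \<phi>"
            unfolding normal_trace_distribution_eq[OF \<Omega> H(1)] ind vint_indicator_const[OF \<Omega>b DM_extD(1)[OF \<Omega> H(1)] UB] .
          then show ?thesis by (simp add: inner_commute)
        qed
        show "F U \<bullet> b = G U \<bullet> b"
          unfolding *[OF F s] *[OF G t] div \<open>s = t\<close> ..
      qed
    qed (use True in \<open>simp_all add: borel_on_iff\<close>)
  qed (simp add: vector_measure_on_outside[OF Fm] vector_measure_on_outside[OF Gm])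
qed

end

section \<open>Cauchy fluxes\<close>

locale flux_on_open =
  fixes \<Omega> :: "'a::euclidean_space set" and \<F> \<sigma> \<mu>
  assumes \<Omega>: "open \<Omega>" and flux: "cauchy_flux \<Omega> \<F> \<sigma> \<mu>"
begin

lemmas flux_conjuncts = flux[unfolded cauchy_flux_def]

lemma \<sigma>: "signed_measure_on \<Omega> \<sigma>"
  by (rule conjunct1[OF flux_conjuncts])

sublocale radon_on_open \<Omega> \<mu>
  using \<Omega> conjunct1[OF conjunct2[OF flux_conjuncts]] by unfold_locales

lemma flux_balance: "open_compactly_inside U \<Omega> \<Longrightarrow> \<F> U (frontier U) = \<sigma> U"
  by (erule mp[OF spec[OF conjunct1[OF conjunct2[OF conjunct2[OF flux_conjuncts]]]]])

lemma flux_Un: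
  assumes "U \<in> \<O>" "S \<in> sets borel" "T \<in> sets borel" "S \<subseteq> frontier U" "T \<subseteq> frontier U"
    "S \<inter> T = {}"
  shows "\<F> U (S \<union> T) = \<F> U S + \<F> U T"
proof -
  from conjunct1[OF conjunct2[OF conjunct2[OF conjunct2[OF flux_conjuncts]]]] assms(1)
  have "\<forall>S T. S \<in> sets borel \<longrightarrow> T \<in> sets borel \<longrightarrow>
        S \<subseteq> frontier U \<longrightarrow> T \<subseteq> frontier U \<longrightarrow> S \<inter> T = {} \<longrightarrow> \<F> U (S \<union> T) = \<F> U S + \<F> U T"
    by (rule bspec)
  from this[rule_format, OF assms(2-6)] show ?thesis .
qed

lemma flux_local:
  assumes "U \<in> \<O>" "V \<in> \<O>" "open A" "A \<subseteq> \<Omega>" "A \<inter> U = A \<inter> V"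
  shows "\<F> U (A \<inter> frontier U) = \<F> V (A \<inter> frontier V)"
proof -
  note bspec[OF conjunct1[OF conjunct2[OF conjunct2[OF conjunct2[OF conjunct2[OF flux_conjuncts]]]]] assms(1)]
  from bspec[OF this assms(2), rule_format, OF assms(3-5)] show ?thesis .
qed

lemma flux_le_layer_limit:
  assumes "U \<in> \<O>" "layer_limit \<Omega> \<mu> U \<nu>" "S \<in> sets borel" "S \<subseteq> frontier U"
  shows "\<bar>\<F> U S\<bar> \<le> measure \<nu> S"
proof -
  note bspec[OF conjunct2[OF conjunct2[OF conjunct2[OF conjunct2[OF conjunct2[OF flux_conjuncts]]]]] assms(1)]
  from bspec[OF mp[OF spec[OF this] assms(2)] assms(3)] assms(4) show ?thesis by (rule mp)
qed

text \<open>The flux is assumed only finitely additive; countable additivity comes from domination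
  by a layer limit, which compactness provides.\<close>

lemma flux_measure:
  assumes U: "U \<in> \<O>"
  shows "signed_measure_on \<Omega> (\<lambda>S. if S \<in> borel_on \<Omega> then \<F> U (S \<inter> frontier U) else 0)"
proof -
  note Ui = O_classD[OF U]
  obtain e :: "nat \<Rightarrow> real" and C where e: "\<forall>k. e k > 0" "decseq e" "e \<longlonglongrightarrow> 0" and C: "C \<ge> 0"
    "\<forall>k. measure \<mu> {x \<in> U. infdist x (frontier U) \<le> e k} \<le> C * e k"
    by (rule O_class_sequence[OF U \<mu>])
  obtain r \<nu> where \<nu>l: "layer_limit \<Omega> \<mu> U \<nu>"
    by (rule layer_limit_subsequence[where C=C, OF Ui spec[OF e(1)] e(2,3)])
       (use C(2) in \<open>simp add: closed_layer_def\<close>)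
  then have \<nu>: "radon_measure_on \<Omega> \<nu>" by (simp add: layer_limit_def)
  interpret finite_measure \<nu> using \<nu> by (rule radon_measure_onD)
  show ?thesis
  proof (rule vector_measure_on_of_dominated[OF \<Omega>b \<nu>, where c=1])
    fix A B assume AB: "A \<in> borel_on \<Omega>" "B \<in> borel_on \<Omega>" "A \<inter> B = {}"
    have "\<F> U ((A \<inter> frontier U) \<union> (B \<inter> frontier U)) = \<F> U (A \<inter> frontier U) + \<F> U (B \<inter> frontier U)"
      by (rule flux_Un[OF U]) (use AB in \<open>auto simp: borel_on_iff\<close>)
    moreover have "A \<union> B \<in> borel_on \<Omega>" using AB by (auto simp: borel_on_iff)
    ultimately show "(if A \<union> B \<in> borel_on \<Omega> then \<F> U ((A \<union> B) \<inter> frontier U) else 0) =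
      (if A \<in> borel_on \<Omega> then \<F> U (A \<inter> frontier U) else 0) + (if B \<in> borel_on \<Omega> then \<F> U (B \<inter> frontier U) else 0)"
      using AB by (simp add: Int_Un_distrib2)
  next
    fix A assume A: "A \<in> borel_on \<Omega>"
    have "\<bar>\<F> U (A \<inter> frontier U)\<bar> \<le> measure \<nu> (A \<inter> frontier U)"
      by (rule flux_le_layer_limit[OF U \<nu>l]) (use A in \<open>auto simp: borel_on_iff\<close>)
    also have "\<dots> \<le> measure \<nu> A"
      by (rule finite_measure_mono) (use A in \<open>auto simp: radon_measure_onD(2)[OF \<nu>]\<close>)
    finally show "norm (if A \<in> borel_on \<Omega> then \<F> U (A \<inter> frontier U) else 0) \<le> 1 * measure \<nu> A"
      using A by simp
  qed simp
qed

text \<open>\<open>X k\<close> covers the part of the layer of \<open>V\<close> inside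
  \<open>W\<close>, and \<open>Y k\<close> covers the whole layer. Along one subsequence the liminf
  bounds both: the \<open>Y\<close>-term, with whatever weight \<open>\<eta> > 0\<close>, puts
  \<open>V\<close> into the class and yields a limit measure \<nu>, and the \<open>X\<close>-term
  gives \<open>\<nu> (W \<inter> \<Omega>) \<le> c\<close>.\<close>

lemma flux_le:
  assumes V: "open_compactly_inside V \<Omega>" and e: "\<And>k. e k > 0" "decseq e" "e \<longlonglongrightarrow> 0"
    and W: "open W" and S: "S \<in> sets borel" "S \<subseteq> frontier V" "S \<subseteq> W" and \<eta>: "\<eta> > 0"
    and X: "\<forall>\<^sub>F k in sequentially. W \<inter> closed_layer V (e k) \<subseteq> X k" "\<And>k. X k \<in> borel_on \<Omega>"
    and Y: "\<forall>\<^sub>F k in sequentially. closed_layer V (e k) \<subseteq> Y k" "\<And>k. Y k \<in> borel_on \<Omega>"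
    and c: "liminf (\<lambda>k. ennreal (1 / e k) * (emeasure \<mu> (X k) + ennreal \<eta> * emeasure \<mu> (Y k))) < ennreal c"
  shows "V \<in> \<O>" and "\<bar>\<F> V S\<bar> \<le> c"
proof -
  note VD = open_compactly_insideD[OF V]
  obtain k0 where k0: "\<And>k. k \<ge> k0 \<Longrightarrow> W \<inter> closed_layer V (e k) \<subseteq> X k \<and> closed_layer V (e k) \<subseteq> Y k"
    using eventually_conj[OF X(1) Y(1)] by (auto simp: eventually_sequentially)
  define q where "q k = (measure \<mu> (X k) + \<eta> * measure \<mu> (Y k)) / e k" for k
  have "ennreal (1 / e k) * (emeasure \<mu> (X k) + ennreal \<eta> * emeasure \<mu> (Y k)) = ennreal (q k)" for k
    using e(1)[of k] \<eta> by (simp add: emeasure_eq_measure ennreal_mult[symmetric] ennreal_plus[symmetric] q_def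
        del: ennreal_plus)
  then have "liminf (\<lambda>k. ennreal (q k)) < ennreal c" using c by simp
  then obtain r0 where r0: "strict_mono (r0 :: nat \<Rightarrow> nat)" "\<forall>k. ennreal (q (r0 k)) < ennreal c"
    by (rule liminf_subsequence)
  define r where "r k = r0 (k + k0)" for k
  have r: "strict_mono r" using r0(1) by (auto simp: r_def strict_mono_def)
  have rk: "r k \<ge> k0" for k using strict_mono_imp_increasing[OF r0(1), of "k + k0"] by (simp add: r_def)
  have q0: "q k \<ge> 0" for k using e(1)[of k] \<eta> by (simp add: q_def)
  have q: "q (r k) < c" for k using spec[OF r0(2), of "k + k0"] q0[of "r0 (k + k0)"] by (simp add: r_def ennreal_less_iff)
  define e' where "e' k = e (r k)" for k
  have e': "e' k > 0" "decseq e'" "e' \<longlonglongrightarrow> 0" for k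
  proof -
    show "e' k > 0" unfolding e'_def by (rule e(1))
    show "decseq e'" unfolding e'_def[abs_def] decseq_def
      using decseqD[OF e(2)] strict_mono_less_eq[OF r] by simp
    show "e' \<longlonglongrightarrow> 0" using LIMSEQ_subseq_LIMSEQ[OF e(3) r] by (simp add: e'_def[abs_def] o_def)
  qed
  have sets: "X k \<in> sets \<mu>" "Y k \<in> sets \<mu>" for k using X(2) Y(2) by (simp_all add: sets_\<mu>)
  have qe: "measure \<mu> (X (r k)) + \<eta> * measure \<mu> (Y (r k)) < c * e' k" for k
    using q[of k] e'(1)[of k] by (simp add: q_def e'_def pos_divide_less_eq)
  \<comment> \<open>The weight \<eta> affects the constant of the mass bound only; it does not
    appear in the final estimate.\<close>
  have mass: "measure \<mu> (closed_layer V (e' k)) \<le> c / \<eta> * e' k" for k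
  proof -
    have "measure \<mu> (closed_layer V (e' k)) \<le> measure \<mu> (Y (r k))"
      by (rule finite_measure_mono[OF _ sets(2)]) (use k0[OF rk] in \<open>simp add: e'_def\<close>)
    moreover have "\<eta> * measure \<mu> (Y (r k)) \<le> c * e' k" using qe[of k] measure_nonneg[of \<mu> "X (r k)"] by linarith
    then have "measure \<mu> (Y (r k)) \<le> c / \<eta> * e' k" using \<eta> by (simp add: field_simps)
    ultimately show ?thesis by linarith
  qed
  show VO: "V \<in> \<O>" by (rule O_class_of_sequence[OF V e'(1,3) mass])
  obtain r' \<nu> where r': "strict_mono (r' :: nat \<Rightarrow> nat)" and \<nu>l: "layer_limit \<Omega> \<mu> V \<nu>"
    and lim: "\<forall>\<phi>\<in>test_functions 0 \<Omega>. (\<lambda>k. integral\<^sup>L (scaled_layer \<mu> V (e' (r' k))) \<phi>) \<longlonglongrightarrow> integral\<^sup>L \<nu> \<phi>"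
    by (rule layer_limit_subsequence[OF V e' mass])
  have \<nu>: "radon_measure_on \<Omega> \<nu>" using \<nu>l by (simp add: layer_limit_def)
  interpret \<nu>: finite_measure \<nu> using \<nu> by (rule radon_measure_onD)
  have W\<Omega>: "open (W \<inter> \<Omega>)" using W \<Omega> by auto
  \<comment> \<open>Lower semicontinuity of mass on open sets: functions supported in
    \<open>W \<inter> \<Omega>\<close> see only the portion of the layer covered by
    \<open>X\<close>.\<close>
  obtain f :: "nat \<Rightarrow> 'a \<Rightarrow> real" where f: "\<And>j. f j \<in> test_functions 0 (W \<inter> \<Omega>)"
    "\<And>j x. 0 \<le> f j x" "\<And>j x. f j x \<le> 1" "\<And>x. (\<lambda>j. f j x) \<longlonglongrightarrow> indicator (W \<inter> \<Omega>) x"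
    using open_indicator_approx[OF W\<Omega>] by metis
  have fb: "bounded_borel (f j)" for j by (rule test_function_bounded_borel[OF f(1)])
  have fc: "integral\<^sup>L \<nu> (f j) \<le> c" for j
  proof (rule LIMSEQ_le_const2)
    have "f j \<in> test_functions 0 \<Omega>" by (rule test_functions_mono[OF f(1)]) simp
    then show "(\<lambda>k. integral\<^sup>L (scaled_layer \<mu> V (e' (r' k))) (f j)) \<longlonglongrightarrow> integral\<^sup>L \<nu> (f j)" using lim by blast
    have "integral\<^sup>L (scaled_layer \<mu> V (e' k)) (f j) \<le> c" for k
    proof -
      have "(\<integral>x. indicator (layer V (e' k)) x * f j x \<partial>\<mu>) \<le> (\<integral>x. indicator (X (r k)) x \<partial>\<mu>)"
      proof (rule integral_mono)
        show "integrable \<mu> (\<lambda>x. indicator (layer V (e' k)) x * f j x)"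
          by (intro radon_integrable[OF \<mu> \<Omega>b] bounded_borel_mult bounded_borel_indicator layer_borel[OF VD(1)] fb)
        show "integrable \<mu> (indicator (X (r k)) :: 'a \<Rightarrow> real)"
          by (intro radon_integrable[OF \<mu> \<Omega>b] bounded_borel_indicator) (use X(2) in \<open>simp add: borel_on_iff\<close>)
        fix x
        have "f j x = 0" if "x \<notin> W" using test_functionsD(6)[OF f(1), of x j] that by simp
        moreover have "x \<in> X (r k)" if "x \<in> W" "x \<in> layer V (e' k)"
          using that k0[OF rk, of k] layer_subset_closed_layer[of V "e' k"] unfolding e'_def by blast
        ultimately show "indicator (layer V (e' k)) x * f j x \<le> indicator (X (r k)) x"
          using f(2,3)[of j x] by (auto simp: indicator_def)
      qed
      also have "\<dots> = measure \<mu> (X (r k))"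
        using X(2)[of "r k"] by (simp add: space_\<mu> borel_on_iff Int_absorb2)
      also have "\<dots> \<le> c * e' k"
      proof -
        have "\<eta> * measure \<mu> (Y (r k)) \<ge> 0" using \<eta> by simp
        then show ?thesis using qe[of k] by linarith
      qed
      finally show ?thesis
        unfolding integral_scaled_layer[OF \<mu> \<Omega>b VD(1) e'(1) fb] using e'(1)[of k] by (simp add: pos_divide_le_eq)
    qed
    then show "\<exists>N. \<forall>n\<ge>N. integral\<^sup>L (scaled_layer \<mu> V (e' (r' n))) (f j) \<le> c" by blast
  qed
  have lim1: "(\<lambda>j. integral\<^sup>L \<nu> (f j)) \<longlonglongrightarrow> integral\<^sup>L \<nu> (indicator (W \<inter> \<Omega>))"
  proof (rule integral_dominated_convergence[where w="\<lambda>x. 1"])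
    show "(indicator (W \<inter> \<Omega>) :: 'a \<Rightarrow> real) \<in> borel_measurable \<nu>"
      by (intro radon_measurable[OF \<nu> \<Omega>b] borel_measurable_indicator borel_open W\<Omega>)
    show "f j \<in> borel_measurable \<nu>" for j
      by (rule radon_measurable[OF \<nu> \<Omega>b bounded_borel_measurable[OF fb]])
    show "AE x in \<nu>. (\<lambda>j. f j x) \<longlonglongrightarrow> indicator (W \<inter> \<Omega>) x" by (intro AE_I2 f(4))
    show "AE x in \<nu>. norm (f j x) \<le> 1" for j using f(2,3) by (intro AE_I2) simp
  qed simp
  have "integral\<^sup>L \<nu> (indicator (W \<inter> \<Omega>)) = measure \<nu> (W \<inter> \<Omega>)"
    by (simp add: radon_measure_onD(1)[OF \<nu>])
  moreover have "integral\<^sup>L \<nu> (indicator (W \<inter> \<Omega>)) \<le> c"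
    by (rule LIMSEQ_le_const2[OF lim1]) (use fc in blast)
  ultimately have "measure \<nu> (W \<inter> \<Omega>) \<le> c" by (simp only:)
  moreover have "measure \<nu> S \<le> measure \<nu> (W \<inter> \<Omega>)"
    by (rule \<nu>.finite_measure_mono) (use S VD(6) W\<Omega> in \<open>auto simp: radon_measure_onD(2)[OF \<nu>] borel_on_iff\<close>)
  moreover have "\<bar>\<F> V S\<bar> \<le> measure \<nu> S" by (rule flux_le_layer_limit[OF VO \<nu>l S(1,2)])
  ultimately show "\<bar>\<F> V S\<bar> \<le> c" by linarith
qed

lemma flux_empty: "U \<in> \<O> \<Longrightarrow> \<F> U {} = 0"
  using flux_Un[of U "{}" "{}"] by simp

text \<open>The balance law makes the total mass of \<open>net_flux U\<close> vanish, so a layer-cake formula for it needs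
  no correction by the lower bound of the integrand.\<close>

definition net_flux :: "'a set \<Rightarrow> 'a set \<Rightarrow> real" where
  "net_flux U S = (if S \<in> borel_on \<Omega> then \<sigma> (S \<inter> U) - \<F> U (S \<inter> frontier U) else 0)"

lemma net_flux_measure:
  assumes U: "U \<in> \<O>"
  shows "signed_measure_on \<Omega> (net_flux U)"
proof -
  have "U \<in> sets borel" using U by (simp add: O_class_def open_compactly_inside_def)
  then have "signed_measure_on \<Omega> (\<lambda>S. (if S \<in> borel_on \<Omega> then \<sigma> (S \<inter> U) else 0) - (if S \<in> borel_on \<Omega> then \<F> U (S \<inter> frontier U) else 0))"
    using \<Omega> by (intro vector_measure_on_diff vector_measure_on_restrict flux_measure[OF U] \<sigma>) simp_all
  also have "(\<lambda>S. (if S \<in> borel_on \<Omega> then \<sigma> (S \<inter> U) else 0) - (if S \<in> borel_on \<Omega> then \<F> U (S \<inter> frontier U) else 0)) = net_flux U"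
    by (auto simp: net_flux_def)
  finally show ?thesis .
qed

lemma net_flux_total:
  assumes U: "U \<in> \<O>"
  shows "net_flux U \<Omega> = 0"
proof -
  note Ui = O_classD[OF U]
  note UD = open_compactly_insideD[OF Ui]
  have "\<Omega> \<inter> U = U" "\<Omega> \<inter> frontier U = frontier U" using UD by auto
  then show ?thesis using flux_balance[OF Ui] \<Omega> by (simp add: net_flux_def borel_on_iff)
qed

lemma net_flux_closure:
  assumes U: "U \<in> \<O>" and S: "S \<in> borel_on \<Omega>"
  shows "net_flux U S = net_flux U (S \<inter> closure U)"
proof -
  have "S \<inter> closure U \<in> borel_on \<Omega>" using S by (auto simp: borel_on_iff)
  moreover have "S \<inter> closure U \<inter> U = S \<inter> U" "S \<inter> closure U \<inter> frontier U = S \<inter> frontier U"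
    using closure_subset[of U] by (auto simp: frontier_def)
  ultimately show ?thesis using S by (simp add: net_flux_def)
qed

text \<open>The boundary side of the Gauss-Green formula, that is, the prospective integral of
  \<open>grad \<phi> \<bullet> dF\<close> over \<open>U\<close>. The indicator turns an unbounded
  Lipschitz function into a bounded integrand and is harmless, since \<open>net_flux U\<close> is
  carried by \<open>closure U\<close>.\<close>

definition net_integral :: "'a set \<Rightarrow> ('a \<Rightarrow> real) \<Rightarrow> real" where
  "net_integral U \<phi> = sint \<Omega> (net_flux U) (\<lambda>x. indicator (closure U) x * \<phi> x)"

section \<open>Fluxes through the level sets of a Lipschitz function\<close>

context
  fixes L :: real and \<phi> :: "'a \<Rightarrow> real"
  assumes L: "L > 0" "L-lipschitz_on UNIV \<phi>"
begin

abbreviation above :: "'a set \<Rightarrow> real \<Rightarrow> 'a set" where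
  "above U t \<equiv> U \<inter> {x. \<phi> x > t}"

text \<open>If \<open>\<F>\<close> comes from a field \<open>F\<close>, the integral over \<open>t\<close> of \<open>slice_flux U t S\<close> is that of
  \<open>grad \<phi> \<bullet> dF\<close> over \<open>S \<inter> U\<close>, by the coarea formula.\<close>

definition slice_flux :: "'a set \<Rightarrow> real \<Rightarrow> 'a set \<Rightarrow> real" where
  "slice_flux U t S = \<F> (above U t) (S \<inter> U \<inter> frontier (above U t))"

text \<open>One estimate behind three applications: null edges, an integrable majorant, and the
  bound by \<open>L * measure \<mu> A\<close>. Inside the window \<open>W t\<close>, points of the
  layer of \<open>U\<close> are charged to \<open>G k\<close> with level offset in \<open>I\<close>,
  and the slab above level \<open>t\<close> is charged to \<open>E\<close>. Integrated over
  \<open>t\<close> and divided by the thickness, these give \<open>l * C'\<close> and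
  \<open>L * measure \<mu> E\<close>; the \<eta>-term pays for the whole layer. Fatou's lemma bounds
  the integral of the liminf \<open>g\<close>.\<close>

lemma slice_bound:
  assumes U: "U \<in> \<O>"
    and R: "R \<ge> 0" "\<And>x. x \<in> closure U \<Longrightarrow> \<bar>\<phi> x\<bar> < R"
    and e: "\<And>k. e k > 0" "decseq e" "e \<longlonglongrightarrow> 0" and C: "\<And>k. measure \<mu> (closed_layer U (e k)) \<le> C * e k"
    and G: "\<And>k. G k \<in> borel_on \<Omega>" "\<And>k. measure \<mu> (G k) \<le> C' * e k"
    and I: "I \<in> sets borel" "emeasure lborel I = ennreal l" "l \<ge> 0" and E: "E \<in> borel_on \<Omega>" and \<eta>: "\<eta> > 0"
    and W: "\<And>t. open (W t)" "\<And>t. \<forall>\<^sub>F k in sequentially. W t \<inter> closed_layer U (e k) \<subseteq> {x \<in> G k. \<phi> x - t \<in> I}"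
      "\<And>t. W t \<inter> U \<subseteq> E"
  obtains g where "g \<in> borel_measurable lborel"
    "(\<integral>\<^sup>+t. g t \<partial>lborel) \<le> ennreal (l * C' + L * measure \<mu> E + \<eta> * (4 * R * C + L * measure \<mu> U))"
    "AE t in lborel. above U t \<in> \<O> \<and>
      (\<forall>S\<in>sets borel. S \<subseteq> frontier (above U t) \<inter> W t \<inter> {x. \<phi> x = t} \<longrightarrow>
        ennreal \<bar>\<F> (above U t) S\<bar> \<le> g t)"
proof -
  note Ui = O_classD[OF U]
  note UD = open_compactly_insideD[OF Ui]
  have \<phi>: "\<phi> \<in> borel_measurable borel"
    by (rule borel_measurable_continuous_onI[OF lipschitz_on_continuous_on[OF L(2)]])
  have UB: "U \<in> borel_on \<Omega>" using UD by (simp add: borel_on_iff)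
  have clB: "closed_layer U (e k) \<in> borel_on \<Omega>" for k
    using borel_closed_layer[OF UD(1)] closed_layer_subset[of U "e k"] UD(4) by (auto simp: borel_on_iff)
  define m where "m A J t = emeasure \<mu> {x \<in> A. \<phi> x - t \<in> J}" for A J t
  have mm: "m A J \<in> borel_measurable lborel" if "A \<in> borel_on \<Omega>" "J \<in> sets borel" for A J
    using nn_integral_slices(1)[OF \<phi> that] by (simp add: m_def[abs_def])
  have mi: "(\<integral>\<^sup>+t. m A J t \<partial>lborel) = emeasure lborel J * emeasure \<mu> A" if "A \<in> borel_on \<Omega>" "J \<in> sets borel" for A J
    using nn_integral_slices(2)[OF \<phi> that] by (simp add: m_def)
  have sliceB: "{x \<in> A. \<phi> x - t \<in> J} \<in> borel_on \<Omega>" if "A \<in> borel_on \<Omega>" "J \<in> sets borel" for A J t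
  proof -
    have "{x \<in> A. \<phi> x - t \<in> J} = A \<inter> (\<lambda>x. \<phi> x - t) -` J" by auto
    moreover have "(\<lambda>x. \<phi> x - t) -` J \<in> sets borel"
      using measurable_sets[OF borel_measurable_diff[OF \<phi> borel_measurable_const[of t]] that(2)] by simp
    ultimately show ?thesis using that(1) by (auto simp: borel_on_iff)
  qed
  \<comment> \<open>\<open>J k\<close> is the slab above level \<open>t\<close> from
    \<open>superlevel_layer\<close>. The interval \<open>K\<close> defined next contains every
    offset \<open>\<phi> x - t\<close> with \<open>\<bar>t\<bar> < R\<close> and \<open>x\<close> in
    \<open>U\<close>, so it imposes no restriction on the layer of \<open>U\<close>.\<close>
  define J where "J k = {0<..L * e k}" for k
  define K where "K = {- (2 * R)..2 * R}"
  have JK: "J k \<in> sets borel" "K \<in> sets borel" "emeasure lborel (J k) = ennreal (L * e k)" "emeasure lborel K = ennreal (4 * R)" for k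
    using L e(1)[of k] R(1) by (simp_all add: J_def K_def)
  define w where "w k t = ennreal (1 / e k) * (m (G k) I t + m E (J k) t + ennreal \<eta> * (m (closed_layer U (e k)) K t + m U (J k) t))" for k t
  have wm: "w k \<in> borel_measurable lborel" for k
    unfolding w_def[abs_def]
    by (intro borel_measurable_times_ennreal borel_measurable_add borel_measurable_const mm G clB UB E I JK)
  define T where "T = l * C' + L * measure \<mu> E + \<eta> * (4 * R * C + L * measure \<mu> U)"
  have wi: "(\<integral>\<^sup>+t. w k t \<partial>lborel) \<le> ennreal T" for k
  proof -
    have "(\<integral>\<^sup>+t. w k t \<partial>lborel) = ennreal (1 / e k) * (ennreal l * emeasure \<mu> (G k) + ennreal (L * e k) * emeasure \<mu> E
       + ennreal \<eta> * (ennreal (4 * R) * emeasure \<mu> (closed_layer U (e k)) + ennreal (L * e k) * emeasure \<mu> U))"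
      unfolding w_def using mm[OF G(1) I(1)] mm[OF E JK(1)] mm[OF clB JK(2)] mm[OF UB JK(1)]
      by (simp add: nn_integral_cmult nn_integral_add mi[OF G(1) I(1)] mi[OF E JK(1)] mi[OF clB JK(2)] mi[OF UB JK(1)] I(2) JK(3,4))
    also have "\<dots> = ennreal ((1 / e k) * (l * measure \<mu> (G k) + (L * e k) * measure \<mu> E
       + \<eta> * ((4 * R) * measure \<mu> (closed_layer U (e k)) + (L * e k) * measure \<mu> U)))"
      using L(1) e(1)[of k] I(3) R(1) \<eta> by (simp add: emeasure_eq_measure ennreal_mult[symmetric] ennreal_plus[symmetric] del: ennreal_plus)
    also have "\<dots> \<le> ennreal T"
    proof (rule ennreal_leI)
      have "l * measure \<mu> (G k) + (L * e k) * measure \<mu> E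
          + \<eta> * ((4 * R) * measure \<mu> (closed_layer U (e k)) + (L * e k) * measure \<mu> U)
        \<le> l * (C' * e k) + (L * e k) * measure \<mu> E + \<eta> * ((4 * R) * (C * e k) + (L * e k) * measure \<mu> U)"
        using I(3) \<eta> R(1) by (intro add_mono mult_left_mono G C order_refl) simp_all
      also have "\<dots> = T * e k" by (simp add: T_def algebra_simps)
      finally show "(1 / e k) * (l * measure \<mu> (G k) + (L * e k) * measure \<mu> E
          + \<eta> * ((4 * R) * measure \<mu> (closed_layer U (e k)) + (L * e k) * measure \<mu> U)) \<le> T"
        using e(1)[of k] by (simp add: pos_divide_le_eq)
    qed
    finally show ?thesis .
  qed
  define g where "g t = liminf (\<lambda>k. w k t)" for t
  have gm: "g \<in> borel_measurable lborel" unfolding g_def[abs_def] by (rule borel_measurable_liminf[OF wm])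
  have "(\<integral>\<^sup>+t. g t \<partial>lborel) \<le> liminf (\<lambda>k. \<integral>\<^sup>+t. w k t \<partial>lborel)"
    unfolding g_def by (rule nn_integral_liminf[OF wm])
  also have "\<dots> \<le> liminf (\<lambda>k::nat. ennreal T)" by (rule Liminf_mono) (simp add: wi)
  finally have gi: "(\<integral>\<^sup>+t. g t \<partial>lborel) \<le> ennreal T" by (simp add: Liminf_const)
  have "(\<integral>\<^sup>+t. g t \<partial>lborel) \<noteq> \<infinity>" using le_less_trans[OF gi ennreal_less_top] by simp
  from nn_integral_PInf_AE[OF gm this] have gfin: "AE t in lborel. g t \<noteq> \<infinity>" .
  have main: "above U t \<in> \<O> \<and>
      (\<forall>S\<in>sets borel. S \<subseteq> frontier (above U t) \<inter> W t \<inter> {x. \<phi> x = t} \<longrightarrow>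
        ennreal \<bar>\<F> (above U t) S\<bar> \<le> g t)" if g: "g t \<noteq> \<infinity>" for t
  proof -
    define V where "V = above U t"
    have fV: "frontier V \<subseteq> closure U" using frontier_superlevel_subset[OF L(2), of U t] by (auto simp: V_def)
    have Vo: "open V" unfolding V_def by (rule open_superlevel[OF UD(1) L(2)])
    have Vi: "open_compactly_inside V \<Omega>"
      by (rule open_compactly_inside_subset[OF Ui _ Vo]) (simp add: V_def)
    have "V \<in> \<O> \<and> (\<forall>S\<in>sets borel. S \<subseteq> frontier V \<inter> W t \<inter> {x. \<phi> x = t} \<longrightarrow> ennreal \<bar>\<F> V S\<bar> \<le> g t)"
    \<comment> \<open>Beyond the range of \<phi> the superlevel set is empty or all of
      \<open>U\<close>, and the level \<open>t\<close> is not attained on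
      \<open>closure U\<close>.\<close>
    proof (cases "\<bar>t\<bar> < R")
      case False
      have "V = {} \<or> V = U"
      proof (cases "t \<ge> 0")
        case True
        then have "V = {}" using False R(2) closure_subset[of U] by (force simp: V_def)
        then show ?thesis ..
      next
        case t: False
        then have "V = U" using False R(2) closure_subset[of U] by (force simp: V_def)
        then show ?thesis ..
      qed
      then have VO: "V \<in> \<O>" using U empty_O_class by auto
      have "S = {}" if "S \<subseteq> frontier V \<inter> W t \<inter> {x. \<phi> x = t}" for S
        using that fV R(2) False by fastforce
      then have "\<F> V S = 0" if "S \<subseteq> frontier V \<inter> W t \<inter> {x. \<phi> x = t}" for S
        using that flux_empty[OF VO] by (metis (no_types))
      then show ?thesis using VO by simp
    next
      case True
      obtain g0 where g0: "g0 \<ge> 0" "g t = ennreal g0" using g by (cases "g t") auto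
      define X where "X k = {x \<in> G k. \<phi> x - t \<in> I} \<union> {x \<in> E. \<phi> x - t \<in> J k}" for k
      define Y where "Y k = {x \<in> closed_layer U (e k). \<phi> x - t \<in> K} \<union> {x \<in> U. \<phi> x - t \<in> J k}" for k
      have sup: "x \<in> U \<and> (x \<in> closed_layer U (e k) \<or> \<phi> x - t \<in> J k)" if "x \<in> closed_layer V (e k)" for x k
        using that superlevel_layer[OF UD(1,5) L(2), of x t "e k"] closed_layer_subset[of V "e k"]
        by (auto simp: V_def J_def)
      have X1: "\<forall>\<^sub>F k in sequentially. W t \<inter> closed_layer V (e k) \<subseteq> X k"
        using W(2)[of t]
      proof eventually_elim
        case (elim k)
        then show ?case using sup[of _ k] W(3)[of t] unfolding X_def by blast
      qed
      have Y1: "\<forall>\<^sub>F k in sequentially. closed_layer V (e k) \<subseteq> Y k"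
      proof (intro always_eventually allI subsetI)
        fix k x assume x: "x \<in> closed_layer V (e k)"
        have "\<bar>\<phi> x\<bar> < R" using sup[OF x] closure_subset[of U] by (intro R) auto
        then have "\<phi> x - t \<in> K" using True by (auto simp: K_def)
        then show "x \<in> Y k" using sup[OF x] by (auto simp: Y_def)
      qed
      have XB: "X k \<in> borel_on \<Omega>" for k
        using sliceB[OF G(1)[of k] I(1), of t] sliceB[OF E JK(1)[of k], of t] by (auto simp: X_def borel_on_iff)
      have YB: "Y k \<in> borel_on \<Omega>" for k
        using sliceB[OF clB[of k] JK(2), of t] sliceB[OF UB JK(1)[of k], of t] by (auto simp: Y_def borel_on_iff)
      have em: "emeasure \<mu> (X k) \<le> m (G k) I t + m E (J k) t" "emeasure \<mu> (Y k) \<le> m (closed_layer U (e k)) K t + m U (J k) t" for k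
        unfolding X_def Y_def m_def
        by (rule emeasure_subadditive; simp add: sets_\<mu> sliceB G I E JK clB UB)+
      have le: "liminf (\<lambda>k. ennreal (1 / e k) * (emeasure \<mu> (X k) + ennreal \<eta> * emeasure \<mu> (Y k))) \<le> g t"
        unfolding g_def w_def by (intro Liminf_mono always_eventually allI mult_left_mono add_mono em) simp_all
      \<comment> \<open>The criterion needs strict inequality, so the bound is first obtained for
        every \<open>c\<close> above the liminf.\<close>
      have fl: "V \<in> \<O> \<and> \<bar>\<F> V S\<bar> \<le> c" if c: "g0 < c" and S: "S \<in> sets borel" "S \<subseteq> frontier V" "S \<subseteq> W t" for S c
      proof -
        have "liminf (\<lambda>k. ennreal (1 / e k) * (emeasure \<mu> (X k) + ennreal \<eta> * emeasure \<mu> (Y k))) < ennreal c"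
          using le c g0 by (auto intro: le_less_trans ennreal_lessI)
        note flux_le[OF Vi e W(1) S \<eta> X1 XB Y1 YB this]
        then show ?thesis ..
      qed
      have "V \<in> \<O>" using fl[of "g0 + 1" "{}"] by simp
      moreover have "ennreal \<bar>\<F> V S\<bar> \<le> g t" if "S \<in> sets borel" "S \<subseteq> frontier V \<inter> W t \<inter> {x. \<phi> x = t}" for S
      proof -
        have "\<bar>\<F> V S\<bar> \<le> g0 + \<epsilon>" if "\<epsilon> > 0" for \<epsilon>
          using fl[of "g0 + \<epsilon>" S] that \<open>S \<in> sets borel\<close> \<open>S \<subseteq> _\<close> by simp
        then have "\<bar>\<F> V S\<bar> \<le> g0" by (rule field_le_epsilon)
        then show ?thesis by (simp add: g0 ennreal_leI)
      qed
      ultimately show ?thesis by blast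
    qed
    then show ?thesis by (simp add: V_def)
  qed
  show ?thesis
    by (rule that[OF gm gi[unfolded T_def]]) (use gfin in eventually_elim, rule main)
qed

text \<open>The window shrinks to the edge: points within \<delta> of the level and within \<delta>
  of \<open>frontier U\<close>. All bounds \<open>g j\<close> majorize the same flux, so their
  infimum does too, and its integral is 0.\<close>

lemma AE_edge:
  assumes U: "U \<in> \<O>"
  shows "AE t in lborel. above U t \<in> \<O> \<and>
    \<F> (above U t) (frontier (above U t) \<inter> frontier U \<inter> {x. \<phi> x = t}) = 0"
proof -
  note Ui = O_classD[OF U]
  note UD = open_compactly_insideD[OF Ui]
  have \<phi>c: "continuous_on UNIV \<phi>" by (rule lipschitz_on_continuous_on[OF L(2)])
  obtain e :: "nat \<Rightarrow> real" and C where e: "\<forall>k. e k > 0" "decseq e" "e \<longlonglongrightarrow> 0" and C: "C \<ge> 0"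
    "\<forall>k. measure \<mu> {x \<in> U. infdist x (frontier U) \<le> e k} \<le> C * e k"
    by (rule O_class_sequence[OF U \<mu>])
  obtain R where R: "R \<ge> 0" "\<forall>x\<in>closure U. \<bar>\<phi> x\<bar> < R" by (rule lipschitz_bounded_on[OF UD(2) L(2)])
  define S where "S t = frontier (above U t) \<inter> frontier U \<inter> {x. \<phi> x = t}" for t
  define \<delta> where "\<delta> j = 1 / real (Suc j)" for j
  have \<delta>: "\<delta> j > 0" "\<delta> \<longlonglongrightarrow> 0" for j
    unfolding \<delta>_def by (simp, rule LIMSEQ_Suc[OF lim_1_over_n])
  \<comment> \<open>The first term is the layer of \<open>U\<close> with offsets in an interval of
    length \<open>2 * \<delta> j\<close>, the second the slabs inside the closed layer of thickness
    \<open>\<delta> j\<close>, and the last the total layer mass, weighted with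
    \<open>\<eta> = \<delta> j\<close>. All three tend to 0.\<close>
  define K where "K j = 2 * \<delta> j * C + L * measure \<mu> (closed_layer U (\<delta> j)) + \<delta> j * (4 * R * C + L * measure \<mu> U)" for j
  have cl: "measure \<mu> (closed_layer U (e k)) \<le> C * e k" for k using C(2) by (simp add: closed_layer_def)
  have clB: "closed_layer U r \<in> borel_on \<Omega>" for r
    using borel_closed_layer[OF UD(1)] closed_layer_subset[of U r] UD(4) by (auto simp: borel_on_iff)
  have "\<exists>g. g \<in> borel_measurable lborel \<and> (\<integral>\<^sup>+t. g t \<partial>lborel) \<le> ennreal (K j) \<and>
    (AE t in lborel. above U t \<in> \<O> \<and> ennreal \<bar>\<F> (above U t) (S t)\<bar> \<le> g t)" for j
  proof -
    define W where "W t = {x. \<bar>\<phi> x - t\<bar> < \<delta> j} \<inter> {x. infdist x (frontier U) < \<delta> j}" for t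
    have W1: "open (W t)" for t
      unfolding W_def by (intro open_Int open_Collect_less continuous_intros \<phi>c)
    have W2: "\<forall>\<^sub>F k in sequentially. W t \<inter> closed_layer U (e k) \<subseteq> {x \<in> closed_layer U (e k). \<phi> x - t \<in> {- \<delta> j<..<\<delta> j}}" for t
      by (intro always_eventually allI subsetI) (auto simp: W_def)
    have W3: "W t \<inter> U \<subseteq> closed_layer U (\<delta> j)" for t by (auto simp: W_def closed_layer_def)
    have IB: "{- \<delta> j<..<\<delta> j} \<in> sets borel" by simp
    have l: "emeasure lborel {- \<delta> j<..<\<delta> j} = ennreal (2 * \<delta> j)" "2 * \<delta> j \<ge> 0" using \<delta>(1)[of j] by simp_all
    obtain g where g: "g \<in> borel_measurable lborel" "(\<integral>\<^sup>+t. g t \<partial>lborel) \<le> ennreal (K j)"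
      "AE t in lborel. above U t \<in> \<O> \<and>
        (\<forall>S\<in>sets borel. S \<subseteq> frontier (above U t) \<inter> W t \<inter> {x. \<phi> x = t} \<longrightarrow>
          ennreal \<bar>\<F> (above U t) S\<bar> \<le> g t)"
      unfolding K_def
      by (rule slice_bound[OF U R(1) bspec[OF R(2)] spec[OF e(1)] e(2,3) cl clB cl IB l clB \<delta>(1) W1 W2 W3])
    have SB: "S t \<in> sets borel" for t
      unfolding S_def by (intro sets.Int borel_closed frontier_closed closed_Collect_eq \<phi>c continuous_on_const)
    have SW: "S t \<subseteq> frontier (above U t) \<inter> W t \<inter> {x. \<phi> x = t}" for t
      using \<delta>(1)[of j] by (auto simp: S_def W_def)
    have "AE t in lborel. above U t \<in> \<O> \<and> ennreal \<bar>\<F> (above U t) (S t)\<bar> \<le> g t"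
      using g(3)
    proof eventually_elim
      case (elim t)
      then have "above U t \<in> \<O>" by (rule conjunct1)
      moreover have "ennreal \<bar>\<F> (above U t) (S t)\<bar> \<le> g t"
        by (rule mp[OF bspec[OF conjunct2[OF elim] SB] SW])
      ultimately show ?case ..
    qed
    then show ?thesis using g(1,2) by blast
  qed
  then have "\<exists>g. \<forall>j. g j \<in> borel_measurable lborel \<and> (\<integral>\<^sup>+t. g j t \<partial>lborel) \<le> ennreal (K j) \<and>
    (AE t in lborel. above U t \<in> \<O> \<and> ennreal \<bar>\<F> (above U t) (S t)\<bar> \<le> g j t)"
    by (intro choice allI)
  then obtain g where g0: "\<forall>j. g j \<in> borel_measurable lborel \<and> (\<integral>\<^sup>+t. g j t \<partial>lborel) \<le> ennreal (K j) \<and>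
    (AE t in lborel. above U t \<in> \<O> \<and> ennreal \<bar>\<F> (above U t) (S t)\<bar> \<le> g j t)" ..
  have g: "g j \<in> borel_measurable lborel" "(\<integral>\<^sup>+t. g j t \<partial>lborel) \<le> ennreal (K j)"
    "AE t in lborel. above U t \<in> \<O> \<and> ennreal \<bar>\<F> (above U t) (S t)\<bar> \<le> g j t" for j
    using spec[OF g0, of j] by simp_all
  define h where "h t = (INF j. g j t)" for t
  have hm: "h \<in> borel_measurable lborel" unfolding h_def[abs_def] by (rule borel_measurable_INF) (use g(1) in auto)
  have "K \<longlonglongrightarrow> 2 * 0 * C + L * 0 + 0 * (4 * R * C + L * measure \<mu> U)"
    unfolding K_def[abs_def] using measure_closed_layer_tendsto_0[OF Ui]
    by (intro tendsto_add tendsto_mult tendsto_const \<delta>(2)) (simp add: \<delta>_def)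
  then have "(\<lambda>j. ennreal (K j)) \<longlonglongrightarrow> ennreal 0" by (intro tendsto_ennrealI) simp
  then have "(\<integral>\<^sup>+t. h t \<partial>lborel) \<le> ennreal 0"
  proof (rule LIMSEQ_le_const, intro exI[of _ 0] allI impI)
    fix j
    have "(\<integral>\<^sup>+t. h t \<partial>lborel) \<le> (\<integral>\<^sup>+t. g j t \<partial>lborel)" by (intro nn_integral_mono) (simp add: h_def, rule INF_lower, simp)
    then show "(\<integral>\<^sup>+t. h t \<partial>lborel) \<le> ennreal (K j)" using g(2)[of j] by (rule order_trans)
  qed
  then have "(\<integral>\<^sup>+t. h t \<partial>lborel) = 0" by simp
  then have h0: "AE t in lborel. h t = 0" using nn_integral_0_iff_AE[OF hm] by simp
  have "AE t in lborel. \<forall>j. above U t \<in> \<O> \<and> ennreal \<bar>\<F> (above U t) (S t)\<bar> \<le> g j t"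
    unfolding AE_all_countable using g(3) by blast
  with h0 show ?thesis
  proof eventually_elim
    case (elim t)
    have "ennreal \<bar>\<F> (above U t) (S t)\<bar> \<le> h t" unfolding h_def by (rule INF_greatest) (use elim(2) in blast)
    then have "\<F> (above U t) (S t) = 0" using elim(1) by simp
    then show ?case using spec[OF elim(2), of 0] by (simp add: S_def)
  qed
qed

text \<open>A crude majorant, with the widest window and weight 1, for dominated convergence in the
  level. The quantifier over \<open>S\<close> stands inside the almost-everywhere statement, so one
  exceptional null set serves all Borel sets.\<close>

lemma slice_dominated:
  assumes U: "U \<in> \<O>"
  obtains D where "integrable lborel D"
    "AE t in lborel. \<forall>S\<in>sets borel. \<bar>slice_flux U t S\<bar> \<le> D t"
proof -
  note Ui = O_classD[OF U]
  note UD = open_compactly_insideD[OF Ui]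
  obtain e :: "nat \<Rightarrow> real" and C where e: "\<forall>k. e k > 0" "decseq e" "e \<longlonglongrightarrow> 0" and C: "C \<ge> 0"
    "\<forall>k. measure \<mu> {x \<in> U. infdist x (frontier U) \<le> e k} \<le> C * e k"
    by (rule O_class_sequence[OF U \<mu>])
  obtain R where R: "R \<ge> 0" "\<forall>x\<in>closure U. \<bar>\<phi> x\<bar> < R" by (rule lipschitz_bounded_on[OF UD(2) L(2)])
  have cl: "measure \<mu> (closed_layer U (e k)) \<le> C * e k" for k using C(2) by (simp add: closed_layer_def)
  have clB: "closed_layer U r \<in> borel_on \<Omega>" for r
    using borel_closed_layer[OF UD(1)] closed_layer_subset[of U r] UD(4) by (auto simp: borel_on_iff)
  have UB: "U \<in> borel_on \<Omega>" using UD by (simp add: borel_on_iff)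
  \<comment> \<open>For levels beyond the range of \<phi> the offsets would leave the interval;
    there the slice is empty and so may be the window.\<close>
  define W :: "real \<Rightarrow> 'a set" where "W t = (if \<bar>t\<bar> < R then UNIV else {})" for t
  have W1: "open (W t)" for t by (simp add: W_def)
  have W2: "\<forall>\<^sub>F k in sequentially. W t \<inter> closed_layer U (e k) \<subseteq> {x \<in> closed_layer U (e k). \<phi> x - t \<in> {- (2 * R)..2 * R}}" for t
  proof (intro always_eventually allI subsetI)
    fix k x assume x: "x \<in> W t \<inter> closed_layer U (e k)"
    then have "\<bar>t\<bar> < R" by (auto simp: W_def split: if_splits)
    moreover have "\<bar>\<phi> x\<bar> < R" using x closed_layer_subset[of U "e k"] closure_subset[of U] by (intro bspec[OF R(2)]) auto
    ultimately show "x \<in> {x \<in> closed_layer U (e k). \<phi> x - t \<in> {- (2 * R)..2 * R}}" using x by auto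
  qed
  have W3: "W t \<inter> U \<subseteq> U" for t by simp
  have IB: "{- (2 * R)..2 * R} \<in> sets borel" by simp
  have l: "emeasure lborel {- (2 * R)..2 * R} = ennreal (4 * R)" "4 * R \<ge> 0" using R(1) by simp_all
  obtain g where g: "g \<in> borel_measurable lborel"
    "(\<integral>\<^sup>+t. g t \<partial>lborel) \<le> ennreal (4 * R * C + L * measure \<mu> U + 1 * (4 * R * C + L * measure \<mu> U))"
    "AE t in lborel. above U t \<in> \<O> \<and>
      (\<forall>S\<in>sets borel. S \<subseteq> frontier (above U t) \<inter> W t \<inter> {x. \<phi> x = t} \<longrightarrow>
        ennreal \<bar>\<F> (above U t) S\<bar> \<le> g t)"
    by (rule slice_bound[OF U R(1) bspec[OF R(2)] spec[OF e(1)] e(2,3) cl clB cl IB l UB zero_less_one W1 W2 W3])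
  have gfin: "(\<integral>\<^sup>+t. g t \<partial>lborel) \<noteq> \<infinity>" using le_less_trans[OF g(2) ennreal_less_top] by simp
  have gAE: "AE t in lborel. g t \<noteq> \<infinity>" using nn_integral_PInf_AE[OF g(1) gfin] .
  define D where "D t = enn2real (g t)" for t
  have "integrable lborel D"
  proof (rule integrableI_bounded)
    show "D \<in> borel_measurable lborel" unfolding D_def[abs_def] using g(1) by (rule borel_measurable_enn2real)
    have "(\<integral>\<^sup>+t. ennreal (norm (D t)) \<partial>lborel) \<le> (\<integral>\<^sup>+t. g t \<partial>lborel)"
      by (intro nn_integral_mono) (simp add: D_def enn2real_nonneg ennreal_enn2real_if)
    then show "(\<integral>\<^sup>+t. ennreal (norm (D t)) \<partial>lborel) < \<infinity>" using gfin by (simp add: less_top[symmetric] top_unique) (metis top_unique)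
  qed
  moreover have "AE t in lborel. \<forall>S\<in>sets borel. \<bar>slice_flux U t S\<bar> \<le> D t"
    using gAE g(3)
  proof eventually_elim
    case (elim t)
    define V where "V = above U t"
    show ?case
    proof
      fix S :: "'a set" assume S: "S \<in> sets borel"
      define T where "T = S \<inter> U \<inter> frontier V"
      have TB: "T \<in> sets borel" unfolding T_def by (intro sets.Int S borel_open UD(1) borel_closed frontier_closed)
      have T\<phi>: "T \<subseteq> {x. \<phi> x = t}" using slice_support[OF UD(1) L(2), of t] by (auto simp: T_def V_def)
      have "T \<subseteq> W t"
      proof
        fix x assume x: "x \<in> T"
        then have "x \<in> closure U" using closure_subset[of U] by (auto simp: T_def)
        then have "\<bar>\<phi> x\<bar> < R" using R(2) by blast
        then show "x \<in> W t" using T\<phi> x by (auto simp: W_def)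
      qed
      then have "T \<subseteq> frontier V \<inter> W t \<inter> {x. \<phi> x = t}" using T\<phi> by (auto simp: T_def)
      then have "ennreal \<bar>\<F> V T\<bar> \<le> g t" by (rule mp[OF bspec[OF conjunct2[OF elim(2)] TB], folded V_def])
      also have "g t = ennreal (D t)" using elim(1) by (simp add: D_def less_top)
      finally show "\<bar>slice_flux U t S\<bar> \<le> D t"
        by (simp add: slice_flux_def T_def V_def D_def)
    qed
  qed
  ultimately show ?thesis by (rule that)
qed

text \<open>A set compactly inside \<open>U\<close> eventually avoids the layers of
  \<open>U\<close>, so only the slab term survives. Letting \<eta> tend to 0 removes the cost of the
  whole layer and leaves the constant \<open>L\<close>.\<close>

lemma slice_mass:
  assumes U: "U \<in> \<O>" and A: "open_compactly_inside A U"
  shows "(\<integral>\<^sup>+t. ennreal \<bar>slice_flux U t A\<bar> \<partial>lborel) \<le> ennreal (L * measure \<mu> A)"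
proof -
  note Ui = O_classD[OF U]
  note UD = open_compactly_insideD[OF Ui] and AD = open_compactly_insideD[OF A]
  obtain e :: "nat \<Rightarrow> real" and C where e: "\<forall>k. e k > 0" "decseq e" "e \<longlonglongrightarrow> 0" and C: "C \<ge> 0"
    "\<forall>k. measure \<mu> {x \<in> U. infdist x (frontier U) \<le> e k} \<le> C * e k"
    by (rule O_class_sequence[OF U \<mu>])
  obtain R where R: "R \<ge> 0" "\<forall>x\<in>closure U. \<bar>\<phi> x\<bar> < R" by (rule lipschitz_bounded_on[OF UD(2) L(2)])
  have cl: "measure \<mu> (closed_layer U (e k)) \<le> C * e k" for k using C(2) by (simp add: closed_layer_def)
  have AB: "A \<in> borel_on \<Omega>" using UD(4) AD(1,4) by (simp add: borel_on_iff)
  have EB: "{} \<in> borel_on \<Omega>" "measure \<mu> {} \<le> 0 * e k" for k by (simp_all add: borel_on_iff)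
  have l: "({}::real set) \<in> sets borel" "emeasure lborel ({}::real set) = ennreal 0" "(0::real) \<ge> 0" by simp_all
  \<comment> \<open>The compact set \<open>closure A\<close> has positive distance from
    \<open>frontier U\<close>.\<close>
  have "\<forall>\<^sub>F k in sequentially. A \<inter> closed_layer U (e k) = {}"
  proof (cases "A = {}")
    case False
    then have "closure A \<noteq> {}" by simp
    have "continuous_on (closure A) (\<lambda>x. infdist x (frontier U))" by (intro continuous_intros)
    from continuous_attains_inf[OF AD(2) \<open>closure A \<noteq> {}\<close> this]
    obtain y where y: "y \<in> closure A" "\<forall>x\<in>closure A. infdist y (frontier U) \<le> infdist x (frontier U)"
      by blast
    have "infdist y (frontier U) > 0" by (rule infdist_frontier_pos[OF UD(1,5)]) (use y(1) AD(3) in blast)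
    then have "\<forall>\<^sub>F k in sequentially. e k < infdist y (frontier U)" using e(3) by (rule order_tendstoD(2)[rotated])
    then show ?thesis
    proof eventually_elim
      case (elim k)
      then show ?case using y(2) closure_subset[of A] by (force simp: closed_layer_def)
    qed
  qed simp
  then have W2: "\<forall>\<^sub>F k in sequentially. A \<inter> closed_layer U (e k) \<subseteq> {x \<in> {}. \<phi> x - t \<in> {}}" for t
    by eventually_elim simp
  have W3: "A \<inter> U \<subseteq> A" by simp
  define K where "K = 4 * R * C + L * measure \<mu> U"
  have est: "(\<integral>\<^sup>+t. ennreal \<bar>slice_flux U t A\<bar> \<partial>lborel) \<le> ennreal (L * measure \<mu> A + \<eta> * K)" if \<eta>: "\<eta> > 0" for \<eta>
  proof -
    obtain g where g: "g \<in> borel_measurable lborel" "(\<integral>\<^sup>+t. g t \<partial>lborel) \<le> ennreal (0 * 0 + L * measure \<mu> A + \<eta> * (4 * R * C + L * measure \<mu> U))"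
      "AE t in lborel. above U t \<in> \<O> \<and>
        (\<forall>S\<in>sets borel. S \<subseteq> frontier (above U t) \<inter> A \<inter> {x. \<phi> x = t} \<longrightarrow>
          ennreal \<bar>\<F> (above U t) S\<bar> \<le> g t)"
      by (rule slice_bound[OF U R(1) bspec[OF R(2)] spec[OF e(1)] e(2,3) cl EB l AB \<eta> AD(1) W2 W3])
    have "AE t in lborel. ennreal \<bar>slice_flux U t A\<bar> \<le> g t"
      using g(3)
    proof eventually_elim
      case (elim t)
      define T where "T = A \<inter> U \<inter> frontier (above U t)"
      have TB: "T \<in> sets borel" unfolding T_def by (intro sets.Int AD(1) borel_open UD(1) borel_closed frontier_closed)
      have "T \<subseteq> frontier (above U t) \<inter> A \<inter> {x. \<phi> x = t}"
        using slice_support[OF UD(1) L(2), of t] by (auto simp: T_def)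
      then have "ennreal \<bar>\<F> (above U t) T\<bar> \<le> g t" by (rule mp[OF bspec[OF conjunct2[OF elim] TB]])
      then show ?case by (simp add: slice_flux_def T_def)
    qed
    then have "(\<integral>\<^sup>+t. ennreal \<bar>slice_flux U t A\<bar> \<partial>lborel) \<le> (\<integral>\<^sup>+t. g t \<partial>lborel)" by (rule nn_integral_mono_AE)
    then show ?thesis using g(2) by (simp add: K_def)
  qed
  have "(\<lambda>n. ennreal (L * measure \<mu> A + 1 / real (Suc n) * K)) \<longlonglongrightarrow> ennreal (L * measure \<mu> A + 0 * K)"
    by (intro tendsto_ennrealI tendsto_add tendsto_mult tendsto_const LIMSEQ_Suc[OF lim_1_over_n])
  then have "(\<integral>\<^sup>+t. ennreal \<bar>slice_flux U t A\<bar> \<partial>lborel) \<le> ennreal (L * measure \<mu> A + 0 * K)"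
    by (rule LIMSEQ_le_const) (intro exI[of _ 0] allI impI est, simp)
  then show ?thesis by simp
qed

text \<open>Balance on the superlevel set \<open>V\<close>, whose frontier splits into three parts:
  the slice inside \<open>U\<close>, the part where \<phi> exceeds \<open>t\<close>, which
  localization identifies with part of \<open>frontier U\<close>, and the edge, which carries no
  flux.\<close>

lemma slice_flux_total:
  assumes U: "U \<in> \<O>"
    and V: "above U t \<in> \<O>"
    and edge: "\<F> (above U t) (frontier (above U t) \<inter> frontier U \<inter> {x. \<phi> x = t}) = 0"
  shows "slice_flux U t U = net_flux U {x \<in> \<Omega>. \<phi> x > t}"
proof -
  note Ui = O_classD[OF U]
  note UD = open_compactly_insideD[OF Ui]
  define V where "V = above U t"
  define A where "A = {x \<in> \<Omega>. \<phi> x > t}"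
  have VO: "V \<in> \<O>" using V by (simp add: V_def)
  note Vi = O_classD[OF VO]
  have \<phi>c: "continuous_on UNIV \<phi>" by (rule lipschitz_on_continuous_on[OF L(2)])
  have oA: "open A" unfolding A_def using open_superlevel[OF \<Omega> L(2), of t] by (simp add: Int_def)
  have fsub: "frontier V \<subseteq> closure U \<inter> {x. \<phi> x \<ge> t}" unfolding V_def by (rule frontier_superlevel_subset[OF L(2)])
  have AU: "A \<inter> V = A \<inter> U" using UD(4) by (auto simp: A_def V_def)
  have loc: "\<F> V (A \<inter> frontier V) = \<F> U (A \<inter> frontier U)"
    by (rule flux_local[OF VO U oA _ AU]) (auto simp: A_def)
  have Af: "A \<inter> frontier V = A \<inter> frontier U" by (rule frontier_local[OF oA AU])
  define E where "E = frontier V \<inter> frontier U \<inter> {x. \<phi> x = t}"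
  have EB: "E \<in> sets borel"
    unfolding E_def by (intro sets.Int borel_closed frontier_closed closed_Collect_eq \<phi>c continuous_on_const)
  have AB: "A \<inter> frontier V \<in> sets borel" using oA by simp
  have UB: "U \<inter> frontier V \<in> sets borel" using UD(1) by simp
  have Uf: "U \<inter> frontier U = {}" using UD(1) by (auto simp: frontier_def interior_open)
  have dec: "frontier V = (U \<inter> frontier V) \<union> ((A \<inter> frontier V) \<union> E)"
  proof
    show "frontier V \<subseteq> (U \<inter> frontier V) \<union> ((A \<inter> frontier V) \<union> E)"
    proof
      fix x assume x: "x \<in> frontier V"
      show "x \<in> (U \<inter> frontier V) \<union> ((A \<inter> frontier V) \<union> E)"
      proof (cases "x \<in> U")
        case False
        then have "x \<in> frontier U" using x fsub UD(1) by (auto simp: frontier_def interior_open)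
        moreover have "x \<in> \<Omega>" using \<open>x \<in> frontier U\<close> UD(6) by auto
        moreover have "\<phi> x \<ge> t" using x fsub by auto
        ultimately show ?thesis using x by (cases "\<phi> x = t") (auto simp: A_def E_def)
      qed (use x in simp)
    qed
  qed (auto simp: E_def)
  have "\<sigma> V = \<F> V (frontier V)" by (rule flux_balance[OF Vi, symmetric])
  also have "\<dots> = \<F> V (U \<inter> frontier V) + \<F> V ((A \<inter> frontier V) \<union> E)"
    by (subst dec, rule flux_Un[OF VO UB sets.Un[OF AB EB]]) (use Uf Af in \<open>auto simp: E_def\<close>)
  also have "\<F> V ((A \<inter> frontier V) \<union> E) = \<F> V (A \<inter> frontier V) + \<F> V E"
    by (rule flux_Un[OF VO AB EB]) (auto simp: E_def A_def)
  also have "\<F> V E = 0" using edge by (simp add: V_def E_def)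
  also have "\<F> V (A \<inter> frontier V) = \<F> U (A \<inter> frontier U)" by (rule loc)
  finally have "\<F> V (U \<inter> frontier V) = \<sigma> V - \<F> U (A \<inter> frontier U)" by simp
  moreover have "A \<in> borel_on \<Omega>" using oA by (auto simp: borel_on_iff A_def)
  moreover have "A \<inter> U = V" using UD(4) by (auto simp: A_def V_def)
  ultimately show ?thesis by (simp add: slice_flux_def net_flux_def V_def[symmetric] A_def[symmetric])
qed

lemma slice_flux_total_integral:
  assumes U: "U \<in> \<O>"
  shows "integrable lborel (\<lambda>t. net_flux U {x \<in> \<Omega>. \<phi> x > t})"
    and "(\<integral>t. net_flux U {x \<in> \<Omega>. \<phi> x > t} \<partial>lborel)
      = sint \<Omega> (net_flux U) (\<lambda>x. indicator (closure U) x * \<phi> x)"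
proof -
  note Ui = O_classD[OF U]
  note UD = open_compactly_insideD[OF Ui]
  obtain R where R: "R \<ge> 0" "\<forall>x\<in>closure U. \<bar>\<phi> x\<bar> < R" by (rule lipschitz_bounded_on[OF UD(2) L(2)])
  have "\<Omega> \<in> sets borel" using \<Omega> by simp
  note lc = layer_cake_signed[OF this net_flux_measure[OF U] net_flux_total[OF U] borel_closed[OF closed_closure] net_flux_closure[OF U]
    borel_measurable_continuous_onI[OF lipschitz_on_continuous_on[OF L(2)]] R(1) less_imp_le[OF bspec[OF R(2)]]]
  show "integrable lborel (\<lambda>t. net_flux U {x \<in> \<Omega>. \<phi> x > t})" by (rule lc(1))
  show "(\<integral>t. net_flux U {x \<in> \<Omega>. \<phi> x > t} \<partial>lborel)
      = sint \<Omega> (net_flux U) (\<lambda>x. indicator (closure U) x * \<phi> x)" by (rule lc(2))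
qed

section \<open>Measurability in the level and integration over levels\<close>

lemma slice_flux_Int: "slice_flux U t S = slice_flux U t (S \<inter> U)"
  by (simp add: slice_flux_def Int_assoc)

lemma slice_flux_measure:
  assumes U: "open U" and V: "above U t \<in> \<O>"
  shows "signed_measure_on \<Omega> (\<lambda>S. if S \<in> borel_on \<Omega> then slice_flux U t S else 0)"
proof -
  define V where "V = above U t"
  define m where "m S = (if S \<in> borel_on \<Omega> then \<F> V (S \<inter> frontier V) else 0)" for S
  have "signed_measure_on \<Omega> m"
    unfolding m_def[abs_def] V_def by (rule flux_measure[OF V])
  then have "signed_measure_on \<Omega> (\<lambda>S. if S \<in> borel_on \<Omega> then m (S \<inter> U) else 0)"
    using \<Omega> U by (intro vector_measure_on_restrict) simp_all
  moreover have "(\<lambda>S. if S \<in> borel_on \<Omega> then m (S \<inter> U) else 0) =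
      (\<lambda>S. if S \<in> borel_on \<Omega> then slice_flux U t S else 0)"
    using U by (auto simp: fun_eq_iff m_def slice_flux_def V_def borel_on_iff)
  ultimately show ?thesis by simp
qed

lemma slice_flux_AE:
  assumes U: "U \<in> \<O>"
  shows "AE t in lborel. above U t \<in> \<O> \<and>
    slice_flux U t U = net_flux U {x \<in> \<Omega>. \<phi> x > t}"
  using AE_edge[OF U]
proof eventually_elim
  case (elim t)
  then show ?case using slice_flux_total[OF U, of t] by blast
qed

text \<open>The superlevel sets of \<open>U\<close> and of \<open>A\<close> coincide within
  \<open>A\<close>, so localization lets the explicit formula for \<open>A\<close> be read off from
  the slices of \<open>U\<close>.\<close>

lemma slice_flux_AE_subset:
  assumes U: "U \<in> \<O>" and A: "A \<in> \<O>" "A \<subseteq> U"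
  shows "AE t in lborel. slice_flux U t A = net_flux A {x \<in> \<Omega>. \<phi> x > t}"
  using slice_flux_AE[OF U] slice_flux_AE[OF A(1)]
proof eventually_elim
  case (elim t)
  note Ai = O_classD[OF A(1)]
  have "A \<inter> (above U t) = A \<inter> (above A t)" using A(2) by auto
  from flux_local[OF conjunct1[OF elim(1)] conjunct1[OF elim(2)] open_compactly_insideD(1,4)[OF Ai] this]
  have "slice_flux U t A = slice_flux A t A"
    using A(2) by (simp add: slice_flux_def Int_absorb2)
  then show ?case using elim(2) by simp
qed

text \<open>On admissible subsets the slice flux equals almost everywhere an integrable function
  obtained from the balance law. Exhaustion makes the slice flux of an open set an almost-everywhere
  limit of such functions, and completeness of the measure absorbs the null sets.\<close>

lemma slice_flux_measurable_open:
  assumes U: "U \<in> \<O>" and A: "open A" "A \<subseteq> U"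
  shows "(\<lambda>t. slice_flux U t A) \<in> borel_measurable lebesgue"
proof -
  note Ui = O_classD[OF U]
  note UD = open_compactly_insideD[OF Ui]
  have A\<Omega>: "A \<subseteq> \<Omega>" using A UD(4) by auto
  obtain B :: "nat \<Rightarrow> 'a set" where B: "incseq B" "(\<Union>j. B j) = A"
    "\<forall>j. B j \<in> \<O> \<and> open_compactly_inside (B j) A"
    by (rule O_class_exhaustion[OF A(1) A\<Omega>])
  have BO: "B j \<in> \<O>" and BA: "B j \<subseteq> A" and Bo: "open (B j)" for j
    using spec[OF B(3), of j] open_compactly_insideD(1,4)[of "B j" A] by simp_all
  define h where "h j t = net_flux (B j) {x \<in> \<Omega>. \<phi> x > t}" for j t
  have hm: "h j \<in> borel_measurable lebesgue" for j
    using borel_measurable_integrable[OF slice_flux_total_integral(1)[OF BO[of j]]]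
    by (auto simp: h_def[abs_def] intro: measurable_completion)
  have "AE t in lborel. \<forall>j. slice_flux U t (B j) = h j t"
    unfolding AE_all_countable h_def using slice_flux_AE_subset[OF U BO] BA A(2) by blast
  with slice_flux_AE[OF U] have "AE t in lborel. lim (\<lambda>j. h j t) = slice_flux U t A"
  proof eventually_elim
    case (elim t)
    define m where "m S = (if S \<in> borel_on \<Omega> then slice_flux U t S else 0)" for S
    have m: "signed_measure_on \<Omega> m"
      unfolding m_def[abs_def] by (rule slice_flux_measure[OF UD(1) conjunct1[OF elim(1)]])
    have AB: "A \<in> borel_on \<Omega>" using A A\<Omega> by (simp add: borel_on_iff)
    have BB: "B j \<in> borel_on \<Omega>" for j using Bo[of j] BA[of j] A\<Omega> by (auto simp: borel_on_iff)
    have "(\<lambda>j. m (B j)) \<longlonglongrightarrow> m (\<Union>j. B j)"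
      by (rule vector_measure_on_incseq[OF m]) (use BB B(1) in \<open>auto simp: borel_on_iff\<close>)
    then have "(\<lambda>j. h j t) \<longlonglongrightarrow> slice_flux U t A"
      using AB BB elim(2) by (simp add: B(2) m_def)
    then show ?case by (rule limI)
  qed
  then have ae: "AE t in lebesgue. lim (\<lambda>j. h j t) = slice_flux U t A" by (rule AE_completion)
  show ?thesis by (rule borel_measurable_AE[OF borel_measurable_lim_metric[OF hm] ae])
qed

text \<open>Dynkin induction in the set. Complements are taken relative to \<open>U\<close>, which
  carries the slice; the additivity used holds only for almost every level.\<close>

lemma slice_flux_measurable:
  assumes U: "U \<in> \<O>" and S: "S \<in> sets borel"
  shows "(\<lambda>t. slice_flux U t S) \<in> borel_measurable lebesgue"
proof -
  note Ui = O_classD[OF U]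
  note UD = open_compactly_insideD[OF Ui]
  define m where "m t S = (if S \<in> borel_on \<Omega> then slice_flux U t S else 0)" for t S
  have m: "AE t in lebesgue. signed_measure_on \<Omega> (m t)"
    using AE_completion[OF slice_flux_AE[OF U]]
  proof eventually_elim
    case (elim t)
    then show ?case unfolding m_def[abs_def] by (intro slice_flux_measure UD(1)) simp
  qed
  have UB: "S \<inter> U \<in> borel_on \<Omega>" if "S \<in> sets borel" for S using that UD(1,4) by (auto simp: borel_on_iff)
  have sf: "slice_flux U t S = m t (S \<inter> U)" if "S \<in> sets borel" for S t
    using UB[OF that] slice_flux_Int[of U t S] by (simp add: m_def)
  show ?thesis
    using S
  proof (induction rule: borel_disjoint_induct)
    case (basic S)
    have "(\<lambda>t. slice_flux U t (S \<inter> U)) \<in> borel_measurable lebesgue"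
      by (rule slice_flux_measurable_open[OF U]) (use basic UD(1) in auto)
    then show ?case by (subst slice_flux_Int)
  next
    case (compl S)
    have "(\<lambda>t. slice_flux U t U - slice_flux U t S) \<in> borel_measurable lebesgue"
      by (intro borel_measurable_diff slice_flux_measurable_open[OF U UD(1)] compl) simp
    moreover have "AE t in lebesgue. slice_flux U t U - slice_flux U t S = slice_flux U t (- S)"
      using m
    proof eventually_elim
      case (elim t)
      have "m t (U - S \<inter> U) = m t U - m t (S \<inter> U)"
        by (rule vector_measure_on_Diff[OF elim]) (use compl(1) UD(1,4) in auto)
      moreover have "U - S \<inter> U = - S \<inter> U" by auto
      moreover have "slice_flux U t U = m t U" using sf[of U t] UD(1) by simp
      ultimately show ?case using sf[of S t] sf[of "- S" t] compl(1) by simp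
    qed
    ultimately show ?case by (rule borel_measurable_AE)
  next
    case (union A)
    have "(\<lambda>t. \<Sum>i. slice_flux U t (A i)) \<in> borel_measurable lebesgue"
      by (intro borel_measurable_suminf union)
    moreover have "AE t in lebesgue. (\<Sum>i. slice_flux U t (A i)) = slice_flux U t (\<Union>i. A i)"
      using m
    proof eventually_elim
      case (elim t)
      have "(\<lambda>i. m t (U \<inter> A i)) sums m t (\<Union>i. U \<inter> A i)"
        by (rule vector_measure_on_sums[OF elim _ _ disjoint_family_Int[OF union(2)]]) (use union(1) UD(1,4) in auto)
      moreover have "(\<Union>i. U \<inter> A i) = (\<Union>i. A i) \<inter> U" by auto
      ultimately have "(\<lambda>i. slice_flux U t (A i)) sums slice_flux U t (\<Union>i. A i)"
        using union(1) by (simp add: sf Int_commute)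
      then show ?case by (rule sums_unique[symmetric])
    qed
    ultimately show ?case by (rule borel_measurable_AE)
  qed
qed

text \<open>The bound by \<open>L * measure \<mu>\<close> is first available for sets compactly
  inside \<open>U\<close>; exhaustion gives it for open subsets of \<open>U\<close>, and outer
  regularity for Borel sets.\<close>

lemma slice_integral_measure:
  assumes U: "U \<in> \<O>"
  obtains \<Phi> where "signed_measure_on \<Omega> \<Phi>" "\<forall>S\<in>borel_on \<Omega>. \<Phi> S = \<Phi> (S \<inter> U)"
    "\<forall>S\<in>borel_on \<Omega>. \<bar>\<Phi> S\<bar> \<le> L * measure \<mu> S"
    "\<forall>V\<in>\<O>. V \<subseteq> U \<longrightarrow>
      \<Phi> V = sint \<Omega> (net_flux V) (\<lambda>x. indicator (closure V) x * \<phi> x)"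
proof -
  note Ui = O_classD[OF U]
  note UD = open_compactly_insideD[OF Ui]
  have UB: "S \<inter> U \<in> borel_on \<Omega>" if "S \<in> sets borel" for S using that UD(1,4) by (auto simp: borel_on_iff)
  obtain D where D: "integrable lborel D" "AE t in lborel. \<forall>S\<in>sets borel. \<bar>slice_flux U t S\<bar> \<le> D t"
    by (rule slice_dominated[OF U])
  have Di: "integrable lebesgue D" using D(1) by (simp add: integrable_completion borel_measurable_integrable)
  have DA: "AE t in lebesgue. \<forall>S\<in>sets borel. \<bar>slice_flux U t S\<bar> \<le> D t" by (rule AE_completion[OF D(2)])
  have DS: "AE t in lebesgue. norm (slice_flux U t S) \<le> D t" if "S \<in> sets borel" for S
    using DA by eventually_elim (use that in simp)
  have int: "integrable lebesgue (\<lambda>t. slice_flux U t S)" if "S \<in> sets borel" for S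
  proof (rule Bochner_Integration.integrable_bound[OF Di slice_flux_measurable[OF U that]])
    show "AE t in lebesgue. norm (slice_flux U t S) \<le> norm (D t)"
      using DS[OF that] by eventually_elim simp
  qed
  define m where "m t S = (if S \<in> borel_on \<Omega> then slice_flux U t S else 0)" for t S
  have m: "AE t in lebesgue. signed_measure_on \<Omega> (m t)"
    using AE_completion[OF slice_flux_AE[OF U]]
  proof eventually_elim
    case (elim t)
    then show ?case unfolding m_def[abs_def] by (intro slice_flux_measure UD(1)) simp
  qed
  define \<Phi> where "\<Phi> S = (if S \<in> borel_on \<Omega> then \<integral>t. slice_flux U t S \<partial>lebesgue else 0)" for S
  have \<Phi>: "signed_measure_on \<Omega> \<Phi>"
    unfolding vector_measure_on_def
  proof (intro conjI allI impI)
    fix A :: "nat \<Rightarrow> 'a set" assume A: "range A \<subseteq> borel_on \<Omega>" "disjoint_family A"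
    have AB: "A i \<in> borel_on \<Omega>" for i using A(1) by auto
    have Ab: "A i \<in> sets borel" for i using AB[of i] by (simp add: borel_on_iff)
    have UAB: "(\<Union>i. A i) \<in> borel_on \<Omega>" using AB by (auto simp: borel_on_iff)
    have UAb: "(\<Union>i. A i) \<in> sets borel" using UAB by (simp add: borel_on_iff)
    have "(\<lambda>n. \<integral>t. (\<Sum>i<n. slice_flux U t (A i)) \<partial>lebesgue) \<longlonglongrightarrow> (\<integral>t. slice_flux U t (\<Union>i. A i) \<partial>lebesgue)"
    proof (rule integral_dominated_convergence[OF slice_flux_measurable[OF U UAb] _ Di])
      show "(\<lambda>t. \<Sum>i<n. slice_flux U t (A i)) \<in> borel_measurable lebesgue" for n
        by (intro borel_measurable_sum slice_flux_measurable[OF U Ab])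
      show "AE t in lebesgue. (\<lambda>n. \<Sum>i<n. slice_flux U t (A i)) \<longlonglongrightarrow> slice_flux U t (\<Union>i. A i)"
        using m
      proof eventually_elim
        case (elim t)
        have "(\<lambda>i. m t (A i)) sums m t (\<Union>i. A i)"
          by (rule vector_measure_on_sums[OF elim _ _ A(2)]) (use AB in \<open>auto simp: borel_on_iff\<close>)
        then show ?case using AB UAB by (simp add: sums_def m_def)
      qed
      \<comment> \<open>A partial sum is the slice flux of a partial union, hence lies under the
        common majorant.\<close>
      show "AE t in lebesgue. norm (\<Sum>i<n. slice_flux U t (A i)) \<le> D t" for n
        using m DA
      proof eventually_elim
        case (elim t)
        have B: "(\<Union>i<n. A i) \<in> borel_on \<Omega>" using AB by (auto simp: borel_on_iff)
        have "m t (\<Union>i\<in>{..<n}. A i) = (\<Sum>i\<in>{..<n}. m t (A i))"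
          by (rule vector_measure_on_finite_UN[OF elim(1)])
             (use AB A(2) in \<open>auto simp: borel_on_iff disjoint_family_on_def\<close>)
        then have "(\<Sum>i<n. slice_flux U t (A i)) = slice_flux U t (\<Union>i<n. A i)"
          using AB B by (simp add: m_def)
        then show ?case using bspec[OF elim(2), of "\<Union>i<n. A i"] B by (simp add: borel_on_iff)
      qed
    qed
    then show "(\<lambda>i. \<Phi> (A i)) sums \<Phi> (\<Union>i. A i)"
      using AB UAB by (simp add: sums_def \<Phi>_def Bochner_Integration.integral_sum[OF int[OF Ab]])
  qed (simp add: \<Phi>_def)
  have \<Phi>U: "\<Phi> S = \<Phi> (S \<inter> U)" if "S \<in> borel_on \<Omega>" for S
    using that UB[of S] slice_flux_Int[of U _ S] by (simp add: \<Phi>_def borel_on_iff)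
  have mass: "\<bar>\<Phi> A\<bar> \<le> L * measure \<mu> A" if A: "open A" "A \<subseteq> U" for A
  proof -
    have A\<Omega>: "A \<subseteq> \<Omega>" using A UD(4) by auto
    have As: "A \<in> sets \<mu>" using A A\<Omega> by (simp add: sets_\<mu> borel_on_iff)
    obtain B :: "nat \<Rightarrow> 'a set" where B: "incseq B" "(\<Union>j. B j) = A"
      "\<forall>j. B j \<in> \<O> \<and> open_compactly_inside (B j) A"
      by (rule O_class_exhaustion[OF A(1) A\<Omega>])
    have BA: "open_compactly_inside (B j) A" for j using B(3) by blast
    have le: "\<bar>\<Phi> (B j)\<bar> \<le> L * measure \<mu> A" for j
    proof -
      note BD = open_compactly_insideD[OF BA[of j]]
      have BU: "open_compactly_inside (B j) U" using BA[of j] A(2) by (auto simp: open_compactly_inside_def)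
      have Bb: "B j \<in> sets borel" using BD(1) by simp
      have "B j \<in> borel_on \<Omega>" using BD(1,4) A\<Omega> by (auto simp: borel_on_iff)
      then have "\<bar>\<Phi> (B j)\<bar> \<le> (\<integral>t. \<bar>slice_flux U t (B j)\<bar> \<partial>lebesgue)"
        using integral_norm_bound[of lebesgue "\<lambda>t. slice_flux U t (B j)"] by (simp add: \<Phi>_def)
      also have "\<dots> \<le> L * measure \<mu> (B j)"
      proof -
        have "ennreal (\<integral>t. \<bar>slice_flux U t (B j)\<bar> \<partial>lebesgue) = (\<integral>\<^sup>+t. ennreal \<bar>slice_flux U t (B j)\<bar> \<partial>lebesgue)"
          by (rule nn_integral_eq_integral[symmetric]) (use int[OF Bb] in auto)
        also have "\<dots> \<le> ennreal (L * measure \<mu> (B j))"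
          unfolding nn_integral_completion by (rule slice_mass[OF U BU])
        finally show ?thesis using L(1) by simp
      qed
      also have "\<dots> \<le> L * measure \<mu> A"
        using L(1) finite_measure_mono[OF BD(4) As] by simp
      finally show ?thesis .
    qed
    have "(\<lambda>j. \<Phi> (B j)) \<longlonglongrightarrow> \<Phi> (\<Union>j. B j)"
      by (rule vector_measure_on_incseq[OF \<Phi>])
         (use open_compactly_insideD(1,4)[OF BA] A\<Omega> B(1) in \<open>auto simp: borel_on_iff\<close>)
    then have "(\<lambda>j. \<bar>\<Phi> (B j)\<bar>) \<longlonglongrightarrow> \<bar>\<Phi> A\<bar>" unfolding B(2) by (rule tendsto_rabs)
    then show ?thesis by (rule LIMSEQ_le_const2) (use le in blast)
  qed
  have dom: "\<bar>\<Phi> S\<bar> \<le> L * measure \<mu> S" if S: "S \<in> borel_on \<Omega>" for S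
  proof -
    have "\<bar>\<Phi> (S \<inter> U)\<bar> \<le> L * measure \<mu> (S \<inter> U)"
      by (rule signed_measure_dominated_of_open[OF \<Omega> \<Phi> \<mu> UD(1,4) less_imp_le[OF L(1)] mass])
         (use S UD(1) in \<open>auto simp: borel_on_iff\<close>)
    also have "\<dots> \<le> L * measure \<mu> S"
      using L(1) S by (intro mult_left_mono finite_measure_mono) (auto simp: sets_\<mu>)
    finally show ?thesis using \<Phi>U[OF S] by simp
  qed
  have total: "\<Phi> V = sint \<Omega> (net_flux V) (\<lambda>x. indicator (closure V) x * \<phi> x)"
    if V: "V \<in> \<O>" "V \<subseteq> U" for V
  proof -
    note Vi = O_classD[OF V(1)]
    have VB: "V \<in> borel_on \<Omega>" "V \<in> sets borel" using open_compactly_insideD(1,4)[OF Vi] by (simp_all add: borel_on_iff)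
    note T = slice_flux_total_integral[OF V(1)]
    have Tm: "(\<lambda>t. net_flux V {x \<in> \<Omega>. \<phi> x > t}) \<in> borel_measurable lborel"
      using T(1) by (rule borel_measurable_integrable)
    have "\<Phi> V = (\<integral>t. net_flux V {x \<in> \<Omega>. \<phi> x > t} \<partial>lebesgue)"
      unfolding \<Phi>_def using VB
      by (simp, intro integral_cong_AE slice_flux_measurable[OF U] measurable_completion[OF Tm]
          AE_completion[OF slice_flux_AE_subset[OF U V]])
    also have "\<dots> = (\<integral>t. net_flux V {x \<in> \<Omega>. \<phi> x > t} \<partial>lborel)" by (rule integral_completion[OF Tm])
    finally show ?thesis by (simp add: T(2))
  qed
  show ?thesis by (rule that[of \<Phi>]) (use \<Phi> \<Phi>U dom total in blast)+
qed

text \<open>The measures obtained from the members of an exhaustion are glued. Every admissible set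
  is relatively compact in \<Omega>, so it lies in one member and its value is already known
  there.\<close>

lemma potential_exists:
  obtains \<Psi> where "signed_measure_on \<Omega> \<Psi>" "\<forall>S\<in>borel_on \<Omega>. \<bar>\<Psi> S\<bar> \<le> L * measure \<mu> S"
    "\<forall>U\<in>\<O>. \<Psi> U = net_integral U \<phi>"
proof -
  obtain B :: "nat \<Rightarrow> 'a set" where B: "incseq B" "(\<Union>j. B j) = \<Omega>"
    "\<forall>j. B j \<in> \<O> \<and> open_compactly_inside (B j) \<Omega>"
    by (rule O_class_exhaustion[OF \<Omega> order_refl])
  have BO: "B n \<in> \<O>" and Bi: "open_compactly_inside (B n) \<Omega>" for n using B(3) by blast+
  note BD = open_compactly_insideD[OF Bi]
  have BB: "B n \<in> borel_on \<Omega>" for n using BD(1,4)[of n] by (simp add: borel_on_iff)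
  have "\<exists>\<Phi>. signed_measure_on \<Omega> \<Phi> \<and> (\<forall>S\<in>borel_on \<Omega>. \<bar>\<Phi> S\<bar> \<le> L * measure \<mu> S) \<and>
    (\<forall>V\<in>\<O>. V \<subseteq> B n \<longrightarrow> \<Phi> V = net_integral V \<phi>)" for n
  proof -
    obtain \<Phi> where "signed_measure_on \<Omega> \<Phi>" "\<forall>S\<in>borel_on \<Omega>. \<Phi> S = \<Phi> (S \<inter> B n)"
      "\<forall>S\<in>borel_on \<Omega>. \<bar>\<Phi> S\<bar> \<le> L * measure \<mu> S"
      "\<forall>V\<in>\<O>. V \<subseteq> B n \<longrightarrow>
        \<Phi> V = sint \<Omega> (net_flux V) (\<lambda>x. indicator (closure V) x * \<phi> x)"
      by (rule slice_integral_measure[OF BO])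
    then show ?thesis by (intro exI[of _ \<Phi>]) (simp add: net_integral_def)
  qed
  then have "\<exists>\<Phi>. \<forall>n. signed_measure_on \<Omega> (\<Phi> n) \<and> (\<forall>S\<in>borel_on \<Omega>. \<bar>\<Phi> n S\<bar> \<le> L * measure \<mu> S) \<and>
    (\<forall>V\<in>\<O>. V \<subseteq> B n \<longrightarrow> \<Phi> n V = net_integral V \<phi>)" by (intro choice allI)
  then obtain \<Phi> where \<Phi>0: "\<forall>n. signed_measure_on \<Omega> (\<Phi> n) \<and> (\<forall>S\<in>borel_on \<Omega>. \<bar>\<Phi> n S\<bar> \<le> L * measure \<mu> S) \<and>
    (\<forall>V\<in>\<O>. V \<subseteq> B n \<longrightarrow> \<Phi> n V = net_integral V \<phi>)" ..
  have \<Phi>: "signed_measure_on \<Omega> (\<Phi> n)" for n using spec[OF \<Phi>0, of n] by (rule conjunct1)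
  have dom: "\<bar>\<Phi> n S\<bar> \<le> L * measure \<mu> S" if "S \<in> borel_on \<Omega>" for n S
    by (rule bspec[OF conjunct1[OF conjunct2[OF spec[OF \<Phi>0, of n]]] that])
  have \<Phi>T: "\<Phi> n V = net_integral V \<phi>" if "V \<in> \<O>" "V \<subseteq> B n" for n V
    by (rule mp[OF bspec[OF conjunct2[OF conjunct2[OF spec[OF \<Phi>0, of n]]] that(1)] that(2)])
  \<comment> \<open>Both measures take the value \<open>net_integral V \<phi>\<close> on admissible
    \<open>V\<close>, which does not refer to the member of the exhaustion.\<close>
  have agree: "\<Phi> m S = \<Phi> n S" if mn: "m \<le> n" and S: "S \<in> sets borel" "S \<subseteq> B m" for m n S
  proof (rule vector_measure_eq_of_O_class[OF \<Phi> \<Phi> BD(1,4) _ S])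
    fix V assume V: "V \<in> \<O>" "open_compactly_inside V (B m)"
    have "V \<subseteq> B m" using open_compactly_insideD(4)[OF V(2)] .
    moreover have "B m \<subseteq> B n" by (rule incseqD[OF B(1) mn])
    ultimately show "\<Phi> m V = \<Phi> n V" using \<Phi>T[OF V(1), of m] \<Phi>T[OF V(1), of n] by auto
  qed
  obtain \<Psi> where \<Psi>: "signed_measure_on \<Omega> \<Psi>" "\<forall>S\<in>borel_on \<Omega>. \<bar>\<Psi> S\<bar> \<le> L * measure \<mu> S"
    "\<forall>n S. S \<in> sets borel \<longrightarrow> S \<subseteq> B n \<longrightarrow> \<Psi> S = \<Phi> n S"
    by (rule signed_measure_glue[where B=B and \<Phi>=\<Phi>, OF \<Omega>b \<mu> \<Phi> B(1) BB B(2) agree dom])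
  have "\<Psi> U = net_integral U \<phi>" if U: "U \<in> \<O>" for U
  proof -
    note Ui = O_classD[OF U]
    note UD = open_compactly_insideD[OF Ui]
    have "closure U \<subseteq> (\<Union>n\<in>UNIV. B n)" using UD(3) B(2) by simp
    then obtain N where N: "finite N" "closure U \<subseteq> (\<Union>n\<in>N. B n)"
      using compactE_image[OF UD(2), of UNIV B] BD(1) by (metis subset_UNIV)
    have "B n \<subseteq> B (Max (insert 0 N))" if "n \<in> N" for n
      by (rule incseqD[OF B(1)]) (use that N(1) in simp)
    then have UB: "U \<subseteq> B (Max (insert 0 N))" using N(2) closure_subset[of U] by blast
    have "\<Psi> U = \<Phi> (Max (insert 0 N)) U" using \<Psi>(3) UB UD(1) borel_open by blast
    then show ?thesis using \<Phi>T[OF U UB] by simp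
  qed
  then show ?thesis using that[OF \<Psi>(1,2)] by blast
qed

end

section \<open>Potentials and the field\<close>

text \<open>\<open>flux_potential \<phi>\<close> is the measure \<open>grad \<phi> \<bullet> dF\<close> of the field \<open>F\<close> to be constructed. It exists
  for Lipschitz \<open>\<phi>\<close> (junk otherwise) and is linear in \<open>\<phi>\<close>, being determined by its values on \<open>\<O>\<close>.\<close>

definition flux_potential :: "('a \<Rightarrow> real) \<Rightarrow> 'a set \<Rightarrow> real" where
  "flux_potential \<phi> = (THE \<Psi>. signed_measure_on \<Omega> \<Psi> \<and> (\<forall>U\<in>\<O>. \<Psi> U = net_integral U \<phi>))"

definition flux_field :: "'a set \<Rightarrow> 'a" where
  "flux_field S = (\<Sum>b\<in>Basis. flux_potential (\<lambda>x. x \<bullet> b) S *\<^sub>R b)"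

lemma potential_unique:
  assumes \<Psi>: "signed_measure_on \<Omega> \<Psi>" and eq: "\<And>U. U \<in> \<O> \<Longrightarrow> \<Psi> U = net_integral U \<phi>"
  shows "flux_potential \<phi> = \<Psi>"
  unfolding flux_potential_def
proof (rule the_equality)
  show "signed_measure_on \<Omega> \<Psi> \<and> (\<forall>U\<in>\<O>. \<Psi> U = net_integral U \<phi>)" using \<Psi> eq by blast
  fix \<Theta> assume \<Theta>: "signed_measure_on \<Omega> \<Theta> \<and> (\<forall>U\<in>\<O>. \<Theta> U = net_integral U \<phi>)"
  show "\<Theta> = \<Psi>"
  proof
    fix S
    show "\<Theta> S = \<Psi> S"
    proof (cases "S \<in> borel_on \<Omega>")
      case True
      show ?thesis
      proof (rule vector_measure_eq_of_O_class[OF conjunct1[OF \<Theta>] \<Psi> \<Omega> order_refl])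
        fix V assume "V \<in> \<O>"
        then show "\<Theta> V = \<Psi> V" using bspec[OF conjunct2[OF \<Theta>]] eq by simp
      qed (use True in \<open>simp_all add: borel_on_iff\<close>)
    qed (simp add: vector_measure_on_outside[OF conjunct1[OF \<Theta>]] vector_measure_on_outside[OF \<Psi>])
  qed
qed

lemma flux_potential:
  fixes \<phi> :: "'a \<Rightarrow> real"
  assumes L: "L > 0" "L-lipschitz_on UNIV \<phi>"
  shows "signed_measure_on \<Omega> (flux_potential \<phi>)"
    and "S \<in> borel_on \<Omega> \<Longrightarrow> \<bar>flux_potential \<phi> S\<bar> \<le> L * measure \<mu> S"
    and "U \<in> \<O> \<Longrightarrow> flux_potential \<phi> U = net_integral U \<phi>"
proof -
  obtain \<Psi> where \<Psi>: "signed_measure_on \<Omega> \<Psi>" "\<forall>S\<in>borel_on \<Omega>. \<bar>\<Psi> S\<bar> \<le> L * measure \<mu> S"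
    "\<forall>U\<in>\<O>. \<Psi> U = net_integral U \<phi>"
    by (rule potential_exists[OF L])
  have eq: "flux_potential \<phi> = \<Psi>" by (rule potential_unique[OF \<Psi>(1) bspec[OF \<Psi>(3)]])
  show "signed_measure_on \<Omega> (flux_potential \<phi>)" unfolding eq by (rule \<Psi>(1))
  show "\<bar>flux_potential \<phi> S\<bar> \<le> L * measure \<mu> S" if "S \<in> borel_on \<Omega>" unfolding eq by (rule bspec[OF \<Psi>(2) that])
  show "flux_potential \<phi> U = net_integral U \<phi>" if "U \<in> \<O>" unfolding eq by (rule bspec[OF \<Psi>(3) that])
qed

lemma coordinate_lipschitz: "b \<in> Basis \<Longrightarrow> 1-lipschitz_on UNIV (\<lambda>x. x \<bullet> b)"
  using inner_lipschitz[of b 1 UNIV] by (simp add: inner_commute)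

lemma flux_field_measure: "vector_measure_on \<Omega> flux_field"
  unfolding flux_field_def[abs_def]
proof (intro vector_measure_on_sum)
  fix b :: 'a assume "b \<in> Basis"
  from flux_potential(1)[OF zero_less_one coordinate_lipschitz[OF this]]
  show "vector_measure_on \<Omega> (\<lambda>S. flux_potential (\<lambda>x. x \<bullet> b) S *\<^sub>R b)"
    by (rule vector_measure_on_bounded_linear[OF bounded_linear_scaleR_left])
qed

lemma flux_field_inner:
  "b \<in> Basis \<Longrightarrow> flux_field S \<bullet> b = flux_potential (\<lambda>x. x \<bullet> b) S"
  by (simp add: flux_field_def inner_sum_left inner_Basis if_distrib cong: if_cong)

lemma flux_field_dominated:
  assumes S: "S \<in> borel_on \<Omega>"
  shows "norm (flux_field S) \<le> real DIM('a) * measure \<mu> S"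
proof -
  have "norm (flux_field S) \<le> (\<Sum>b\<in>Basis. norm (flux_potential (\<lambda>x. x \<bullet> b) S *\<^sub>R b))"
    unfolding flux_field_def by (rule norm_sum)
  also have "\<dots> \<le> (\<Sum>b\<in>(Basis :: 'a set). measure \<mu> S)"
  proof (rule sum_mono)
    fix b :: 'a assume b: "b \<in> Basis"
    show "norm (flux_potential (\<lambda>x. x \<bullet> b) S *\<^sub>R b) \<le> measure \<mu> S"
      using flux_potential(2)[OF zero_less_one coordinate_lipschitz[OF b] S] b by simp
  qed
  finally show ?thesis by simp
qed

lemma flux_potential_diff_linear:
  assumes L: "L > 0" "L-lipschitz_on UNIV \<phi>"
  shows "flux_potential (\<lambda>x. \<phi> x - a \<bullet> x) S = flux_potential \<phi> S - a \<bullet> flux_field S"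
proof -
  have "flux_potential (\<lambda>x. \<phi> x - a \<bullet> x) = (\<lambda>S. flux_potential \<phi> S - flux_field S \<bullet> a)"
  proof (rule potential_unique)
    show "signed_measure_on \<Omega> (\<lambda>S. flux_potential \<phi> S - flux_field S \<bullet> a)"
      by (intro vector_measure_on_diff flux_potential(1)[OF L] vector_measure_on_inner flux_field_measure)
    fix U assume U: "U \<in> \<O>"
    note Ui = O_classD[OF U]
    have K: "compact (closure U)" by (rule open_compactly_insideD(2)[OF Ui])
    note nm = net_flux_measure[OF U]
    define I where "I x = (indicator (closure U) x :: real)" for x
    have bb: "bounded_borel (\<lambda>x. I x * \<phi> x)"
      unfolding I_def by (rule bounded_borel_indicator_compact[OF K lipschitz_on_continuous_on[OF L(2)]])
    have bc: "bounded_borel (\<lambda>x. I x * (x \<bullet> b))" for b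
      unfolding I_def by (rule bounded_borel_indicator_compact[OF K]) (intro continuous_intros)
    have bs: "bounded_borel (\<lambda>x. (a \<bullet> b) * (I x * (x \<bullet> b)))" for b by (rule bounded_borel_cmult[OF bc])
    have "flux_field U \<bullet> a = (\<Sum>b\<in>Basis. (a \<bullet> b) * net_integral U (\<lambda>x. x \<bullet> b))"
      unfolding euclidean_inner[of "flux_field U" a]
      by (intro sum.cong refl)
         (simp add: flux_field_inner flux_potential(3)[OF zero_less_one coordinate_lipschitz U])
    also have "\<dots> = sint \<Omega> (net_flux U) (\<lambda>x. \<Sum>b\<in>Basis. (a \<bullet> b) * (I x * (x \<bullet> b)))"
      by (simp add: net_integral_def I_def[symmetric] sint_sum[OF \<Omega>b nm _ bs] sint_cmult[OF \<Omega>b nm])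
    finally have F: "flux_field U \<bullet> a = \<dots>" .
    have I: "I x * (\<phi> x - a \<bullet> x) = I x * \<phi> x - (\<Sum>b\<in>Basis. (a \<bullet> b) * (I x * (x \<bullet> b)))" for x
      unfolding euclidean_inner[of a x] by (simp add: right_diff_distrib sum_distrib_left mult.left_commute)
    have "net_integral U (\<lambda>x. \<phi> x - a \<bullet> x)
        = net_integral U \<phi> - sint \<Omega> (net_flux U) (\<lambda>x. \<Sum>b\<in>Basis. (a \<bullet> b) * (I x * (x \<bullet> b)))"
      unfolding net_integral_def I_def[symmetric] I
      by (rule sint_diff[OF \<Omega>b nm bb]) (intro bounded_borel_sum bs)
    then show "flux_potential \<phi> U - flux_field U \<bullet> a = net_integral U (\<lambda>x. \<phi> x - a \<bullet> x)"
      using F flux_potential(3)[OF L U] by simp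
  qed
  then show ?thesis by (simp add: inner_commute)
qed

text \<open>On an admissible \<open>V\<close> compactly inside \<open>W\<close> the value involves
  \<phi> only on \<open>closure V\<close>. Hence \<phi> may be altered off a ball to improve its
  Lipschitz constant.\<close>

lemma flux_potential_local:
  assumes \<phi>: "L > 0" "L-lipschitz_on UNIV \<phi>" and \<psi>: "M > 0" "M-lipschitz_on UNIV \<psi>"
    and W: "open W" "W \<subseteq> \<Omega>" and eq: "\<And>x. x \<in> W \<Longrightarrow> \<phi> x = \<psi> x" and S: "S \<in> sets borel" "S \<subseteq> W"
  shows "flux_potential \<phi> S = flux_potential \<psi> S"
proof (rule vector_measure_eq_of_O_class[OF flux_potential(1)[OF \<phi>] flux_potential(1)[OF \<psi>] W _ S])
  fix V assume V: "V \<in> \<O>" "open_compactly_inside V W"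
  have "indicator (closure V) x * \<phi> x = indicator (closure V) x * \<psi> x" for x
    using eq[of x] open_compactly_insideD(3)[OF V(2)] by (auto simp: indicator_def)
  then have "(\<lambda>x. indicator (closure V) x * \<phi> x) = (\<lambda>x. indicator (closure V) x * \<psi> x)" by (rule ext)
  then show "flux_potential \<phi> V = flux_potential \<psi> V"
    unfolding flux_potential(3)[OF \<phi> V(1)] flux_potential(3)[OF \<psi> V(1)] net_integral_def by (rule arg_cong)
qed

lemma flux_potential_ball:
  assumes \<phi>: "L > 0" "L-lipschitz_on UNIV \<phi>" and \<omega>: "\<omega> > 0" "\<omega>-lipschitz_on (cball z r) (\<lambda>x. \<phi> x - a \<bullet> x)"
    and r: "r > 0" and S: "S \<in> borel_on \<Omega>" "S \<subseteq> ball z r"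
  shows "\<bar>flux_potential \<phi> S - a \<bullet> flux_field S\<bar> \<le> \<omega> * measure \<mu> S"
proof -
  define \<psi> where "\<psi> x = \<phi> x - a \<bullet> x" for x
  \<comment> \<open>The projection onto the ball turns the local Lipschitz constant into a global one.\<close>
  define \<theta> where "\<theta> x = \<psi> (closest_point (cball z r) x)" for x
  have ne: "cball z r \<noteq> {}" using r by simp
  have "(L + norm a)-lipschitz_on UNIV (\<lambda>x. \<phi> x - a \<bullet> x)"
    by (rule lipschitz_on_diff[OF \<phi>(2) inner_lipschitz]) simp
  then have \<psi>: "(L + norm a)-lipschitz_on UNIV \<psi>" by (simp add: \<psi>_def[abs_def])
  have La: "L + norm a > 0" using \<phi>(1) by (simp add: add_pos_nonneg)
  have \<theta>: "\<omega>-lipschitz_on UNIV \<theta>"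
  proof (rule lipschitz_onI[OF _ less_imp_le[OF \<omega>(1)]])
    fix x y
    have "dist (\<theta> x) (\<theta> y) \<le> \<omega> * dist (closest_point (cball z r) x) (closest_point (cball z r) y)"
      unfolding \<theta>_def \<psi>_def
      by (rule lipschitz_onD[OF \<omega>(2)]) (intro closest_point_in_set closed_cball ne)+
    also have "\<dots> \<le> \<omega> * dist x y"
      using \<omega>(1) by (intro mult_left_mono closest_point_lipschitz convex_cball closed_cball ne) simp
    finally show "dist (\<theta> x) (\<theta> y) \<le> \<omega> * dist x y" .
  qed
  have "\<psi> x = \<theta> x" if "x \<in> ball z r \<inter> \<Omega>" for x
    using that closest_point_self[of x "cball z r"] by (simp add: \<theta>_def)
  then have "flux_potential \<psi> S = flux_potential \<theta> S"
    by (rule flux_potential_local[OF La \<psi> \<omega>(1) \<theta> open_Int[OF open_ball \<Omega>] Int_lower2])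
       (use S in \<open>auto simp: borel_on_iff\<close>)
  moreover have "flux_potential \<psi> S = flux_potential \<phi> S - a \<bullet> flux_field S"
    unfolding \<psi>_def[abs_def] by (rule flux_potential_diff_linear[OF \<phi>])
  moreover have "\<bar>flux_potential \<theta> S\<bar> \<le> \<omega> * measure \<mu> S" by (rule flux_potential(2)[OF \<omega>(1) \<theta> S(1)])
  ultimately show ?thesis by simp
qed

section \<open>Gradient representation and the Gauss-Green formula\<close>

text \<open>With \<open>a = grad \<phi> z\<close>, the remainder
  \<open>\<phi> x - a \<bullet> x\<close> has Lipschitz constant \<omega> on the ball, which
  accounts for the summand 1. Replacing \<open>grad \<phi>\<close> by \<open>a\<close> in the
  integral against the field, whose domination constant is the dimension, accounts for the
  other.\<close>

lemma flux_potential_gradient_estimate: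
  assumes \<phi>: "\<phi> \<in> test_functions 1 \<Omega>" and L: "L > 0" "L-lipschitz_on UNIV \<phi>"
    and d: "d > 0" "\<And>x y. dist x y < d \<Longrightarrow> dist (grad \<phi> x) (grad \<phi> y) < \<omega>" and \<omega>: "\<omega> > 0"
    and S: "S \<in> borel_on \<Omega>" "S \<subseteq> ball z (d / 2)"
  shows "\<bar>flux_potential \<phi> S - vint \<Omega> flux_field (\<lambda>x. indicator S x *\<^sub>R grad \<phi> x)\<bar>
    \<le> (1 + real DIM('a)) * \<omega> * measure \<mu> S"
proof -
  define F where "F = flux_field"
  have F: "vector_measure_on \<Omega> F" unfolding F_def by (rule flux_field_measure)
  define a where "a = grad \<phi> z"
  have Ck: "Ck (Suc 0) \<phi>" using test_functionsD(1)[OF \<phi>] by simp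
  have gb: "bounded_borel (grad \<phi>)" by (rule grad_bounded_borel[of _ 0]) (use \<phi> in simp)
  have Sb: "S \<in> sets borel" using S by (simp add: borel_on_iff)
  have close: "norm (grad \<phi> x - a) \<le> \<omega>" if "x \<in> cball z (d / 2)" for x
  proof -
    have "dist x z < d" using that d(1) by (simp add: dist_commute)
    from d(2)[OF this] show ?thesis by (simp add: a_def dist_norm)
  qed
  have lip: "\<omega>-lipschitz_on (cball z (d / 2)) (\<lambda>x. \<phi> x - a \<bullet> x)"
  proof (rule lipschitz_of_gradient_bound[OF convex_cball, where g="\<lambda>x. grad \<phi> x - a"])
    show "((\<lambda>x. \<phi> x - a \<bullet> x) has_derivative (\<lambda>h. (grad \<phi> x - a) \<bullet> h)) (at x)" for x
      by (rule has_derivative_eq_rhs[OF has_derivative_diff[OF has_derivative_grad[OF Ck] has_derivative_inner_right[OF has_derivative_ident]]])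
         (simp add: inner_diff_left)
  qed (use close \<omega> in auto)
  have d2: "d / 2 > 0" using d(1) by simp
  have e1: "\<bar>flux_potential \<phi> S - a \<bullet> F S\<bar> \<le> \<omega> * measure \<mu> S"
    unfolding F_def by (rule flux_potential_ball[OF L \<omega> lip d2 S])
  have b1: "bounded_borel (\<lambda>x. indicator S x *\<^sub>R grad \<phi> x)"
    by (intro bounded_borel_scaleR bounded_borel_indicator Sb gb)
  have b2: "bounded_borel (\<lambda>x. indicator S x *\<^sub>R a)"
    by (intro bounded_borel_scaleR bounded_borel_indicator Sb bounded_borel_const)
  have b3: "bounded_borel (\<lambda>x. indicator S x *\<^sub>R grad \<phi> x - indicator S x *\<^sub>R a)"
    using bounded_borel_add[OF b1 bounded_borel_scaleR[OF bounded_borel_const[of "-1"] b2]] by simp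
  have "\<bar>vint \<Omega> F (\<lambda>x. indicator S x *\<^sub>R grad \<phi> x - indicator S x *\<^sub>R a)\<bar>
      \<le> real DIM('a) * (\<integral>x. norm (indicator S x *\<^sub>R grad \<phi> x - indicator S x *\<^sub>R a) \<partial>\<mu>)"
    unfolding F_def by (rule vint_abs_le[OF \<Omega>b flux_field_measure \<mu> flux_field_dominated b3])
  also have "\<dots> \<le> real DIM('a) * (\<integral>x. \<omega> * indicator S x \<partial>\<mu>)"
  proof (rule mult_left_mono[OF integral_mono])
    show "integrable \<mu> (\<lambda>x. norm (indicator S x *\<^sub>R grad \<phi> x - indicator S x *\<^sub>R a))"
      by (rule radon_integrable[OF \<mu> \<Omega>b bounded_borel_norm[OF b3]])
    show "integrable \<mu> (\<lambda>x. \<omega> * indicator S x)"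
      by (rule radon_integrable[OF \<mu> \<Omega>b bounded_borel_cmult[OF bounded_borel_indicator[OF Sb]]])
    show "norm (indicator S x *\<^sub>R grad \<phi> x - indicator S x *\<^sub>R a) \<le> \<omega> * indicator S x" for x
      using close[of x] S(2) by (auto simp: indicator_def subset_iff less_imp_le)
  qed simp
  also have "(\<integral>x. \<omega> * indicator S x \<partial>\<mu>) = \<omega> * measure \<mu> S"
    using S by (simp add: space_\<mu> borel_on_iff Int_absorb2)
  finally have e2: "\<bar>vint \<Omega> F (\<lambda>x. indicator S x *\<^sub>R grad \<phi> x) - a \<bullet> F S\<bar> \<le> real DIM('a) * (\<omega> * measure \<mu> S)"
    unfolding vint_diff[OF \<Omega>b F b1 b2] vint_indicator_const[OF \<Omega>b F S(1)] .
  have "(1 + real DIM('a)) * \<omega> * measure \<mu> S = \<omega> * measure \<mu> S + real DIM('a) * (\<omega> * measure \<mu> S)"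
    by (simp add: algebra_simps)
  then show ?thesis using e1 e2 unfolding F_def by linarith
qed

text \<open>Finitely many small balls cover \<open>closure U\<close>. Cutting \<open>U\<close> into
  disjoint pieces along them makes the local errors add up to a multiple of
  \<open>\<omega> * measure \<mu> \<Omega>\<close>, independently of the number of balls, and
  \<omega> is arbitrary.\<close>

lemma net_integral_gradient:
  assumes U: "U \<in> \<O>" and \<phi>: "\<phi> \<in> test_functions 1 \<Omega>"
  shows "net_integral U \<phi> = vint \<Omega> flux_field (\<lambda>x. indicator U x *\<^sub>R grad \<phi> x)"
proof -
  note Ui = O_classD[OF U]
  note UD = open_compactly_insideD[OF Ui]
  define F where "F = flux_field"
  have F: "vector_measure_on \<Omega> F" unfolding F_def by (rule flux_field_measure)
  have Ck: "Ck (Suc 0) \<phi>" using test_functionsD(1)[OF \<phi>] by simp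
  have gb: "bounded_borel (grad \<phi>)" by (rule grad_bounded_borel[of _ 0]) (use \<phi> in simp)
  obtain M where M: "M \<ge> 0" "\<And>x. norm (grad \<phi> x) \<le> M" by (rule bounded_borel_bound[OF gb]) (rule that)
  \<comment> \<open>Potentials are set up for positive Lipschitz constants, and \<open>M\<close> may
    be 0.\<close>
  have L: "M + 1 > 0" "(M + 1)-lipschitz_on UNIV \<phi>"
  proof -
    show "(M + 1)-lipschitz_on UNIV \<phi>"
      by (rule lipschitz_of_gradient_bound[OF convex_UNIV has_derivative_grad[OF Ck]])
         (rule order_trans[OF M(2)], use M(1) in simp_all)
  qed (use M(1) in simp)
  define \<Psi> where "\<Psi> = flux_potential \<phi>"
  have \<Psi>: "signed_measure_on \<Omega> \<Psi>" unfolding \<Psi>_def by (rule flux_potential(1)[OF L])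
  define c where "c = (1 + real DIM('a)) * measure \<mu> \<Omega>"
  have est: "\<bar>\<Psi> U - vint \<Omega> F (\<lambda>x. indicator U x *\<^sub>R grad \<phi> x)\<bar> \<le> c * \<omega>" if \<omega>: "\<omega> > 0" for \<omega>
  proof -
    obtain d where d: "d > 0" "\<forall>x y. dist x y < d \<longrightarrow> dist (grad \<phi> x) (grad \<phi> y) < \<omega>"
      by (rule uniformly_continuous_compact_support[OF continuous_on_grad[OF Ck] test_functionsD(2)[OF \<phi>] grad_zero_outside_support \<omega>])
    have "x \<in> ball x (d / 2)" for x :: 'a using d(1) by simp
    then have "closure U \<subseteq> (\<Union>x\<in>UNIV. ball x (d / 2))" by blast
    then obtain N where N: "finite N" "closure U \<subseteq> (\<Union>x\<in>N. ball x (d / 2))"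
      using compactE_image[OF UD(2), of UNIV "\<lambda>x. ball x (d / 2)"] open_ball by (metis subset_UNIV)
    have "\<bar>\<Psi> S - vint \<Omega> F (\<lambda>x. indicator S x *\<^sub>R grad \<phi> x)\<bar> \<le> (1 + real DIM('a)) * \<omega> * measure \<mu> S"
      if "S \<in> borel_on \<Omega>" "S \<subseteq> (\<Union>x\<in>N. ball x (d / 2))" for S
      using N(1) that
    proof (induction N arbitrary: S rule: finite_induct)
      case empty
      then have "S = {}" by simp
      moreover have "vint \<Omega> F (\<lambda>x. 0 *\<^sub>R grad \<phi> x) = 0" unfolding vint_scaleR[OF \<Omega>b F] by simp
      ultimately show ?case by (simp add: vector_measure_on_empty[OF \<Psi>])
    next
      case (insert x N)
      define S1 S2 where "S1 = S \<inter> ball x (d / 2)" and "S2 = S - ball x (d / 2)"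
      have B: "S1 \<in> borel_on \<Omega>" "S2 \<in> borel_on \<Omega>" using insert.prems(1) by (auto simp: S1_def S2_def borel_on_iff)
      have S: "S1 \<union> S2 = S" "S1 \<inter> S2 = {}" by (auto simp: S1_def S2_def)
      have B': "S1 \<in> sets borel" "S2 \<in> sets borel" "S1 \<subseteq> \<Omega>" "S2 \<subseteq> \<Omega>" using B by (simp_all add: borel_on_iff)
      have 1: "\<bar>\<Psi> S1 - vint \<Omega> F (\<lambda>x. indicator S1 x *\<^sub>R grad \<phi> x)\<bar> \<le> (1 + real DIM('a)) * \<omega> * measure \<mu> S1"
        unfolding \<Psi>_def F_def
        by (rule flux_potential_gradient_estimate[OF \<phi> L d(1) d(2)[rule_format] \<omega> B(1), where z=x]) (simp_all add: S1_def)
      have 2: "\<bar>\<Psi> S2 - vint \<Omega> F (\<lambda>x. indicator S2 x *\<^sub>R grad \<phi> x)\<bar> \<le> (1 + real DIM('a)) * \<omega> * measure \<mu> S2"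
        by (rule insert.IH[OF B(2)]) (use insert.prems(2) in \<open>auto simp: S2_def\<close>)
      have 3: "\<Psi> S = \<Psi> S1 + \<Psi> S2" unfolding S(1)[symmetric]
        by (rule vector_measure_on_Un[OF \<Psi> B' S(2)])
      have 4: "measure \<mu> S = measure \<mu> S1 + measure \<mu> S2" unfolding S(1)[symmetric]
        by (rule finite_measure_Union) (use B S(2) in \<open>auto simp: sets_\<mu>\<close>)
      have ind: "indicator S y *\<^sub>R grad \<phi> y = indicator S1 y *\<^sub>R grad \<phi> y + indicator S2 y *\<^sub>R grad \<phi> y" for y
        by (simp add: S1_def S2_def indicator_def)
      have 5: "vint \<Omega> F (\<lambda>x. indicator S x *\<^sub>R grad \<phi> x)
        = vint \<Omega> F (\<lambda>x. indicator S1 x *\<^sub>R grad \<phi> x) + vint \<Omega> F (\<lambda>x. indicator S2 x *\<^sub>R grad \<phi> x)"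
        unfolding ind by (intro vint_add \<Omega>b F bounded_borel_scaleR bounded_borel_indicator B' gb)
      show ?case using 1 2 unfolding 3 4 5 by (simp add: distrib_left)
    qed
    then have "\<bar>\<Psi> U - vint \<Omega> F (\<lambda>x. indicator U x *\<^sub>R grad \<phi> x)\<bar> \<le> (1 + real DIM('a)) * \<omega> * measure \<mu> U"
      using N(2) closure_subset[of U] UD(1,4) by (simp add: borel_on_iff)
    also have "\<dots> \<le> (1 + real DIM('a)) * \<omega> * measure \<mu> \<Omega>"
      using \<omega> \<Omega>b UD(4) by (intro mult_left_mono finite_measure_mono) (auto simp: sets_\<mu> borel_on_iff)
    finally show ?thesis by (simp add: c_def mult_ac)
  qed
  have "(\<lambda>n. c * (1 / real (Suc n))) \<longlonglongrightarrow> c * 0" by (intro tendsto_mult tendsto_const LIMSEQ_Suc[OF lim_1_over_n])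
  then have "\<bar>\<Psi> U - vint \<Omega> F (\<lambda>x. indicator U x *\<^sub>R grad \<phi> x)\<bar> \<le> c * 0"
    by (rule LIMSEQ_le_const) (intro exI[of _ 0] allI impI est, simp)
  then have "\<Psi> U = vint \<Omega> F (\<lambda>x. indicator U x *\<^sub>R grad \<phi> x)" by simp
  then show ?thesis using flux_potential(3)[OF L U] by (simp add: \<Psi>_def F_def)
qed

text \<open>The gradient representation is rewritten by splitting \<open>net_flux U\<close> into
  \<sigma> restricted to \<open>U\<close> and the flux on the frontier. The indicator of
  \<open>closure U\<close> disappears, since both parts are carried by that set.\<close>

lemma flux_Gauss_Green:
  assumes U: "U \<in> \<O>" and \<phi>: "\<phi> \<in> test_functions 1 \<Omega>"
  shows "vint \<Omega> flux_field (\<lambda>x. indicator U x *\<^sub>R grad \<phi> x) =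
    sint \<Omega> \<sigma> (\<lambda>x. indicator U x * \<phi> x) - sint \<Omega> (\<lambda>S. if S \<in> borel_on \<Omega> then \<F> U (S \<inter> frontier U) else 0) \<phi>"
proof -
  note Ui = O_classD[OF U]
  note UD = open_compactly_insideD[OF Ui]
  define C where "C = closure U"
  define \<tau> where "\<tau> S = (if S \<in> borel_on \<Omega> then \<F> U (S \<inter> frontier U) else 0)" for S
  define s where "s S = (if S \<in> borel_on \<Omega> then \<sigma> (S \<inter> U) else 0)" for S
  have \<tau>: "signed_measure_on \<Omega> \<tau>" unfolding \<tau>_def[abs_def] by (rule flux_measure[OF U])
  have Ub: "U \<in> sets borel" "C \<in> sets borel" using UD(1) by (simp_all add: C_def)
  have \<sigma>: "signed_measure_on \<Omega> \<sigma>" by (rule \<sigma>)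
  have s: "signed_measure_on \<Omega> s" unfolding s_def[abs_def] by (rule vector_measure_on_restrict[OF \<Omega>b \<sigma> Ub(1)])
  have \<phi>b: "bounded_borel \<phi>" by (rule test_function_bounded_borel[OF \<phi>])
  have C\<phi>: "bounded_borel (\<lambda>x. indicator C x * \<phi> x)" by (intro bounded_borel_mult bounded_borel_indicator Ub \<phi>b)
  have "net_flux U = (\<lambda>S. s S - \<tau> S)" by (auto simp: net_flux_def s_def \<tau>_def)
  then have "net_integral U \<phi> = sint \<Omega> s (\<lambda>x. indicator C x * \<phi> x) - sint \<Omega> \<tau> (\<lambda>x. indicator C x * \<phi> x)"
    unfolding net_integral_def C_def[symmetric] using sint_diff_measure[OF \<Omega>b s \<tau> C\<phi>] by simp
  also have "sint \<Omega> s (\<lambda>x. indicator C x * \<phi> x) = sint \<Omega> \<sigma> (\<lambda>x. indicator U x * (indicator C x * \<phi> x))"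
    unfolding s_def[abs_def] by (rule sint_restrict_measure[OF \<Omega>b \<sigma> Ub(1) C\<phi>])
  also have "(\<lambda>x. indicator U x * (indicator C x * \<phi> x)) = (\<lambda>x. indicator U x * \<phi> x)"
    using closure_subset[of U] by (auto simp: C_def indicator_def fun_eq_iff)
  also have "sint \<Omega> \<tau> (\<lambda>x. indicator C x * \<phi> x) = sint \<Omega> (\<lambda>S. if S \<in> borel_on \<Omega> then \<tau> (S \<inter> C) else 0) \<phi>"
    by (rule sint_restrict_measure[OF \<Omega>b \<tau> Ub(2) \<phi>b, symmetric])
  also have "(\<lambda>S. if S \<in> borel_on \<Omega> then \<tau> (S \<inter> C) else 0) = \<tau>"
  proof
    fix S
    have "S \<inter> C \<inter> frontier U = S \<inter> frontier U" by (auto simp: C_def frontier_def)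
    then show "(if S \<in> borel_on \<Omega> then \<tau> (S \<inter> C) else 0) = \<tau> S"
      using Ub(2) by (auto simp: \<tau>_def borel_on_iff)
  qed
  finally show ?thesis unfolding net_integral_gradient[OF U \<phi>] \<tau>_def[abs_def] .
qed

text \<open>An admissible \<open>U\<close> containing the support of the test function is chosen;
  the boundary term of the Gauss-Green formula then vanishes and the integrals over \<open>U\<close>
  become integrals over \<Omega>.\<close>

lemma flux_field_divergence: "is_divergence \<Omega> flux_field (\<lambda>A. - \<sigma> A)"
  unfolding is_divergence_def
proof (intro conjI ballI)
  define F where "F = flux_field"
  have F: "vector_measure_on \<Omega> F" unfolding F_def by (rule flux_field_measure)
  have \<sigma>: "signed_measure_on \<Omega> \<sigma>" by (rule \<sigma>)
  then show "signed_measure_on \<Omega> (\<lambda>A. - \<sigma> A)" by (rule vector_measure_on_uminus)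
  fix \<phi> assume \<phi>s: "\<phi> \<in> smooth_test_functions \<Omega>"
  have \<phi>: "\<phi> \<in> test_functions 1 \<Omega>" by (rule smooth_test_functions_subset[OF \<phi>s])
  have \<phi>b: "bounded_borel \<phi>" by (rule test_function_bounded_borel[OF \<phi>])
  obtain U where U: "U \<in> \<O>" "closure {x. \<phi> x \<noteq> 0} \<subseteq> U"
    by (rule O_class_superset[OF test_functionsD(2,3)[OF \<phi>]])
  note Ui = O_classD[OF U(1)]
  note UD = open_compactly_insideD[OF Ui]
  define \<tau> where "\<tau> S = (if S \<in> borel_on \<Omega> then \<F> U (S \<inter> frontier U) else 0)" for S
  have \<tau>: "signed_measure_on \<Omega> \<tau>" unfolding \<tau>_def[abs_def] by (rule flux_measure[OF U(1)])
  have zero: "\<phi> x = 0" "grad \<phi> x = 0" if "x \<notin> U" for x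
  proof -
    have x: "x \<notin> closure {x. \<phi> x \<noteq> 0}" using that U(2) by blast
    show "\<phi> x = 0" by (rule test_functionsD(5)[OF \<phi> x])
    show "grad \<phi> x = 0" by (rule grad_zero_outside_support[OF x])
  qed
  have eq: "(\<lambda>x. indicator U x *\<^sub>R grad \<phi> x) = grad \<phi>" "(\<lambda>x. indicator U x * \<phi> x) = \<phi>"
    using zero by (auto simp: fun_eq_iff indicator_def)
  have "sint \<Omega> \<tau> (\<lambda>x. indicator U x * \<phi> x) = 0"
  proof (rule sint_null[OF \<Omega>b \<tau> borel_open[OF UD(1)] _ \<phi>b])
    fix S assume S: "S \<subseteq> U \<inter> \<Omega>"
    then have "S \<inter> frontier U = {}" using UD(1) by (auto simp: frontier_def interior_open)
    then show "\<tau> S = 0" using flux_empty[OF U(1)] by (simp add: \<tau>_def)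
  qed
  then have "vint \<Omega> F (grad \<phi>) = sint \<Omega> \<sigma> \<phi>"
    using flux_Gauss_Green[OF U(1) \<phi>] unfolding eq \<tau>_def[symmetric] F_def[symmetric] by simp
  then show "sint \<Omega> (\<lambda>A. - \<sigma> A) \<phi> = - vector_integral \<Omega> flux_field \<Omega> (grad \<phi>)"
    unfolding vector_integral_space F_def[symmetric] by (simp add: sint_uminus_measure[OF \<Omega>b \<sigma> \<phi>b])
qed

lemma flux_field_DM_ext: "flux_field \<in> DM_ext \<Omega>"
  unfolding DM_ext_def using flux_field_measure flux_field_divergence by blast

lemma flux_field_divergence_eq: "divergence \<Omega> flux_field = (\<lambda>A. - \<sigma> A)"
  by (rule divergence_eq[OF \<Omega> flux_field_divergence])

lemma flux_field_normal_trace: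
  assumes U: "U \<in> \<O>"
  shows "represents_normal_trace \<Omega> flux_field U (\<lambda>S. if S \<in> borel_on \<Omega> then \<F> U (S \<inter> frontier U) else 0)"
  unfolding represents_normal_trace_def
proof (intro conjI ballI)
  show "signed_measure_on \<Omega> (\<lambda>S. if S \<in> borel_on \<Omega> then \<F> U (S \<inter> frontier U) else 0)"
    by (rule flux_measure[OF U])
  fix \<phi> assume \<phi>: "\<phi> \<in> test_functions 1 \<Omega>"
  have Ub: "U \<in> sets borel" using U by (simp add: O_class_def open_compactly_inside_def)
  have "bounded_borel (\<lambda>x. indicator U x * \<phi> x)"
    by (intro bounded_borel_mult bounded_borel_indicator Ub test_function_bounded_borel[OF \<phi>])
  then have "sint \<Omega> (\<lambda>A. - \<sigma> A) (\<lambda>x. indicator U x * \<phi> x) = - sint \<Omega> \<sigma> (\<lambda>x. indicator U x * \<phi> x)"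
    by (rule sint_uminus_measure[OF \<Omega>b \<sigma>])
  then show "normal_trace_distribution \<Omega> flux_field U \<phi> =
      sint \<Omega> (\<lambda>S. if S \<in> borel_on \<Omega> then \<F> U (S \<inter> frontier U) else 0) \<phi>"
    unfolding normal_trace_distribution_eq[OF \<Omega> flux_field_DM_ext] flux_field_divergence_eq flux_Gauss_Green[OF U \<phi>] by simp
qed

lemma flux_field_normal_trace_eq:
  assumes U: "U \<in> \<O>" and S: "S \<in> sets borel" "S \<subseteq> frontier U"
  shows "\<F> U S = normal_trace \<Omega> flux_field U S"
proof -
  note Ui = O_classD[OF U]
  have "S \<in> borel_on \<Omega>" using S open_compactly_insideD(6)[OF Ui] by (auto simp: borel_on_iff)
  moreover have "S \<inter> frontier U = S" using S(2) by auto
  ultimately show ?thesis by (simp add: normal_trace_eq[OF \<Omega> flux_field_normal_trace[OF U]])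
qed

theorem flux_field_unique:
  "\<exists>!F. F \<in> DM_ext \<Omega> \<and> (\<lambda>A. - divergence \<Omega> F A) = \<sigma> \<and>
    (\<forall>U\<in>\<O>. has_normal_trace \<Omega> F U \<and>
      (\<forall>S\<in>sets borel. S \<subseteq> frontier U \<longrightarrow> \<F> U S = normal_trace \<Omega> F U S))"
proof (rule ex1I[of _ "flux_field"])
  define G where "G = flux_field"
  have hn: "has_normal_trace \<Omega> G U" if "U \<in> \<O>" for U
    unfolding has_normal_trace_def G_def using flux_field_normal_trace[OF that] by blast
  show "flux_field \<in> DM_ext \<Omega> \<and> (\<lambda>A. - divergence \<Omega> flux_field A) = \<sigma> \<and>
    (\<forall>U\<in>\<O>. has_normal_trace \<Omega> flux_field U \<and>
      (\<forall>S\<in>sets borel. S \<subseteq> frontier U \<longrightarrow> \<F> U S = normal_trace \<Omega> flux_field U S))"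
    using flux_field_DM_ext flux_field_normal_trace_eq hn unfolding G_def
    by (intro conjI ballI impI) (simp_all add: flux_field_divergence_eq)
  fix F
  assume F: "F \<in> DM_ext \<Omega> \<and> (\<lambda>A. - divergence \<Omega> F A) = \<sigma> \<and>
    (\<forall>U\<in>\<O>. has_normal_trace \<Omega> F U \<and>
      (\<forall>S\<in>sets borel. S \<subseteq> frontier U \<longrightarrow> \<F> U S = normal_trace \<Omega> F U S))"
  show "F = flux_field"
  proof (rule DM_ext_eqI[OF conjunct1[OF F] flux_field_DM_ext])
    have "- divergence \<Omega> F A = \<sigma> A" for A using F by (metis (no_types))
    then show "divergence \<Omega> F = divergence \<Omega> flux_field"
      unfolding flux_field_divergence_eq by (metis (no_types) add.inverse_inverse ext)
    fix U assume U: "U \<in> \<O>"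
    note FU = bspec[OF conjunct2[OF conjunct2[OF F]] U]
    show "has_normal_trace \<Omega> F U \<and> has_normal_trace \<Omega> flux_field U \<and>
      (\<forall>S\<in>sets borel. S \<subseteq> frontier U \<longrightarrow> normal_trace \<Omega> F U S = normal_trace \<Omega> flux_field U S)"
    proof (intro conjI ballI impI)
      show "has_normal_trace \<Omega> F U" by (rule conjunct1[OF FU])
      show "has_normal_trace \<Omega> flux_field U" using hn[OF U] by (simp add: G_def)
      fix S assume S: "S \<in> sets borel" "S \<subseteq> frontier U"
      have "\<F> U S = normal_trace \<Omega> F U S" by (rule mp[OF bspec[OF conjunct2[OF FU] S(1)] S(2)])
      then show "normal_trace \<Omega> F U S = normal_trace \<Omega> flux_field U S"
        using flux_field_normal_trace_eq[OF U S] by simp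
    qed
  qed
qed

end

theorem theorem6p6:
  fixes \<Omega> :: "(real ^ 'n) set"
  assumes "CARD('n) \<ge> 2" and "open \<Omega>"
  shows "(\<forall>\<F> \<sigma> \<mu>. cauchy_flux \<Omega> \<F> \<sigma> \<mu> \<longrightarrow>
            (\<exists>!F. F \<in> DM_ext \<Omega> \<and>
               (\<lambda>A. - divergence \<Omega> F A) = \<sigma> \<and>
               (\<forall>U\<in>O_class \<Omega> \<mu>. has_normal_trace \<Omega> F U \<and>
                  (\<forall>S\<in>sets borel. S \<subseteq> frontier U \<longrightarrow> \<F> U S = normal_trace \<Omega> F U S)))) \<and>
         (\<forall>F\<in>DM_ext \<Omega>.
            (\<exists>\<F>. flux_of_field \<Omega> F \<F>) \<and>
            (\<forall>\<F>. flux_of_field \<Omega> F \<F> \<longrightarrow>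
               cauchy_flux \<Omega> \<F> (\<lambda>A. - divergence \<Omega> F A) (variation \<Omega> F)))"
proof (intro conjI allI impI ballI)
  fix \<F> \<sigma> \<mu> assume "cauchy_flux \<Omega> \<F> \<sigma> \<mu>"
  then interpret flux_on_open \<Omega> \<F> \<sigma> \<mu> using assms(2) by unfold_locales
  show "\<exists>!F. F \<in> DM_ext \<Omega> \<and> (\<lambda>A. - divergence \<Omega> F A) = \<sigma> \<and>
      (\<forall>U\<in>O_class \<Omega> \<mu>. has_normal_trace \<Omega> F U \<and>
        (\<forall>S\<in>sets borel. S \<subseteq> frontier U \<longrightarrow> \<F> U S = normal_trace \<Omega> F U S))"
    by (rule flux_field_unique)
next
  fix F assume "F \<in> DM_ext \<Omega>"
  then show "\<exists>\<F>. flux_of_field \<Omega> F \<F>" by (rule flux_of_field_exists[OF assms(2)])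
next
  fix F \<F> assume "F \<in> DM_ext \<Omega>" "flux_of_field \<Omega> F \<F>"
  then show "cauchy_flux \<Omega> \<F> (\<lambda>A. - divergence \<Omega> F A) (variation \<Omega> F)"
    by (rule cauchy_flux_of_field[OF assms(2)])
qed

end
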